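(* Let $G$ be a $PD_3$-group which is a generalized free product with amalgamation $A*_CB$ or an HNN extension $A*_C\varphi$, with $C$ a $PD_2$-group. Then the splitting is minimal in the partial order on splittings of $G$ determined by inclusions. That is: if $G=A*_CB$ and $G=A'*_{C'}B'$ is another generalized free product structure for $G$ with $A'*_{C'}B'\leq A*_CB$, then $A'=A$, $B'=B$ and $C'=C$; and if $G=A*_C\varphi$ and $G=A'*_{C'}\varphi'$ is another HNN structure for $G$ with $A'*_{C'}\varphi'\leq A*_C\varphi$, then $A'=A$ and $C'=C$ (and so $\varphi'=\varphi$).
   Context: A $PD_n$-group is a group $G$ of type $FP$ such that $H^i(G;\mathbb{Z}[G])=0$ for $i\neq n$ and $H^n(G;\mathbb{Z}[G])$ is infinite cyclic as an abelian group. A generalized free product with amalgamation $G=A*_CB$ is understood with $C<A$ and $C<B$ (proper subgroups). An HNN extension $G=A*_C\varphi$ has base $A$, associated subgroups $C\leq A$ and $\varphi(C)\leq A$, where $\varphi:C\to A$ is a monomorphism, and stable letter $t$ with $tct^{-1}=\varphi(c)$ for all $c\in C$. All the groups $A,B,C,A',B',C'$ are identified with subgroups of $G$. The partial order on such splittings of $G$ is defined by inclusion: $A'*_{C'}B'\leq A*_CB$ if $A'\leq A$, $B'\leq B$ and $C'\leq C$; and $A'*_{C'}\varphi'\leq A*_C\varphi$ if $A'\leq A$, $C'\leq C$, $\varphi|_{C'}=\varphi'$, and the stable letters coincide. *)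

theory Defs
  imports "HOL-Algebra.Algebra" "HOL-Algebra.Free_Abelian_Groups"
begin

section \<open>Modules over the integral group ring\<close>

text \<open>
  A (left) module over the integral group ring of G is an abelian group with an additive action
  of G. The underlying abelian group is written multiplicatively, as everywhere in HOL-Algebra.
\<close>

record ('g, 'b) gmod = "'b monoid" +
  act :: "'g \<Rightarrow> 'b \<Rightarrow> 'b"

locale gmodule =
  G: group G + M: comm_group M
  for G :: "('g, 'm) monoid_scheme" and M :: "('g, 'b, 'n) gmod_scheme" +
  assumes act_hom: "g \<in> carrier G \<Longrightarrow> act M g \<in> hom M M"
    and act_one: "x \<in> carrier M \<Longrightarrow> act M \<one>\<^bsub>G\<^esub> x = x"
    and act_mult: "\<lbrakk>g \<in> carrier G; h \<in> carrier G; x \<in> carrier M\<rbrakk>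
          \<Longrightarrow> act M (g \<otimes>\<^bsub>G\<^esub> h) x = act M g (act M h x)"

definition gmod_hom ::
    "('g, 'm) monoid_scheme \<Rightarrow> ('g, 'b, 'n) gmod_scheme \<Rightarrow> ('g, 'c, 'k) gmod_scheme \<Rightarrow> ('b \<Rightarrow> 'c) set"
  where "gmod_hom G M N =
    {f \<in> hom M N. \<forall>g\<in>carrier G. \<forall>x\<in>carrier M. f (act M g x) = act N g (f x)}"

text \<open>The free abelian group on a set on which the group acts, with the induced action.\<close>

definition permutation_gmod :: "'x set \<Rightarrow> ('g \<Rightarrow> 'x \<Rightarrow> 'x) \<Rightarrow> ('g, 'x \<Rightarrow>\<^sub>0 int) gmod"
  where "permutation_gmod \<Omega> \<alpha> =
    \<lparr>carrier = carrier (free_Abelian_group \<Omega>), monoid.mult = (+), one = 0,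
     act = (\<lambda>g. frag_extend (\<lambda>x. frag_of (\<alpha> g x)))\<rparr>"

definition group_ring_gmod :: "('g, 'm) monoid_scheme \<Rightarrow> ('g, 'g \<Rightarrow>\<^sub>0 int) gmod"
  where "group_ring_gmod G = permutation_gmod (carrier G) (\<lambda>g x. g \<otimes>\<^bsub>G\<^esub> x)"

text \<open>The free module with basis indexed by I.\<close>

definition free_gmod :: "('g, 'm) monoid_scheme \<Rightarrow> 'x set \<Rightarrow> ('g, 'g \<times> 'x \<Rightarrow>\<^sub>0 int) gmod"
  where "free_gmod G I = permutation_gmod (carrier G \<times> I) (\<lambda>g (h, x). (g \<otimes>\<^bsub>G\<^esub> h, x))"

definition trivial_int_gmod :: "('g, int) gmod"
  where "trivial_int_gmod = \<lparr>carrier = UNIV, monoid.mult = (+), one = 0, act = (\<lambda>g x. x)\<rparr>"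

definition fg_gmod :: "('g, 'm) monoid_scheme \<Rightarrow> ('g, 'b, 'n) gmod_scheme \<Rightarrow> bool"
  where "fg_gmod G M \<longleftrightarrow> gmodule G M \<and>
    (\<exists>S. finite S \<and> S \<subseteq> carrier M \<and>
         generate M {act M g s | g s. g \<in> carrier G \<and> s \<in> S} = carrier M)"

text \<open>
  Projective means: a direct summand of a free module. Every module is a quotient of the free
  module on its own set of elements, and this quotient map splits if the module is projective, so
  it is no restriction to take the basis of the free module inside the type of the module.
\<close>

definition projective_gmod :: "('g, 'm) monoid_scheme \<Rightarrow> ('g, 'b, 'n) gmod_scheme \<Rightarrow> bool"
  where "projective_gmod G P \<longleftrightarrow> gmodule G P \<and>
    (\<exists>(I :: 'b set) i p. i \<in> gmod_hom G P (free_gmod G I) \<and> p \<in> gmod_hom G (free_gmod G I) P \<and>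
         (\<forall>x\<in>carrier P. p (i x) = x))"

section \<open>Groups of type FP\<close>

text \<open>
  The trivial module of integers has a resolution of finite length by finitely generated
  projective modules. Such a module is isomorphic to a submodule of a free module of finite rank,
  so it is no restriction to realise all terms of the resolution on one type of formal sums.
\<close>

definition type_FP :: "('g, 'm) monoid_scheme \<Rightarrow> bool"
  where "type_FP G \<longleftrightarrow> group G \<and>
    (\<exists>(P :: nat \<Rightarrow> ('g, 'g \<times> nat \<Rightarrow>\<^sub>0 int) gmod) d \<epsilon> n.
       (\<forall>i. fg_gmod G (P i) \<and> projective_gmod G (P i)) \<and>
       (\<forall>i>n. carrier (P i) = {\<one>\<^bsub>P i\<^esub>}) \<and>
       (\<forall>i. d i \<in> gmod_hom G (P (Suc i)) (P i)) \<and>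
       \<epsilon> \<in> gmod_hom G (P 0) trivial_int_gmod \<and>
       \<epsilon> ` carrier (P 0) = carrier (trivial_int_gmod :: ('g, int) gmod) \<and>
       d 0 ` carrier (P 1) = kernel (P 0) (trivial_int_gmod :: ('g, int) gmod) \<epsilon> \<and>
       (\<forall>i. d (Suc i) ` carrier (P (Suc (Suc i))) = kernel (P (Suc i)) (P i) (d i)))"

section \<open>Group cohomology\<close>

text \<open>
  Cohomology of the complex of inhomogeneous cochains (the standard, or bar, resolution). An
  n-cochain is a function on the n-tuples of group elements, here lists of length n.
\<close>

definition tuples :: "('g, 'm) monoid_scheme \<Rightarrow> nat \<Rightarrow> 'g list set"
  where "tuples G n = {l \<in> lists (carrier G). length l = n}"

definition cochain_group ::
    "('g, 'm) monoid_scheme \<Rightarrow> ('g, 'b, 'n) gmod_scheme \<Rightarrow> nat \<Rightarrow> ('g list \<Rightarrow> 'b) monoid"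
  where "cochain_group G M n = product_group (tuples G n) (\<lambda>_. M)"

definition merge_at :: "('g, 'm) monoid_scheme \<Rightarrow> nat \<Rightarrow> 'g list \<Rightarrow> 'g list"
  where "merge_at G i l = take i l @ (l ! i \<otimes>\<^bsub>G\<^esub> l ! Suc i) # drop (i + 2) l"

text \<open>
  Additively, the value of the coboundary of f at (g_1, ..., g_(n+1)) is
  g_1 f(g_2, ..., g_(n+1)) + sum over i = 1, ..., n of (-1)^i f(..., g_i g_(i+1), ...)
  + (-1)^(n+1) f(g_1, ..., g_n).
\<close>

definition coboundary ::
    "('g, 'm) monoid_scheme \<Rightarrow> ('g, 'b, 'n) gmod_scheme \<Rightarrow> nat \<Rightarrow> ('g list \<Rightarrow> 'b) \<Rightarrow> 'g list \<Rightarrow> 'b"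
  where "coboundary G M n f = (\<lambda>l\<in>tuples G (Suc n).
      act M (hd l) (f (tl l)) \<otimes>\<^bsub>M\<^esub>
      (\<Otimes>\<^bsub>M\<^esub>i\<in>{..<n}. f (merge_at G i l) [^]\<^bsub>M\<^esub> ((- 1) ^ Suc i :: int)) \<otimes>\<^bsub>M\<^esub>
      f (butlast l) [^]\<^bsub>M\<^esub> ((- 1) ^ Suc n :: int))"

definition cocycles ::
    "('g, 'm) monoid_scheme \<Rightarrow> ('g, 'b, 'n) gmod_scheme \<Rightarrow> nat \<Rightarrow> ('g list \<Rightarrow> 'b) set"
  where "cocycles G M n = kernel (cochain_group G M n) (cochain_group G M (Suc n)) (coboundary G M n)"

definition coboundaries ::
    "('g, 'm) monoid_scheme \<Rightarrow> ('g, 'b, 'n) gmod_scheme \<Rightarrow> nat \<Rightarrow> ('g list \<Rightarrow> 'b) set"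
  where "coboundaries G M n = (case n of
      0 \<Rightarrow> {\<one>\<^bsub>cochain_group G M 0\<^esub>}
    | Suc k \<Rightarrow> coboundary G M k ` carrier (cochain_group G M k))"

definition cohomology ::
    "('g, 'm) monoid_scheme \<Rightarrow> ('g, 'b, 'n) gmod_scheme \<Rightarrow> nat \<Rightarrow> ('g list \<Rightarrow> 'b) set monoid"
  where "cohomology G M n =
    (cochain_group G M n)\<lparr>carrier := cocycles G M n\<rparr> Mod coboundaries G M n"

section \<open>Poincare duality groups\<close>

definition PD_group :: "nat \<Rightarrow> ('g, 'm) monoid_scheme \<Rightarrow> bool"
  where "PD_group n G \<longleftrightarrow> type_FP G \<and>
    (\<forall>i. i \<noteq> n \<longrightarrow> trivial_group (cohomology G (group_ring_gmod G) i)) \<and>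
    cyclic_group (cohomology G (group_ring_gmod G) n) \<and>
    infinite (carrier (cohomology G (group_ring_gmod G) n))"

section \<open>Groups given by generators and relations\<close>

text \<open>
  The congruence on words over L generated by R, and the quotient monoid. In the presentations
  below every letter has an inverse modulo the relations, so the quotient is a group.
\<close>

inductive word_cong :: "'l set \<Rightarrow> ('l list \<times> 'l list) set \<Rightarrow> 'l list \<Rightarrow> 'l list \<Rightarrow> bool"
  for L R where
    rel: "(u, v) \<in> R \<Longrightarrow> word_cong L R u v"
  | refl: "u \<in> lists L \<Longrightarrow> word_cong L R u u"
  | sym: "word_cong L R u v \<Longrightarrow> word_cong L R v u"
  | trans: "word_cong L R u v \<Longrightarrow> word_cong L R v w \<Longrightarrow> word_cong L R u w"
  | append: "word_cong L R u u' \<Longrightarrow> word_cong L R v v' \<Longrightarrow> word_cong L R (u @ v) (u' @ v')"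

definition presented :: "'l set \<Rightarrow> ('l list \<times> 'l list) set \<Rightarrow> 'l list set monoid"
  where "presented L R =
    (let E = {(u, v). word_cong L R u v} in
     \<lparr>carrier = lists L // E,
      monoid.mult = (\<lambda>U V. \<Union>u\<in>U. \<Union>v\<in>V. E `` {u @ v}),
      one = E `` {[]}\<rparr>)"

definition word_value :: "('g, 'm) monoid_scheme \<Rightarrow> ('l \<Rightarrow> 'g) \<Rightarrow> 'l list \<Rightarrow> 'g"
  where "word_value G v w = foldr (\<lambda>x y. v x \<otimes>\<^bsub>G\<^esub> y) w \<one>\<^bsub>G\<^esub>"

text \<open>
  The map out of a presented group induced by a valuation of the letters that respects the
  relations (so that all words of a class have the same value).
\<close>

definition induced_map :: "('g, 'm) monoid_scheme \<Rightarrow> ('l \<Rightarrow> 'g) \<Rightarrow> 'l list set \<Rightarrow> 'g"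
  where "induced_map G v W = the_elem (word_value G v ` W)"

section \<open>Generalized free products with amalgamation\<close>

text \<open>The free product of the subgroups A and B of G with their common subgroup C amalgamated.\<close>

definition amalgam_relations ::
    "('g, 'm) monoid_scheme \<Rightarrow> 'g set \<Rightarrow> 'g set \<Rightarrow> 'g set \<Rightarrow> (('g + 'g) list \<times> ('g + 'g) list) set"
  where "amalgam_relations G A B C =
    {([Inl a, Inl a'], [Inl (a \<otimes>\<^bsub>G\<^esub> a')]) | a a'. a \<in> A \<and> a' \<in> A} \<union>
    {([Inr b, Inr b'], [Inr (b \<otimes>\<^bsub>G\<^esub> b')]) | b b'. b \<in> B \<and> b' \<in> B} \<union>
    {([Inl \<one>\<^bsub>G\<^esub>], []), ([Inr \<one>\<^bsub>G\<^esub>], [])} \<union>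
    {([Inl c], [Inr c]) | c. c \<in> C}"

definition amalgamated_product ::
    "('g, 'm) monoid_scheme \<Rightarrow> 'g set \<Rightarrow> 'g set \<Rightarrow> 'g set \<Rightarrow> ('g + 'g) list set monoid"
  where "amalgamated_product G A B C = presented (Inl ` A \<union> Inr ` B) (amalgam_relations G A B C)"

definition amalgam_splitting ::
    "('g, 'm) monoid_scheme \<Rightarrow> 'g set \<Rightarrow> 'g set \<Rightarrow> 'g set \<Rightarrow> bool"
  where "amalgam_splitting G A B C \<longleftrightarrow>
    subgroup A G \<and> subgroup B G \<and> subgroup C G \<and> C \<subset> A \<and> C \<subset> B \<and>
    induced_map G (case_sum id id) \<in> iso (amalgamated_product G A B C) G"

section \<open>HNN extensions\<close>

datatype 'g hnn_letter = Base 'g | Stable | Stable_inv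

primrec hnn_letter_value :: "('g, 'm) monoid_scheme \<Rightarrow> 'g \<Rightarrow> 'g hnn_letter \<Rightarrow> 'g" where
  "hnn_letter_value G t (Base a) = a"
| "hnn_letter_value G t Stable = t"
| "hnn_letter_value G t Stable_inv = inv\<^bsub>G\<^esub> t"

definition hnn_relations ::
    "('g, 'm) monoid_scheme \<Rightarrow> 'g set \<Rightarrow> 'g set \<Rightarrow> ('g \<Rightarrow> 'g)
      \<Rightarrow> ('g hnn_letter list \<times> 'g hnn_letter list) set"
  where "hnn_relations G A C \<phi> =
    {([Base a, Base a'], [Base (a \<otimes>\<^bsub>G\<^esub> a')]) | a a'. a \<in> A \<and> a' \<in> A} \<union>
    {([Base \<one>\<^bsub>G\<^esub>], []), ([Stable, Stable_inv], []), ([Stable_inv, Stable], [])} \<union>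
    {([Stable, Base c, Stable_inv], [Base (\<phi> c)]) | c. c \<in> C}"

definition hnn_extension ::
    "('g, 'm) monoid_scheme \<Rightarrow> 'g set \<Rightarrow> 'g set \<Rightarrow> ('g \<Rightarrow> 'g) \<Rightarrow> 'g hnn_letter list set monoid"
  where "hnn_extension G A C \<phi> = presented (Base ` A \<union> {Stable, Stable_inv}) (hnn_relations G A C \<phi>)"

definition hnn_splitting ::
    "('g, 'm) monoid_scheme \<Rightarrow> 'g set \<Rightarrow> 'g set \<Rightarrow> ('g \<Rightarrow> 'g) \<Rightarrow> 'g \<Rightarrow> bool"
  where "hnn_splitting G A C \<phi> t \<longleftrightarrow>
    subgroup A G \<and> subgroup C G \<and> C \<subseteq> A \<and>
    \<phi> \<in> hom (G\<lparr>carrier := C\<rparr>) (G\<lparr>carrier := A\<rparr>) \<and> inj_on \<phi> C \<and>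
    t \<in> carrier G \<and> (\<forall>c\<in>C. t \<otimes>\<^bsub>G\<^esub> c \<otimes>\<^bsub>G\<^esub> inv\<^bsub>G\<^esub> t = \<phi> c) \<and>
    induced_map G (hnn_letter_value G t) \<in> iso (hnn_extension G A C \<phi>) G"

section \<open>The partial order on splittings\<close>

definition amalgam_le :: "'g set \<times> 'g set \<times> 'g set \<Rightarrow> 'g set \<times> 'g set \<times> 'g set \<Rightarrow> bool"
  where "amalgam_le = (\<lambda>(A', B', C') (A, B, C). A' \<subseteq> A \<and> B' \<subseteq> B \<and> C' \<subseteq> C)"

definition hnn_le ::
    "'g set \<times> 'g set \<times> ('g \<Rightarrow> 'g) \<times> 'g \<Rightarrow> 'g set \<times> 'g set \<times> ('g \<Rightarrow> 'g) \<times> 'g \<Rightarrow> bool"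
  where "hnn_le = (\<lambda>(A', C', \<phi>', t') (A, C, \<phi>, t).
    A' \<subseteq> A \<and> C' \<subseteq> C \<and> (\<forall>c\<in>C'. \<phi> c = \<phi>' c) \<and> t' = t)"

end

theory Submission
  imports Defs "HOL-Library.Function_Algebras" "HOL-Library.Product_Plus"
begin

text \<open>
  Let d' be the derivation of G with values in the chains on G/C' that belongs to the smaller
  splitting: it vanishes on A' and, for an amalgam, is b C' - C' at b in B'; for an HNN extension
  its value at the stable letter t is t C'. Pushed forward to chains on G/A it becomes the inner
  derivation g A - A, and pushed forward to G/B it becomes zero. (For an HNN extension, the
  difference of the two maps from edges to vertices, g C to g A and g C to g inv(t) A, does the
  same.) This is the Bass-Serre tree seen through derivations.

  Poincare duality enters through one statement, PD3_derivation_divisible: after pushing d' forward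
  to chains on G/C, it is inner modulo the index n of C' in C, where n = 0 if the index is infinite.
  The reason is that H^1(G; Z[G/C']) and H^1(G; Z[G/C]) are H_2 of C' and of C with twisted
  coefficients, by duality for G, and that H_2(C') maps to multiples of n times the fundamental
  class of C, by duality for C. So there is a chain x on G/C such that d' minus the inner
  derivation of x is divisible by n. On the infinite coset spaces G/A and G/B a chain that is
  invariant modulo n is divisible by n. Hence n divides A - x in chains on G/A and x in chains on
  G/B; comparing the sums of coefficients, n divides 1, so C' = C. For an HNN extension the sum of
  coefficients of the image of x is zero and the conclusion is the same.

  Once C' = C, the derivations of the two splittings agree on generators, so they are equal. The
  derivation of the larger splitting vanishes on A, and the push to G/A' of the derivation of the
  smaller one is g A' - A'. Therefore a A' = A' for a in A, that is, A is contained in A'. The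
  same argument with G/B' gives B' = B.

  Homological algebra is done with cochains. For a projective resolution M of Z, the dual complex
  consists of the additive maps from M i to Z that have finite support on every orbit; for
  a group of dimension n it is, read backwards, a projective resolution of Z twisted by
  the orientation character (rev_resolution, rev_dual_basis). Invariant maps under a subgroup are
  norms of such maps (norm_over_surj). The comparison of the backwards complexes of G and C and the
  homotopy between them give the divisibility (transfer_mod_index).
\<close>

section \<open>Modules as additive subgroups\<close>

text \<open>
  The action of the integers on an arbitrary abelian group. It is needed for maps to the integers
  and for formal sums alike, where it becomes multiplication.
\<close>

definition iscale :: "int \<Rightarrow> 'a::ab_group_add \<Rightarrow> 'a" where
  "iscale n x = (if 0 \<le> n then (\<Sum>i<nat n. x) else - (\<Sum>i<nat (- n). x))"

lemma sum_const_add: "(\<Sum>i<a + b. x) = (\<Sum>i<a. x) + (\<Sum>i<b. x :: 'a::ab_group_add)" for a b :: nat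
  by (induction b) (auto simp: algebra_simps)

lemma iscale_of_nat_diff: "iscale (int a - int b) x = (\<Sum>i<a. x) - (\<Sum>i<b. x)"
proof (cases "b \<le> a")
  case True
  then obtain c where a: "a = b + c" using le_Suc_ex by blast
  then have "nat (int a - int b) = c" "0 \<le> int a - int b" by simp_all
  then show ?thesis unfolding iscale_def a sum_const_add by simp
next
  case False
  then obtain c where b: "b = a + Suc c" by (metis add_Suc_right less_imp_Suc_add linorder_not_le)
  then have "nat (- (int a - int b)) = Suc c" "\<not> 0 \<le> int a - int b" by simp_all
  then show ?thesis unfolding iscale_def b sum_const_add by simp
qed

interpretation iscale: Modules.module "iscale :: int \<Rightarrow> 'a::ab_group_add \<Rightarrow> 'a"
proof
  have mul: "(\<Sum>i<a * b. x) = (\<Sum>i<a. \<Sum>i<b. x)" for a b :: nat and x :: 'a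
    by (induction a) (auto simp: sum_const_add add.commute)
  fix m n :: int and x y :: 'a
  obtain a b where m: "m = int a - int b" using int_diff_cases by blast
  obtain c d where n: "n = int c - int d" using int_diff_cases by blast
  show "iscale m (x + y) = iscale m x + iscale m y"
    unfolding m iscale_of_nat_diff by (simp add: sum.distrib)
  have "m + n = int (a + c) - int (b + d)" unfolding m n by simp
  then have "iscale (m + n) x = iscale (int (a + c) - int (b + d)) x" by simp
  also have "\<dots> = iscale m x + iscale n x"
    unfolding m n iscale_of_nat_diff sum_const_add by (simp add: algebra_simps)
  finally show "iscale (m + n) x = iscale m x + iscale n x" .
  have "m * n = int (a * c + b * d) - int (a * d + b * c)" unfolding m n by (simp add: algebra_simps)
  then have "iscale (m * n) x = iscale (int (a * c + b * d) - int (a * d + b * c)) x" by simp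
  also have "\<dots> = iscale m (iscale n x)"
    unfolding m n iscale_of_nat_diff sum_const_add mul by (simp add: sum_subtractf algebra_simps)
  finally show "iscale m (iscale n x) = iscale (m * n) x" by simp
  show "iscale 1 x = x" by (simp add: iscale_def)
qed

definition addsub :: "'a::ab_group_add set \<Rightarrow> bool" where
  "addsub M \<longleftrightarrow> 0 \<in> M \<and> (\<forall>x\<in>M. \<forall>y\<in>M. x + y \<in> M) \<and> (\<forall>x\<in>M. - x \<in> M)"

lemma addsub_UNIV [simp]: "addsub UNIV"
  by (simp add: addsub_def)

lemma addsubD:
  assumes "addsub M"
  shows "0 \<in> M" "x \<in> M \<Longrightarrow> y \<in> M \<Longrightarrow> x + y \<in> M" "x \<in> M \<Longrightarrow> - x \<in> M"
    "x \<in> M \<Longrightarrow> y \<in> M \<Longrightarrow> x - y \<in> M"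
  using assms unfolding addsub_def by (blast, blast, blast, metis diff_conv_add_uminus)

lemma addsub_sum: "addsub M \<Longrightarrow> (\<And>i. i \<in> I \<Longrightarrow> f i \<in> M) \<Longrightarrow> sum f I \<in> M"
  by (induction I rule: infinite_finite_induct) (auto simp: addsub_def)

lemma addsub_iscale: "addsub M \<Longrightarrow> x \<in> M \<Longrightarrow> iscale n x \<in> M"
  unfolding iscale_def by (auto intro!: addsub_sum addsubD)

definition addmap :: "'a::ab_group_add set \<Rightarrow> ('a \<Rightarrow> 'b::ab_group_add) \<Rightarrow> bool" where
  "addmap M f \<longleftrightarrow> (\<forall>x\<in>M. \<forall>y\<in>M. f (x + y) = f x + f y)"

lemma addmap_add: "addmap M f \<Longrightarrow> x \<in> M \<Longrightarrow> y \<in> M \<Longrightarrow> f (x + y) = f x + f y"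
  by (simp add: addmap_def)

lemma addmap_0: "addmap M f \<Longrightarrow> addsub M \<Longrightarrow> f 0 = 0"
  by (metis addmap_def addsub_def add_cancel_right_left)

lemma addmap_minus: "addmap M f \<Longrightarrow> addsub M \<Longrightarrow> x \<in> M \<Longrightarrow> f (- x) = - f x"
  using addmap_add[of M f x "- x"] addmap_0[of M f] addsubD(3)[of M x]
  by (simp add: eq_neg_iff_add_eq_0 add.commute)

lemma addmap_diff: "addmap M f \<Longrightarrow> addsub M \<Longrightarrow> x \<in> M \<Longrightarrow> y \<in> M \<Longrightarrow> f (x - y) = f x - f y"
  using addmap_add[of M f x "- y"] addmap_minus[of M f y] addsubD(3)[of M y] by simp

lemma addmap_sum:
  "addmap M f \<Longrightarrow> addsub M \<Longrightarrow> (\<And>i. i \<in> I \<Longrightarrow> g i \<in> M) \<Longrightarrow> f (sum g I) = (\<Sum>i\<in>I. f (g i))"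
proof (induction I rule: infinite_finite_induct)
  case (insert i I)
  then show ?case by (simp add: addmap_add addsub_sum)
qed (auto simp: addmap_0)

lemma addmap_iscale: "addmap M f \<Longrightarrow> addsub M \<Longrightarrow> x \<in> M \<Longrightarrow> f (iscale n x) = iscale n (f x)"
  unfolding iscale_def by (auto simp: addmap_minus addmap_sum addsub_sum)

lemma addmap_comp: "addmap M f \<Longrightarrow> addmap N g \<Longrightarrow> f ` M \<subseteq> N \<Longrightarrow> addmap M (\<lambda>x. g (f x))"
  unfolding addmap_def by (auto simp: image_subset_iff)

lemma iscale_int [simp]: "iscale n (m::int) = n * m"
  unfolding iscale_def by auto

lemma iscale_fun [simp]: "iscale n f x = iscale n (f x)"
  using addmap_iscale[of UNIV "\<lambda>f. f x" f n] by (simp add: addmap_def)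

lemma iscale_lookup [simp]: "poly_mapping.lookup (iscale n p) x = n * poly_mapping.lookup p x"
  using addmap_iscale[of UNIV "\<lambda>f. poly_mapping.lookup f x" p n] by (simp add: addmap_def lookup_add)

lemma iscale_frag [simp]: "iscale n (p :: 'a \<Rightarrow>\<^sub>0 int) = frag_cmul n p"
  by (simp add: poly_mapping_eqI)

text \<open>
  Modules over a subgroup H of G are additive subgroups of a type with an action, rather than
  records: the terms of all resolutions below, their duals and the modules of chains are then
  handled by one notion, and restriction to a subgroup changes nothing but H.
\<close>

definition gmod :: "('g, 'm) monoid_scheme \<Rightarrow> 'g set \<Rightarrow> 'a::ab_group_add set \<Rightarrow> ('g \<Rightarrow> 'a \<Rightarrow> 'a) \<Rightarrow> bool" where
  "gmod G H M \<alpha> \<longleftrightarrow> addsub M \<and> (\<forall>g\<in>H. \<alpha> g ` M \<subseteq> M \<and> addmap M (\<alpha> g)) \<and>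
     (\<forall>x\<in>M. \<alpha> \<one>\<^bsub>G\<^esub> x = x) \<and> (\<forall>g\<in>H. \<forall>h\<in>H. \<forall>x\<in>M. \<alpha> (g \<otimes>\<^bsub>G\<^esub> h) x = \<alpha> g (\<alpha> h x))"

lemma gmodD:
  assumes "gmod G H M \<alpha>"
  shows "addsub M" "g \<in> H \<Longrightarrow> x \<in> M \<Longrightarrow> \<alpha> g x \<in> M" "g \<in> H \<Longrightarrow> addmap M (\<alpha> g)"
    "x \<in> M \<Longrightarrow> \<alpha> \<one>\<^bsub>G\<^esub> x = x"
    "g \<in> H \<Longrightarrow> h \<in> H \<Longrightarrow> x \<in> M \<Longrightarrow> \<alpha> (g \<otimes>\<^bsub>G\<^esub> h) x = \<alpha> g (\<alpha> h x)"
  using assms unfolding gmod_def by auto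

lemma gmod_subset: "gmod G K M \<alpha> \<Longrightarrow> H \<subseteq> K \<Longrightarrow> gmod G H M \<alpha>"
  unfolding gmod_def by blast

lemma gmod_act_0: "gmod G H M \<alpha> \<Longrightarrow> g \<in> H \<Longrightarrow> \<alpha> g 0 = 0"
  by (rule addmap_0[OF gmodD(3) gmodD(1)])

lemma gmod_zero:
  assumes "gmod G H M \<alpha>"
  shows "gmod G H {0} \<alpha>"
  using gmodD(4,5)[OF assms, where x=0] addsubD(1)[OF gmodD(1)[OF assms]] gmod_act_0[OF assms]
  by (simp add: gmod_def addsub_def addmap_def)

definition ghom :: "'g set \<Rightarrow> 'a::ab_group_add set \<Rightarrow> ('g \<Rightarrow> 'a \<Rightarrow> 'a) \<Rightarrow> 'b::ab_group_add set
    \<Rightarrow> ('g \<Rightarrow> 'b \<Rightarrow> 'b) \<Rightarrow> ('a \<Rightarrow> 'b) \<Rightarrow> bool" where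
  "ghom H M \<alpha> N \<beta> f \<longleftrightarrow> f ` M \<subseteq> N \<and> addmap M f \<and> (\<forall>g\<in>H. \<forall>x\<in>M. f (\<alpha> g x) = \<beta> g (f x))"

lemma ghomD:
  assumes "ghom H M \<alpha> N \<beta> f"
  shows "x \<in> M \<Longrightarrow> f x \<in> N" "addmap M f" "g \<in> H \<Longrightarrow> x \<in> M \<Longrightarrow> f (\<alpha> g x) = \<beta> g (f x)"
  using assms unfolding ghom_def by auto

lemma ghom_subset: "ghom K M \<alpha> N \<beta> f \<Longrightarrow> H \<subseteq> K \<Longrightarrow> ghom H M \<alpha> N \<beta> f"
  unfolding ghom_def by blast

lemma ghom_comp: "ghom H M \<alpha> N \<beta> f \<Longrightarrow> ghom H N \<beta> P \<gamma> g \<Longrightarrow> ghom H M \<alpha> P \<gamma> (\<lambda>x. g (f x))"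
  unfolding ghom_def by (auto simp: image_subset_iff addmap_def)

lemma ghom_id: "gmod G H M \<alpha> \<Longrightarrow> ghom H M \<alpha> M \<alpha> (\<lambda>x. x)"
  unfolding ghom_def by (simp add: addmap_def)

lemma ghom_diff:
  assumes "ghom H M \<alpha> N \<beta> f" "ghom H M \<alpha> N \<beta> g" "gmod G H N \<beta>"
  shows "ghom H M \<alpha> N \<beta> (\<lambda>x. f x - g x)"
  unfolding ghom_def
proof (intro conjI ballI)
  note N = gmodD[OF assms(3)] and f = ghomD[OF assms(1)] and g = ghomD[OF assms(2)]
  show "(\<lambda>x. f x - g x) ` M \<subseteq> N" using f(1) g(1) addsubD(4)[OF N(1)] by blast
  show "addmap M (\<lambda>x. f x - g x)"
    using f(2) g(2) by (simp add: addmap_def)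
  show "f (\<alpha> h x) - g (\<alpha> h x) = \<beta> h (f x - g x)" if "h \<in> H" "x \<in> M" for h x
    using addmap_diff[OF N(3) N(1) f(1) g(1)] f(3) g(3) that by simp
qed

text \<open>The pairs (g, j) that contribute to the expansion of x in a dual basis.\<close>

definition dsupp :: "('g, 'm) monoid_scheme \<Rightarrow> 'g set \<Rightarrow> ('g \<Rightarrow> 'a \<Rightarrow> 'a) \<Rightarrow> 'j set \<Rightarrow> ('j \<Rightarrow> 'a \<Rightarrow> int) \<Rightarrow> 'a \<Rightarrow> ('g \<times> 'j) set" where
  "dsupp G K \<alpha> J \<kappa> x = {(g, j). g \<in> K \<and> j \<in> J \<and> \<kappa> j (\<alpha> (inv\<^bsub>G\<^esub> g) x) \<noteq> 0}"

text \<open>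
  Projectivity in coordinates. The additive maps \<open>\<kappa> j\<close> are the coefficients at the identity of
  the linear forms of a dual basis over the group ring of K; the coefficient at g of such a form is
  \<open>\<kappa> j\<close> after the action of the inverse of g.
\<close>

definition dual_basis :: "('g, 'm) monoid_scheme \<Rightarrow> 'g set \<Rightarrow> 'a::ab_group_add set \<Rightarrow> ('g \<Rightarrow> 'a \<Rightarrow> 'a) \<Rightarrow> 'j set
     \<Rightarrow> ('j \<Rightarrow> 'a) \<Rightarrow> ('j \<Rightarrow> 'a \<Rightarrow> int) \<Rightarrow> bool" where
  "dual_basis G K M \<alpha> J b \<kappa> \<longleftrightarrow> (\<forall>j\<in>J. b j \<in> M \<and> addmap M (\<kappa> j)) \<and>
     (\<forall>x\<in>M. finite (dsupp G K \<alpha> J \<kappa> x) \<and>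
        x = (\<Sum>(g, j)\<in>dsupp G K \<alpha> J \<kappa> x. iscale (\<kappa> j (\<alpha> (inv\<^bsub>G\<^esub> g) x)) (\<alpha> g (b j))))"

lemma dual_basisD:
  assumes "dual_basis G K M \<alpha> J b \<kappa>"
  shows "j \<in> J \<Longrightarrow> b j \<in> M" "j \<in> J \<Longrightarrow> addmap M (\<kappa> j)" "x \<in> M \<Longrightarrow> finite (dsupp G K \<alpha> J \<kappa> x)"
    "x \<in> M \<Longrightarrow> x = (\<Sum>(g, j)\<in>dsupp G K \<alpha> J \<kappa> x. iscale (\<kappa> j (\<alpha> (inv\<^bsub>G\<^esub> g) x)) (\<alpha> g (b j)))"
  using assms unfolding dual_basis_def by auto

lemma dsupp_sum_superset:
  fixes c :: "'g \<times> 'j \<Rightarrow> 'b::ab_group_add"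
  assumes "finite T" "T \<subseteq> K \<times> J" "dsupp G K \<alpha> J \<kappa> x \<subseteq> T"
  shows "(\<Sum>(g, j)\<in>dsupp G K \<alpha> J \<kappa> x. iscale (\<kappa> j (\<alpha> (inv\<^bsub>G\<^esub> g) x)) (c (g, j))) =
    (\<Sum>(g, j)\<in>T. iscale (\<kappa> j (\<alpha> (inv\<^bsub>G\<^esub> g) x)) (c (g, j)))"
  using assms by (intro sum.mono_neutral_left) (auto simp: dsupp_def)

lemma dual_basis_expand:
  assumes "dual_basis G K M \<alpha> J b \<kappa>" "x \<in> M" "finite T" "T \<subseteq> K \<times> J" "dsupp G K \<alpha> J \<kappa> x \<subseteq> T"
  shows "x = (\<Sum>(g, j)\<in>T. iscale (\<kappa> j (\<alpha> (inv\<^bsub>G\<^esub> g) x)) (\<alpha> g (b j)))"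
  using dual_basisD(4)[OF assms(1,2)] dsupp_sum_superset[OF assms(3-5), where c="\<lambda>(g, j). \<alpha> g (b j)"] by simp

lemma dsupp_shift:
  assumes "group G" "subgroup K G" "gmod G K M \<alpha>" "h \<in> K" "x \<in> M"
  shows "bij_betw (\<lambda>(g, j). (h \<otimes>\<^bsub>G\<^esub> g, j)) (dsupp G K \<alpha> J \<kappa> x) (dsupp G K \<alpha> J \<kappa> (\<alpha> h x))"
    and "g \<in> K \<Longrightarrow> \<alpha> (inv\<^bsub>G\<^esub> (h \<otimes>\<^bsub>G\<^esub> g)) (\<alpha> h x) = \<alpha> (inv\<^bsub>G\<^esub> g) x"
proof -
  interpret G: group G by fact
  interpret K: subgroup K G by fact
  note M = gmodD[OF assms(3)]
  have key: "\<alpha> (inv\<^bsub>G\<^esub> (h' \<otimes>\<^bsub>G\<^esub> g)) (\<alpha> h' y) = \<alpha> (inv\<^bsub>G\<^esub> g) y"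
    if "g \<in> K" "y \<in> M" "h' \<in> K" for g y h'
  proof -
    have "\<alpha> (inv\<^bsub>G\<^esub> (h' \<otimes>\<^bsub>G\<^esub> g)) (\<alpha> h' y) = \<alpha> (inv\<^bsub>G\<^esub> (h' \<otimes>\<^bsub>G\<^esub> g) \<otimes>\<^bsub>G\<^esub> h') y"
      using that by (simp add: M)
    also have "inv\<^bsub>G\<^esub> (h' \<otimes>\<^bsub>G\<^esub> g) \<otimes>\<^bsub>G\<^esub> h' = inv\<^bsub>G\<^esub> g"
      using that by (simp add: G.inv_mult_group G.m_assoc)
    finally show ?thesis .
  qed
  then show "g \<in> K \<Longrightarrow> \<alpha> (inv\<^bsub>G\<^esub> (h \<otimes>\<^bsub>G\<^esub> g)) (\<alpha> h x) = \<alpha> (inv\<^bsub>G\<^esub> g) x"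
    using assms by blast
  have inj: "inj_on (\<lambda>(g, j). (h \<otimes>\<^bsub>G\<^esub> g, j)) (K \<times> J)"
    using assms(4) by (auto simp: inj_on_def)
  have sub: "(\<lambda>(g, j). (h' \<otimes>\<^bsub>G\<^esub> g, j)) ` dsupp G K \<alpha> J \<kappa> y \<subseteq> dsupp G K \<alpha> J \<kappa> (\<alpha> h' y)"
    if "h' \<in> K" "y \<in> M" for h' y
    using that key by (auto simp: dsupp_def)
  have "dsupp G K \<alpha> J \<kappa> (\<alpha> h x) \<subseteq> (\<lambda>(g, j). (h \<otimes>\<^bsub>G\<^esub> g, j)) ` dsupp G K \<alpha> J \<kappa> x"
  proof
    fix p assume p: "p \<in> dsupp G K \<alpha> J \<kappa> (\<alpha> h x)"
    obtain g j where gj: "p = (g, j)" by (cases p)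
    then have g: "g \<in> K" using p by (auto simp: dsupp_def)
    have "(inv\<^bsub>G\<^esub> h \<otimes>\<^bsub>G\<^esub> g, j) \<in> dsupp G K \<alpha> J \<kappa> (\<alpha> (inv\<^bsub>G\<^esub> h) (\<alpha> h x))"
      using sub[of "inv\<^bsub>G\<^esub> h" "\<alpha> h x"] p assms M(2) by (force simp: gj)
    also have "\<alpha> (inv\<^bsub>G\<^esub> h) (\<alpha> h x) = x"
      using assms by (metis K.m_inv_closed K.mem_carrier M(4,5) G.l_inv)
    finally show "p \<in> (\<lambda>(g, j). (h \<otimes>\<^bsub>G\<^esub> g, j)) ` dsupp G K \<alpha> J \<kappa> x"
      using g assms by (force simp: gj G.m_assoc[symmetric])
  qed
  then show "bij_betw (\<lambda>(g, j). (h \<otimes>\<^bsub>G\<^esub> g, j)) (dsupp G K \<alpha> J \<kappa> x) (dsupp G K \<alpha> J \<kappa> (\<alpha> h x))"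
    using inj sub[OF assms(4,5)] unfolding bij_betw_def
    by (auto simp: dsupp_def elim!: inj_on_subset)
qed

text \<open>
  A module that is projective over K is projective over every subgroup H of K: choose preimages of
  the images of r b_j for representatives r of the cosets H r only, extend them H-equivariantly, and
  expand in the dual basis.
\<close>

lemma projective_lift:
  assumes "group G" "subgroup H G" "subgroup K G" "H \<subseteq> K"
    and M: "gmod G K M \<alpha>" and db: "dual_basis G K M \<alpha> J b \<kappa>"
    and N: "gmod G H N \<beta>" and P: "gmod G H P \<gamma>"
    and p: "ghom H P \<gamma> N \<beta> p" and f: "ghom H M \<alpha> N \<beta> f" and im: "f ` M \<subseteq> p ` P"
  obtains L where "ghom H M \<alpha> P \<gamma> L" "\<And>x. x \<in> M \<Longrightarrow> p (L x) = f x"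
proof -
  interpret G: group G by fact
  interpret H: subgroup H G by fact
  interpret K: subgroup K G by fact
  note MD = gmodD[OF M] and ND = gmodD[OF N] and PD = gmodD[OF P] and pD = ghomD[OF p] and fD = ghomD[OF f]
  define \<rho> where "\<rho> g = (SOME r. r \<in> H #>\<^bsub>G\<^esub> g)" for g
  have \<rho>: "\<rho> g \<in> H #>\<^bsub>G\<^esub> g" if "g \<in> K" for g
    unfolding \<rho>_def using G.rcos_self[OF _ assms(2), of g] that by (intro someI) auto
  have \<rho>K: "\<rho> g \<in> K" if "g \<in> K" for g
    using \<rho>[OF that] that assms(4) by (auto simp: r_coset_def)
  have \<rho>H: "g \<otimes>\<^bsub>G\<^esub> inv\<^bsub>G\<^esub> \<rho> g \<in> H" if g: "g \<in> K" for g
  proof -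
    obtain h where h: "h \<in> H" "\<rho> g = h \<otimes>\<^bsub>G\<^esub> g" using \<rho>[OF g] by (auto simp: r_coset_def)
    then have "g \<otimes>\<^bsub>G\<^esub> inv\<^bsub>G\<^esub> \<rho> g = inv\<^bsub>G\<^esub> h"
      using g by (simp add: G.inv_mult_group G.m_assoc[symmetric])
    then show ?thesis using h by simp
  qed
  have \<rho>inv: "\<rho> (h \<otimes>\<^bsub>G\<^esub> g) = \<rho> g" if "h \<in> H" "g \<in> K" for h g
  proof -
    have "H #>\<^bsub>G\<^esub> (h \<otimes>\<^bsub>G\<^esub> g) = H #>\<^bsub>G\<^esub> g"
      using that by (metis G.coset_mult_assoc G.coset_join2 H.mem_carrier H.subset K.mem_carrier assms(2))
    then show ?thesis by (simp add: \<rho>_def)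
  qed
  define \<zeta> where "\<zeta> r j = (SOME z. z \<in> P \<and> p z = f (\<alpha> r (b j)))" for r j
  have \<zeta>: "\<zeta> r j \<in> P \<and> p (\<zeta> r j) = f (\<alpha> r (b j))" if "r \<in> K" "j \<in> J" for r j
  proof -
    have "\<alpha> r (b j) \<in> M" using that MD(2) dual_basisD(1)[OF db] by simp
    then have "f (\<alpha> r (b j)) \<in> p ` P" using im by blast
    then have "\<exists>z. z \<in> P \<and> p z = f (\<alpha> r (b j))" by auto
    then show ?thesis unfolding \<zeta>_def by (rule someI_ex)
  qed
  \<comment> \<open>preimages of the vectors \<open>g b\<^sub>j\<close>, chosen on representatives and translated by H\<close>
  define z where "z = (\<lambda>(g, j). \<gamma> (g \<otimes>\<^bsub>G\<^esub> inv\<^bsub>G\<^esub> \<rho> g) (\<zeta> (\<rho> g) j))"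
  have zP: "z (g, j) \<in> P" if "g \<in> K" "j \<in> J" for g j
    unfolding z_def using \<zeta>[OF \<rho>K that(2)] \<rho>H PD(2) that by simp
  have pz: "p (z (g, j)) = f (\<alpha> g (b j))" if "g \<in> K" "j \<in> J" for g j
  proof -
    have bj: "\<alpha> (\<rho> g) (b j) \<in> M" using \<rho>K MD(2) dual_basisD(1)[OF db] that by simp
    have "p (z (g, j)) = \<beta> (g \<otimes>\<^bsub>G\<^esub> inv\<^bsub>G\<^esub> \<rho> g) (f (\<alpha> (\<rho> g) (b j)))"
      unfolding z_def using \<zeta>[OF \<rho>K that(2)] \<rho>H pD(3) that by simp
    also have "\<dots> = f (\<alpha> (g \<otimes>\<^bsub>G\<^esub> inv\<^bsub>G\<^esub> \<rho> g) (\<alpha> (\<rho> g) (b j)))"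
      using fD(3) \<rho>H bj that by simp
    also have "\<alpha> (g \<otimes>\<^bsub>G\<^esub> inv\<^bsub>G\<^esub> \<rho> g) (\<alpha> (\<rho> g) (b j)) = \<alpha> (g \<otimes>\<^bsub>G\<^esub> inv\<^bsub>G\<^esub> \<rho> g \<otimes>\<^bsub>G\<^esub> \<rho> g) (b j)"
      using \<rho>H \<rho>K MD(5) dual_basisD(1)[OF db] that assms(4) by (metis subsetD)
    also have "g \<otimes>\<^bsub>G\<^esub> inv\<^bsub>G\<^esub> \<rho> g \<otimes>\<^bsub>G\<^esub> \<rho> g = g"
      using \<rho>K that by (simp add: G.m_assoc)
    finally show ?thesis .
  qed
  have zeq: "z (h \<otimes>\<^bsub>G\<^esub> g, j) = \<gamma> h (z (g, j))" if "h \<in> H" "g \<in> K" "j \<in> J" for h g j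
    using that \<rho>H \<rho>K \<zeta> by (simp add: z_def \<rho>inv G.m_assoc PD(5))
  define L where "L x = (\<Sum>(g, j)\<in>dsupp G K \<alpha> J \<kappa> x. iscale (\<kappa> j (\<alpha> (inv\<^bsub>G\<^esub> g) x)) (z (g, j)))" for x
  have LT: "L x = (\<Sum>(g, j)\<in>T. iscale (\<kappa> j (\<alpha> (inv\<^bsub>G\<^esub> g) x)) (z (g, j)))"
    if "finite T" "T \<subseteq> K \<times> J" "dsupp G K \<alpha> J \<kappa> x \<subseteq> T" for x T
    unfolding L_def using dsupp_sum_superset[OF that] .
  have suppKJ: "dsupp G K \<alpha> J \<kappa> x \<subseteq> K \<times> J" for x by (auto simp: dsupp_def)
  have LP: "L x \<in> P" for x
    unfolding L_def using suppKJ[of x]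
    by (intro addsub_sum[OF PD(1)]) (auto intro!: addsub_iscale[OF PD(1)] zP)
  have Ladd: "L (x + y) = L x + L y" if x: "x \<in> M" and y: "y \<in> M" for x y
  proof -
    have xy: "x + y \<in> M" using x y addsubD(2)[OF MD(1)] by blast
    define T where "T = dsupp G K \<alpha> J \<kappa> x \<union> dsupp G K \<alpha> J \<kappa> y \<union> dsupp G K \<alpha> J \<kappa> (x + y)"
    have T: "finite T" "T \<subseteq> K \<times> J"
      using dual_basisD(3)[OF db] x y xy suppKJ by (auto simp: T_def)
    have s: "dsupp G K \<alpha> J \<kappa> x \<subseteq> T" "dsupp G K \<alpha> J \<kappa> y \<subseteq> T" "dsupp G K \<alpha> J \<kappa> (x + y) \<subseteq> T"
      by (auto simp: T_def)
    have e: "\<kappa> j (\<alpha> (inv\<^bsub>G\<^esub> g) (x + y)) = \<kappa> j (\<alpha> (inv\<^bsub>G\<^esub> g) x) + \<kappa> j (\<alpha> (inv\<^bsub>G\<^esub> g) y)"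
      if "(g, j) \<in> T" for g j
    proof -
      have gj: "g \<in> K" "j \<in> J" using T that by auto
      then have "\<alpha> (inv\<^bsub>G\<^esub> g) (x + y) = \<alpha> (inv\<^bsub>G\<^esub> g) x + \<alpha> (inv\<^bsub>G\<^esub> g) y"
        using x y by (simp add: addmap_add[OF MD(3)])
      then show ?thesis using MD(2) x y gj by (simp add: addmap_add[OF dual_basisD(2)[OF db gj(2)]])
    qed
    show ?thesis
      unfolding LT[OF T s(1)] LT[OF T s(2)] LT[OF T s(3)] sum.distrib[symmetric]
      by (intro sum.cong HOL.refl) (auto simp: e iscale.scale_left_distrib)
  qed
  have Leq: "L (\<alpha> h x) = \<gamma> h (L x)" if h: "h \<in> H" and x: "x \<in> M" for h x
  proof -
    have hK: "h \<in> K" using h assms(4) by blast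
    note sh = dsupp_shift[OF assms(1,3) M hK x]
    have "L (\<alpha> h x) = (\<Sum>(g, j)\<in>dsupp G K \<alpha> J \<kappa> x.
        iscale (\<kappa> j (\<alpha> (inv\<^bsub>G\<^esub> (h \<otimes>\<^bsub>G\<^esub> g)) (\<alpha> h x))) (z (h \<otimes>\<^bsub>G\<^esub> g, j)))"
      unfolding L_def by (subst sum.reindex_bij_betw[OF sh(1), symmetric]) (simp add: case_prod_beta)
    also have "\<dots> = (\<Sum>(g, j)\<in>dsupp G K \<alpha> J \<kappa> x. \<gamma> h (iscale (\<kappa> j (\<alpha> (inv\<^bsub>G\<^esub> g) x)) (z (g, j))))"
      using suppKJ[of x]
      by (intro sum.cong HOL.refl) (auto simp: sh(2) zeq h zP addmap_iscale[OF PD(3)[OF h] PD(1)] subset_iff)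
    also have "\<dots> = \<gamma> h (L x)"
      unfolding L_def using suppKJ[of x]
      by (subst addmap_sum[OF PD(3)[OF h] PD(1)]) (auto intro!: addsub_iscale[OF PD(1)] zP simp: case_prod_beta)
    finally show ?thesis .
  qed
  have pL: "p (L x) = f x" if x: "x \<in> M" for x
  proof -
    have "p (L x) = (\<Sum>(g, j)\<in>dsupp G K \<alpha> J \<kappa> x. p (iscale (\<kappa> j (\<alpha> (inv\<^bsub>G\<^esub> g) x)) (z (g, j))))"
      unfolding L_def using suppKJ[of x]
      by (subst addmap_sum[OF pD(2) PD(1)]) (auto intro!: addsub_iscale[OF PD(1)] zP simp: case_prod_beta)
    also have "\<dots> = (\<Sum>(g, j)\<in>dsupp G K \<alpha> J \<kappa> x. f (iscale (\<kappa> j (\<alpha> (inv\<^bsub>G\<^esub> g) x)) (\<alpha> g (b j))))"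
      using suppKJ[of x] MD(2) dual_basisD(1)[OF db]
      by (intro sum.cong HOL.refl)
        (auto simp: addmap_iscale[OF pD(2) PD(1)] addmap_iscale[OF fD(2) MD(1)] zP pz subset_iff)
    also have "\<dots> = f (\<Sum>(g, j)\<in>dsupp G K \<alpha> J \<kappa> x. iscale (\<kappa> j (\<alpha> (inv\<^bsub>G\<^esub> g) x)) (\<alpha> g (b j)))"
      using suppKJ[of x] MD(2) dual_basisD(1)[OF db]
      by (subst addmap_sum[OF fD(2) MD(1)]) (auto intro!: addsub_iscale[OF MD(1)] simp: case_prod_beta)
    finally show ?thesis using dual_basisD(4)[OF db x] by simp
  qed
  show thesis
  proof (rule that[OF _ pL])
    show "ghom H M \<alpha> P \<gamma> L"
      unfolding ghom_def addmap_def using LP Ladd Leq by blast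
  qed
qed

section \<open>Resolutions\<close>

definition resolution :: "('g, 'm) monoid_scheme \<Rightarrow> 'g set \<Rightarrow> ('g \<Rightarrow> int) \<Rightarrow> (nat \<Rightarrow> 'a::ab_group_add set)
    \<Rightarrow> (nat \<Rightarrow> 'g \<Rightarrow> 'a \<Rightarrow> 'a) \<Rightarrow> (nat \<Rightarrow> 'a \<Rightarrow> 'a) \<Rightarrow> ('a \<Rightarrow> int) \<Rightarrow> bool" where
  "resolution G H w M \<alpha> d \<epsilon> \<longleftrightarrow>
     (\<forall>i. gmod G H (M i) (\<alpha> i)) \<and>
     (\<forall>i. ghom H (M (Suc i)) (\<alpha> (Suc i)) (M i) (\<alpha> i) (d i)) \<and>
     ghom H (M 0) (\<alpha> 0) UNIV (\<lambda>g k. w g * k) \<epsilon> \<and>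
     \<epsilon> ` M 0 = UNIV \<and>
     d 0 ` M (Suc 0) = {x \<in> M 0. \<epsilon> x = 0} \<and>
     (\<forall>i. d (Suc i) ` M (Suc (Suc i)) = {x \<in> M (Suc i). d i x = 0})"

lemma resolutionD:
  assumes "resolution G H w M \<alpha> d \<epsilon>"
  shows "gmod G H (M i) (\<alpha> i)" "ghom H (M (Suc i)) (\<alpha> (Suc i)) (M i) (\<alpha> i) (d i)"
    "ghom H (M 0) (\<alpha> 0) UNIV (\<lambda>g k. w g * k) \<epsilon>" "\<epsilon> ` M 0 = UNIV"
    "d 0 ` M (Suc 0) = {x \<in> M 0. \<epsilon> x = 0}"
    "d (Suc i) ` M (Suc (Suc i)) = {x \<in> M (Suc i). d i x = 0}"
  using assms unfolding resolution_def by blast+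

lemma resolution_subset:
  "resolution G K w M \<alpha> d \<epsilon> \<Longrightarrow> H \<subseteq> K \<Longrightarrow> resolution G H w M \<alpha> d \<epsilon>"
  unfolding resolution_def using gmod_subset ghom_subset by meson

lemma ghom_kernel: 
  assumes "gmod G H M \<alpha>" "gmod G H N \<beta>" "ghom H M \<alpha> N \<beta> f"
  shows "gmod G H {x \<in> M. f x = 0} \<alpha>"
  using addmap_0[OF ghomD(2)[OF assms(3)] gmodD(1)[OF assms(1)]]
    addmap_minus[OF ghomD(2)[OF assms(3)] gmodD(1)[OF assms(1)]]
    addmap_0[OF gmodD(3)[OF assms(2)] gmodD(1)[OF assms(2)]] assms
  unfolding gmod_def addsub_def addmap_def ghom_def image_subset_iff by auto

lemma twisted_int_gmod:
  assumes "\<And>g h. g \<in> H \<Longrightarrow> h \<in> H \<Longrightarrow> w (g \<otimes>\<^bsub>G\<^esub> h) = w g * w h" "w \<one>\<^bsub>G\<^esub> = (1::int)"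
  shows "gmod G H UNIV (\<lambda>g k. w g * k)"
  using assms by (auto simp: gmod_def addmap_def algebra_simps)

definition chain_map :: "'g set \<Rightarrow> (nat \<Rightarrow> 'a::ab_group_add set)
    \<Rightarrow> (nat \<Rightarrow> 'g \<Rightarrow> 'a \<Rightarrow> 'a) \<Rightarrow> (nat \<Rightarrow> 'a \<Rightarrow> 'a) \<Rightarrow> (nat \<Rightarrow> 'b::ab_group_add set)
    \<Rightarrow> (nat \<Rightarrow> 'g \<Rightarrow> 'b \<Rightarrow> 'b) \<Rightarrow> (nat \<Rightarrow> 'b \<Rightarrow> 'b) \<Rightarrow> (nat \<Rightarrow> 'a \<Rightarrow> 'b) \<Rightarrow> bool" where
  "chain_map H M \<alpha> d N \<beta> e f \<longleftrightarrow> (\<forall>i. ghom H (M i) (\<alpha> i) (N i) (\<beta> i) (f i)) \<and>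
     (\<forall>i. \<forall>x\<in>M (Suc i). e i (f (Suc i) x) = f i (d i x))"

text \<open>
  The comparison theorem. Two groups occur because a resolution over K will be compared with
  a resolution over its subgroup H.
\<close>

lemma chain_map_exists:
  assumes "group G" "subgroup H G" "subgroup K G" "H \<subseteq> K"
    and M: "resolution G H w M \<alpha> d \<epsilon>" and MK: "\<And>i. gmod G K (M i) (\<alpha> i)"
    and db: "\<And>i. dual_basis G K (M i) (\<alpha> i) (J i) (b i) (\<kappa> i)"
    and N: "resolution G H w N \<beta> e \<eta>"
    and w: "\<And>g h. g \<in> H \<Longrightarrow> h \<in> H \<Longrightarrow> w (g \<otimes>\<^bsub>G\<^esub> h) = w g * w h" "w \<one>\<^bsub>G\<^esub> = 1"
  obtains f where "chain_map H M \<alpha> d N \<beta> e f" "\<And>x. x \<in> M 0 \<Longrightarrow> \<eta> (f 0 x) = \<epsilon> x"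
proof -
  note MD = resolutionD[OF M] and ND = resolutionD[OF N]
  obtain f0 where f0: "ghom H (M 0) (\<alpha> 0) (N 0) (\<beta> 0) f0" "\<And>x. x \<in> M 0 \<Longrightarrow> \<eta> (f0 x) = \<epsilon> x"
    using projective_lift[OF assms(1-4) MK db twisted_int_gmod[of H w G, OF w] ND(1) ND(3) MD(3)] ND(4) by auto
  define Q where "Q i f f' \<longleftrightarrow> (\<forall>x\<in>M (Suc i). e i (f' x) = f (d i x))" for i f f'
  define R where "R i f \<longleftrightarrow> ghom H (M i) (\<alpha> i) (N i) (\<beta> i) f \<and>
      f ` (d i ` M (Suc i)) \<subseteq> e i ` N (Suc i)" for i f
  have "\<exists>f. \<forall>i. (R i (f i) \<and> (i = 0 \<longrightarrow> f i = f0)) \<and> Q i (f i) (f (Suc i))"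
  proof (rule dependent_nat_choice)
    have "f0 ` (d 0 ` M (Suc 0)) \<subseteq> e 0 ` N (Suc 0)"
      unfolding MD(5) ND(5) using f0 ghomD(1)[OF f0(1)] by auto
    then show "\<exists>f. R 0 f \<and> (0 = 0 \<longrightarrow> f = f0)" using f0 by (simp add: R_def)
  next
    fix f i assume f: "R i f \<and> (i = (0::nat) \<longrightarrow> f = f0)"
    have c: "ghom H (M (Suc i)) (\<alpha> (Suc i)) (N i) (\<beta> i) (\<lambda>x. f (d i x))"
      using ghom_comp[OF MD(2)] f by (auto simp: R_def)
    have im: "(\<lambda>x. f (d i x)) ` M (Suc i) \<subseteq> e i ` N (Suc i)"
      using f by (auto simp: R_def)
    obtain f' where f': "ghom H (M (Suc i)) (\<alpha> (Suc i)) (N (Suc i)) (\<beta> (Suc i)) f'"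
        "\<And>x. x \<in> M (Suc i) \<Longrightarrow> e i (f' x) = f (d i x)"
      using projective_lift[OF assms(1-4) MK db ND(1) ND(1) ND(2) c im] by blast
    have fi: "ghom H (M i) (\<alpha> i) (N i) (\<beta> i) f" using f by (simp add: R_def)
    have f0': "f 0 = 0"
      by (rule addmap_0[OF ghomD(2)[OF fi] gmodD(1)[OF MD(1)]])
    have "f' ` (d (Suc i) ` M (Suc (Suc i))) \<subseteq> e (Suc i) ` N (Suc (Suc i))"
      unfolding MD(6) ND(6) using f' ghomD(1)[OF f'(1)] f0' by auto
    then show "\<exists>f'. (R (Suc i) f' \<and> (Suc i = 0 \<longrightarrow> f' = f0)) \<and> Q i f f'"
      using f' by (auto simp: R_def Q_def)
  qed
  then obtain f where f: "\<And>i. R i (f i)" "f 0 = f0" "\<And>i. Q i (f i) (f (Suc i))" by auto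
  have f1: "ghom H (M i) (\<alpha> i) (N i) (\<beta> i) (f i)" for i
    using f(1)[of i] by (simp add: R_def)
  have f2: "e i (f (Suc i) x) = f i (d i x)" if "x \<in> M (Suc i)" for i x
    using f(3)[of i] that by (simp add: Q_def)
  have "chain_map H M \<alpha> d N \<beta> e f"
    unfolding chain_map_def using f1 f2 by blast
  moreover have "\<eta> (f 0 x) = \<epsilon> x" if "x \<in> M 0" for x
    using f0(2)[OF that] f(2) by simp
  ultimately show thesis by (rule that)
qed

text \<open>
  The augmentations of the two resolutions may be twisted by different characters, since only the
  vanishing of the map on augmentations matters.
\<close>

lemma null_homotopy_exists:
  assumes "group G" "subgroup H G" "subgroup K G" "H \<subseteq> K"
    and M: "resolution G H w M \<alpha> d \<epsilon>" and MK: "\<And>i. gmod G K (M i) (\<alpha> i)"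
    and db: "\<And>i. dual_basis G K (M i) (\<alpha> i) (J i) (b i) (\<kappa> i)"
    and N: "resolution G H v N \<beta> e \<eta>"
    and f: "chain_map H M \<alpha> d N \<beta> e f" and f0: "\<And>x. x \<in> M 0 \<Longrightarrow> \<eta> (f 0 x) = 0"
  obtains h where "\<And>i. ghom H (M i) (\<alpha> i) (N (Suc i)) (\<beta> (Suc i)) (h i)"
    "\<And>x. x \<in> M 0 \<Longrightarrow> f 0 x = e 0 (h 0 x)"
    "\<And>i x. x \<in> M (Suc i) \<Longrightarrow> f (Suc i) x = e (Suc i) (h (Suc i) x) + h i (d i x)"
proof -
  note MD = resolutionD[OF M] and ND = resolutionD[OF N]
  have fh: "ghom H (M i) (\<alpha> i) (N i) (\<beta> i) (f i)" and
    fc: "x \<in> M (Suc i) \<Longrightarrow> e i (f (Suc i) x) = f i (d i x)" for i x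
    using f by (auto simp: chain_map_def)
  have im0: "f 0 ` M 0 \<subseteq> e 0 ` N (Suc 0)"
    unfolding ND(5) using f0 ghomD(1)[OF fh] by auto
  obtain h0 where h0: "ghom H (M 0) (\<alpha> 0) (N (Suc 0)) (\<beta> (Suc 0)) h0" "\<And>x. x \<in> M 0 \<Longrightarrow> e 0 (h0 x) = f 0 x"
    using projective_lift[OF assms(1-4) MK db ND(1) ND(1) ND(2) fh im0] by blast
  define Q where "Q i h h' \<longleftrightarrow> (\<forall>x\<in>M (Suc i). e (Suc i) (h' x) = f (Suc i) x - h (d i x))" for i h h'
  define R where "R i h \<longleftrightarrow> ghom H (M i) (\<alpha> i) (N (Suc i)) (\<beta> (Suc i)) h \<and>
      (\<forall>x\<in>M (Suc i). e i (h (d i x)) = f i (d i x))" for i h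
  have "\<exists>h. \<forall>i. (R i (h i) \<and> (i = 0 \<longrightarrow> h i = h0)) \<and> Q i (h i) (h (Suc i))"
  proof (rule dependent_nat_choice)
    show "\<exists>h. R 0 h \<and> (0 = 0 \<longrightarrow> h = h0)" using h0 ghomD(1)[OF MD(2)] by (simp add: R_def)
  next
    fix h i assume h: "R i h \<and> (i = (0::nat) \<longrightarrow> h = h0)"
    have hh: "ghom H (M i) (\<alpha> i) (N (Suc i)) (\<beta> (Suc i)) h" using h by (simp add: R_def)
    let ?g = "\<lambda>x. f (Suc i) x - h (d i x)"
    have g: "ghom H (M (Suc i)) (\<alpha> (Suc i)) (N (Suc i)) (\<beta> (Suc i)) ?g"
      by (rule ghom_diff[OF fh ghom_comp[OF MD(2) hh] ND(1)])
    have im: "?g ` M (Suc i) \<subseteq> e (Suc i) ` N (Suc (Suc i))"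
    proof
      fix y assume "y \<in> ?g ` M (Suc i)"
      then obtain x where x: "x \<in> M (Suc i)" "y = ?g x" by blast
      have "e i y = e i (f (Suc i) x) - e i (h (d i x))"
        unfolding x using ghomD(1)[OF fh] ghomD(1)[OF hh] ghomD(1)[OF MD(2)] x
        by (subst addmap_diff[OF ghomD(2)[OF ND(2)] gmodD(1)[OF ND(1)]]) auto
      also have "\<dots> = 0" using fc x h by (simp add: R_def)
      finally show "y \<in> e (Suc i) ` N (Suc (Suc i))"
        unfolding ND(6) using x ghomD(1)[OF g] by auto
    qed
    obtain h' where h': "ghom H (M (Suc i)) (\<alpha> (Suc i)) (N (Suc (Suc i))) (\<beta> (Suc (Suc i))) h'"
        "\<And>x. x \<in> M (Suc i) \<Longrightarrow> e (Suc i) (h' x) = ?g x"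
      using projective_lift[OF assms(1-4) MK db ND(1) ND(1) ND(2) g im] by blast
    have "h (d i (d (Suc i) x)) = 0" if "x \<in> M (Suc (Suc i))" for x
    proof -
      have "d i (d (Suc i) x) = 0" using MD(6) that by auto
      then show ?thesis using addmap_0[OF ghomD(2)[OF hh] gmodD(1)[OF MD(1)]] by simp
    qed
    then show "\<exists>h'. (R (Suc i) h' \<and> (Suc i = 0 \<longrightarrow> h' = h0)) \<and> Q i h h'"
      using h' ghomD(1)[OF MD(2)] by (auto simp: R_def Q_def)
  qed
  then obtain h where h: "\<And>i. R i (h i)" "h 0 = h0" "\<And>i. Q i (h i) (h (Suc i))" by auto
  have h1: "ghom H (M i) (\<alpha> i) (N (Suc i)) (\<beta> (Suc i)) (h i)" for i
    using h(1)[of i] by (simp add: R_def)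
  have h2: "f 0 x = e 0 (h 0 x)" if "x \<in> M 0" for x
    using h0(2)[OF that] h(2) by simp
  have h3: "f (Suc i) x = e (Suc i) (h (Suc i) x) + h i (d i x)" if "x \<in> M (Suc i)" for i x
    using h(3)[of i] that by (simp add: Q_def)
  show thesis by (rule that[OF h1 h2 h3])
qed

section \<open>Dual modules with finite supports\<close>

text \<open>
  The linear forms of a module over the group ring of K, encoded by their coefficient at the
  identity: the coefficient at g is the value at the translate by the inverse of g, so that forms
  correspond to additive maps with finite support on every orbit. Maps are zero outside M, so that
  equality of forms is equality of functions.
\<close>

definition dual_mod :: "'g set \<Rightarrow> 'a::ab_group_add set \<Rightarrow> ('g \<Rightarrow> 'a \<Rightarrow> 'a) \<Rightarrow> ('a \<Rightarrow> int) set" where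
  "dual_mod K M \<alpha> = {\<phi>. addmap M \<phi> \<and> (\<forall>x. x \<notin> M \<longrightarrow> \<phi> x = 0) \<and>
      (\<forall>x\<in>M. finite {g \<in> K. \<phi> (\<alpha> g x) \<noteq> 0})}"

definition dual_act :: "('g, 'm) monoid_scheme \<Rightarrow> 'g set \<Rightarrow> 'a set \<Rightarrow> ('g \<Rightarrow> 'a \<Rightarrow> 'a) \<Rightarrow> 'g
    \<Rightarrow> ('a \<Rightarrow> int) \<Rightarrow> 'a \<Rightarrow> int" where
  "dual_act G K M \<alpha> g \<phi> = (\<lambda>x. if x \<in> M \<and> g \<in> K then \<phi> (\<alpha> (inv\<^bsub>G\<^esub> g) x) else 0)"

definition dual_map :: "'a set \<Rightarrow> ('a \<Rightarrow> 'b) \<Rightarrow> ('b \<Rightarrow> int) \<Rightarrow> 'a \<Rightarrow> int" where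
  "dual_map M f \<phi> = (\<lambda>x. if x \<in> M then \<phi> (f x) else 0)"

text \<open>
  The sum of the translates of a form by L. It is the image of the form in the coinvariants under L,
  written as an L-invariant map.
\<close>

definition norm_over :: "'g set \<Rightarrow> ('g \<Rightarrow> 'a \<Rightarrow> 'a) \<Rightarrow> ('a \<Rightarrow> int) \<Rightarrow> 'a \<Rightarrow> int" where
  "norm_over L \<alpha> \<phi> x = (\<Sum>k\<in>{k \<in> L. \<phi> (\<alpha> k x) \<noteq> 0}. \<phi> (\<alpha> k x))"

lemma dual_modD:
  assumes "\<phi> \<in> dual_mod K M \<alpha>"
  shows "addmap M \<phi>" "x \<notin> M \<Longrightarrow> \<phi> x = 0" "x \<in> M \<Longrightarrow> finite {g \<in> K. \<phi> (\<alpha> g x) \<noteq> 0}"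
  using assms unfolding dual_mod_def by blast+

lemma dual_mod_addsub: "addsub (dual_mod K M \<alpha>)"
  unfolding addsub_def
proof (intro conjI ballI)
  show "0 \<in> dual_mod K M \<alpha>" by (simp add: dual_mod_def addmap_def)
next
  fix \<phi> \<psi> assume \<phi>: "\<phi> \<in> dual_mod K M \<alpha>" and \<psi>: "\<psi> \<in> dual_mod K M \<alpha>"
  have "finite {g \<in> K. (\<phi> + \<psi>) (\<alpha> g x) \<noteq> 0}" if "x \<in> M" for x
    by (rule finite_subset[OF _ finite_UnI[OF dual_modD(3)[OF \<phi> that] dual_modD(3)[OF \<psi> that]]]) auto
  then show "\<phi> + \<psi> \<in> dual_mod K M \<alpha>"
    using dual_modD(1,2)[OF \<phi>] dual_modD(1,2)[OF \<psi>] by (simp add: dual_mod_def addmap_def)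
next
  fix \<phi> assume "\<phi> \<in> dual_mod K M \<alpha>"
  then show "- \<phi> \<in> dual_mod K M \<alpha>" by (simp add: dual_mod_def addmap_def)
qed

lemma addmap_eval: "addmap S (\<lambda>\<phi>. \<phi> x)"
  by (simp add: addmap_def)

lemma dual_gmod:
  assumes "group G" "subgroup K G" "gmod G K M \<alpha>"
  shows "gmod G K (dual_mod K M \<alpha>) (dual_act G K M \<alpha>)"
proof -
  interpret G: group G by fact
  interpret K: subgroup K G by fact
  note MD = gmodD[OF assms(3)]
  have closed: "dual_act G K M \<alpha> h \<phi> \<in> dual_mod K M \<alpha>" if h: "h \<in> K" and \<phi>: "\<phi> \<in> dual_mod K M \<alpha>" for h \<phi>
    unfolding dual_mod_def mem_Collect_eq
  proof (intro conjI ballI allI impI)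
    show "addmap M (dual_act G K M \<alpha> h \<phi>)"
      using h unfolding addmap_def dual_act_def
      by (simp add: addsubD(2)[OF MD(1)] addmap_add[OF MD(3)] addmap_add[OF dual_modD(1)[OF \<phi>]] MD(2))
    show "dual_act G K M \<alpha> h \<phi> x = 0" if "x \<notin> M" for x
      using that by (simp add: dual_act_def)
    show "finite {g \<in> K. dual_act G K M \<alpha> h \<phi> (\<alpha> g x) \<noteq> 0}" if x: "x \<in> M" for x
    proof (rule finite_subset[OF _ finite_imageI[OF dual_modD(3)[OF \<phi> x], of "\<lambda>g. h \<otimes>\<^bsub>G\<^esub> g"]])
      show "{g \<in> K. dual_act G K M \<alpha> h \<phi> (\<alpha> g x) \<noteq> 0} \<subseteq> (\<lambda>g. h \<otimes>\<^bsub>G\<^esub> g) ` {g \<in> K. \<phi> (\<alpha> g x) \<noteq> 0}"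
      proof
        fix g assume "g \<in> {g \<in> K. dual_act G K M \<alpha> h \<phi> (\<alpha> g x) \<noteq> 0}"
        then have g: "g \<in> K" and nz: "\<phi> (\<alpha> (inv\<^bsub>G\<^esub> h) (\<alpha> g x)) \<noteq> 0"
          using h x MD(2) by (auto simp: dual_act_def)
        have "\<alpha> (inv\<^bsub>G\<^esub> h) (\<alpha> g x) = \<alpha> (inv\<^bsub>G\<^esub> h \<otimes>\<^bsub>G\<^esub> g) x"
          using h g x by (simp add: MD(5))
        moreover have "g = h \<otimes>\<^bsub>G\<^esub> (inv\<^bsub>G\<^esub> h \<otimes>\<^bsub>G\<^esub> g)"
          using h g by (simp add: G.m_assoc[symmetric])
        ultimately show "g \<in> (\<lambda>g. h \<otimes>\<^bsub>G\<^esub> g) ` {g \<in> K. \<phi> (\<alpha> g x) \<noteq> 0}"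
          using nz g h by (intro image_eqI[of _ _ "inv\<^bsub>G\<^esub> h \<otimes>\<^bsub>G\<^esub> g"]) auto
      qed
    qed
  qed
  show ?thesis
    unfolding gmod_def
  proof (intro conjI ballI dual_mod_addsub)
    fix g assume g: "g \<in> K"
    show "dual_act G K M \<alpha> g ` dual_mod K M \<alpha> \<subseteq> dual_mod K M \<alpha>" using closed[OF g] by blast
    show "addmap (dual_mod K M \<alpha>) (dual_act G K M \<alpha> g)"
      by (auto simp: addmap_def dual_act_def fun_eq_iff)
  next
    fix \<phi> assume "\<phi> \<in> dual_mod K M \<alpha>"
    then show "dual_act G K M \<alpha> \<one>\<^bsub>G\<^esub> \<phi> = \<phi>"
      using MD(4) dual_modD(2) by (force simp: dual_act_def fun_eq_iff)
  next
    fix g h \<phi> assume g: "g \<in> K" and h: "h \<in> K" and "\<phi> \<in> dual_mod K M \<alpha>"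
    show "dual_act G K M \<alpha> (g \<otimes>\<^bsub>G\<^esub> h) \<phi> = dual_act G K M \<alpha> g (dual_act G K M \<alpha> h \<phi>)"
      using g h by (auto simp: dual_act_def fun_eq_iff G.inv_mult_group MD(5) MD(2))
  qed
qed

lemma dual_map_ghom:
  assumes "group G" "subgroup K G" "gmod G K M \<alpha>" "gmod G K N \<beta>" "ghom K M \<alpha> N \<beta> f"
  shows "ghom K (dual_mod K N \<beta>) (dual_act G K N \<beta>) (dual_mod K M \<alpha>) (dual_act G K M \<alpha>) (dual_map M f)"
proof -
  interpret G: group G by fact
  interpret K: subgroup K G by fact
  note MD = gmodD[OF assms(3)] and ND = gmodD[OF assms(4)] and fD = ghomD[OF assms(5)]
  show ?thesis
    unfolding ghom_def
  proof (intro conjI ballI)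
    show "dual_map M f ` dual_mod K N \<beta> \<subseteq> dual_mod K M \<alpha>"
    proof (rule image_subsetI)
      fix \<phi> assume \<phi>: "\<phi> \<in> dual_mod K N \<beta>"
      have "finite {g \<in> K. dual_map M f \<phi> (\<alpha> g x) \<noteq> 0}" if x: "x \<in> M" for x
        by (rule finite_subset[OF _ dual_modD(3)[OF \<phi> fD(1)[OF x]]])
          (use x in \<open>auto simp: dual_map_def fD(3) MD(2)\<close>)
      then show "dual_map M f \<phi> \<in> dual_mod K M \<alpha>"
        by (simp add: dual_mod_def dual_map_def addmap_def addmap_add[OF fD(2)] addsubD(2)[OF MD(1)]
            addmap_add[OF dual_modD(1)[OF \<phi>]] fD(1))
    qed
    show "addmap (dual_mod K N \<beta>) (dual_map M f)"
      by (auto simp: addmap_def dual_map_def fun_eq_iff)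
    fix g \<phi> assume "g \<in> K" "\<phi> \<in> dual_mod K N \<beta>"
    then show "dual_map M f (dual_act G K N \<beta> g \<phi>) = dual_act G K M \<alpha> g (dual_map M f \<phi>)"
      by (auto simp: dual_act_def dual_map_def fun_eq_iff fD(1) fD(3) MD(2))
  qed
qed

definition dual_vec :: "'a set \<Rightarrow> ('j \<Rightarrow> 'a \<Rightarrow> int) \<Rightarrow> 'j \<Rightarrow> 'a \<Rightarrow> int" where
  "dual_vec M \<kappa> j = (\<lambda>x. if x \<in> M then \<kappa> j x else 0)"

lemma dual_vec_in_dual:
  assumes "group G" "subgroup K G" "gmod G K M \<alpha>" "dual_basis G K M \<alpha> J b \<kappa>" "j \<in> J"
  shows "dual_vec M \<kappa> j \<in> dual_mod K M \<alpha>"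
proof -
  interpret G: group G by fact
  interpret K: subgroup K G by fact
  note MD = gmodD[OF assms(3)]
  have "finite {g \<in> K. dual_vec M \<kappa> j (\<alpha> g x) \<noteq> 0}" if x: "x \<in> M" for x
  proof (rule finite_subset[OF _ finite_imageI[OF dual_basisD(3)[OF assms(4) x], of "\<lambda>(g, j). inv\<^bsub>G\<^esub> g"]])
    show "{g \<in> K. dual_vec M \<kappa> j (\<alpha> g x) \<noteq> 0} \<subseteq> (\<lambda>(g, j). inv\<^bsub>G\<^esub> g) ` dsupp G K \<alpha> J \<kappa> x"
      using assms(5) x MD(2)
      by (auto simp: dual_vec_def dsupp_def intro!: image_eqI[of _ _ "(inv\<^bsub>G\<^esub> _, j)"] split: if_splits)
  qed
  moreover have "addmap M (dual_vec M \<kappa> j)"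
    unfolding addmap_def dual_vec_def
    by (simp add: addsubD(2)[OF MD(1)] addmap_add[OF dual_basisD(2)[OF assms(4,5)]])
  ultimately show ?thesis unfolding dual_mod_def by (simp add: dual_vec_def)
qed

text \<open>
  A finite dual basis can be read in the opposite direction: the forms become the basis and
  evaluation at the basis vectors the forms.
\<close>

lemma dual_dual_basis:
  assumes "group G" "subgroup K G" "gmod G K M \<alpha>" "dual_basis G K M \<alpha> J b \<kappa>" "finite J"
  shows "dual_basis G K (dual_mod K M \<alpha>) (dual_act G K M \<alpha>) J (dual_vec M \<kappa>) (\<lambda>j \<phi>. \<phi> (b j))"
proof -
  interpret G: group G by fact
  interpret K: subgroup K G by fact
  note MD = gmodD[OF assms(3)] and bD = dual_basisD[OF assms(4)]
  show ?thesis
    unfolding dual_basis_def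
  proof (intro conjI ballI)
    fix j assume "j \<in> J"
    then show "dual_vec M \<kappa> j \<in> dual_mod K M \<alpha>" by (rule dual_vec_in_dual[OF assms(1-4)])
    show "addmap (dual_mod K M \<alpha>) (\<lambda>\<phi>. \<phi> (b j))" by (rule addmap_eval)
  next
    fix \<phi> assume \<phi>: "\<phi> \<in> dual_mod K M \<alpha>"
    let ?D = "dsupp G K (dual_act G K M \<alpha>) J (\<lambda>j \<phi>. \<phi> (b j)) \<phi>"
    have D: "?D = {(g, j). g \<in> K \<and> j \<in> J \<and> \<phi> (\<alpha> g (b j)) \<noteq> 0}"
      by (auto simp: dsupp_def dual_act_def bD(1))
    have "?D \<subseteq> (\<Union>j\<in>J. (\<lambda>g. (g, j)) ` {g \<in> K. \<phi> (\<alpha> g (b j)) \<noteq> 0})"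
      unfolding D by auto
    then show fin: "finite ?D"
      using assms(5) dual_modD(3)[OF \<phi> bD(1)] by (auto elim!: finite_subset)
    show "\<phi> = (\<Sum>(g, j)\<in>?D. iscale (dual_act G K M \<alpha> (inv\<^bsub>G\<^esub> g) \<phi> (b j)) (dual_act G K M \<alpha> g (dual_vec M \<kappa> j)))"
      (is "\<phi> = ?S")
    proof
      fix x
      have S: "?S x = (\<Sum>(g, j)\<in>?D. dual_act G K M \<alpha> (inv\<^bsub>G\<^esub> g) \<phi> (b j) * dual_act G K M \<alpha> g (dual_vec M \<kappa> j) x)"
        by (subst addmap_sum[OF addmap_eval addsub_UNIV]) (auto intro!: sum.cong)
      show "\<phi> x = ?S x"
      proof (cases "x \<in> M")
        case False
        then show ?thesis unfolding S using dual_modD(2)[OF \<phi> False] by (simp add: dual_act_def)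
      next
        case x: True
        let ?T = "?D \<union> dsupp G K \<alpha> J \<kappa> x"
        have T: "finite ?T" "?T \<subseteq> K \<times> J" using fin bD(3)[OF x] by (auto simp: dsupp_def)
        have "?S x = (\<Sum>(g, j)\<in>?D. \<phi> (\<alpha> g (b j)) * \<kappa> j (\<alpha> (inv\<^bsub>G\<^esub> g) x))"
          unfolding S using x by (intro sum.cong HOL.refl) (auto simp: D dual_act_def bD(1) dual_vec_def MD(2))
        also have "\<dots> = (\<Sum>(g, j)\<in>?T. \<phi> (\<alpha> g (b j)) * \<kappa> j (\<alpha> (inv\<^bsub>G\<^esub> g) x))"
          using T by (intro sum.mono_neutral_left) (auto simp: D)
        also have "\<dots> = (\<Sum>(g, j)\<in>?T. \<phi> (iscale (\<kappa> j (\<alpha> (inv\<^bsub>G\<^esub> g) x)) (\<alpha> g (b j))))"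
          using T(2)
          by (intro sum.cong HOL.refl)
            (auto simp: addmap_iscale[OF dual_modD(1)[OF \<phi>] MD(1)] MD(2) bD(1) subset_iff)
        also have "\<dots> = \<phi> (\<Sum>(g, j)\<in>?T. iscale (\<kappa> j (\<alpha> (inv\<^bsub>G\<^esub> g) x)) (\<alpha> g (b j)))"
          using T(2) by (subst addmap_sum[OF dual_modD(1)[OF \<phi>] MD(1)])
            (auto simp: case_prod_beta intro!: addsub_iscale[OF MD(1)] MD(2) bD(1))
        also have "\<dots> = \<phi> x"
          using dual_basis_expand[OF assms(4) x T] by simp
        finally show ?thesis by simp
      qed
    qed
  qed
qed

lemma dual_basis_retract:
  assumes "group G" "subgroup K G" "gmod G K M \<alpha>" "dual_basis G K M \<alpha> J b \<kappa>" "N \<subseteq> M" "gmod G K N \<alpha>"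
    "ghom K M \<alpha> N \<alpha> r" "\<And>x. x \<in> N \<Longrightarrow> r x = x"
  shows "dual_basis G K N \<alpha> J (\<lambda>j. r (b j)) \<kappa>"
proof -
  interpret G: group G by fact
  interpret K: subgroup K G by fact
  note MD = gmodD[OF assms(3)] and bD = dual_basisD[OF assms(4)] and rD = ghomD[OF assms(7)]
  have "x = (\<Sum>(g, j)\<in>dsupp G K \<alpha> J \<kappa> x. iscale (\<kappa> j (\<alpha> (inv\<^bsub>G\<^esub> g) x)) (\<alpha> g (r (b j))))"
    if x: "x \<in> N" for x
  proof -
    have xM: "x \<in> M" using x assms(5) by blast
    have "x = r x" using assms(8)[OF x] by simp
    also have "\<dots> = r (\<Sum>(g, j)\<in>dsupp G K \<alpha> J \<kappa> x. iscale (\<kappa> j (\<alpha> (inv\<^bsub>G\<^esub> g) x)) (\<alpha> g (b j)))"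
      using bD(4)[OF xM] by simp
    also have "\<dots> = (\<Sum>(g, j)\<in>dsupp G K \<alpha> J \<kappa> x. r (iscale (\<kappa> j (\<alpha> (inv\<^bsub>G\<^esub> g) x)) (\<alpha> g (b j))))"
      by (subst addmap_sum[OF rD(2) MD(1)])
        (auto simp: case_prod_beta dsupp_def intro!: addsub_iscale[OF MD(1)] MD(2) bD(1))
    also have "\<dots> = (\<Sum>(g, j)\<in>dsupp G K \<alpha> J \<kappa> x. iscale (\<kappa> j (\<alpha> (inv\<^bsub>G\<^esub> g) x)) (\<alpha> g (r (b j))))"
      by (intro sum.cong HOL.refl) (auto simp: dsupp_def addmap_iscale[OF rD(2) MD(1)] MD(2) bD(1) rD(3))
    finally show ?thesis .
  qed
  moreover have "addmap N (\<kappa> j)" if "j \<in> J" for j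
    using bD(2)[OF that] assms(5) by (auto simp: addmap_def)
  ultimately show ?thesis
    unfolding dual_basis_def using bD(3) rD(1)[OF bD(1)] assms(5) by blast
qed

section \<open>Norms\<close>

lemma norm_over_superset:
  assumes "finite T" "T \<subseteq> L" "\<And>k. k \<in> L \<Longrightarrow> \<phi> (\<alpha> k x) \<noteq> 0 \<Longrightarrow> k \<in> T"
  shows "norm_over L \<alpha> \<phi> x = (\<Sum>k\<in>T. \<phi> (\<alpha> k x))"
  unfolding norm_over_def using assms by (intro sum.mono_neutral_left) auto

lemma dual_support_finite:
  assumes "\<phi> \<in> dual_mod K M \<alpha>" "L \<subseteq> K" "x \<in> M"
  shows "finite {k \<in> L. \<phi> (\<alpha> k x) \<noteq> 0}"
  by (rule finite_subset[OF _ dual_modD(3)[OF assms(1,3)]]) (use assms(2) in auto)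

lemma norm_over_addmap:
  assumes "L \<subseteq> K" "x \<in> M"
  shows "addmap (dual_mod K M \<alpha>) (\<lambda>\<phi>. norm_over L \<alpha> \<phi> x)"
  unfolding addmap_def
proof (intro ballI)
  fix \<phi> \<psi> assume \<phi>: "\<phi> \<in> dual_mod K M \<alpha>" and \<psi>: "\<psi> \<in> dual_mod K M \<alpha>"
  define T where "T = {k \<in> L. \<phi> (\<alpha> k x) \<noteq> 0} \<union> {k \<in> L. \<psi> (\<alpha> k x) \<noteq> 0}"
  have T: "finite T" "T \<subseteq> L"
    unfolding T_def using dual_support_finite[OF \<phi> assms] dual_support_finite[OF \<psi> assms] by auto
  have "norm_over L \<alpha> (\<phi> + \<psi>) x = (\<Sum>k\<in>T. (\<phi> + \<psi>) (\<alpha> k x))"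
    by (rule norm_over_superset[OF T]) (auto simp: T_def)
  also have "\<dots> = (\<Sum>k\<in>T. \<phi> (\<alpha> k x)) + (\<Sum>k\<in>T. \<psi> (\<alpha> k x))" by (simp add: sum.distrib)
  also have "\<dots> = norm_over L \<alpha> \<phi> x + norm_over L \<alpha> \<psi> x"
    by (subst (1 2) norm_over_superset[OF T]) (auto simp: T_def)
  finally show "norm_over L \<alpha> (\<phi> + \<psi>) x = norm_over L \<alpha> \<phi> x + norm_over L \<alpha> \<psi> x" .
qed

lemma norm_over_act:
  assumes "group G" "subgroup K G" "gmod G K M \<alpha>" "subgroup L G" "L \<subseteq> K" "h \<in> L" "x \<in> M"
  shows "norm_over L \<alpha> \<phi> (\<alpha> h x) = norm_over L \<alpha> \<phi> x"
proof -
  interpret G: group G by fact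
  interpret K: subgroup K G by fact
  interpret L: subgroup L G by fact
  have e: "\<alpha> k (\<alpha> h x) = \<alpha> (k \<otimes>\<^bsub>G\<^esub> h) x" if "k \<in> L" for k
    by (rule gmodD(5)[OF assms(3), symmetric]) (use assms(5-7) that in blast)+
  have c1: "k \<otimes>\<^bsub>G\<^esub> inv\<^bsub>G\<^esub> h \<otimes>\<^bsub>G\<^esub> h = k" "k \<otimes>\<^bsub>G\<^esub> h \<otimes>\<^bsub>G\<^esub> inv\<^bsub>G\<^esub> h = k" if "k \<in> L" for k
    using that assms(6) by (simp_all add: G.m_assoc)
  have "bij_betw (\<lambda>k. k \<otimes>\<^bsub>G\<^esub> h) {k \<in> L. \<phi> (\<alpha> k (\<alpha> h x)) \<noteq> 0} {k \<in> L. \<phi> (\<alpha> k x) \<noteq> 0}"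
  proof (rule bij_betwI[where g = "\<lambda>k. k \<otimes>\<^bsub>G\<^esub> inv\<^bsub>G\<^esub> h"])
    show "(\<lambda>k. k \<otimes>\<^bsub>G\<^esub> h) \<in> {k \<in> L. \<phi> (\<alpha> k (\<alpha> h x)) \<noteq> 0} \<rightarrow> {k \<in> L. \<phi> (\<alpha> k x) \<noteq> 0}"
      using assms(6) by (auto simp: e)
    show "(\<lambda>k. k \<otimes>\<^bsub>G\<^esub> inv\<^bsub>G\<^esub> h) \<in> {k \<in> L. \<phi> (\<alpha> k x) \<noteq> 0} \<rightarrow> {k \<in> L. \<phi> (\<alpha> k (\<alpha> h x)) \<noteq> 0}"
      using assms(6) by (auto simp: e c1)
  qed (use assms(6) in \<open>simp_all add: c1\<close>)
  from sum.reindex_bij_betw[OF this, of "\<lambda>k. \<phi> (\<alpha> k x)"]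
  show ?thesis unfolding norm_over_def by (simp add: e)
qed

lemma norm_over_dual_act:
  assumes "group G" "subgroup K G" "gmod G K M \<alpha>" "subgroup L G" "L \<subseteq> K" "h \<in> L" "x \<in> M"
  shows "norm_over L \<alpha> (dual_act G K M \<alpha> h \<phi>) x = norm_over L \<alpha> \<phi> x"
proof -
  interpret G: group G by fact
  interpret K: subgroup K G by fact
  interpret L: subgroup L G by fact
  have e: "dual_act G K M \<alpha> h \<phi> (\<alpha> k x) = \<phi> (\<alpha> (inv\<^bsub>G\<^esub> h \<otimes>\<^bsub>G\<^esub> k) x)" if "k \<in> L" for k
  proof -
    have "\<alpha> (inv\<^bsub>G\<^esub> h \<otimes>\<^bsub>G\<^esub> k) x = \<alpha> (inv\<^bsub>G\<^esub> h) (\<alpha> k x)"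
      using that assms(5-7) by (intro gmodD(5)[OF assms(3)]) auto
    moreover have "\<alpha> k x \<in> M" using that assms(5,7) gmodD(2)[OF assms(3)] by auto
    ultimately show ?thesis using assms(5,6) by (auto simp: dual_act_def)
  qed
  have c1: "inv\<^bsub>G\<^esub> h \<otimes>\<^bsub>G\<^esub> (h \<otimes>\<^bsub>G\<^esub> k) = k" "h \<otimes>\<^bsub>G\<^esub> (inv\<^bsub>G\<^esub> h \<otimes>\<^bsub>G\<^esub> k) = k" if "k \<in> L" for k
    using that assms(6) by (simp_all add: G.m_assoc[symmetric])
  have "bij_betw (\<lambda>k. inv\<^bsub>G\<^esub> h \<otimes>\<^bsub>G\<^esub> k) {k \<in> L. dual_act G K M \<alpha> h \<phi> (\<alpha> k x) \<noteq> 0} {k \<in> L. \<phi> (\<alpha> k x) \<noteq> 0}"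
  proof (rule bij_betwI[where g = "\<lambda>k. h \<otimes>\<^bsub>G\<^esub> k"])
    show "(\<lambda>k. inv\<^bsub>G\<^esub> h \<otimes>\<^bsub>G\<^esub> k) \<in> {k \<in> L. dual_act G K M \<alpha> h \<phi> (\<alpha> k x) \<noteq> 0} \<rightarrow> {k \<in> L. \<phi> (\<alpha> k x) \<noteq> 0}"
      using assms(6) by (auto simp: e)
    show "(\<lambda>k. h \<otimes>\<^bsub>G\<^esub> k) \<in> {k \<in> L. \<phi> (\<alpha> k x) \<noteq> 0} \<rightarrow> {k \<in> L. dual_act G K M \<alpha> h \<phi> (\<alpha> k x) \<noteq> 0}"
      using assms(6) by (auto simp: e c1)
  qed (use assms(6) in \<open>simp_all add: c1\<close>)
  from sum.reindex_bij_betw[OF this, of "\<lambda>k. \<phi> (\<alpha> k x)"]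
  show ?thesis unfolding norm_over_def by (simp add: e)
qed

lemma norm_over_dual_map:
  assumes "gmod G K M \<alpha>" "ghom K M \<alpha> N \<beta> f" "L \<subseteq> K" "x \<in> M"
  shows "norm_over L \<alpha> (dual_map M f \<phi>) x = norm_over L \<beta> \<phi> (f x)"
proof -
  have "dual_map M f \<phi> (\<alpha> k x) = \<phi> (\<beta> k (f x))" if "k \<in> L" for k
    using that assms(3,4) gmodD(2)[OF assms(1)] ghomD(3)[OF assms(2)] by (auto simp: dual_map_def)
  then show ?thesis unfolding norm_over_def by (intro sum.cong) auto
qed

lemma norm_over_addmap_right:
  assumes "gmod G K M \<alpha>" "\<phi> \<in> dual_mod K M \<alpha>" "L \<subseteq> K"
  shows "addmap M (norm_over L \<alpha> \<phi>)"
  unfolding addmap_def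
proof (intro ballI)
  fix x y assume x: "x \<in> M" and y: "y \<in> M"
  note MD = gmodD[OF assms(1)]
  have xy: "x + y \<in> M" using addsubD(2)[OF MD(1) x y] .
  define T where "T = {k \<in> L. \<phi> (\<alpha> k x) \<noteq> 0} \<union> {k \<in> L. \<phi> (\<alpha> k y) \<noteq> 0} \<union> {k \<in> L. \<phi> (\<alpha> k (x + y)) \<noteq> 0}"
  have T: "finite T" "T \<subseteq> L"
    unfolding T_def using dual_support_finite[OF assms(2,3)] x y xy by auto
  have "\<phi> (\<alpha> k (x + y)) = \<phi> (\<alpha> k x) + \<phi> (\<alpha> k y)" if "k \<in> T" for k
    using that T(2) assms(3) x y
    by (simp add: addmap_add[OF MD(3)] addmap_add[OF dual_modD(1)[OF assms(2)]] MD(2) subset_iff)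
  then have "(\<Sum>k\<in>T. \<phi> (\<alpha> k (x + y))) = (\<Sum>k\<in>T. \<phi> (\<alpha> k x)) + (\<Sum>k\<in>T. \<phi> (\<alpha> k y))"
    by (simp add: sum.distrib)
  then show "norm_over L \<alpha> \<phi> (x + y) = norm_over L \<alpha> \<phi> x + norm_over L \<alpha> \<phi> y"
    by (subst (1 2 3) norm_over_superset[OF T]) (auto simp: T_def)
qed

lemma sum_pair_cong:
  "(\<And>r j. r \<in> R \<Longrightarrow> j \<in> J \<Longrightarrow> F r j = F' r j) \<Longrightarrow> (\<Sum>(r, j)\<in>R \<times> J. F r j) = (\<Sum>(r, j)\<in>R \<times> J. F' r j)"
  by (rule sum.cong) auto

lemma sum_triple_cong:
  "(\<And>r j k. r \<in> R \<Longrightarrow> j \<in> J \<Longrightarrow> k \<in> E \<Longrightarrow> F r j k = F' r j k) \<Longrightarrow>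
   (\<Sum>((r, j), k)\<in>(R \<times> J) \<times> E. F r j k) = (\<Sum>((r, j), k)\<in>(R \<times> J) \<times> E. F' r j k)"
  by (rule sum.cong) auto

definition coset_rep :: "('g, 'm) monoid_scheme \<Rightarrow> 'g set \<Rightarrow> 'g \<Rightarrow> 'g" where
  "coset_rep G L g = (SOME r. r \<in> L #>\<^bsub>G\<^esub> g)"

lemma coset_rep:
  assumes "group G" "subgroup L G" "g \<in> carrier G"
  obtains l where "l \<in> L" "g = l \<otimes>\<^bsub>G\<^esub> coset_rep G L g" "coset_rep G L g = inv\<^bsub>G\<^esub> l \<otimes>\<^bsub>G\<^esub> g"
    "coset_rep G L g \<in> carrier G"
proof -
  interpret G: group G by fact
  interpret L: subgroup L G by fact
  have "coset_rep G L g \<in> L #>\<^bsub>G\<^esub> g"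
    unfolding coset_rep_def using G.rcos_self[OF assms(3,2)] by (rule someI)
  then obtain k where k: "k \<in> L" "coset_rep G L g = k \<otimes>\<^bsub>G\<^esub> g" by (auto simp: r_coset_def)
  show thesis
    by (rule that[of "inv\<^bsub>G\<^esub> k"]) (use k assms(3) in \<open>auto simp: G.m_assoc[symmetric]\<close>)
qed

lemma coset_rep_mult:
  assumes "group G" "subgroup L G" "g \<in> carrier G" "l \<in> L"
  shows "coset_rep G L (l \<otimes>\<^bsub>G\<^esub> g) = coset_rep G L g"
proof -
  interpret G: group G by fact
  interpret L: subgroup L G by fact
  have "L #>\<^bsub>G\<^esub> (l \<otimes>\<^bsub>G\<^esub> g) = L #>\<^bsub>G\<^esub> g"
    using assms by (metis G.coset_mult_assoc G.coset_join2 L.mem_carrier L.subset)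
  then show ?thesis by (simp add: coset_rep_def)
qed

text \<open>Pairwise distinct cosets L r, without the requirement that they exhaust the group.\<close>

definition independent_reps :: "('g, 'm) monoid_scheme \<Rightarrow> 'g set \<Rightarrow> 'g set \<Rightarrow> bool" where
  "independent_reps G L R \<longleftrightarrow> (\<forall>r\<in>R. \<forall>s\<in>R. \<forall>l\<in>L. r = l \<otimes>\<^bsub>G\<^esub> s \<longrightarrow> r = s)"

lemma independent_reps_coset_rep:
  assumes "group G" "subgroup L G" "S \<subseteq> carrier G"
  shows "independent_reps G L (coset_rep G L ` S)"
proof -
  interpret G: group G by fact
  interpret L: subgroup L G by fact
  have idem: "coset_rep G L (coset_rep G L g) = coset_rep G L g" if "g \<in> carrier G" for g
    using coset_rep[OF assms(1,2) that] coset_rep_mult[OF assms(1,2) that] by (metis L.m_inv_closed)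
  have "coset_rep G L g = coset_rep G L h"
    if "g \<in> S" "h \<in> S" "l \<in> L" "coset_rep G L g = l \<otimes>\<^bsub>G\<^esub> coset_rep G L h" for g h l
  proof -
    have g: "g \<in> carrier G" and h: "h \<in> carrier G" using that assms(3) by auto
    have "coset_rep G L h \<in> carrier G" using coset_rep[OF assms(1,2) h] by blast
    then show ?thesis
      using idem[OF g] idem[OF h] coset_rep_mult[OF assms(1,2) _ that(3), of "coset_rep G L h"] that(4) by simp
  qed
  then show ?thesis unfolding independent_reps_def by auto
qed

lemma independent_reps_inj:
  assumes "group G" "subgroup L G" "R \<subseteq> carrier G" "independent_reps G L R"
  shows "inj_on (\<lambda>(l, r). l \<otimes>\<^bsub>G\<^esub> r) (L \<times> R)"
proof -
  interpret G: group G by fact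
  interpret L: subgroup L G by fact
  have "l = l' \<and> r = r'" if "l \<in> L" "r \<in> R" "l' \<in> L" "r' \<in> R" "l \<otimes>\<^bsub>G\<^esub> r = l' \<otimes>\<^bsub>G\<^esub> r'" for l r l' r'
  proof -
    have c: "r \<in> carrier G" "r' \<in> carrier G" using that assms(3) by auto
    have "r = (inv\<^bsub>G\<^esub> l \<otimes>\<^bsub>G\<^esub> l') \<otimes>\<^bsub>G\<^esub> r'"
      using that c by (metis G.inv_closed G.inv_solve_left G.m_assoc G.m_closed L.mem_carrier)
    then have "r = r'" using assms(4) that unfolding independent_reps_def by blast
    then show ?thesis using that c by simp
  qed
  then show ?thesis by (auto simp: inj_on_def)
qed

text \<open>
  Norms in stages. The finite set R need only represent those cosets on which the orbit of x
  meets the support of the form.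
\<close>

lemma norm_over_trans:
  assumes "group G" "subgroup K G" "gmod G K M \<alpha>" "subgroup L G" "subgroup L' G" "L' \<subseteq> L" "L \<subseteq> K"
    and \<phi>: "\<phi> \<in> dual_mod K M \<alpha>" and x: "x \<in> M"
    and R: "finite R" "R \<subseteq> L" "independent_reps G L' R"
      "\<And>g. g \<in> L \<Longrightarrow> \<phi> (\<alpha> g x) \<noteq> 0 \<Longrightarrow> \<exists>l\<in>L'. \<exists>r\<in>R. g = l \<otimes>\<^bsub>G\<^esub> r"
  shows "norm_over L \<alpha> \<phi> x = (\<Sum>r\<in>R. norm_over L' \<alpha> \<phi> (\<alpha> r x))"
proof -
  interpret G: group G by fact
  interpret L: subgroup L G by fact
  interpret L': subgroup L' G by fact
  note MD = gmodD[OF assms(3)]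
  have Rc: "R \<subseteq> carrier G" using R(2) L.subset by blast
  have rx: "\<alpha> r x \<in> M" if "r \<in> R" for r using that R(2) assms(7) x MD(2) by blast
  define S where "S = (\<Union>r\<in>R. {k \<in> L'. \<phi> (\<alpha> k (\<alpha> r x)) \<noteq> 0})"
  have L'K: "L' \<subseteq> K" using assms(6,7) by blast
  have S: "finite S" "S \<subseteq> L'"
    unfolding S_def using R(1) dual_support_finite[OF \<phi> L'K rx] by auto
  have e: "\<alpha> (k \<otimes>\<^bsub>G\<^esub> r) x = \<alpha> k (\<alpha> r x)" if "k \<in> L'" "r \<in> R" for k r
    using that R(2) assms(6,7) by (intro MD(5) x) auto
  let ?T = "(\<lambda>(l, r). l \<otimes>\<^bsub>G\<^esub> r) ` (S \<times> R)"
  have inj: "inj_on (\<lambda>(l, r). l \<otimes>\<^bsub>G\<^esub> r) (S \<times> R)"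
    using independent_reps_inj[OF assms(1,5) Rc R(3)] by (rule inj_on_subset) (use S in auto)
  have "norm_over L \<alpha> \<phi> x = (\<Sum>k\<in>?T. \<phi> (\<alpha> k x))"
  proof (rule norm_over_superset)
    show "finite ?T" using S R by simp
    show "?T \<subseteq> L" using S(2) R(2) assms(6) by auto
    fix k assume k: "k \<in> L" "\<phi> (\<alpha> k x) \<noteq> 0"
    obtain l r where lr: "l \<in> L'" "r \<in> R" "k = l \<otimes>\<^bsub>G\<^esub> r" using R(4)[OF k] by blast
    then have "l \<in> S" unfolding S_def using k e by auto
    then show "k \<in> ?T" using lr by auto
  qed
  also have "\<dots> = (\<Sum>(l, r)\<in>S \<times> R. \<phi> (\<alpha> (l \<otimes>\<^bsub>G\<^esub> r) x))"
    by (subst sum.reindex[OF inj]) (simp add: case_prod_beta)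
  also have "\<dots> = (\<Sum>(l, r)\<in>S \<times> R. \<phi> (\<alpha> l (\<alpha> r x)))"
    using S(2) by (intro sum.cong HOL.refl) (auto simp: e)
  also have "\<dots> = (\<Sum>l\<in>S. \<Sum>r\<in>R. \<phi> (\<alpha> l (\<alpha> r x)))"
    by (simp add: sum.cartesian_product)
  also have "\<dots> = (\<Sum>r\<in>R. \<Sum>l\<in>S. \<phi> (\<alpha> l (\<alpha> r x)))"
    by (rule sum.swap)
  also have "\<dots> = (\<Sum>r\<in>R. norm_over L' \<alpha> \<phi> (\<alpha> r x))"
    by (intro sum.cong HOL.refl norm_over_superset[OF S, symmetric]) (auto simp: S_def)
  finally show ?thesis .
qed


lemma finite_coset_reps:
  assumes "group G" "subgroup L G" "finite S" "S \<subseteq> carrier G"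
  obtains R where "finite R" "independent_reps G L R" "R \<subseteq> carrier G"
    "\<forall>r\<in>R. \<exists>l\<in>L. \<exists>s\<in>S. r = l \<otimes>\<^bsub>G\<^esub> s" "\<forall>s\<in>S. \<exists>l\<in>L. \<exists>r\<in>R. s = l \<otimes>\<^bsub>G\<^esub> r"
proof (rule that[of "coset_rep G L ` S"])
  interpret G: group G by fact
  interpret L: subgroup L G by fact
  show "independent_reps G L (coset_rep G L ` S)"
    by (rule independent_reps_coset_rep[OF assms(1,2,4)])
  show "coset_rep G L ` S \<subseteq> carrier G"
  proof (rule image_subsetI)
    fix s assume "s \<in> S"
    with assms(4) have "s \<in> carrier G" by blast
    then show "coset_rep G L s \<in> carrier G" by (rule coset_rep[OF assms(1,2)])
  qed
  show "\<forall>r\<in>coset_rep G L ` S. \<exists>l\<in>L. \<exists>s\<in>S. r = l \<otimes>\<^bsub>G\<^esub> s"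
  proof
    fix r assume "r \<in> coset_rep G L ` S"
    obtain s where s: "s \<in> S" "r = coset_rep G L s" using \<open>r \<in> coset_rep G L ` S\<close> by blast
    then have "s \<in> carrier G" using assms(4) by blast
    then obtain l where l: "l \<in> L" "r = inv\<^bsub>G\<^esub> l \<otimes>\<^bsub>G\<^esub> s" unfolding s(2) by (rule coset_rep[OF assms(1,2)])
    show "\<exists>l\<in>L. \<exists>s\<in>S. r = l \<otimes>\<^bsub>G\<^esub> s" using L.m_inv_closed[OF l(1)] s(1) l(2) by blast
  qed
  show "\<forall>s\<in>S. \<exists>l\<in>L. \<exists>r\<in>coset_rep G L ` S. s = l \<otimes>\<^bsub>G\<^esub> r"
  proof
    fix s assume "s \<in> S"
    have "s \<in> carrier G" using \<open>s \<in> S\<close> assms(4) by blast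
    then obtain l where l: "l \<in> L" "s = l \<otimes>\<^bsub>G\<^esub> coset_rep G L s" by (rule coset_rep[OF assms(1,2)])
    then show "\<exists>l\<in>L. \<exists>r\<in>coset_rep G L ` S. s = l \<otimes>\<^bsub>G\<^esub> r" using \<open>s \<in> S\<close> by blast
  qed
qed (use assms(3) in simp)

text \<open>
  Maps invariant under L whose support on every orbit of K is finite modulo L. These are the
  L-invariant elements of the complex with coefficients in chains on cosets of L.
\<close>

definition inv_mod :: "('g, 'm) monoid_scheme \<Rightarrow> 'g set \<Rightarrow> 'g set \<Rightarrow> 'a::ab_group_add set \<Rightarrow> ('g \<Rightarrow> 'a \<Rightarrow> 'a) \<Rightarrow> ('a \<Rightarrow> int) set" where
  "inv_mod G K L M \<alpha> = {\<psi>. addmap M \<psi> \<and> (\<forall>l\<in>L. \<forall>x\<in>M. \<psi> (\<alpha> l x) = \<psi> x) \<and>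
     (\<forall>x\<in>M. \<exists>F. finite F \<and> F \<subseteq> K \<and> (\<forall>g\<in>K. \<psi> (\<alpha> g x) \<noteq> 0 \<longrightarrow> (\<exists>l\<in>L. \<exists>f\<in>F. g = l \<otimes>\<^bsub>G\<^esub> f)))}"

text \<open>
  The norm identifies coinvariants with invariants for a finitely generated projective module: only
  finitely many cosets L r carry a nonzero value of \<open>\<psi>\<close> on the translates of the basis, and
  the sum of \<open>\<psi> (r b\<^sub>j)\<close> times the translate by r of the form \<open>\<kappa> j\<close> has norm \<open>\<psi>\<close>.
\<close>

lemma norm_over_surj:
  assumes "group G" "subgroup K G" "gmod G K M \<alpha>" "dual_basis G K M \<alpha> J b \<kappa>" "finite J"
    and "subgroup L G" "L \<subseteq> K" "\<psi> \<in> inv_mod G K L M \<alpha>"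
  obtains \<phi> where "\<phi> \<in> dual_mod K M \<alpha>" "\<And>x. x \<in> M \<Longrightarrow> norm_over L \<alpha> \<phi> x = \<psi> x"
proof -
  interpret G: group G by fact
  interpret K: subgroup K G by fact
  interpret L: subgroup L G by fact
  note MD = gmodD[OF assms(3)] and bD = dual_basisD[OF assms(4)]
  note DD = gmodD[OF dual_gmod[OF assms(1-3)]]
  have \<psi>: "addmap M \<psi>" "\<And>l x. l \<in> L \<Longrightarrow> x \<in> M \<Longrightarrow> \<psi> (\<alpha> l x) = \<psi> x"
    using assms(8) by (auto simp: inv_mod_def)
  have "\<forall>j\<in>J. \<exists>F. finite F \<and> F \<subseteq> K \<and> (\<forall>g\<in>K. \<psi> (\<alpha> g (b j)) \<noteq> 0 \<longrightarrow> (\<exists>l\<in>L. \<exists>f\<in>F. g = l \<otimes>\<^bsub>G\<^esub> f))"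
    using assms(8) bD(1) by (auto simp: inv_mod_def)
  from bchoice[OF this] obtain F where F0: "\<forall>j\<in>J. finite (F j) \<and> F j \<subseteq> K \<and>
      (\<forall>g\<in>K. \<psi> (\<alpha> g (b j)) \<noteq> 0 \<longrightarrow> (\<exists>l\<in>L. \<exists>f\<in>F j. g = l \<otimes>\<^bsub>G\<^esub> f))" ..
  have F: "\<And>j. j \<in> J \<Longrightarrow> finite (F j) \<and> F j \<subseteq> K"
     "\<And>j g. j \<in> J \<Longrightarrow> g \<in> K \<Longrightarrow> \<psi> (\<alpha> g (b j)) \<noteq> 0 \<Longrightarrow> \<exists>l\<in>L. \<exists>f\<in>F j. g = l \<otimes>\<^bsub>G\<^esub> f"
    using F0 by simp_all
  define S where "S = (\<Union>j\<in>J. F j)"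
  have S: "finite S" "S \<subseteq> K" "S \<subseteq> carrier G" using F(1) assms(5) K.subset by (auto simp: S_def)
  obtain R where R: "finite R" "independent_reps G L R" "R \<subseteq> carrier G"
    and R1: "\<forall>r\<in>R. \<exists>l\<in>L. \<exists>s\<in>S. r = l \<otimes>\<^bsub>G\<^esub> s"
    and R2: "\<forall>s\<in>S. \<exists>l\<in>L. \<exists>r\<in>R. s = l \<otimes>\<^bsub>G\<^esub> r"
    by (rule finite_coset_reps[OF assms(1,6) S(1,3)])
  have RK: "R \<subseteq> K"
  proof
    fix r assume "r \<in> R"
    then obtain l s where "l \<in> L" "s \<in> S" "r = l \<otimes>\<^bsub>G\<^esub> s" using R1 by blast
    then show "r \<in> K" using S(2) assms(7) by auto
  qed
  have cover: "\<exists>l\<in>L. \<exists>r\<in>R. g = l \<otimes>\<^bsub>G\<^esub> r" if jg: "j \<in> J" "g \<in> K" "\<psi> (\<alpha> g (b j)) \<noteq> 0" for g j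
  proof -
    obtain l s where l: "l \<in> L" "s \<in> S" "g = l \<otimes>\<^bsub>G\<^esub> s" using F(2)[OF jg] jg(1) by (auto simp: S_def)
    obtain l' r where l': "l' \<in> L" "r \<in> R" "s = l' \<otimes>\<^bsub>G\<^esub> r" using R2 l(2) by blast
    have "g = (l \<otimes>\<^bsub>G\<^esub> l') \<otimes>\<^bsub>G\<^esub> r" using l l' R(3) by (auto simp: G.m_assoc)
    moreover have "l \<otimes>\<^bsub>G\<^esub> l' \<in> L" using l(1) l'(1) by simp
    ultimately show ?thesis using l'(2) by blast
  qed
  define \<phi> where "\<phi> = (\<Sum>(r, j)\<in>R \<times> J. iscale (\<psi> (\<alpha> r (b j))) (dual_act G K M \<alpha> r (dual_vec M \<kappa> j)))"
  have \<phi>D: "\<phi> \<in> dual_mod K M \<alpha>"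
    unfolding \<phi>_def using RK
    by (intro addsub_sum[OF dual_mod_addsub])
      (auto intro!: addsub_iscale[OF dual_mod_addsub] DD(2) dual_vec_in_dual[OF assms(1-4)])
  have \<phi>x: "\<phi> x = (\<Sum>(r, j)\<in>R \<times> J. \<psi> (\<alpha> r (b j)) * \<kappa> j (\<alpha> (inv\<^bsub>G\<^esub> r) x))" if x: "x \<in> M" for x
    unfolding \<phi>_def
    by (subst addmap_sum[OF addmap_eval addsub_UNIV])
      (use RK x in \<open>auto intro!: sum.cong simp: dual_act_def dual_vec_def MD(2) subset_iff\<close>)
  have "norm_over L \<alpha> \<phi> x = \<psi> x" if x: "x \<in> M" for x
  proof -
    let ?D = "dsupp G K \<alpha> J \<kappa> x"
    define E where "E = {k \<in> L. \<phi> (\<alpha> k x) \<noteq> 0} \<union> {k \<in> L. \<exists>r\<in>R. \<exists>j. (inv\<^bsub>G\<^esub> k \<otimes>\<^bsub>G\<^esub> r, j) \<in> ?D}"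
    have E: "finite E" "E \<subseteq> L"
    proof -
      have "{k \<in> L. \<exists>r\<in>R. \<exists>j. (inv\<^bsub>G\<^esub> k \<otimes>\<^bsub>G\<^esub> r, j) \<in> ?D} \<subseteq> (\<lambda>((g, j), r). r \<otimes>\<^bsub>G\<^esub> inv\<^bsub>G\<^esub> g) ` (?D \<times> R)"
      proof
        fix k assume "k \<in> {k \<in> L. \<exists>r\<in>R. \<exists>j. (inv\<^bsub>G\<^esub> k \<otimes>\<^bsub>G\<^esub> r, j) \<in> ?D}"
        then obtain r j where k: "k \<in> L" "r \<in> R" "(inv\<^bsub>G\<^esub> k \<otimes>\<^bsub>G\<^esub> r, j) \<in> ?D" by blast
        have "r \<in> carrier G" using k R(3) by blast
        then have "k = r \<otimes>\<^bsub>G\<^esub> inv\<^bsub>G\<^esub> (inv\<^bsub>G\<^esub> k \<otimes>\<^bsub>G\<^esub> r)"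
          using k(1) by (simp add: G.inv_mult_group G.m_assoc[symmetric])
        then show "k \<in> (\<lambda>((g, j), r). r \<otimes>\<^bsub>G\<^esub> inv\<^bsub>G\<^esub> g) ` (?D \<times> R)"
          using k(2,3) by (intro image_eqI[of _ _ "((inv\<^bsub>G\<^esub> k \<otimes>\<^bsub>G\<^esub> r, j), r)"]) auto
      qed
      then have "finite {k \<in> L. \<exists>r\<in>R. \<exists>j. (inv\<^bsub>G\<^esub> k \<otimes>\<^bsub>G\<^esub> r, j) \<in> ?D}"
        using bD(3)[OF x] R(1) by (auto elim!: finite_subset)
      then show "finite E" unfolding E_def using dual_support_finite[OF \<phi>D assms(7) x] by simp
      show "E \<subseteq> L" by (auto simp: E_def)
    qed
    let ?f = "\<lambda>((k, r), j). (inv\<^bsub>G\<^esub> k \<otimes>\<^bsub>G\<^esub> r, j)"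
    have inj: "inj_on ?f ((E \<times> R) \<times> J)"
    proof (rule inj_onI)
      fix p q assume A: "p \<in> (E \<times> R) \<times> J" "q \<in> (E \<times> R) \<times> J" "?f p = ?f q"
      obtain r j k where p: "p = ((k, r), j)" by (metis surj_pair)
      obtain r' j' k' where q: "q = ((k', r'), j')" by (metis surj_pair)
      note pq = p q
      have k: "k \<in> L" "k' \<in> L" "r \<in> R" "r' \<in> R" using A(1,2) E(2) unfolding p q by auto
      have e: "inv\<^bsub>G\<^esub> k \<otimes>\<^bsub>G\<^esub> r = inv\<^bsub>G\<^esub> k' \<otimes>\<^bsub>G\<^esub> r'" "j = j'" using A(3) unfolding p q by auto
      have "(inv\<^bsub>G\<^esub> k, r) = (inv\<^bsub>G\<^esub> k', r')"
        using inj_onD[OF independent_reps_inj[OF assms(1,6) R(3,2)], of "(inv\<^bsub>G\<^esub> k, r)" "(inv\<^bsub>G\<^esub> k', r')"] e k by auto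
      then show "p = q" using pq k e(2) by (metis G.inv_inv L.mem_carrier prod.inject)
    qed
    let ?T = "?f ` ((E \<times> R) \<times> J)"
    have T: "finite ?T" "?T \<subseteq> K \<times> J" using E R(1) assms(5,7) RK by auto
    have "norm_over L \<alpha> \<phi> x = (\<Sum>k\<in>E. \<phi> (\<alpha> k x))"
      by (rule norm_over_superset[OF E]) (auto simp: E_def)
    also have "\<dots> = (\<Sum>k\<in>E. \<Sum>(r, j)\<in>R \<times> J. \<kappa> j (\<alpha> (inv\<^bsub>G\<^esub> (inv\<^bsub>G\<^esub> k \<otimes>\<^bsub>G\<^esub> r)) x) * \<psi> (\<alpha> (inv\<^bsub>G\<^esub> k \<otimes>\<^bsub>G\<^esub> r) (b j)))"
    proof (rule sum.cong[OF HOL.refl])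
      fix k assume "k \<in> E"
      then have k: "k \<in> L" "k \<in> K" "inv\<^bsub>G\<^esub> k \<in> L" "inv\<^bsub>G\<^esub> k \<in> K" using E(2) assms(7) by auto
      have "\<phi> (\<alpha> k x) = (\<Sum>(r, j)\<in>R \<times> J. \<psi> (\<alpha> r (b j)) * \<kappa> j (\<alpha> (inv\<^bsub>G\<^esub> r) (\<alpha> k x)))"
        by (rule \<phi>x) (rule MD(2)[OF k(2) x])
      also have "\<dots> = (\<Sum>(r, j)\<in>R \<times> J. \<kappa> j (\<alpha> (inv\<^bsub>G\<^esub> (inv\<^bsub>G\<^esub> k \<otimes>\<^bsub>G\<^esub> r)) x) * \<psi> (\<alpha> (inv\<^bsub>G\<^esub> k \<otimes>\<^bsub>G\<^esub> r) (b j)))"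
      proof (rule sum_pair_cong)
        fix r j assume r: "r \<in> R" and j: "j \<in> J"
        have rK: "r \<in> K" using r RK by blast
        have "\<alpha> (inv\<^bsub>G\<^esub> (inv\<^bsub>G\<^esub> k \<otimes>\<^bsub>G\<^esub> r)) x = \<alpha> (inv\<^bsub>G\<^esub> r \<otimes>\<^bsub>G\<^esub> k) x"
          using k rK by (simp add: G.inv_mult_group)
        also have "\<dots> = \<alpha> (inv\<^bsub>G\<^esub> r) (\<alpha> k x)" using k rK x by (simp add: MD(5))
        finally have 1: "\<alpha> (inv\<^bsub>G\<^esub> (inv\<^bsub>G\<^esub> k \<otimes>\<^bsub>G\<^esub> r)) x = \<alpha> (inv\<^bsub>G\<^esub> r) (\<alpha> k x)" .
        have "\<psi> (\<alpha> (inv\<^bsub>G\<^esub> k \<otimes>\<^bsub>G\<^esub> r) (b j)) = \<psi> (\<alpha> r (b j))"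
          using k rK j by (simp add: MD(5) MD(2) bD(1) \<psi>(2))
        then show "\<psi> (\<alpha> r (b j)) * \<kappa> j (\<alpha> (inv\<^bsub>G\<^esub> r) (\<alpha> k x)) =
            \<kappa> j (\<alpha> (inv\<^bsub>G\<^esub> (inv\<^bsub>G\<^esub> k \<otimes>\<^bsub>G\<^esub> r)) x) * \<psi> (\<alpha> (inv\<^bsub>G\<^esub> k \<otimes>\<^bsub>G\<^esub> r) (b j))"
          using 1 by simp
      qed
      finally show "\<phi> (\<alpha> k x) = (\<Sum>(r, j)\<in>R \<times> J. \<kappa> j (\<alpha> (inv\<^bsub>G\<^esub> (inv\<^bsub>G\<^esub> k \<otimes>\<^bsub>G\<^esub> r)) x) * \<psi> (\<alpha> (inv\<^bsub>G\<^esub> k \<otimes>\<^bsub>G\<^esub> r) (b j)))" .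
    qed
    also have "\<dots> = (\<Sum>(g, j)\<in>?T. \<kappa> j (\<alpha> (inv\<^bsub>G\<^esub> g) x) * \<psi> (\<alpha> g (b j)))"
      by (subst sum.reindex[OF inj]) (simp add: sum.cartesian_product' case_prod_beta)
    also have "\<dots> = (\<Sum>(g, j)\<in>?T \<union> ?D. \<kappa> j (\<alpha> (inv\<^bsub>G\<^esub> g) x) * \<psi> (\<alpha> g (b j)))"
    proof (rule sum.mono_neutral_left)
      show "finite (?T \<union> ?D)" using T bD(3)[OF x] by simp
      show "\<forall>p\<in>?T \<union> ?D - ?T. (case p of (g, j) \<Rightarrow> \<kappa> j (\<alpha> (inv\<^bsub>G\<^esub> g) x) * \<psi> (\<alpha> g (b j))) = 0"
      proof (rule ballI, rule ccontr)
        fix p assume P: "p \<in> ?T \<union> ?D - ?T"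
          and nz': "(case p of (g, j) \<Rightarrow> \<kappa> j (\<alpha> (inv\<^bsub>G\<^esub> g) x) * \<psi> (\<alpha> g (b j))) \<noteq> 0"
        obtain g j where p: "p = (g, j)" by (cases p)
        have D: "(g, j) \<in> ?D" and nT: "(g, j) \<notin> ?T" using P unfolding p by blast+
        have nz: "\<kappa> j (\<alpha> (inv\<^bsub>G\<^esub> g) x) * \<psi> (\<alpha> g (b j)) \<noteq> 0" using nz' unfolding p by simp
        have g: "g \<in> K" "j \<in> J" using D by (auto simp: dsupp_def)
        obtain l r where lr: "l \<in> L" "r \<in> R" "g = l \<otimes>\<^bsub>G\<^esub> r" using cover[OF g(2,1)] nz by auto
        have "inv\<^bsub>G\<^esub> l \<in> E" unfolding E_def using lr D by auto
        then have "(g, j) \<in> ?T" using lr g by (intro image_eqI[of _ _ "((inv\<^bsub>G\<^esub> l, r), j)"]) auto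
        then show False using nT by blast
      qed
    qed simp
    finally have 1: "norm_over L \<alpha> \<phi> x = (\<Sum>(g, j)\<in>?T \<union> ?D. \<kappa> j (\<alpha> (inv\<^bsub>G\<^esub> g) x) * \<psi> (\<alpha> g (b j)))" .
    define U where "U = ?T \<union> ?D"
    have U: "finite U" "U \<subseteq> K \<times> J" "?D \<subseteq> U"
      unfolding U_def using T bD(3)[OF x] by (auto simp: dsupp_def)
    have UD: "\<alpha> g (b j) \<in> M" if "(g, j) \<in> U" for g j
      using U(2) that by (auto intro!: MD(2) bD(1))
    have "norm_over L \<alpha> \<phi> x = (\<Sum>(g, j)\<in>U. \<psi> (iscale (\<kappa> j (\<alpha> (inv\<^bsub>G\<^esub> g) x)) (\<alpha> g (b j))))"
      unfolding 1 U_def[symmetric]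
      by (rule sum.cong[OF HOL.refl]) (auto simp: addmap_iscale[OF \<psi>(1) MD(1)] UD)
    also have "\<dots> = \<psi> (\<Sum>(g, j)\<in>U. iscale (\<kappa> j (\<alpha> (inv\<^bsub>G\<^esub> g) x)) (\<alpha> g (b j)))"
      by (subst addmap_sum[OF \<psi>(1) MD(1)]) (auto simp: case_prod_beta intro!: addsub_iscale[OF MD(1)] UD)
    also have "(\<Sum>(g, j)\<in>U. iscale (\<kappa> j (\<alpha> (inv\<^bsub>G\<^esub> g) x)) (\<alpha> g (b j))) = x"
      using dual_basis_expand[OF assms(4) x U] by simp
    finally show ?thesis .
  qed
  then show thesis using \<phi>D that by blast
qed

text \<open>
  Equivariant maps act on coinvariants, so divisibility of the norm is preserved although F need not
  be induced by a map of the modules. The form \<open>\<phi>\<close> is expanded in the dual basis of the dual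
  module; its coefficients, summed over L, are values of the norm and so are divisible by n. The
  case n = 0 says that a form of norm zero is mapped to a form of norm zero.
\<close>

lemma norm_over_divisible:
  assumes "group G" "subgroup K G" "gmod G K M \<alpha>" "dual_basis G K M \<alpha> J b \<kappa>" "finite J"
    and "subgroup K' G" "gmod G K' N \<beta>"
    and "subgroup L G" "L \<subseteq> K" "L \<subseteq> K'"
    and F: "ghom L (dual_mod K M \<alpha>) (dual_act G K M \<alpha>) (dual_mod K' N \<beta>) (dual_act G K' N \<beta>) F"
    and \<phi>: "\<phi> \<in> dual_mod K M \<alpha>" and dv: "\<And>x. x \<in> M \<Longrightarrow> n dvd norm_over L \<alpha> \<phi> x" and y: "y \<in> N"
  shows "n dvd norm_over L \<beta> (F \<phi>) y"
proof -
  interpret G: group G by fact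
  interpret K: subgroup K G by fact
  interpret L: subgroup L G by fact
  note MD = gmodD[OF assms(3)] and bD = dual_basisD[OF assms(4)] and FD = ghomD[OF F]
  note DD = gmodD[OF dual_gmod[OF assms(1-3)]]
  let ?u = "\<lambda>j. dual_vec M \<kappa> j"
  have u: "?u j \<in> dual_mod K M \<alpha>" if "j \<in> J" for j by (rule dual_vec_in_dual[OF assms(1-4) that])
  define S where "S = (\<Union>j\<in>J. {g \<in> K. \<phi> (\<alpha> g (b j)) \<noteq> 0})"
  have S: "finite S" "S \<subseteq> K" "S \<subseteq> carrier G"
    unfolding S_def using assms(5) dual_modD(3)[OF \<phi> bD(1)] K.subset by auto
  obtain R where R: "finite R" "independent_reps G L R" "R \<subseteq> carrier G"
    and R1: "\<forall>r\<in>R. \<exists>l\<in>L. \<exists>s\<in>S. r = l \<otimes>\<^bsub>G\<^esub> s"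
    and R2: "\<forall>s\<in>S. \<exists>l\<in>L. \<exists>r\<in>R. s = l \<otimes>\<^bsub>G\<^esub> r"
    by (rule finite_coset_reps[OF assms(1,8) S(1,3)])
  have RK: "R \<subseteq> K"
  proof
    fix r assume "r \<in> R"
    then obtain l s where "l \<in> L" "s \<in> S" "r = l \<otimes>\<^bsub>G\<^esub> s" using R1 by blast
    then show "r \<in> K" using S(2) assms(9) by auto
  qed
  define E where "E = (\<Union>r\<in>R. \<Union>j\<in>J. {k \<in> L. \<phi> (\<alpha> k (\<alpha> r (b j))) \<noteq> 0})"
  have E: "finite E" "E \<subseteq> L"
    unfolding E_def using R(1) assms(5) RK by (auto intro!: dual_support_finite[OF \<phi> assms(9)] MD(2) bD(1))
  have LK: "l \<in> K" if "l \<in> L" for l using that assms(9) by blast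
  let ?f = "\<lambda>((r, j), k). (k \<otimes>\<^bsub>G\<^esub> r, j)"
  have inj: "inj_on ?f ((R \<times> J) \<times> E)"
  proof (rule inj_onI)
    fix p q assume A: "p \<in> (R \<times> J) \<times> E" "q \<in> (R \<times> J) \<times> E" "?f p = ?f q"
      obtain r j k where p: "p = ((r, j), k)" by (metis surj_pair)
      obtain r' j' k' where q: "q = ((r', j'), k')" by (metis surj_pair)
      note pq = p q
      have k: "k \<in> L" "k' \<in> L" "r \<in> R" "r' \<in> R" using A(1,2) E(2) unfolding p q by auto
      have e: "k \<otimes>\<^bsub>G\<^esub> r = k' \<otimes>\<^bsub>G\<^esub> r'" "j = j'" using A(3) unfolding p q by auto
    have "(k, r) = (k', r')"
      using inj_onD[OF independent_reps_inj[OF assms(1,8) R(3,2)], of "(k, r)" "(k', r')"] e k by auto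
    then show "p = q" using pq e by auto
  qed
  let ?T = "?f ` ((R \<times> J) \<times> E)"
  have T: "finite ?T" "?T \<subseteq> K \<times> J" using E R(1) assms(5) RK LK by auto
  have "dsupp G K (dual_act G K M \<alpha>) J (\<lambda>j \<phi>. \<phi> (b j)) \<phi> \<subseteq> ?T"
  proof
    fix p assume "p \<in> dsupp G K (dual_act G K M \<alpha>) J (\<lambda>j \<phi>. \<phi> (b j)) \<phi>"
    then obtain g j where p: "p = (g, j)" and g: "g \<in> K" "j \<in> J" and nz: "\<phi> (\<alpha> g (b j)) \<noteq> 0"
      using bD(1) by (auto simp: dsupp_def dual_act_def)
    then have "g \<in> S" by (auto simp: S_def)
    then obtain l r where lr: "l \<in> L" "r \<in> R" "g = l \<otimes>\<^bsub>G\<^esub> r" using R2 by blast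
    have rK: "r \<in> K" using lr RK by blast
    have "\<phi> (\<alpha> l (\<alpha> r (b j))) \<noteq> 0"
      using nz MD(5)[OF LK[OF lr(1)] rK bD(1)[OF g(2)]] lr(3) by simp
    then have "l \<in> E" unfolding E_def using lr g by blast
    then show "p \<in> ?T" using lr g p by (intro image_eqI[of _ _ "((r, j), l)"]) auto
  qed
  then have "\<phi> = (\<Sum>(g, j)\<in>?T. iscale (dual_act G K M \<alpha> (inv\<^bsub>G\<^esub> g) \<phi> (b j)) (dual_act G K M \<alpha> g (?u j)))"
    by (rule dual_basis_expand[OF dual_dual_basis[OF assms(1-5)] \<phi> T])
  also have "\<dots> = (\<Sum>(g, j)\<in>?T. iscale (\<phi> (\<alpha> g (b j))) (dual_act G K M \<alpha> g (?u j)))"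
    by (intro sum.cong HOL.refl) (use T(2) in \<open>auto simp: dual_act_def bD(1)\<close>)
  also have "\<dots> = (\<Sum>((r, j), k)\<in>(R \<times> J) \<times> E. iscale (\<phi> (\<alpha> (k \<otimes>\<^bsub>G\<^esub> r) (b j))) (dual_act G K M \<alpha> (k \<otimes>\<^bsub>G\<^esub> r) (?u j)))"
    by (subst sum.reindex[OF inj]) (simp add: case_prod_beta)
  also have "\<dots> = (\<Sum>((r, j), k)\<in>(R \<times> J) \<times> E. iscale (\<phi> (\<alpha> k (\<alpha> r (b j)))) (dual_act G K M \<alpha> k (dual_act G K M \<alpha> r (?u j))))"
  proof (rule sum_triple_cong)
    fix r j k assume "r \<in> R" "j \<in> J" "k \<in> E"
    then have "k \<in> K" "r \<in> K" "j \<in> J" using E(2) LK RK by auto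
    then show "iscale (\<phi> (\<alpha> (k \<otimes>\<^bsub>G\<^esub> r) (b j))) (dual_act G K M \<alpha> (k \<otimes>\<^bsub>G\<^esub> r) (?u j)) =
       iscale (\<phi> (\<alpha> k (\<alpha> r (b j)))) (dual_act G K M \<alpha> k (dual_act G K M \<alpha> r (?u j)))"
      by (simp add: MD(5) bD(1) DD(5) u)
  qed
  finally have "\<phi> = (\<Sum>((r, j), k)\<in>(R \<times> J) \<times> E. iscale (\<phi> (\<alpha> k (\<alpha> r (b j)))) (dual_act G K M \<alpha> k (dual_act G K M \<alpha> r (?u j))))" .
  then have "norm_over L \<beta> (F \<phi>) y =
      norm_over L \<beta> (F (\<Sum>((r, j), k)\<in>(R \<times> J) \<times> E. iscale (\<phi> (\<alpha> k (\<alpha> r (b j)))) (dual_act G K M \<alpha> k (dual_act G K M \<alpha> r (?u j))))) y"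
    by simp
  also have "\<dots> = (\<Sum>((r, j), k)\<in>(R \<times> J) \<times> E. norm_over L \<beta> (F (iscale (\<phi> (\<alpha> k (\<alpha> r (b j)))) (dual_act G K M \<alpha> k (dual_act G K M \<alpha> r (?u j))))) y)"
  proof -
    have "addmap (dual_mod K M \<alpha>) (\<lambda>\<phi>. norm_over L \<beta> (F \<phi>) y)"
      by (rule addmap_comp[OF FD(2) norm_over_addmap[OF assms(10) y]]) (use FD(1) in auto)
    then show ?thesis
      using E(2) LK RK
      by (subst addmap_sum[OF _ dual_mod_addsub])
        (auto simp: case_prod_beta subset_iff intro!: addsub_iscale[OF dual_mod_addsub] DD(2) u)
  qed
  also have "\<dots> = (\<Sum>((r, j), k)\<in>(R \<times> J) \<times> E. \<phi> (\<alpha> k (\<alpha> r (b j))) * norm_over L \<beta> (F (dual_act G K M \<alpha> r (?u j))) y)"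
  proof (rule sum_triple_cong)
    fix r j k assume r: "r \<in> R" and j: "j \<in> J" and k: "k \<in> E"
    have kL: "k \<in> L" and kK: "k \<in> K" and rK: "r \<in> K" using E(2) LK RK r k by auto
    have ru: "dual_act G K M \<alpha> r (?u j) \<in> dual_mod K M \<alpha>" using DD(2) rK u j by simp
    have kru: "dual_act G K M \<alpha> k (dual_act G K M \<alpha> r (?u j)) \<in> dual_mod K M \<alpha>" using DD(2) kK ru by simp
    have "norm_over L \<beta> (F (iscale c (dual_act G K M \<alpha> k (dual_act G K M \<alpha> r (?u j))))) y =
        c * norm_over L \<beta> (F (dual_act G K M \<alpha> k (dual_act G K M \<alpha> r (?u j)))) y" for c
      using addmap_iscale[OF norm_over_addmap[OF assms(10) y] dual_mod_addsub FD(1)[OF kru], of c]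
      by (simp add: addmap_iscale[OF FD(2) dual_mod_addsub kru])
    moreover have "norm_over L \<beta> (F (dual_act G K M \<alpha> k (dual_act G K M \<alpha> r (?u j)))) y =
        norm_over L \<beta> (F (dual_act G K M \<alpha> r (?u j))) y"
      unfolding FD(3)[OF kL ru] by (rule norm_over_dual_act[OF assms(1,6,7,8,10) kL y])
    ultimately show "norm_over L \<beta> (F (iscale (\<phi> (\<alpha> k (\<alpha> r (b j)))) (dual_act G K M \<alpha> k (dual_act G K M \<alpha> r (?u j))))) y =
        \<phi> (\<alpha> k (\<alpha> r (b j))) * norm_over L \<beta> (F (dual_act G K M \<alpha> r (?u j))) y" by simp
  qed
  also have "\<dots> = (\<Sum>p\<in>R \<times> J. \<Sum>k\<in>E. \<phi> (\<alpha> k (\<alpha> (fst p) (b (snd p)))) * norm_over L \<beta> (F (dual_act G K M \<alpha> (fst p) (?u (snd p)))) y)"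
    by (simp add: sum.cartesian_product case_prod_beta)
  also have "\<dots> = (\<Sum>p\<in>R \<times> J. norm_over L \<alpha> \<phi> (\<alpha> (fst p) (b (snd p))) * norm_over L \<beta> (F (dual_act G K M \<alpha> (fst p) (?u (snd p)))) y)"
  proof (rule sum.cong[OF HOL.refl])
    fix p assume p: "p \<in> R \<times> J"
    have "norm_over L \<alpha> \<phi> (\<alpha> (fst p) (b (snd p))) = (\<Sum>k\<in>E. \<phi> (\<alpha> k (\<alpha> (fst p) (b (snd p)))))"
      by (rule norm_over_superset[OF E]) (use p in \<open>auto simp: E_def\<close>)
    then show "(\<Sum>k\<in>E. \<phi> (\<alpha> k (\<alpha> (fst p) (b (snd p)))) * norm_over L \<beta> (F (dual_act G K M \<alpha> (fst p) (?u (snd p)))) y) =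
       norm_over L \<alpha> \<phi> (\<alpha> (fst p) (b (snd p))) * norm_over L \<beta> (F (dual_act G K M \<alpha> (fst p) (?u (snd p)))) y"
      by (simp add: sum_distrib_right)
  qed
  finally have e: "norm_over L \<beta> (F \<phi>) y = (\<Sum>p\<in>R \<times> J. norm_over L \<alpha> \<phi> (\<alpha> (fst p) (b (snd p))) *
       norm_over L \<beta> (F (dual_act G K M \<alpha> (fst p) (?u (snd p)))) y)" .
  show ?thesis
    unfolding e using RK by (intro dvd_sum dvd_mult2 dv MD(2)) (auto intro: bD(1))
qed

section \<open>Exactness of the dual complex and orientation\<close>

definition dual_cocycles :: "'g set \<Rightarrow> (nat \<Rightarrow> 'a::ab_group_add set) \<Rightarrow> (nat \<Rightarrow> 'g \<Rightarrow> 'a \<Rightarrow> 'a)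
    \<Rightarrow> (nat \<Rightarrow> 'a \<Rightarrow> 'a) \<Rightarrow> nat \<Rightarrow> ('a \<Rightarrow> int) set" where
  "dual_cocycles K M \<alpha> d i = {\<phi> \<in> dual_mod K (M i) (\<alpha> i). dual_map (M (Suc i)) (d i) \<phi> = 0}"

text \<open>
  The cohomology of the dual complex is that of an n-dimensional duality group: it vanishes
  outside degree n, and \<open>\<eta>\<close> identifies it with the integers in degree n.
\<close>

definition dual_exact :: "'g set \<Rightarrow> nat \<Rightarrow> (nat \<Rightarrow> 'a::ab_group_add set) \<Rightarrow> (nat \<Rightarrow> 'g \<Rightarrow> 'a \<Rightarrow> 'a)
    \<Rightarrow> (nat \<Rightarrow> 'a \<Rightarrow> 'a) \<Rightarrow> (('a \<Rightarrow> int) \<Rightarrow> int) \<Rightarrow> bool" where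
  "dual_exact K n M \<alpha> d \<eta> \<longleftrightarrow> 0 < n \<and> dual_cocycles K M \<alpha> d 0 \<subseteq> {0} \<and>
     (\<forall>i. Suc i \<noteq> n \<longrightarrow> dual_cocycles K M \<alpha> d (Suc i) \<subseteq> dual_map (M (Suc i)) (d i) ` dual_mod K (M i) (\<alpha> i)) \<and>
     addmap (dual_cocycles K M \<alpha> d n) \<eta> \<and> \<eta> ` dual_cocycles K M \<alpha> d n = UNIV \<and>
     {\<phi> \<in> dual_cocycles K M \<alpha> d n. \<eta> \<phi> = 0} = dual_map (M n) (d (n - 1)) ` dual_mod K (M (n - 1)) (\<alpha> (n - 1))"

lemma dual_exactD:
  assumes "dual_exact K n M \<alpha> d \<eta>"
  shows "0 < n" "dual_cocycles K M \<alpha> d 0 \<subseteq> {0}"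
    "Suc i \<noteq> n \<Longrightarrow> dual_cocycles K M \<alpha> d (Suc i) \<subseteq> dual_map (M (Suc i)) (d i) ` dual_mod K (M i) (\<alpha> i)"
    "addmap (dual_cocycles K M \<alpha> d n) \<eta>" "\<eta> ` dual_cocycles K M \<alpha> d n = UNIV"
    "{\<phi> \<in> dual_cocycles K M \<alpha> d n. \<eta> \<phi> = 0} = dual_map (M n) (d (n - 1)) ` dual_mod K (M (n - 1)) (\<alpha> (n - 1))"
  using assms unfolding dual_exact_def by blast+

lemma dual_map_zero: "dual_map M f 0 = 0"
  by (auto simp: dual_map_def fun_eq_iff)

lemma dual_cochain_gmod:
  assumes "group G" "subgroup K G" "resolution G K v M \<alpha> d \<epsilon>"
  shows "gmod G K (dual_mod K (M i) (\<alpha> i)) (dual_act G K (M i) (\<alpha> i))"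
    "ghom K (dual_mod K (M i) (\<alpha> i)) (dual_act G K (M i) (\<alpha> i))
      (dual_mod K (M (Suc i)) (\<alpha> (Suc i))) (dual_act G K (M (Suc i)) (\<alpha> (Suc i))) (dual_map (M (Suc i)) (d i))"
    "gmod G K (dual_cocycles K M \<alpha> d i) (dual_act G K (M i) (\<alpha> i))"
proof -
  note MD = resolutionD[OF assms(3)]
  show 1: "gmod G K (dual_mod K (M i) (\<alpha> i)) (dual_act G K (M i) (\<alpha> i))" for i
    by (rule dual_gmod[OF assms(1,2) MD(1)])
  show 2: "ghom K (dual_mod K (M i) (\<alpha> i)) (dual_act G K (M i) (\<alpha> i))
      (dual_mod K (M (Suc i)) (\<alpha> (Suc i))) (dual_act G K (M (Suc i)) (\<alpha> (Suc i))) (dual_map (M (Suc i)) (d i))"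
    by (rule dual_map_ghom[OF assms(1,2) MD(1) MD(1) MD(2)])
  show "gmod G K (dual_cocycles K M \<alpha> d i) (dual_act G K (M i) (\<alpha> i))"
    unfolding dual_cocycles_def by (rule ghom_kernel[OF 1 1 2])
qed

lemma dual_map_dual_map:
  assumes "resolution G K v M \<alpha> d \<epsilon>" "\<phi> \<in> dual_mod K (M i) (\<alpha> i)"
  shows "dual_map (M (Suc (Suc i))) (d (Suc i)) (dual_map (M (Suc i)) (d i) \<phi>) = 0"
proof
  fix x
  note MD = resolutionD[OF assms(1)]
  have "d i (d (Suc i) x) = 0" if "x \<in> M (Suc (Suc i))" using MD(6) that by auto
  moreover have "\<phi> 0 = 0" by (rule addmap_0[OF dual_modD(1)[OF assms(2)] gmodD(1)[OF MD(1)]])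
  moreover have "d (Suc i) x \<in> M (Suc i)" if "x \<in> M (Suc (Suc i))" using ghomD(1)[OF MD(2) that] .
  ultimately show "dual_map (M (Suc (Suc i))) (d (Suc i)) (dual_map (M (Suc i)) (d i) \<phi>) x = 0 x"
    by (simp add: dual_map_def)
qed

lemma dual_map_in_cocycles:
  assumes "group G" "subgroup K G" "resolution G K v M \<alpha> d \<epsilon>" "\<phi> \<in> dual_mod K (M i) (\<alpha> i)"
  shows "dual_map (M (Suc i)) (d i) \<phi> \<in> dual_cocycles K M \<alpha> d (Suc i)"
  using ghomD(1)[OF dual_cochain_gmod(2)[OF assms(1-3)] assms(4)] dual_map_dual_map[OF assms(3,4)]
  by (simp add: dual_cocycles_def)

text \<open>The action on the top cohomology group Z is by automorphisms of Z, that is, by signs.\<close>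

lemma orientation_character:
  assumes "group G" "subgroup K G" "resolution G K v M \<alpha> d \<epsilon>" "dual_exact K n M \<alpha> d \<eta>"
  obtains w :: "'g \<Rightarrow> int" where "\<And>g h. g \<in> K \<Longrightarrow> h \<in> K \<Longrightarrow> w (g \<otimes>\<^bsub>G\<^esub> h) = w g * w h" "w \<one>\<^bsub>G\<^esub> = 1"
    "\<And>g. g \<in> K \<Longrightarrow> w g \<in> {1, -1}"
    "\<And>g \<phi>. g \<in> K \<Longrightarrow> \<phi> \<in> dual_cocycles K M \<alpha> d n \<Longrightarrow> \<eta> (dual_act G K (M n) (\<alpha> n) g \<phi>) = w g * \<eta> \<phi>"
proof -
  interpret G: group G by fact
  interpret K: subgroup K G by fact
  note DE = dual_exactD[OF assms(4)]
  let ?Z = "dual_cocycles K M \<alpha> d n"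
  let ?a = "dual_act G K (M n) (\<alpha> n)"
  note ZD = gmodD[OF dual_cochain_gmod(3)[OF assms(1-3), of n]]
  have "1 \<in> \<eta> ` ?Z" using DE(5) by blast
  then obtain u where u: "u \<in> ?Z" "\<eta> u = 1" by auto
  define w where "w g = \<eta> (?a g u)" for g
  obtain m where m: "n = Suc m" using DE(1) by (cases n) auto
  have key: "\<eta> (?a g \<phi>) = w g * \<eta> \<phi>" if g: "g \<in> K" and \<phi>: "\<phi> \<in> ?Z" for g \<phi>
  proof -
    let ?\<psi> = "\<phi> - iscale (\<eta> \<phi>) u"
    have su: "iscale (\<eta> \<phi>) u \<in> ?Z" by (rule addsub_iscale[OF ZD(1) u(1)])
    have \<psi>: "?\<psi> \<in> ?Z" by (rule addsubD(4)[OF ZD(1) \<phi> su])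
    have "\<eta> ?\<psi> = 0"
      by (simp add: addmap_diff[OF DE(4) ZD(1) \<phi> su] addmap_iscale[OF DE(4) ZD(1) u(1)] u(2))
    then have "?\<psi> \<in> dual_map (M n) (d (n - 1)) ` dual_mod K (M (n - 1)) (\<alpha> (n - 1))"
      using \<psi> DE(6) by blast
    then obtain \<theta> where \<theta>: "\<theta> \<in> dual_mod K (M m) (\<alpha> m)" "?\<psi> = dual_map (M (Suc m)) (d m) \<theta>"
      using m by auto
    note D2 = dual_cochain_gmod(2)[OF assms(1-3), of m]
    have "?a g ?\<psi> = dual_map (M (Suc m)) (d m) (dual_act G K (M m) (\<alpha> m) g \<theta>)"
      unfolding \<theta>(2) m using ghomD(3)[OF D2 g \<theta>(1)] by simp
    moreover have "dual_act G K (M m) (\<alpha> m) g \<theta> \<in> dual_mod K (M m) (\<alpha> m)"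
      by (rule gmodD(2)[OF dual_cochain_gmod(1)[OF assms(1-3)] g \<theta>(1)])
    ultimately have "?a g ?\<psi> \<in> dual_map (M n) (d (n - 1)) ` dual_mod K (M (n - 1)) (\<alpha> (n - 1))"
      using m by simp
    then have "\<eta> (?a g ?\<psi>) = 0" using DE(6) by blast
    moreover have "?a g ?\<psi> = ?a g \<phi> - iscale (\<eta> \<phi>) (?a g u)"
      by (simp add: addmap_diff[OF ZD(3)[OF g] ZD(1) \<phi> su] addmap_iscale[OF ZD(3)[OF g] ZD(1) u(1)])
    moreover have "\<eta> (?a g \<phi> - iscale (\<eta> \<phi>) (?a g u)) = \<eta> (?a g \<phi>) - \<eta> \<phi> * w g"
      using ZD(2)[OF g u(1)] ZD(2)[OF g \<phi>]
      by (simp add: addmap_diff[OF DE(4) ZD(1)] addsub_iscale[OF ZD(1)] addmap_iscale[OF DE(4) ZD(1)] w_def)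
    ultimately show ?thesis by (simp add: algebra_simps)
  qed
  have mult: "w (g \<otimes>\<^bsub>G\<^esub> h) = w g * w h" if "g \<in> K" "h \<in> K" for g h
    using key[OF that(1) ZD(2)[OF that(2) u(1)]] ZD(5)[OF that u(1)] by (simp add: w_def)
  have one: "w \<one>\<^bsub>G\<^esub> = 1" using ZD(4)[OF u(1)] u(2) by (simp add: w_def)
  have "w g \<in> {1, -1}" if "g \<in> K" for g
  proof -
    have "w g * w (inv\<^bsub>G\<^esub> g) = 1" using mult[of g "inv\<^bsub>G\<^esub> g"] that one by simp
    then show ?thesis by (metis insertI1 insertI2 zmult_eq_1_iff)
  qed
  then show thesis using that[of w] mult one key by simp
qed

section \<open>The reversed dual complex\<close>

text \<open>
  The dual complex read from degree n downwards. Cochains of degree n are replaced by cocycles,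
  which takes care of a resolution that is longer than n; \<open>\<eta>\<close> is then an augmentation.
\<close>

definition rev_mod where
  "rev_mod K n M \<alpha> d j = (if j = 0 then dual_cocycles K M \<alpha> d n
     else if j \<le> n then dual_mod K (M (n - j)) (\<alpha> (n - j)) else {0})"

definition rev_act where
  "rev_act G K n M \<alpha> j = dual_act G K (M (n - j)) (\<alpha> (n - j))"

definition rev_map where
  "rev_map n M d j = (if j < n then dual_map (M (n - j)) (d (n - Suc j)) else (\<lambda>_. 0))"

lemma rev_gmod:
  assumes "group G" "subgroup K G" "resolution G K v M \<alpha> d \<epsilon>"
  shows "gmod G K (rev_mod K n M \<alpha> d j) (rev_act G K n M \<alpha> j)"
  using dual_cochain_gmod(1,3)[OF assms] gmod_zero[OF dual_cochain_gmod(1)[OF assms]]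
  by (simp add: rev_mod_def rev_act_def)

lemma ghom_zero:
  assumes "gmod G H N \<beta>"
  shows "ghom H M \<alpha> N \<beta> (\<lambda>_. 0)"
  using addsubD(1)[OF gmodD(1)[OF assms]] gmod_act_0[OF assms] by (auto simp: ghom_def addmap_def)

lemma rev_resolution:
  assumes "group G" "subgroup K G" "resolution G K v M \<alpha> d \<epsilon>" "dual_exact K n M \<alpha> d \<eta>"
    and w: "\<And>g \<phi>. g \<in> K \<Longrightarrow> \<phi> \<in> dual_cocycles K M \<alpha> d n \<Longrightarrow> \<eta> (dual_act G K (M n) (\<alpha> n) g \<phi>) = w g * \<eta> \<phi>"
  shows "resolution G K w (rev_mod K n M \<alpha> d) (rev_act G K n M \<alpha>) (rev_map n M d) \<eta>"
proof -
  note DE = dual_exactD[OF assms(4)]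
  note c1 = dual_cochain_gmod(1)[OF assms(1-3)] and c2 = dual_cochain_gmod(2)[OF assms(1-3)]
  note rg = rev_gmod[OF assms(1-3), of n]
  have map: "ghom K (rev_mod K n M \<alpha> d (Suc i)) (rev_act G K n M \<alpha> (Suc i))
      (rev_mod K n M \<alpha> d i) (rev_act G K n M \<alpha> i) (rev_map n M d i)" for i
  proof (cases "i < n")
    case False
    then show ?thesis using ghom_zero[OF rg[of i]] by (simp add: rev_map_def)
  next
    case True
    define m where "m = n - Suc i"
    have m: "n - i = Suc m" "Suc i \<le> n" using True by (auto simp: m_def)
    show ?thesis
    proof (cases "i = 0")
      case False
      then show ?thesis using c2[of m] m True by (simp add: rev_mod_def rev_act_def rev_map_def m_def[symmetric])
    next
      case i0: True
      then have n: "n = Suc m" using m by simp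
      have "ghom K (dual_mod K (M m) (\<alpha> m)) (dual_act G K (M m) (\<alpha> m))
          (dual_cocycles K M \<alpha> d (Suc m)) (dual_act G K (M (Suc m)) (\<alpha> (Suc m))) (dual_map (M (Suc m)) (d m))"
        using c2[of m] dual_map_in_cocycles[OF assms(1-3), of _ m] unfolding ghom_def by auto
      then show ?thesis by (simp add: rev_mod_def rev_act_def rev_map_def i0 n)
    qed
  qed
  have ex: "rev_map n M d (Suc i) ` rev_mod K n M \<alpha> d (Suc (Suc i)) =
      {x \<in> rev_mod K n M \<alpha> d (Suc i). rev_map n M d i x = 0}" for i
  proof (cases "i < n")
    case False
    then show ?thesis by (auto simp: rev_map_def rev_mod_def)
  next
    case True
    define m where "m = n - Suc i"
    have m: "n - i = Suc m" "Suc i \<le> n" "m \<noteq> n" using True by (auto simp: m_def)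
    have ker: "{x \<in> rev_mod K n M \<alpha> d (Suc i). rev_map n M d i x = 0} = dual_cocycles K M \<alpha> d m"
      using m True by (simp add: rev_mod_def rev_map_def m_def[symmetric] dual_cocycles_def)
    show ?thesis
    proof (cases m)
      case 0
      then have "n = Suc i" using m by simp
      moreover have "dual_cocycles K M \<alpha> d 0 = {0}"
        using DE(2) addsubD(1)[OF gmodD(1)[OF dual_cochain_gmod(3)[OF assms(1-3)]]] by blast
      ultimately show ?thesis unfolding ker 0 by (simp add: rev_mod_def rev_map_def)
    next
      case (Suc k)
      then have k: "n - Suc (Suc i) = k" "Suc i < n" by (auto simp: m_def)
      have "dual_cocycles K M \<alpha> d (Suc k) = dual_map (M (Suc k)) (d k) ` dual_mod K (M k) (\<alpha> k)"
        using DE(3)[of k] dual_map_in_cocycles[OF assms(1-3), of _ k] m(3) Suc by blast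
      then show ?thesis unfolding ker Suc using k m Suc by (simp add: rev_mod_def rev_map_def m_def[symmetric])
    qed
  qed
  show ?thesis
    unfolding resolution_def
  proof (intro conjI allI)
    show "gmod G K (rev_mod K n M \<alpha> d i) (rev_act G K n M \<alpha> i)" for i by (rule rg)
    show "ghom K (rev_mod K n M \<alpha> d (Suc i)) (rev_act G K n M \<alpha> (Suc i))
      (rev_mod K n M \<alpha> d i) (rev_act G K n M \<alpha> i) (rev_map n M d i)" for i by (rule map)
    show "ghom K (rev_mod K n M \<alpha> d 0) (rev_act G K n M \<alpha> 0) UNIV (\<lambda>g k. w g * k) \<eta>"
      using DE(4) w by (simp add: ghom_def rev_mod_def rev_act_def)
    show "\<eta> ` rev_mod K n M \<alpha> d 0 = UNIV" using DE(5) by (simp add: rev_mod_def)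
    show "rev_map n M d 0 ` rev_mod K n M \<alpha> d (Suc 0) = {x \<in> rev_mod K n M \<alpha> d 0. \<eta> x = 0}"
      using DE(1,6) by (simp add: rev_mod_def rev_map_def)
    show "rev_map n M d (Suc i) ` rev_mod K n M \<alpha> d (Suc (Suc i)) =
      {x \<in> rev_mod K n M \<alpha> d (Suc i). rev_map n M d i x = 0}" for i by (rule ex)
  qed
qed

text \<open>
  Above degree n the dual complex is exact and it ends in degree N, so it splits. The induction
  goes downwards from N: a section in one degree makes the cocycles in the previous degree a direct
  summand of a projective module.
\<close>

lemma dual_section:
  assumes "group G" "subgroup K G" "resolution G K v M \<alpha> d \<epsilon>" "dual_exact K n M \<alpha> d \<eta>"
    and db: "\<And>i. dual_basis G K (M i) (\<alpha> i) (J i) (b i) (\<kappa> i)" and fin: "\<And>i. finite (J i)"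
    and bd: "\<And>i. N < i \<Longrightarrow> M i = {0}" and "n \<le> i"
  shows "\<exists>s. ghom K (dual_cocycles K M \<alpha> d (Suc i)) (dual_act G K (M (Suc i)) (\<alpha> (Suc i)))
      (dual_mod K (M i) (\<alpha> i)) (dual_act G K (M i) (\<alpha> i)) s \<and>
      (\<forall>\<phi>\<in>dual_cocycles K M \<alpha> d (Suc i). dual_map (M (Suc i)) (d i) (s \<phi>) = \<phi>)"
  using assms(8)
proof (induction "N - i" arbitrary: i)
  case 0
  note c = dual_cochain_gmod[OF assms(1-3)]
  have Mi: "M (Suc i) = {0}" using 0 bd[of "Suc i"] by simp
  have "\<phi> = 0" if "\<phi> \<in> dual_cocycles K M \<alpha> d (Suc i)" for \<phi>
  proof
    have \<phi>: "\<phi> \<in> dual_mod K (M (Suc i)) (\<alpha> (Suc i))" using that by (simp add: dual_cocycles_def)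
    show "\<phi> x = 0 x" for x
      using addmap_0[OF dual_modD(1)[OF \<phi>] gmodD(1)[OF resolutionD(1)[OF assms(3)]]] dual_modD(2)[OF \<phi>, of x] Mi
      by (cases "x = 0") auto
  qed
  then have "\<forall>\<phi>\<in>dual_cocycles K M \<alpha> d (Suc i). dual_map (M (Suc i)) (d i) 0 = \<phi>"
    unfolding dual_map_zero by blast
  with ghom_zero[OF c(1)[of i]] show ?case by blast
next
  case (Suc k)
  note c = dual_cochain_gmod[OF assms(1-3)]
  have "k = N - Suc i" "n \<le> Suc i" using Suc(2,3) by auto
  from Suc(1)[OF this] obtain s where s: "ghom K (dual_cocycles K M \<alpha> d (Suc (Suc i))) (dual_act G K (M (Suc (Suc i))) (\<alpha> (Suc (Suc i))))
      (dual_mod K (M (Suc i)) (\<alpha> (Suc i))) (dual_act G K (M (Suc i)) (\<alpha> (Suc i))) s"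
    and s': "\<And>\<phi>. \<phi> \<in> dual_cocycles K M \<alpha> d (Suc (Suc i)) \<Longrightarrow> dual_map (M (Suc (Suc i))) (d (Suc i)) (s \<phi>) = \<phi>"
    by blast
  let ?D = "dual_mod K (M (Suc i)) (\<alpha> (Suc i))" and ?a = "dual_act G K (M (Suc i)) (\<alpha> (Suc i))"
  let ?Z = "dual_cocycles K M \<alpha> d (Suc i)"
  let ?\<delta> = "dual_map (M (Suc (Suc i))) (d (Suc i))"
  let ?r = "\<lambda>\<phi>. \<phi> - s (?\<delta> \<phi>)"
  have \<delta>: "ghom K ?D ?a (dual_cocycles K M \<alpha> d (Suc (Suc i))) (dual_act G K (M (Suc (Suc i))) (\<alpha> (Suc (Suc i)))) ?\<delta>"
    using c(2)[of "Suc i"] dual_map_in_cocycles[OF assms(1-3), of _ "Suc i"] unfolding ghom_def by blast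
  have r0: "ghom K ?D ?a ?D ?a ?r" by (rule ghom_diff[OF ghom_id[OF c(1)] ghom_comp[OF \<delta> s] c(1)])
  have "?r \<phi> \<in> ?Z" if \<phi>: "\<phi> \<in> ?D" for \<phi>
  proof -
    have "?\<delta> (?r \<phi>) = ?\<delta> \<phi> - ?\<delta> (s (?\<delta> \<phi>))"
      by (rule addmap_diff[OF ghomD(2)[OF c(2)] gmodD(1)[OF c(1)] \<phi> ghomD(1)[OF s ghomD(1)[OF \<delta> \<phi>]]])
    also have "\<dots> = 0" by (simp add: s'[OF ghomD(1)[OF \<delta> \<phi>]])
    finally show ?thesis using ghomD(1)[OF r0 \<phi>] by (simp add: dual_cocycles_def)
  qed
  then have r: "ghom K ?D ?a ?Z ?a ?r" using r0 unfolding ghom_def by blast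
  have p: "ghom K (dual_mod K (M i) (\<alpha> i)) (dual_act G K (M i) (\<alpha> i)) ?Z ?a (dual_map (M (Suc i)) (d i))"
    using c(2)[of i] dual_map_in_cocycles[OF assms(1-3), of _ i] unfolding ghom_def by blast
  have "?r ` ?D \<subseteq> ?Z" using r unfolding ghom_def by blast
  also have "\<dots> \<subseteq> dual_map (M (Suc i)) (d i) ` dual_mod K (M i) (\<alpha> i)"
    using dual_exactD(3)[OF assms(4)] Suc(3) by simp
  finally have im: "?r ` ?D \<subseteq> dual_map (M (Suc i)) (d i) ` dual_mod K (M i) (\<alpha> i)" .
  note bas = dual_dual_basis[OF assms(1,2) resolutionD(1)[OF assms(3)] db fin, of "Suc i"]
  obtain l where l: "ghom K ?D ?a (dual_mod K (M i) (\<alpha> i)) (dual_act G K (M i) (\<alpha> i)) l"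
    and l': "\<And>\<phi>. \<phi> \<in> ?D \<Longrightarrow> dual_map (M (Suc i)) (d i) (l \<phi>) = ?r \<phi>"
    using projective_lift[OF assms(1,2,2) subset_refl c(1) bas c(3) c(1) p r im] by blast
  have ZD: "?Z \<subseteq> ?D" by (auto simp: dual_cocycles_def)
  have "dual_map (M (Suc i)) (d i) (l \<phi>) = \<phi>" if \<phi>: "\<phi> \<in> ?Z" for \<phi>
  proof -
    have "?\<delta> \<phi> = 0" using \<phi> by (simp add: dual_cocycles_def)
    moreover have "s 0 = 0" by (rule addmap_0[OF ghomD(2)[OF s] gmodD(1)[OF c(3)]])
    ultimately show ?thesis using l'[of \<phi>] \<phi> ZD by auto
  qed
  moreover have "ghom K ?Z ?a (dual_mod K (M i) (\<alpha> i)) (dual_act G K (M i) (\<alpha> i)) l"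
    using l ZD unfolding ghom_def addmap_def by blast
  ultimately show ?case by blast
qed

text \<open>
  The only term of the reversed complex that is not a full dual module is the module of
  n-cocycles. It is projective, being a retract of the n-cochains by the section of the coboundary.
\<close>

lemma rev_dual_basis:
  assumes "group G" "subgroup K G" "resolution G K v M \<alpha> d \<epsilon>" "dual_exact K n M \<alpha> d \<eta>"
    and db: "\<And>i. dual_basis G K (M i) (\<alpha> i) (J i :: 'j set) (b i) (\<kappa> i)" and fin: "\<And>i. finite (J i)"
    and bd: "\<And>i. N < i \<Longrightarrow> M i = {0}"
  obtains J' b' \<kappa>' where "\<And>j. dual_basis G K (rev_mod K n M \<alpha> d j) (rev_act G K n M \<alpha> j) (J' j :: 'j set) (b' j) (\<kappa>' j)"
proof -
  note c = dual_cochain_gmod[OF assms(1-3)]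
  have "\<exists>J' b' \<kappa>'. dual_basis G K (rev_mod K n M \<alpha> d j) (rev_act G K n M \<alpha> j) (J' :: 'j set) b' \<kappa>'" for j
  proof (cases "j = 0")
    case False
    show ?thesis
    proof (cases "j \<le> n")
      case True
      then have *: "dual_basis G K (rev_mod K n M \<alpha> d j) (rev_act G K n M \<alpha> j) (J (n - j))
          (dual_vec (M (n - j)) (\<kappa> (n - j))) (\<lambda>i \<phi>. \<phi> (b (n - j) i))"
        using dual_dual_basis[OF assms(1,2) resolutionD(1)[OF assms(3)] db fin, of "n - j"] False
        by (simp add: rev_mod_def rev_act_def)
      show ?thesis by (rule exI, rule exI, rule exI, rule *)
    next
      case F: False
      have *: "dual_basis G K (rev_mod K n M \<alpha> d j) (rev_act G K n M \<alpha> j) ({} :: 'j set) b' \<kappa>'" for b' \<kappa>'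
        using False F by (auto simp: rev_mod_def dual_basis_def dsupp_def)
      show ?thesis by (rule exI, rule exI, rule exI, rule *)
    qed
  next
    case True
    let ?D = "dual_mod K (M n) (\<alpha> n)" and ?a = "dual_act G K (M n) (\<alpha> n)"
    let ?Z = "dual_cocycles K M \<alpha> d n"
    let ?\<delta> = "dual_map (M (Suc n)) (d n)"
    obtain s where s: "ghom K (dual_cocycles K M \<alpha> d (Suc n)) (dual_act G K (M (Suc n)) (\<alpha> (Suc n))) ?D ?a s"
      and s': "\<And>\<phi>. \<phi> \<in> dual_cocycles K M \<alpha> d (Suc n) \<Longrightarrow> ?\<delta> (s \<phi>) = \<phi>"
      using dual_section[OF assms(1-4) db fin bd order_refl] by blast
    let ?r = "\<lambda>\<phi>. \<phi> - s (?\<delta> \<phi>)"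
    have \<delta>: "ghom K ?D ?a (dual_cocycles K M \<alpha> d (Suc n)) (dual_act G K (M (Suc n)) (\<alpha> (Suc n))) ?\<delta>"
      using c(2)[of n] dual_map_in_cocycles[OF assms(1-3), of _ n] unfolding ghom_def by blast
    have r0: "ghom K ?D ?a ?D ?a ?r" by (rule ghom_diff[OF ghom_id[OF c(1)] ghom_comp[OF \<delta> s] c(1)])
    have "?r \<phi> \<in> ?Z" if \<phi>: "\<phi> \<in> ?D" for \<phi>
    proof -
      have "?\<delta> (?r \<phi>) = ?\<delta> \<phi> - ?\<delta> (s (?\<delta> \<phi>))"
        by (rule addmap_diff[OF ghomD(2)[OF c(2)] gmodD(1)[OF c(1)] \<phi> ghomD(1)[OF s ghomD(1)[OF \<delta> \<phi>]]])
      also have "\<dots> = 0" by (simp add: s'[OF ghomD(1)[OF \<delta> \<phi>]])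
      finally show ?thesis using ghomD(1)[OF r0 \<phi>] by (simp add: dual_cocycles_def)
    qed
    then have r: "ghom K ?D ?a ?Z ?a ?r" using r0 unfolding ghom_def by blast
    have ZD: "?Z \<subseteq> ?D" by (auto simp: dual_cocycles_def)
    have "s 0 = 0" by (rule addmap_0[OF ghomD(2)[OF s] gmodD(1)[OF c(3)]])
    then have id: "?r \<phi> = \<phi>" if "\<phi> \<in> ?Z" for \<phi> using that by (simp add: dual_cocycles_def)
    note bas = dual_dual_basis[OF assms(1,2) resolutionD(1)[OF assms(3)] db fin, of n]
    have "dual_basis G K ?Z ?a (J n) (\<lambda>j. ?r (dual_vec (M n) (\<kappa> n) j)) (\<lambda>j \<phi>. \<phi> (b n j))"
      by (rule dual_basis_retract[OF assms(1,2) c(1) bas ZD c(3) r id])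
    then have *: "dual_basis G K (rev_mod K n M \<alpha> d j) (rev_act G K n M \<alpha> j) (J n)
        (\<lambda>j. ?r (dual_vec (M n) (\<kappa> n) j)) (\<lambda>j \<phi>. \<phi> (b n j))"
      using True by (simp add: rev_mod_def rev_act_def)
    show ?thesis by (rule exI, rule exI, rule exI, rule *)
  qed
  then show thesis using that by metis
qed

section \<open>Duality data\<close>

text \<open>
  A finite resolution of Z twisted by v by finitely generated projectives whose dual complex has the
  cohomology of a duality group of dimension n, with orientation character w.
\<close>

definition pd_data where
  "pd_data G K n v M \<alpha> d \<epsilon> J b \<kappa> w \<eta> \<longleftrightarrow> resolution G K v M \<alpha> d \<epsilon> \<and>
     (\<forall>i. finite (J i) \<and> dual_basis G K (M i) (\<alpha> i) (J i) (b i) (\<kappa> i)) \<and> (\<exists>N. \<forall>i>N. M i = {0}) \<and>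
     dual_exact K n M \<alpha> d \<eta> \<and>
     (\<forall>g\<in>K. \<forall>\<phi>\<in>dual_cocycles K M \<alpha> d n. \<eta> (dual_act G K (M n) (\<alpha> n) g \<phi>) = w g * \<eta> \<phi>)"

text \<open>
  Changing all actions by a sign character changes both the coefficients and the orientation
  character. This is how the orientation of a subgroup is made to agree with that of the group.
\<close>

lemma pd_data_twist:
  assumes "group G" "subgroup K G" and pd: "pd_data G K n v M \<alpha> d \<epsilon> J b \<kappa> w \<eta>"
    and \<chi>: "\<And>g h. g \<in> K \<Longrightarrow> h \<in> K \<Longrightarrow> \<chi> (g \<otimes>\<^bsub>G\<^esub> h) = \<chi> g * \<chi> h" "\<And>g. g \<in> K \<Longrightarrow> \<chi> g \<in> {1, -1}"
  shows "pd_data G K n (\<lambda>g. \<chi> g * v g) M (\<lambda>i g x. iscale (\<chi> g) (\<alpha> i g x)) d \<epsilon> J b \<kappa> (\<lambda>g. \<chi> g * w g) \<eta>"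
proof -
  interpret G: group G by fact
  interpret K: subgroup K G by fact
  let ?\<alpha> = "\<lambda>i g x. iscale (\<chi> g) (\<alpha> i g x)"
  have M: "resolution G K v M \<alpha> d \<epsilon>" and fin: "\<And>i. finite (J i)"
    and db: "\<And>i. dual_basis G K (M i) (\<alpha> i) (J i) (b i) (\<kappa> i)" and bd: "\<exists>N. \<forall>i>N. M i = {0}"
    and ex: "dual_exact K n M \<alpha> d \<eta>"
    and w: "\<And>g \<phi>. g \<in> K \<Longrightarrow> \<phi> \<in> dual_cocycles K M \<alpha> d n \<Longrightarrow> \<eta> (dual_act G K (M n) (\<alpha> n) g \<phi>) = w g * \<eta> \<phi>"
    using pd by (auto simp: pd_data_def)
  note MD = resolutionD[OF M]
  note sub = gmodD(1)[OF MD(1)] and cl = gmodD(2)[OF MD(1)]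
  have \<chi>1: "\<chi> \<one>\<^bsub>G\<^esub> = 1"
  proof -
    have "\<chi> \<one>\<^bsub>G\<^esub> * \<chi> \<one>\<^bsub>G\<^esub> = \<chi> \<one>\<^bsub>G\<^esub>" using \<chi>(1)[of "\<one>\<^bsub>G\<^esub>" "\<one>\<^bsub>G\<^esub>"] by simp
    then show ?thesis using \<chi>(2)[of "\<one>\<^bsub>G\<^esub>"] by auto
  qed
  have \<chi>inv: "\<chi> (inv\<^bsub>G\<^esub> g) * \<chi> g = 1" "\<chi> (inv\<^bsub>G\<^esub> g) = \<chi> g" if "g \<in> K" for g
  proof -
    show "\<chi> (inv\<^bsub>G\<^esub> g) * \<chi> g = 1" using \<chi>(1)[of "inv\<^bsub>G\<^esub> g" g] that \<chi>1 by simp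
    then show "\<chi> (inv\<^bsub>G\<^esub> g) = \<chi> g" using \<chi>(2)[OF that] by auto
  qed
  have gm: "gmod G K (M i) (?\<alpha> i)" for i
    unfolding gmod_def
  proof (intro conjI ballI sub)
    fix g assume g: "g \<in> K"
    show "?\<alpha> i g ` M i \<subseteq> M i" using addsub_iscale[OF sub cl[OF g]] by blast
    show "addmap (M i) (?\<alpha> i g)"
      using addmap_add[OF gmodD(3)[OF MD(1) g]] by (auto simp: addmap_def iscale.scale_right_distrib)
  next
    show "?\<alpha> i \<one>\<^bsub>G\<^esub> x = x" if "x \<in> M i" for x using gmodD(4)[OF MD(1) that] \<chi>1 by simp
  next
    fix g h x assume g: "g \<in> K" and h: "h \<in> K" and x: "x \<in> M i"
    show "?\<alpha> i (g \<otimes>\<^bsub>G\<^esub> h) x = ?\<alpha> i g (?\<alpha> i h x)"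
      by (simp add: \<chi>(1)[OF g h] gmodD(5)[OF MD(1) g h x] addmap_iscale[OF gmodD(3)[OF MD(1) g] sub cl[OF h x]])
  qed
  have hom: "ghom K (M (Suc i)) (?\<alpha> (Suc i)) (M i) (?\<alpha> i) (d i)" for i
    unfolding ghom_def
  proof (intro conjI ballI)
    show "d i ` M (Suc i) \<subseteq> M i" "addmap (M (Suc i)) (d i)" using MD(2)[of i] by (auto simp: ghom_def)
    show "d i (?\<alpha> (Suc i) g x) = ?\<alpha> i g (d i x)" if "g \<in> K" "x \<in> M (Suc i)" for g x
      using addmap_iscale[OF ghomD(2)[OF MD(2)] sub cl[OF that]] ghomD(3)[OF MD(2) that] by simp
  qed
  have \<epsilon>: "ghom K (M 0) (?\<alpha> 0) UNIV (\<lambda>g k. \<chi> g * v g * k) \<epsilon>"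
    unfolding ghom_def
  proof (intro conjI ballI)
    show "\<epsilon> ` M 0 \<subseteq> UNIV" "addmap (M 0) \<epsilon>" using MD(3) by (auto simp: ghom_def)
    show "\<epsilon> (?\<alpha> 0 g x) = \<chi> g * v g * \<epsilon> x" if "g \<in> K" "x \<in> M 0" for g x
      using addmap_iscale[OF ghomD(2)[OF MD(3)] sub cl[OF that]] ghomD(3)[OF MD(3) that] by simp
  qed
  have res: "resolution G K (\<lambda>g. \<chi> g * v g) M ?\<alpha> d \<epsilon>"
    using gm hom \<epsilon> MD(4-6) by (simp add: resolution_def)
  have bas: "dual_basis G K (M i) (?\<alpha> i) (J i) (b i) (\<kappa> i)" for i
  proof -
    note bD = dual_basisD[OF db[of i]]
    have k: "\<kappa> i j (?\<alpha> i (inv\<^bsub>G\<^esub> g) x) = \<chi> g * \<kappa> i j (\<alpha> i (inv\<^bsub>G\<^esub> g) x)" if "j \<in> J i" "g \<in> K" "x \<in> M i" for j g x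
      using addmap_iscale[OF bD(2)[OF that(1)] sub cl[OF K.m_inv_closed[OF that(2)] that(3)]] \<chi>inv(2)[OF that(2)] by simp
    have ds: "dsupp G K (?\<alpha> i) (J i) (\<kappa> i) x = dsupp G K (\<alpha> i) (J i) (\<kappa> i) x" if "x \<in> M i" for x
      using k that \<chi>(2) by (force simp: dsupp_def)
    have "x = (\<Sum>(g, j)\<in>dsupp G K (?\<alpha> i) (J i) (\<kappa> i) x. iscale (\<kappa> i j (?\<alpha> i (inv\<^bsub>G\<^esub> g) x)) (?\<alpha> i g (b i j)))"
      if x: "x \<in> M i" for x
    proof -
      have e: "iscale (\<kappa> i j (?\<alpha> i (inv\<^bsub>G\<^esub> g) x)) (?\<alpha> i g (b i j)) = iscale (\<kappa> i j (\<alpha> i (inv\<^bsub>G\<^esub> g) x)) (\<alpha> i g (b i j))"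
        if "j \<in> J i" "g \<in> K" for g j
        using \<chi>(2)[OF that(2)] unfolding k[OF that x] by auto
      show ?thesis
        unfolding ds[OF x]
        by (subst bD(4)[OF x], rule sum.cong[OF HOL.refl]) (auto simp: dsupp_def e simp del: iscale.scale_scale)
    qed
    then show ?thesis unfolding dual_basis_def using bD(1-3) ds by simp
  qed
  have nz: "\<phi> (?\<alpha> i g x) = \<chi> g * \<phi> (\<alpha> i g x)" if "addmap (M i) \<phi>" "x \<in> M i" "g \<in> K" for \<phi> :: "_ \<Rightarrow> int" and i g x
    using addmap_iscale[OF that(1) sub cl[OF that(3,2)]] by simp
  have dm: "dual_mod K (M i) (?\<alpha> i) = dual_mod K (M i) (\<alpha> i)" for i
  proof -
    have "{g \<in> K. \<phi> (?\<alpha> i g x) \<noteq> 0} = {g \<in> K. \<phi> (\<alpha> i g x) \<noteq> 0}" if "addmap (M i) \<phi>" "x \<in> M i" for \<phi> :: "_ \<Rightarrow> int" and x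
      using nz[OF that] \<chi>(2) by force
    then show ?thesis unfolding dual_mod_def by auto
  qed
  have dc: "dual_cocycles K M ?\<alpha> d i = dual_cocycles K M \<alpha> d i" for i
    by (simp add: dual_cocycles_def dm)
  have ex': "dual_exact K n M ?\<alpha> d \<eta>" using ex by (simp add: dual_exact_def dc dm)
  have "\<eta> (dual_act G K (M n) (?\<alpha> n) g \<phi>) = \<chi> g * w g * \<eta> \<phi>"
    if g: "g \<in> K" and \<phi>: "\<phi> \<in> dual_cocycles K M \<alpha> d n" for g \<phi>
  proof -
    have \<phi>': "addmap (M n) \<phi>" using \<phi> by (auto simp: dual_cocycles_def dual_mod_def)
    have "dual_act G K (M n) (?\<alpha> n) g \<phi> = iscale (\<chi> g) (dual_act G K (M n) (\<alpha> n) g \<phi>)"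
      using nz[OF \<phi>' _ K.m_inv_closed[OF g]] \<chi>inv(2)[OF g] by (auto simp: dual_act_def fun_eq_iff)
    moreover note Z = dual_cochain_gmod(3)[OF assms(1,2) M, of n]
    have "\<eta> (iscale (\<chi> g) (dual_act G K (M n) (\<alpha> n) g \<phi>)) = \<chi> g * \<eta> (dual_act G K (M n) (\<alpha> n) g \<phi>)"
      using addmap_iscale[OF dual_exactD(4)[OF ex] gmodD(1)[OF Z] gmodD(2)[OF Z g \<phi>]] by simp
    ultimately show ?thesis using w[OF g \<phi>] by simp
  qed
  then show ?thesis unfolding pd_data_def using res fin bas bd ex' dc by simp
qed

section \<open>Duality for a subgroup and divisibility by the index\<close>

lemma norm_over_zero_trans:
  assumes "group G" "subgroup K G" "gmod G K M \<alpha>" "subgroup L G" "subgroup L' G" "L' \<subseteq> L" "L \<subseteq> K"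
    and \<phi>: "\<phi> \<in> dual_mod K M \<alpha>" and z: "\<And>x. x \<in> M \<Longrightarrow> norm_over L' \<alpha> \<phi> x = 0" and x: "x \<in> M"
  shows "norm_over L \<alpha> \<phi> x = 0"
proof -
  interpret G: group G by fact
  interpret L: subgroup L G by fact
  interpret L': subgroup L' G by fact
  let ?S = "{g \<in> L. \<phi> (\<alpha> g x) \<noteq> 0}"
  have S: "finite ?S" "?S \<subseteq> carrier G" using dual_support_finite[OF \<phi> assms(7) x] by auto
  obtain R where R: "finite R" "independent_reps G L' R" "R \<subseteq> carrier G"
    and R1: "\<forall>r\<in>R. \<exists>l\<in>L'. \<exists>s\<in>?S. r = l \<otimes>\<^bsub>G\<^esub> s"
    and R2: "\<forall>s\<in>?S. \<exists>l\<in>L'. \<exists>r\<in>R. s = l \<otimes>\<^bsub>G\<^esub> r"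
    by (rule finite_coset_reps[OF assms(1,5) S])
  have RL: "R \<subseteq> L"
  proof
    fix r assume "r \<in> R"
    then obtain l s where "l \<in> L'" "s \<in> ?S" "r = l \<otimes>\<^bsub>G\<^esub> s" using R1 by blast
    then show "r \<in> L" using assms(6) by auto
  qed
  have "norm_over L \<alpha> \<phi> x = (\<Sum>r\<in>R. norm_over L' \<alpha> \<phi> (\<alpha> r x))"
    by (rule norm_over_trans[OF assms(1-7) \<phi> x R(1) RL R(2)]) (use R2 in blast)
  also have "\<dots> = 0" using RL assms(7) x by (intro sum.neutral ballI z gmodD(2)[OF assms(3)]) auto
  finally show ?thesis .
qed

lemma coset_reps_system:
  assumes "group G" "subgroup L G" "subgroup L' G" "L' \<subseteq> L"
  shows "coset_rep G L' ` L \<subseteq> L" "independent_reps G L' (coset_rep G L' ` L)"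
    "card (coset_rep G L' ` L) = card ((\<lambda>g. L' #>\<^bsub>G\<^esub> g) ` L)"
    "finite ((\<lambda>g. L' #>\<^bsub>G\<^esub> g) ` L) \<Longrightarrow> finite (coset_rep G L' ` L)"
    "g \<in> L \<Longrightarrow> \<exists>l\<in>L'. \<exists>r\<in>coset_rep G L' ` L. g = l \<otimes>\<^bsub>G\<^esub> r"
proof -
  interpret G: group G by fact
  interpret L: subgroup L G by fact
  interpret L': subgroup L' G by fact
  show sub: "coset_rep G L' ` L \<subseteq> L"
  proof (rule image_subsetI)
    fix g assume g: "g \<in> L"
    then obtain l where "l \<in> L'" "coset_rep G L' g = inv\<^bsub>G\<^esub> l \<otimes>\<^bsub>G\<^esub> g"
      using coset_rep[OF assms(1,3), of g] by auto
    then show "coset_rep G L' g \<in> L" using g assms(4) by auto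
  qed
  show "independent_reps G L' (coset_rep G L' ` L)"
    by (rule independent_reps_coset_rep[OF assms(1,3) L.subset])
  let ?sel = "\<lambda>S. SOME r. r \<in> S"
  have im: "coset_rep G L' ` L = ?sel ` ((\<lambda>g. L' #>\<^bsub>G\<^esub> g) ` L)"
    by (simp add: image_image coset_rep_def)
  have "inj_on ?sel ((\<lambda>g. L' #>\<^bsub>G\<^esub> g) ` L)"
  proof (rule inj_onI)
    fix S T assume "S \<in> (\<lambda>g. L' #>\<^bsub>G\<^esub> g) ` L" "T \<in> (\<lambda>g. L' #>\<^bsub>G\<^esub> g) ` L" and e: "?sel S = ?sel T"
    then obtain g h where gh: "g \<in> L" "S = L' #>\<^bsub>G\<^esub> g" "h \<in> L" "T = L' #>\<^bsub>G\<^esub> h" by blast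
    have "?sel (L' #>\<^bsub>G\<^esub> x) \<in> L' #>\<^bsub>G\<^esub> x" if "x \<in> L" for x
      using G.rcos_self[OF L.mem_carrier[OF that] assms(3)] by (rule someI)
    from G.repr_independence[OF this L.mem_carrier assms(3)]
    have "L' #>\<^bsub>G\<^esub> x = L' #>\<^bsub>G\<^esub> ?sel (L' #>\<^bsub>G\<^esub> x)" if "x \<in> L" for x using that by simp
    from this[OF gh(1)] this[OF gh(3)] show "S = T" using e gh(2,4) by simp
  qed
  then show "card (coset_rep G L' ` L) = card ((\<lambda>g. L' #>\<^bsub>G\<^esub> g) ` L)"
    unfolding im by (rule card_image)
  show "finite ((\<lambda>g. L' #>\<^bsub>G\<^esub> g) ` L) \<Longrightarrow> finite (coset_rep G L' ` L)"
    unfolding im by simp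
  show "\<exists>l\<in>L'. \<exists>r\<in>coset_rep G L' ` L. g = l \<otimes>\<^bsub>G\<^esub> r" if g: "g \<in> L"
  proof -
    obtain l where "l \<in> L'" "g = l \<otimes>\<^bsub>G\<^esub> coset_rep G L' g"
      by (rule coset_rep[OF assms(1,3) L.mem_carrier[OF g]])
    then show ?thesis using g by blast
  qed
qed

text \<open>
  Since the norm to C' vanishes on boundaries, it is k times the augmentation for some integer k.
  If the index is finite, the norm to C is the sum of the translates by coset representatives, which
  is the index times k if the character \<open>\<chi>\<close> is trivial, and zero otherwise, because it is both
  invariant and a multiple of a twisted augmentation. If the index is infinite, finiteness
  of the support of \<open>\<tau>\<close> on orbits forces k = 0; this is the case in which the cardinality of the
  infinite set of cosets is zero, and divisibility by it means vanishing.
\<close>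

lemma norm_over_index_divisible:
  assumes "group G" "subgroup C G" "subgroup C' G" "C' \<subseteq> C"
    and Q: "resolution G C \<chi> Q \<beta> e \<epsilon>" and \<chi>: "\<And>g. g \<in> C \<Longrightarrow> \<chi> g \<in> {1, -1}"
    and \<tau>: "\<tau> \<in> dual_mod C (Q 0) (\<beta> 0)"
    and z: "\<And>x. x \<in> Q (Suc 0) \<Longrightarrow> norm_over C' (\<beta> 0) \<tau> (e 0 x) = 0"
    and x: "x \<in> Q 0"
  shows "int (card ((\<lambda>g. C' #>\<^bsub>G\<^esub> g) ` C)) dvd norm_over C (\<beta> 0) \<tau> x"
proof -
  interpret G: group G by fact
  interpret C: subgroup C G by fact
  interpret C': subgroup C' G by fact
  note QD = resolutionD[OF Q]
  note Q0 = gmodD[OF QD(1)[of 0]] and \<epsilon>D = ghomD[OF QD(3)]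
  let ?N = "norm_over C' (\<beta> 0) \<tau>"
  have Nadd: "addmap (Q 0) ?N" by (rule norm_over_addmap_right[OF QD(1) \<tau> assms(4)])
  have "1 \<in> \<epsilon> ` Q 0" using QD(4) by blast
  then obtain u where u: "u \<in> Q 0" "\<epsilon> u = 1" by auto
  define k where "k = ?N u"
  have N: "?N y = k * \<epsilon> y" if y: "y \<in> Q 0" for y
  proof -
    have su: "iscale (\<epsilon> y) u \<in> Q 0" by (rule addsub_iscale[OF Q0(1) u(1)])
    have "y - iscale (\<epsilon> y) u \<in> Q 0" by (rule addsubD(4)[OF Q0(1) y su])
    moreover have "\<epsilon> (y - iscale (\<epsilon> y) u) = 0"
      by (simp add: addmap_diff[OF \<epsilon>D(2) Q0(1) y su] addmap_iscale[OF \<epsilon>D(2) Q0(1) u(1)] u(2))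
    ultimately have "y - iscale (\<epsilon> y) u \<in> e 0 ` Q (Suc 0)" using QD(5) by blast
    then have "?N (y - iscale (\<epsilon> y) u) = 0" using z by auto
    then show ?thesis
      by (simp add: addmap_diff[OF Nadd Q0(1) y su] addmap_iscale[OF Nadd Q0(1) u(1)] k_def mult.commute)
  qed
  let ?R = "coset_rep G C' ` C"
  note R = coset_reps_system[OF assms(1-4)]
  show ?thesis
  proof (cases "finite ((\<lambda>g. C' #>\<^bsub>G\<^esub> g) ` C)")
    case True
    have f: "norm_over C (\<beta> 0) \<tau> y = (\<Sum>r\<in>?R. k * \<chi> r) * \<epsilon> y" if y: "y \<in> Q 0" for y
    proof -
      have "norm_over C (\<beta> 0) \<tau> y = (\<Sum>r\<in>?R. ?N (\<beta> 0 r y))"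
        by (rule norm_over_trans[OF assms(1,2) QD(1) assms(2-4) subset_refl \<tau> y R(4)[OF True] R(1,2)]) (rule R(5))
      also have "\<dots> = (\<Sum>r\<in>?R. k * \<chi> r * \<epsilon> y)"
      proof (rule sum.cong[OF HOL.refl])
        fix r assume "r \<in> ?R"
        then have r: "r \<in> C" using R(1) by blast
        show "?N (\<beta> 0 r y) = k * \<chi> r * \<epsilon> y"
          by (simp add: N[OF Q0(2)[OF r y]] \<epsilon>D(3)[OF r y])
      qed
      finally show ?thesis by (simp add: sum_distrib_right)
    qed
    show ?thesis
    proof (cases "\<forall>c\<in>C. \<chi> c = 1")
      case T: True
      have "(\<Sum>r\<in>?R. k * \<chi> r) = (\<Sum>r\<in>?R. k)" using T R(1) by (intro sum.cong HOL.refl) auto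
      then have "norm_over C (\<beta> 0) \<tau> x = int (card ?R) * (k * \<epsilon> x)" using f[OF x] by simp
      then show ?thesis unfolding R(3) by simp
    next
      case False
      then obtain c where c: "c \<in> C" "\<chi> c = -1" using \<chi> by blast
      have "norm_over C (\<beta> 0) \<tau> x = norm_over C (\<beta> 0) \<tau> (\<beta> 0 c x)"
        using norm_over_act[OF assms(1,2) QD(1) assms(2) subset_refl c(1) x] by simp
      also have "\<dots> = - norm_over C (\<beta> 0) \<tau> x"
        by (simp add: f[OF x] f[OF Q0(2)[OF c(1) x]] \<epsilon>D(3)[OF c(1) x] c(2))
      finally show ?thesis by simp
    qed
  next
    case False
    have "k = 0"
    proof (rule ccontr)
      assume k: "k \<noteq> 0"
      have "(\<lambda>g. C' #>\<^bsub>G\<^esub> g) ` C \<subseteq> (\<lambda>g. C' #>\<^bsub>G\<^esub> g) ` {g \<in> C. \<tau> (\<beta> 0 g u) \<noteq> 0}"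
      proof (rule image_subsetI)
        fix c assume c: "c \<in> C"
        have "?N (\<beta> 0 c u) \<noteq> 0"
          using \<chi>[OF c] k by (auto simp: N[OF Q0(2)[OF c u(1)]] \<epsilon>D(3)[OF c u(1)] u(2))
        then obtain l where l: "l \<in> C'" "\<tau> (\<beta> 0 l (\<beta> 0 c u)) \<noteq> 0"
          by (cases "\<exists>l\<in>C'. \<tau> (\<beta> 0 l (\<beta> 0 c u)) \<noteq> 0") (auto simp: norm_over_def)
        have lC: "l \<in> C" using l(1) assms(4) by blast
        have "\<tau> (\<beta> 0 (l \<otimes>\<^bsub>G\<^esub> c) u) \<noteq> 0" using l(2) Q0(5)[OF lC c u(1)] by simp
        moreover have "l \<otimes>\<^bsub>G\<^esub> c \<in> C" using lC c by simp
        moreover have "C' #>\<^bsub>G\<^esub> c = C' #>\<^bsub>G\<^esub> (l \<otimes>\<^bsub>G\<^esub> c)"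
        proof -
          have "l \<in> carrier G" "c \<in> carrier G" using lC c by auto
          then have "C' #>\<^bsub>G\<^esub> (l \<otimes>\<^bsub>G\<^esub> c) = (C' #>\<^bsub>G\<^esub> l) #>\<^bsub>G\<^esub> c"
            by (simp add: G.coset_mult_assoc C'.subset)
          then show ?thesis using G.coset_join2[OF _ assms(3) l(1)] \<open>l \<in> carrier G\<close> by simp
        qed
        ultimately show "C' #>\<^bsub>G\<^esub> c \<in> (\<lambda>g. C' #>\<^bsub>G\<^esub> g) ` {g \<in> C. \<tau> (\<beta> 0 g u) \<noteq> 0}" by blast
      qed
      then show False using False finite_subset[OF _ finite_imageI[OF dual_modD(3)[OF \<tau> u(1)]]] by blast
    qed
    then have "norm_over C (\<beta> 0) \<tau> x = 0"
      by (intro norm_over_zero_trans[OF assms(1,2) QD(1) assms(2-4) subset_refl \<tau> _ x]) (simp add: N)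
    then show ?thesis by simp
  qed
qed

text \<open>
  A 1-cocycle s with coefficients in chains on cosets of C', as a C'-invariant map, is the norm of
  a form t. Both reversed dual complexes resolve the same twisted module of integers over C, so there
  are C-equivariant maps f and g between them and a homotopy h from the identity to g f. The degrees
  match so that f sends t to a form \<open>\<tau>\<close> on the bottom module of the resolution for C, because
  3 - 1 = 2 = 2 - 0. The cocycle condition says that the C'-norm of \<open>\<tau>\<close> vanishes on boundaries, so its
  C-norm is divisible by the index. Mapping back by g, the homotopy produces \<open>\<theta>\<close>.
\<close>

lemma transfer_mod_index:
  assumes "group G" "subgroup C G" "subgroup C' G" "C' \<subseteq> C"
    and PG: "pd_data G (carrier G) 3 (\<lambda>_. 1) M \<alpha> d \<epsilon> (J :: nat \<Rightarrow> 'j set) b \<kappa> w \<eta>"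
    and PC: "pd_data G C 2 \<chi> Q \<beta> e \<epsilon>' (I :: nat \<Rightarrow> 'i set) c \<mu> w \<eta>'"
    and \<chi>: "\<And>g. g \<in> C \<Longrightarrow> \<chi> g \<in> {1, -1}"
    and w: "\<And>g h. g \<in> C \<Longrightarrow> h \<in> C \<Longrightarrow> w (g \<otimes>\<^bsub>G\<^esub> h) = w g * w h" "w \<one>\<^bsub>G\<^esub> = 1"
    and s: "s \<in> inv_mod G (carrier G) C' (M (Suc 0)) (\<alpha> (Suc 0))" "\<And>x. x \<in> M (Suc (Suc 0)) \<Longrightarrow> s (d (Suc 0) x) = 0"
  obtains t \<theta> where "t \<in> dual_mod (carrier G) (M (Suc 0)) (\<alpha> (Suc 0))"
    "\<And>x. x \<in> M (Suc 0) \<Longrightarrow> norm_over C' (\<alpha> (Suc 0)) t x = s x"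
    "\<theta> \<in> dual_mod (carrier G) (M 0) (\<alpha> 0)"
    "\<And>y. y \<in> M (Suc 0) \<Longrightarrow> int (card ((\<lambda>g. C' #>\<^bsub>G\<^esub> g) ` C)) dvd
        norm_over C (\<alpha> (Suc 0)) t y + norm_over C (\<alpha> 0) \<theta> (d 0 y)"
proof -
  interpret G: group G by fact
  interpret C: subgroup C G by fact
  let ?K = "carrier G"
  let ?n = "int (card ((\<lambda>g. C' #>\<^bsub>G\<^esub> g) ` C))"
  have M: "resolution G ?K (\<lambda>_. 1) M \<alpha> d \<epsilon>" and fJ: "\<And>i. finite (J i)"
    and db: "\<And>i. dual_basis G ?K (M i) (\<alpha> i) (J i) (b i) (\<kappa> i)"
    and bd: "\<exists>N. \<forall>i>N. M i = {0}" and ex: "dual_exact ?K 3 M \<alpha> d \<eta>"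
    and wG: "\<And>g \<phi>. g \<in> ?K \<Longrightarrow> \<phi> \<in> dual_cocycles ?K M \<alpha> d 3 \<Longrightarrow> \<eta> (dual_act G ?K (M 3) (\<alpha> 3) g \<phi>) = w g * \<eta> \<phi>"
    using PG by (auto simp: pd_data_def)
  have Q: "resolution G C \<chi> Q \<beta> e \<epsilon>'" and fI: "\<And>i. finite (I i)"
    and dbQ: "\<And>i. dual_basis G C (Q i) (\<beta> i) (I i) (c i) (\<mu> i)"
    and bdQ: "\<exists>N. \<forall>i>N. Q i = {0}" and exQ: "dual_exact C 2 Q \<beta> e \<eta>'"
    and wC: "\<And>g \<phi>. g \<in> C \<Longrightarrow> \<phi> \<in> dual_cocycles C Q \<beta> e 2 \<Longrightarrow> \<eta>' (dual_act G C (Q 2) (\<beta> 2) g \<phi>) = w g * \<eta>' \<phi>"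
    using PC by (auto simp: pd_data_def)
  obtain N where N: "\<And>i. N < i \<Longrightarrow> M i = {0}" using bd by blast
  obtain N' where N': "\<And>i. N' < i \<Longrightarrow> Q i = {0}" using bdQ by blast
  note sG = G.subgroup_self
  let ?R = "rev_mod ?K 3 M \<alpha> d" and ?Ra = "rev_act G ?K 3 M \<alpha>" and ?Rd = "rev_map 3 M d"
  let ?S = "rev_mod C 2 Q \<beta> e" and ?Sa = "rev_act G C 2 Q \<beta>" and ?Sd = "rev_map 2 Q e"
  have RG: "resolution G ?K w ?R ?Ra ?Rd \<eta>"
    by (rule rev_resolution[OF assms(1) sG M ex wG])
  have RC: "resolution G C w ?R ?Ra ?Rd \<eta>" by (rule resolution_subset[OF RG C.subset])
  have SC: "resolution G C w ?S ?Sa ?Sd \<eta>'" by (rule rev_resolution[OF assms(1,2) Q exQ wC])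
  obtain JR bR \<kappa>R where dbR: "\<And>j. dual_basis G ?K (?R j) (?Ra j) (JR j :: 'j set) (bR j) (\<kappa>R j)"
    using rev_dual_basis[OF assms(1) sG M ex db fJ N] by blast
  obtain IS cS \<mu>S where dbS: "\<And>j. dual_basis G C (?S j) (?Sa j) (IS j :: 'i set) (cS j) (\<mu>S j)"
    using rev_dual_basis[OF assms(1,2) Q exQ dbQ fI N'] by blast
  obtain f where f: "chain_map C ?R ?Ra ?Rd ?S ?Sa ?Sd f" "\<And>x. x \<in> ?R 0 \<Longrightarrow> \<eta>' (f 0 x) = \<eta> x"
    using chain_map_exists[OF assms(1,2) sG C.subset RC resolutionD(1)[OF RG] dbR SC w] by blast
  obtain g where g: "chain_map C ?S ?Sa ?Sd ?R ?Ra ?Rd g" "\<And>x. x \<in> ?S 0 \<Longrightarrow> \<eta> (g 0 x) = \<eta>' x"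
    using chain_map_exists[OF assms(1,2,2) subset_refl SC resolutionD(1)[OF SC] dbS RC w] by blast
  have fh: "ghom C (?R i) (?Ra i) (?S i) (?Sa i) (f i)" and
    fc: "\<And>x. x \<in> ?R (Suc i) \<Longrightarrow> ?Sd i (f (Suc i) x) = f i (?Rd i x)" for i
    using f(1) by (simp_all add: chain_map_def)
  have gh: "ghom C (?S i) (?Sa i) (?R i) (?Ra i) (g i)" and
    gc: "\<And>x. x \<in> ?S (Suc i) \<Longrightarrow> ?Rd i (g (Suc i) x) = g i (?Sd i x)" for i
    using g(1) by (simp_all add: chain_map_def)
  \<comment> \<open>this chain map is zero on augmentations, hence null-homotopic over C\<close>
  define p where "p i x = g i (f i x) - x" for i x
  have ph: "ghom C (?R i) (?Ra i) (?R i) (?Ra i) (p i)" for i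
    unfolding p_def
    by (rule ghom_diff[OF ghom_comp[OF fh gh] ghom_id[OF resolutionD(1)[OF RC]] resolutionD(1)[OF RC]])
  have p: "chain_map C ?R ?Ra ?Rd ?R ?Ra ?Rd p"
    unfolding chain_map_def
  proof (intro conjI allI ballI ph)
    fix i x assume x: "x \<in> ?R (Suc i)"
    have gf: "g (Suc i) (f (Suc i) x) \<in> ?R (Suc i)" by (rule ghomD(1)[OF gh ghomD(1)[OF fh x]])
    show "?Rd i (p (Suc i) x) = p i (?Rd i x)"
      by (simp add: p_def addmap_diff[OF ghomD(2)[OF resolutionD(2)[OF RC]] gmodD(1)[OF resolutionD(1)[OF RC]] gf x]
          gc[OF ghomD(1)[OF fh x]] fc[OF x])
  qed
  have p0: "\<eta> (p 0 x) = 0" if x: "x \<in> ?R 0" for x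
    using addmap_diff[OF ghomD(2)[OF resolutionD(3)[OF RC]] gmodD(1)[OF resolutionD(1)[OF RC]] ghomD(1)[OF gh ghomD(1)[OF fh x]] x]
      f(2)[OF x] g(2)[OF ghomD(1)[OF fh x]] by (simp add: p_def)
  have "\<exists>h. (\<forall>i. ghom C (?R i) (?Ra i) (?R (Suc i)) (?Ra (Suc i)) (h i)) \<and>
      (\<forall>i. \<forall>x\<in>?R (Suc i). p (Suc i) x = ?Rd (Suc i) (h (Suc i) x) + h i (?Rd i x))"
    by (rule null_homotopy_exists[where \<eta>=\<eta> and f=p, OF assms(1,2) sG C.subset RC resolutionD(1)[OF RG] dbR RC p p0],
        assumption, rule exI, intro conjI allI ballI) assumption+
  then obtain h where h: "\<And>i. ghom C (?R i) (?Ra i) (?R (Suc i)) (?Ra (Suc i)) (h i)"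
    "\<And>i x. x \<in> ?R (Suc i) \<Longrightarrow> p (Suc i) x = ?Rd (Suc i) (h (Suc i) x) + h i (?Rd i x)"
    by blast
  \<comment> \<open>names for the terms in low degrees\<close>
  let ?M0 = "M 0" and ?M1 = "M (Suc 0)" and ?M2 = "M (Suc (Suc 0))"
  let ?D0 = "dual_mod ?K ?M0 (\<alpha> 0)" and ?D1 = "dual_mod ?K ?M1 (\<alpha> (Suc 0))" and ?D2 = "dual_mod ?K ?M2 (\<alpha> (Suc (Suc 0)))"
  let ?a0 = "dual_act G ?K ?M0 (\<alpha> 0)" and ?a1 = "dual_act G ?K ?M1 (\<alpha> (Suc 0))" and ?a2 = "dual_act G ?K ?M2 (\<alpha> (Suc (Suc 0)))"
  have R: "?R (Suc 0) = ?D2" "?R (Suc (Suc 0)) = ?D1" "?R (Suc (Suc (Suc 0))) = ?D0"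
    "?Ra (Suc 0) = ?a2" "?Ra (Suc (Suc 0)) = ?a1" "?Ra (Suc (Suc (Suc 0))) = ?a0"
    "?Rd (Suc 0) = dual_map ?M2 (d (Suc 0))" "?Rd (Suc (Suc 0)) = dual_map ?M1 (d 0)"
    by (simp_all add: rev_mod_def rev_act_def rev_map_def numeral_3_eq_3)
  have S: "?S (Suc 0) = dual_mod C (Q (Suc 0)) (\<beta> (Suc 0))" "?S (Suc (Suc 0)) = dual_mod C (Q 0) (\<beta> 0)"
    "?Sa (Suc 0) = dual_act G C (Q (Suc 0)) (\<beta> (Suc 0))" "?Sa (Suc (Suc 0)) = dual_act G C (Q 0) (\<beta> 0)"
    "?Sd (Suc 0) = dual_map (Q (Suc 0)) (e 0)"
    by (simp_all add: rev_mod_def rev_act_def rev_map_def numeral_2_eq_2)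
  have C'K: "C' \<subseteq> ?K" using assms(4) C.subset by blast
  have Mg: "gmod G ?K (M i) (\<alpha> i)" for i by (rule resolutionD(1)[OF M])
  have Qg: "gmod G C (Q i) (\<beta> i)" for i by (rule resolutionD(1)[OF Q])
  obtain t where t: "t \<in> ?D1" "\<And>x. x \<in> ?M1 \<Longrightarrow> norm_over C' (\<alpha> (Suc 0)) t x = s x"
    using norm_over_surj[OF assms(1) sG Mg db fJ assms(3) C'K s(1)] by blast
  define \<delta>t where "\<delta>t = dual_map ?M2 (d (Suc 0)) t"
  have \<delta>t: "\<delta>t \<in> ?D2"
    unfolding \<delta>t_def by (rule ghomD(1)[OF dual_cochain_gmod(2)[OF assms(1) sG M] t(1)])
  have \<delta>tN: "norm_over C' (\<alpha> (Suc (Suc 0))) \<delta>t x = 0" if x: "x \<in> ?M2" for x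
    unfolding \<delta>t_def
    using norm_over_dual_map[OF Mg resolutionD(2)[OF M] C'K x] t(2)[OF ghomD(1)[OF resolutionD(2)[OF M] x]] s(2)[OF x]
    by simp
  define \<tau> where "\<tau> = f (Suc (Suc 0)) t"
  have \<tau>: "\<tau> \<in> dual_mod C (Q 0) (\<beta> 0)"
    using ghomD(1)[OF fh[of "Suc (Suc 0)"]] t(1) unfolding R S \<tau>_def by blast
  have \<delta>\<tau>: "dual_map (Q (Suc 0)) (e 0) \<tau> = f (Suc 0) \<delta>t"
    using fc[of t "Suc 0"] t(1) unfolding R S \<tau>_def \<delta>t_def by blast
  have z: "norm_over C' (\<beta> 0) \<tau> (e 0 x) = 0" if x: "x \<in> Q (Suc 0)" for x
  proof -
    have F: "ghom C' ?D2 ?a2 (dual_mod C (Q (Suc 0)) (\<beta> (Suc 0))) (dual_act G C (Q (Suc 0)) (\<beta> (Suc 0))) (f (Suc 0))"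
      using ghom_subset[OF fh[of "Suc 0"] assms(4)] unfolding R S .
    have "0 dvd norm_over C' (\<beta> (Suc 0)) (f (Suc 0) \<delta>t) x"
      by (rule norm_over_divisible[OF assms(1) sG Mg db fJ assms(2) Qg assms(3) C'K assms(4) F \<delta>t _ x])
        (simp add: \<delta>tN)
    then have "norm_over C' (\<beta> (Suc 0)) (dual_map (Q (Suc 0)) (e 0) \<tau>) x = 0" using \<delta>\<tau> by simp
    then show ?thesis using norm_over_dual_map[OF Qg resolutionD(2)[OF Q] assms(4) x] by simp
  qed
  have dv\<tau>: "?n dvd norm_over C (\<beta> 0) \<tau> x" if "x \<in> Q 0" for x
    by (rule norm_over_index_divisible[OF assms(1-4) Q \<chi> \<tau> z that])
  have dvg: "?n dvd norm_over C (\<alpha> (Suc 0)) (g (Suc (Suc 0)) \<tau>) y" if y: "y \<in> ?M1" for y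
  proof -
    have F: "ghom C (dual_mod C (Q 0) (\<beta> 0)) (dual_act G C (Q 0) (\<beta> 0)) ?D1 ?a1 (g (Suc (Suc 0)))"
      using gh[of "Suc (Suc 0)"] unfolding R S .
    show ?thesis
      by (rule norm_over_divisible[OF assms(1,2) Qg dbQ fI sG Mg assms(2) subset_refl C.subset F \<tau> dv\<tau> y])
  qed
  define \<theta> where "\<theta> = h (Suc (Suc 0)) t"
  have \<theta>: "\<theta> \<in> ?D0" using ghomD(1)[OF h(1)[of "Suc (Suc 0)"]] t(1) unfolding R \<theta>_def by blast
  have ht: "g (Suc (Suc 0)) \<tau> - t = dual_map ?M1 (d 0) \<theta> + h (Suc 0) \<delta>t"
    using h(2)[of t "Suc 0"] t(1) unfolding p_def R \<tau>_def \<theta>_def \<delta>t_def by blast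
  have hF: "ghom C ?D2 ?a2 ?D1 ?a1 (h (Suc 0))" using h(1)[of "Suc 0"] unfolding R .
  have h0: "norm_over C (\<alpha> (Suc 0)) (h (Suc 0) \<delta>t) y = 0" if y: "y \<in> ?M1" for y
  proof -
    have "norm_over C (\<alpha> (Suc (Suc 0))) \<delta>t x = 0" if "x \<in> ?M2" for x
      by (rule norm_over_zero_trans[OF assms(1) sG Mg assms(2,3,4) C.subset \<delta>t \<delta>tN that])
    then have "0 dvd norm_over C (\<alpha> (Suc 0)) (h (Suc 0) \<delta>t) y"
      by (intro norm_over_divisible[OF assms(1) sG Mg db fJ sG Mg assms(2) C.subset C.subset hF \<delta>t _ y]) simp
    then show ?thesis by simp
  qed
  have fin: "?n dvd norm_over C (\<alpha> (Suc 0)) t y + norm_over C (\<alpha> 0) \<theta> (d 0 y)" if y: "y \<in> ?M1" for y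
  proof -
    note na = norm_over_addmap[OF C.subset y, where \<alpha>="\<alpha> (Suc 0)"]
    have gt: "g (Suc (Suc 0)) \<tau> \<in> ?D1"
      using ghomD(1)[OF gh[of "Suc (Suc 0)"]] \<tau> unfolding R S by blast
    have d\<theta>: "dual_map ?M1 (d 0) \<theta> \<in> ?D1"
      by (rule ghomD(1)[OF dual_cochain_gmod(2)[OF assms(1) sG M] \<theta>])
    have h\<delta>: "h (Suc 0) \<delta>t \<in> ?D1" by (rule ghomD(1)[OF hF \<delta>t])
    have "norm_over C (\<alpha> (Suc 0)) (g (Suc (Suc 0)) \<tau>) y - norm_over C (\<alpha> (Suc 0)) t y =
        norm_over C (\<alpha> (Suc 0)) (g (Suc (Suc 0)) \<tau> - t) y"
      by (rule addmap_diff[OF na dual_mod_addsub gt t(1), symmetric])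
    also have "\<dots> = norm_over C (\<alpha> (Suc 0)) (dual_map ?M1 (d 0) \<theta>) y + norm_over C (\<alpha> (Suc 0)) (h (Suc 0) \<delta>t) y"
      unfolding ht by (rule addmap_add[OF na d\<theta> h\<delta>])
    also have "\<dots> = norm_over C (\<alpha> 0) \<theta> (d 0 y)"
      using h0[OF y] norm_over_dual_map[OF Mg resolutionD(2)[OF M] C.subset y] by simp
    finally have "norm_over C (\<alpha> (Suc 0)) t y + norm_over C (\<alpha> 0) \<theta> (d 0 y) =
        norm_over C (\<alpha> (Suc 0)) (g (Suc (Suc 0)) \<tau>) y" by simp
    then show ?thesis using dvg[OF y] by simp
  qed
  show thesis by (rule that[OF t \<theta> fin])
qed

section \<open>Comparison of the dual complexes of two resolutions\<close>

lemma chain_map_dual_cocycles: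
  assumes "group G" "subgroup K G" and M: "resolution G K v M \<alpha> d \<epsilon>" and N: "resolution G K v' N \<beta> e \<epsilon>'"
    and f: "chain_map K M \<alpha> d N \<beta> e f" and \<phi>: "\<phi> \<in> dual_mod K (N i) (\<beta> i)"
  shows "dual_map (M i) (f i) \<phi> \<in> dual_mod K (M i) (\<alpha> i)"
    "dual_map (M (Suc i)) (d i) (dual_map (M i) (f i) \<phi>) =
      dual_map (M (Suc i)) (f (Suc i)) (dual_map (N (Suc i)) (e i) \<phi>)"
    "\<phi> \<in> dual_cocycles K N \<beta> e i \<Longrightarrow> dual_map (M i) (f i) \<phi> \<in> dual_cocycles K M \<alpha> d i"
proof -
  have fh: "ghom K (M i) (\<alpha> i) (N i) (\<beta> i) (f i)" for i using f by (simp add: chain_map_def)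
  have fc: "e i (f (Suc i) x) = f i (d i x)" if "x \<in> M (Suc i)" for i x
    using f that by (simp add: chain_map_def)
  show 1: "dual_map (M i) (f i) \<phi> \<in> dual_mod K (M i) (\<alpha> i)"
    by (rule ghomD(1)[OF dual_map_ghom[OF assms(1,2) resolutionD(1)[OF M] resolutionD(1)[OF N] fh] \<phi>])
  show 2: "dual_map (M (Suc i)) (d i) (dual_map (M i) (f i) \<phi>) =
      dual_map (M (Suc i)) (f (Suc i)) (dual_map (N (Suc i)) (e i) \<phi>)"
    using ghomD(1)[OF resolutionD(2)[OF M, of i]] ghomD(1)[OF fh] by (auto simp: dual_map_def fun_eq_iff fc)
  show "dual_map (M i) (f i) \<phi> \<in> dual_cocycles K M \<alpha> d i" if "\<phi> \<in> dual_cocycles K N \<beta> e i"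
    using 1 2 that by (simp add: dual_cocycles_def dual_map_zero)
qed

text \<open>
  Dualising a homotopy between g f and the identity; by symmetry, f and g induce inverse maps on
  cohomology.
\<close>

lemma dual_homotopy:
  assumes "group G" and M: "resolution G (carrier G) v M \<alpha> d \<epsilon>" and N: "resolution G (carrier G) v' N \<beta> e \<epsilon>'"
    and db: "\<And>i. dual_basis G (carrier G) (M i) (\<alpha> i) (J i) (b i) (\<kappa> i)"
    and f: "chain_map (carrier G) M \<alpha> d N \<beta> e f" "\<forall>x\<in>M 0. \<epsilon>' (f 0 x) = \<epsilon> x"
    and g: "chain_map (carrier G) N \<beta> e M \<alpha> d g" "\<forall>x\<in>N 0. \<epsilon> (g 0 x) = \<epsilon>' x"
  shows "\<phi> \<in> dual_cocycles (carrier G) M \<alpha> d 0 \<Longrightarrow> dual_map (M 0) (f 0) (dual_map (N 0) (g 0) \<phi>) = \<phi>"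
    and "\<phi> \<in> dual_cocycles (carrier G) M \<alpha> d (Suc i) \<Longrightarrow> \<exists>\<theta>\<in>dual_mod (carrier G) (M i) (\<alpha> i).
      dual_map (M (Suc i)) (f (Suc i)) (dual_map (N (Suc i)) (g (Suc i)) \<phi>) = \<phi> + dual_map (M (Suc i)) (d i) \<theta>"
proof -
  interpret G: group G by fact
  let ?K = "carrier G"
  have fh: "ghom ?K (M i) (\<alpha> i) (N i) (\<beta> i) (f i)" and
    fc: "\<And>x. x \<in> M (Suc i) \<Longrightarrow> e i (f (Suc i) x) = f i (d i x)" for i
    using f(1) by (simp_all add: chain_map_def)
  have gh: "ghom ?K (N i) (\<beta> i) (M i) (\<alpha> i) (g i)" and
    gc: "\<And>x. x \<in> N (Suc i) \<Longrightarrow> d i (g (Suc i) x) = g i (e i x)" for i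
    using g(1) by (simp_all add: chain_map_def)
  define p where "p i x = g i (f i x) - x" for i x
  have ph: "ghom ?K (M i) (\<alpha> i) (M i) (\<alpha> i) (p i)" for i
    unfolding p_def
    by (rule ghom_diff[OF ghom_comp[OF fh gh] ghom_id[OF resolutionD(1)[OF M]] resolutionD(1)[OF M]])
  have p: "chain_map ?K M \<alpha> d M \<alpha> d p"
    unfolding chain_map_def
  proof (intro conjI allI ballI ph)
    fix i x assume x: "x \<in> M (Suc i)"
    have gf: "g (Suc i) (f (Suc i) x) \<in> M (Suc i)" by (rule ghomD(1)[OF gh ghomD(1)[OF fh x]])
    show "d i (p (Suc i) x) = p i (d i x)"
      by (simp add: p_def addmap_diff[OF ghomD(2)[OF resolutionD(2)[OF M]] gmodD(1)[OF resolutionD(1)[OF M]] gf x]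
          gc[OF ghomD(1)[OF fh x]] fc[OF x])
  qed
  have p0: "\<epsilon> (p 0 x) = 0" if x: "x \<in> M 0" for x
    using addmap_diff[OF ghomD(2)[OF resolutionD(3)[OF M]] gmodD(1)[OF resolutionD(1)[OF M]] ghomD(1)[OF gh ghomD(1)[OF fh x]] x]
      bspec[OF f(2) x] bspec[OF g(2) ghomD(1)[OF fh x]] by (simp add: p_def)
  have "\<exists>h. (\<forall>i. ghom ?K (M i) (\<alpha> i) (M (Suc i)) (\<alpha> (Suc i)) (h i)) \<and>
      (\<forall>x\<in>M 0. p 0 x = d 0 (h 0 x)) \<and>
      (\<forall>i. \<forall>x\<in>M (Suc i). p (Suc i) x = d (Suc i) (h (Suc i) x) + h i (d i x))"
    by (rule null_homotopy_exists[where \<eta>=\<epsilon> and f=p, OF assms(1) G.subgroup_self G.subgroup_self subset_refl M resolutionD(1)[OF M] db M p p0],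
        assumption, rule exI, intro conjI allI ballI) assumption+
  then obtain h where h: "\<And>i. ghom ?K (M i) (\<alpha> i) (M (Suc i)) (\<alpha> (Suc i)) (h i)"
    "\<And>x. x \<in> M 0 \<Longrightarrow> p 0 x = d 0 (h 0 x)"
    "\<And>i x. x \<in> M (Suc i) \<Longrightarrow> p (Suc i) x = d (Suc i) (h (Suc i) x) + h i (d i x)"
    by blast
  have z: "\<phi> (d i y) = 0" if "\<phi> \<in> dual_cocycles ?K M \<alpha> d i" "y \<in> M (Suc i)" for \<phi> i y
  proof -
    have "dual_map (M (Suc i)) (d i) \<phi> y = 0" using that(1) by (simp add: dual_cocycles_def)
    then show ?thesis using that(2) by (simp add: dual_map_def)
  qed
  have gf: "\<phi> (g i (f i x)) = \<phi> x + \<phi> (p i x)" if "\<phi> \<in> dual_mod ?K (M i) (\<alpha> i)" "x \<in> M i" for \<phi> i x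
    using addmap_add[OF dual_modD(1)[OF that(1)] that(2) ghomD(1)[OF ph that(2)]] by (simp add: p_def)
  show "dual_map (M 0) (f 0) (dual_map (N 0) (g 0) \<phi>) = \<phi>" if \<phi>: "\<phi> \<in> dual_cocycles ?K M \<alpha> d 0"
  proof
    fix x
    have \<phi>': "\<phi> \<in> dual_mod ?K (M 0) (\<alpha> 0)" using \<phi> by (simp add: dual_cocycles_def)
    show "dual_map (M 0) (f 0) (dual_map (N 0) (g 0) \<phi>) x = \<phi> x"
    proof (cases "x \<in> M 0")
      case True
      then show ?thesis
        using gf[OF \<phi>' True] h(2)[OF True] z[OF \<phi> ghomD(1)[OF h(1) True]] ghomD(1)[OF fh True] by (simp add: dual_map_def)
    qed (simp add: dual_map_def dual_modD(2)[OF \<phi>'])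
  qed
  show "\<exists>\<theta>\<in>dual_mod ?K (M i) (\<alpha> i).
      dual_map (M (Suc i)) (f (Suc i)) (dual_map (N (Suc i)) (g (Suc i)) \<phi>) = \<phi> + dual_map (M (Suc i)) (d i) \<theta>"
    if \<phi>: "\<phi> \<in> dual_cocycles ?K M \<alpha> d (Suc i)"
  proof
    have \<phi>': "\<phi> \<in> dual_mod ?K (M (Suc i)) (\<alpha> (Suc i))" using \<phi> by (simp add: dual_cocycles_def)
    show "dual_map (M i) (h i) \<phi> \<in> dual_mod ?K (M i) (\<alpha> i)"
      by (rule ghomD(1)[OF dual_map_ghom[OF assms(1) G.subgroup_self resolutionD(1)[OF M] resolutionD(1)[OF M] h(1)] \<phi>'])
    show "dual_map (M (Suc i)) (f (Suc i)) (dual_map (N (Suc i)) (g (Suc i)) \<phi>) =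
        \<phi> + dual_map (M (Suc i)) (d i) (dual_map (M i) (h i) \<phi>)"
    proof
      fix x
      show "dual_map (M (Suc i)) (f (Suc i)) (dual_map (N (Suc i)) (g (Suc i)) \<phi>) x =
        (\<phi> + dual_map (M (Suc i)) (d i) (dual_map (M i) (h i) \<phi>)) x"
      proof (cases "x \<in> M (Suc i)")
        case True
        have dx: "d i x \<in> M i" by (rule ghomD(1)[OF resolutionD(2)[OF M] True])
        have "\<phi> (p (Suc i) x) = \<phi> (d (Suc i) (h (Suc i) x)) + \<phi> (h i (d i x))"
          unfolding h(3)[OF True]
          by (rule addmap_add[OF dual_modD(1)[OF \<phi>'] ghomD(1)[OF resolutionD(2)[OF M] ghomD(1)[OF h(1) True]] ghomD(1)[OF h(1) dx]])
        also have "\<dots> = \<phi> (h i (d i x))" using z[OF \<phi> ghomD(1)[OF h(1) True]] by simp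
        finally show ?thesis
          using gf[OF \<phi>' True] True dx ghomD(1)[OF fh True] by (simp add: dual_map_def)
      qed (simp add: dual_map_def dual_modD(2)[OF \<phi>'])
    qed
  qed
qed

text \<open>
  The cohomology of the dual complex does not depend on the resolution. It is defined by the bar
  resolution but used for a finite one.
\<close>

lemma dual_exact_transfer:
  assumes "group G" and M: "resolution G (carrier G) (\<lambda>_. 1) M \<alpha> d \<epsilon>" and N: "resolution G (carrier G) (\<lambda>_. 1) N \<beta> e \<epsilon>'"
    and dbM: "\<And>i. dual_basis G (carrier G) (M i) (\<alpha> i) (J i) (b i) (\<kappa> i)"
    and dbN: "\<And>i. dual_basis G (carrier G) (N i) (\<beta> i) (I i) (c i) (\<mu> i)"
    and ex: "dual_exact (carrier G) n N \<beta> e \<eta>"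
  obtains \<eta>' where "dual_exact (carrier G) n M \<alpha> d \<eta>'"
proof -
  interpret G: group G by fact
  let ?K = "carrier G"
  note sG = G.subgroup_self
  note DE = dual_exactD[OF ex]
  have "\<exists>f. chain_map ?K M \<alpha> d N \<beta> e f \<and> (\<forall>x\<in>M 0. \<epsilon>' (f 0 x) = \<epsilon> x)"
    by (rule chain_map_exists[OF assms(1) sG sG subset_refl M resolutionD(1)[OF M] dbM N], simp, simp, rule exI, rule conjI, assumption, blast)
  then obtain f where f: "chain_map ?K M \<alpha> d N \<beta> e f" "\<forall>x\<in>M 0. \<epsilon>' (f 0 x) = \<epsilon> x" by blast
  have "\<exists>g. chain_map ?K N \<beta> e M \<alpha> d g \<and> (\<forall>x\<in>N 0. \<epsilon> (g 0 x) = \<epsilon>' x)"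
    by (rule chain_map_exists[OF assms(1) sG sG subset_refl N resolutionD(1)[OF N] dbN M], simp, simp, rule exI, rule conjI, assumption, blast)
  then obtain g where g: "chain_map ?K N \<beta> e M \<alpha> d g" "\<forall>x\<in>N 0. \<epsilon> (g 0 x) = \<epsilon>' x" by blast
  note hM = dual_homotopy[OF assms(1) M N dbM f g]
  note hN = dual_homotopy[OF assms(1) N M dbN g f]
  note f' = chain_map_dual_cocycles[OF assms(1) sG M N f(1)]
  note g' = chain_map_dual_cocycles[OF assms(1) sG N M g(1)]
  let ?ZM = "dual_cocycles ?K M \<alpha> d" and ?ZN = "dual_cocycles ?K N \<beta> e"
  let ?DM = "\<lambda>i. dual_mod ?K (M i) (\<alpha> i)" and ?DN = "\<lambda>i. dual_mod ?K (N i) (\<beta> i)"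
  let ?dM = "\<lambda>i. dual_map (M (Suc i)) (d i)" and ?dN = "\<lambda>i. dual_map (N (Suc i)) (e i)"
  let ?f = "\<lambda>i. dual_map (M i) (f i)" and ?g = "\<lambda>i. dual_map (N i) (g i)"
  have ZM: "\<phi> \<in> ?DM i" if "\<phi> \<in> ?ZM i" for \<phi> i using that by (simp add: dual_cocycles_def)
  have ZN: "\<phi> \<in> ?DN i" if "\<phi> \<in> ?ZN i" for \<phi> i using that by (simp add: dual_cocycles_def)
  have addf: "addmap S (dual_map A k)" for S A k by (auto simp: addmap_def dual_map_def fun_eq_iff)
  \<comment> \<open>pulling a coboundary back and forth\<close>
  have pullback: "\<phi> \<in> ?dM i ` ?DM i" if \<phi>: "\<phi> \<in> ?ZM (Suc i)" and \<psi>: "\<psi> \<in> ?DN i" "?g (Suc i) \<phi> = ?dN i \<psi>" for \<phi> \<psi> i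
  proof -
    obtain \<theta> where \<theta>: "\<theta> \<in> ?DM i" "?f (Suc i) (?g (Suc i) \<phi>) = \<phi> + ?dM i \<theta>" using hM(2)[OF \<phi>] by blast
    have "?f (Suc i) (?g (Suc i) \<phi>) = ?dM i (?f i \<psi>)" unfolding \<psi>(2) using f'(2)[OF \<psi>(1)] by simp
    then have "\<phi> = ?dM i (?f i \<psi>) - ?dM i \<theta>" using \<theta>(2) by (simp add: algebra_simps)
    also have "\<dots> = ?dM i (?f i \<psi> - \<theta>)"
      by (rule addmap_diff[OF addf dual_mod_addsub f'(1)[OF \<psi>(1)] \<theta>(1), symmetric])
    finally show ?thesis using addsubD(4)[OF dual_mod_addsub f'(1)[OF \<psi>(1)] \<theta>(1)] by blast
  qed
  obtain m where m: "n = Suc m" using DE(1) by (cases n) auto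
  have kerN: "{\<phi> \<in> ?ZN n. \<eta> \<phi> = 0} = ?dN m ` ?DN m" using DE(6) m by simp
  define \<eta>' where "\<eta>' \<phi> = \<eta> (?g n \<phi>)" for \<phi>
  have \<eta>'add: "addmap (?ZM n) \<eta>'"
    unfolding \<eta>'_def by (rule addmap_comp[OF addf DE(4)]) (use g'(3)[OF ZM] in blast)
  have "dual_exact ?K n M \<alpha> d \<eta>'"
    unfolding dual_exact_def
  proof (intro conjI allI impI)
    show "0 < n" by (rule DE(1))
    show "?ZM 0 \<subseteq> {0}"
    proof
      fix \<phi> assume \<phi>: "\<phi> \<in> ?ZM 0"
      have "?g 0 \<phi> \<in> ?ZN 0" by (rule g'(3)[OF ZM[OF \<phi>] \<phi>])
      then have "?g 0 \<phi> = 0" using DE(2) by blast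
      then show "\<phi> \<in> {0}" using hM(1)[OF \<phi>] by (simp add: dual_map_zero)
    qed
    show "?ZM (Suc i) \<subseteq> ?dM i ` ?DM i" if i: "Suc i \<noteq> n" for i
    proof
      fix \<phi> assume \<phi>: "\<phi> \<in> ?ZM (Suc i)"
      have "?g (Suc i) \<phi> \<in> ?ZN (Suc i)" by (rule g'(3)[OF ZM[OF \<phi>] \<phi>])
      then obtain \<psi> where "\<psi> \<in> ?DN i" "?g (Suc i) \<phi> = ?dN i \<psi>" using DE(3)[OF i] by blast
      then show "\<phi> \<in> ?dM i ` ?DM i" by (rule pullback[OF \<phi>])
    qed
    show "addmap (?ZM n) \<eta>'" by (rule \<eta>'add)
    show "\<eta>' ` ?ZM n = UNIV"
    proof -
      have "k \<in> \<eta>' ` ?ZM n" for k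
      proof -
        have "k \<in> \<eta> ` ?ZN n" using DE(5) by blast
        then obtain \<psi> where \<psi>: "\<psi> \<in> ?ZN (Suc m)" "\<eta> \<psi> = k" using m by blast
        obtain \<theta> where \<theta>: "\<theta> \<in> ?DN m" "?g (Suc m) (?f (Suc m) \<psi>) = \<psi> + ?dN m \<theta>" using hN(2)[OF \<psi>(1)] by blast
        have "?dN m \<theta> \<in> {\<phi> \<in> ?ZN n. \<eta> \<phi> = 0}" unfolding kerN using \<theta>(1) by blast
        then have "\<eta> (\<psi> + ?dN m \<theta>) = k"
          using addmap_add[OF DE(4), of \<psi> "?dN m \<theta>"] \<psi> m by simp
        then have "\<eta>' (?f (Suc m) \<psi>) = k" unfolding \<eta>'_def m \<theta>(2) .
        moreover have "?f (Suc m) \<psi> \<in> ?ZM n" unfolding m by (rule f'(3)[OF ZN[OF \<psi>(1)] \<psi>(1)])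
        ultimately show ?thesis by blast
      qed
      then show ?thesis by blast
    qed
    show "{\<phi> \<in> ?ZM n. \<eta>' \<phi> = 0} = dual_map (M n) (d (n - 1)) ` dual_mod ?K (M (n - 1)) (\<alpha> (n - 1))"
    proof -
      have "{\<phi> \<in> ?ZM (Suc m). \<eta>' \<phi> = 0} = ?dM m ` ?DM m"
      proof (intro equalityI subsetI)
        fix \<phi> assume "\<phi> \<in> {\<phi> \<in> ?ZM (Suc m). \<eta>' \<phi> = 0}"
        then have \<phi>: "\<phi> \<in> ?ZM (Suc m)" "\<eta> (?g (Suc m) \<phi>) = 0" using m by (auto simp: \<eta>'_def)
        have "?g (Suc m) \<phi> \<in> {\<phi> \<in> ?ZN n. \<eta> \<phi> = 0}" using g'(3)[OF ZM[OF \<phi>(1)] \<phi>(1)] \<phi>(2) m by simp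
        then obtain \<psi> where "\<psi> \<in> ?DN m" "?g (Suc m) \<phi> = ?dN m \<psi>" unfolding kerN by blast
        then show "\<phi> \<in> ?dM m ` ?DM m" by (rule pullback[OF \<phi>(1)])
      next
        fix \<phi> assume "\<phi> \<in> ?dM m ` ?DM m"
        then obtain \<theta> where \<theta>: "\<theta> \<in> ?DM m" "\<phi> = ?dM m \<theta>" by blast
        have "?g (Suc m) \<phi> = ?dN m (?g m \<theta>)" unfolding \<theta>(2) using g'(2)[OF \<theta>(1)] by simp
        then have "?g (Suc m) \<phi> \<in> {\<phi> \<in> ?ZN n. \<eta> \<phi> = 0}" unfolding kerN using g'(1)[OF \<theta>(1)] by blast
        moreover have "\<phi> \<in> ?ZM (Suc m)" unfolding \<theta>(2) by (rule dual_map_in_cocycles[OF assms(1) sG M \<theta>(1)])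
        ultimately show "\<phi> \<in> {\<phi> \<in> ?ZM (Suc m). \<eta>' \<phi> = 0}" using m by (simp add: \<eta>'_def)
      qed
      then show ?thesis using m by simp
    qed
  qed
  then show thesis by (rule that)
qed

section \<open>Free modules and resolutions of type FP\<close>

definition perm_act :: "('g, 'm) monoid_scheme \<Rightarrow> 'g \<Rightarrow> ('g \<times> 'x \<Rightarrow>\<^sub>0 int) \<Rightarrow> 'g \<times> 'x \<Rightarrow>\<^sub>0 int" where
  "perm_act G g = frag_extend (\<lambda>p. frag_of (g \<otimes>\<^bsub>G\<^esub> fst p, snd p))"

lemma perm_act_add [simp]: "perm_act G g (x + y) = perm_act G g x + perm_act G g y"
  and perm_act_diff [simp]: "perm_act G g (x - y) = perm_act G g x - perm_act G g y"
  and perm_act_0 [simp]: "perm_act G g 0 = 0"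
  and perm_act_of [simp]: "perm_act G g (frag_of (h, j)) = frag_of (g \<otimes>\<^bsub>G\<^esub> h, j)"
  by (simp_all add: perm_act_def frag_extend_add frag_extend_diff)

definition free_chains :: "('g, 'm) monoid_scheme \<Rightarrow> 'x set \<Rightarrow> ('g \<times> 'x \<Rightarrow>\<^sub>0 int) set" where
  "free_chains G J = {c. Poly_Mapping.keys c \<subseteq> carrier G \<times> J}"

lemma free_chains_addsub: "addsub (free_chains G J)"
  using keys_add by (fastforce simp: addsub_def free_chains_def)

lemma frag_of_in_free_chains [simp]: "frag_of (g, j) \<in> free_chains G J \<longleftrightarrow> g \<in> carrier G \<and> j \<in> J"
  by (simp add: free_chains_def)

lemma free_chains_induct [consumes 1, case_names zero one diff]:
  assumes "c \<in> free_chains G J" "P 0" "\<And>g j. g \<in> carrier G \<Longrightarrow> j \<in> J \<Longrightarrow> P (frag_of (g, j))"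
    "\<And>x y. x \<in> free_chains G J \<Longrightarrow> y \<in> free_chains G J \<Longrightarrow> P x \<Longrightarrow> P y \<Longrightarrow> P (x - y)"
  shows "P c"
proof -
  have "Poly_Mapping.keys c \<subseteq> carrier G \<times> J" using assms(1) by (simp add: free_chains_def)
  then show ?thesis
    by (rule free_Abelian_group_induct) (use assms(2-4) in \<open>auto simp: free_chains_def\<close>)
qed

lemma free_chains_gmod:
  assumes "group G"
  shows "gmod G (carrier G) (free_chains G J) (perm_act G)"
proof -
  interpret G: group G by fact
  show ?thesis
    unfolding gmod_def
  proof (intro conjI ballI free_chains_addsub)
    show "perm_act G g ` free_chains G J \<subseteq> free_chains G J" if "g \<in> carrier G" for g
    proof (rule image_subsetI)
      fix c assume "c \<in> free_chains G J"
      then show "perm_act G g c \<in> free_chains G J"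
        by (induction rule: free_chains_induct)
          (use that in \<open>auto intro: addsubD[OF free_chains_addsub]\<close>)
    qed
    show "addmap (free_chains G J) (perm_act G g)" for g by (simp add: addmap_def)
  next
    fix c assume "c \<in> free_chains G J"
    then show "perm_act G \<one>\<^bsub>G\<^esub> c = c" by (induction rule: free_chains_induct) auto
  next
    fix g h c assume g: "g \<in> carrier G" and h: "h \<in> carrier G" and "c \<in> free_chains G J"
    from this(3) show "perm_act G (g \<otimes>\<^bsub>G\<^esub> h) c = perm_act G g (perm_act G h c)"
      by (induction rule: free_chains_induct) (use g h in \<open>auto simp: G.m_assoc\<close>)
  qed
qed

lemma lookup_perm_act:
  assumes "group G" "c \<in> free_chains G J" "g \<in> carrier G"
  shows "poly_mapping.lookup (perm_act G (inv\<^bsub>G\<^esub> g) c) (\<one>\<^bsub>G\<^esub>, j) = poly_mapping.lookup c (g, j)"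
proof -
  interpret G: group G by fact
  show ?thesis
    using assms(2)
  proof (induction rule: free_chains_induct)
    case (one h k)
    have "inv\<^bsub>G\<^esub> g \<otimes>\<^bsub>G\<^esub> h = \<one>\<^bsub>G\<^esub> \<longleftrightarrow> g = h"
      using one assms(3) by (metis G.inv_closed G.inv_equality G.inv_inv G.l_inv)
    then show ?case by auto
  qed (simp_all add: lookup_minus)
qed

text \<open>
  For a direct summand of a free module, the images of the free generators and the coefficients at
  them form a dual basis.
\<close>

lemma free_summand_dual_basis:
  assumes "group G" and M: "M \<subseteq> free_chains G J"
    and e: "ghom (carrier G) (free_chains G J) (perm_act G) M (perm_act G) e" "\<And>x. x \<in> M \<Longrightarrow> e x = x"
  shows "dual_basis G (carrier G) M (perm_act G) J (\<lambda>j. e (frag_of (\<one>\<^bsub>G\<^esub>, j))) (\<lambda>j x. poly_mapping.lookup x (\<one>\<^bsub>G\<^esub>, j))"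
proof -
  interpret G: group G by fact
  note eD = ghomD[OF e(1)]
  have ds: "dsupp G (carrier G) (perm_act G) J (\<lambda>j x. poly_mapping.lookup x (\<one>\<^bsub>G\<^esub>, j)) x = Poly_Mapping.keys x"
    if x: "x \<in> M" for x
  proof -
    have xF: "x \<in> free_chains G J" using x M by blast
    then have "Poly_Mapping.keys x \<subseteq> carrier G \<times> J" by (simp add: free_chains_def)
    then show ?thesis
      using lookup_perm_act[OF assms(1) xF] by (auto simp: dsupp_def in_keys_iff)
  qed
  show ?thesis
    unfolding dual_basis_def
  proof (intro conjI ballI)
    show "e (frag_of (\<one>\<^bsub>G\<^esub>, j)) \<in> M" if "j \<in> J" for j using that by (intro eD(1)) simp
    show "addmap M (\<lambda>x. poly_mapping.lookup x (\<one>\<^bsub>G\<^esub>, j))" for j by (simp add: addmap_def lookup_add)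
    fix x assume x: "x \<in> M"
    have xF: "x \<in> free_chains G J" using x M by blast
    then have kx: "Poly_Mapping.keys x \<subseteq> carrier G \<times> J" by (simp add: free_chains_def)
    show "finite (dsupp G (carrier G) (perm_act G) J (\<lambda>j x. poly_mapping.lookup x (\<one>\<^bsub>G\<^esub>, j)) x)"
      unfolding ds[OF x] by simp
    have "x = e x" using e(2)[OF x] by simp
    also have "\<dots> = e (\<Sum>p\<in>Poly_Mapping.keys x. iscale (poly_mapping.lookup x p) (frag_of p))"
      using frag_expansion[of x] by (simp add: frag_extend_def)
    also have "\<dots> = (\<Sum>p\<in>Poly_Mapping.keys x. e (iscale (poly_mapping.lookup x p) (frag_of p)))"
      by (rule addmap_sum[OF eD(2) free_chains_addsub])
        (use kx in \<open>auto intro!: addsub_iscale[OF free_chains_addsub] simp del: iscale_frag\<close>)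
    also have "\<dots> = (\<Sum>(g, j)\<in>Poly_Mapping.keys x. iscale (poly_mapping.lookup (perm_act G (inv\<^bsub>G\<^esub> g) x) (\<one>\<^bsub>G\<^esub>, j))
          (perm_act G g (e (frag_of (\<one>\<^bsub>G\<^esub>, j)))))"
    proof (rule sum.cong[OF HOL.refl])
      fix p assume "p \<in> Poly_Mapping.keys x"
      then obtain g j where p: "p = (g, j)" "g \<in> carrier G" "j \<in> J" using kx by auto
      have "e (frag_of (g, j)) = perm_act G g (e (frag_of (\<one>\<^bsub>G\<^esub>, j)))"
        using eD(3)[of g "frag_of (\<one>\<^bsub>G\<^esub>, j)"] p by simp
      moreover have "e (iscale k (frag_of (g, j))) = iscale k (e (frag_of (g, j)))" for k
        by (rule addmap_iscale[OF eD(2) free_chains_addsub]) (use p in simp)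
      ultimately show "e (iscale (poly_mapping.lookup x p) (frag_of p)) =
         (case p of (g, j) \<Rightarrow> iscale (poly_mapping.lookup (perm_act G (inv\<^bsub>G\<^esub> g) x) (\<one>\<^bsub>G\<^esub>, j))
          (perm_act G g (e (frag_of (\<one>\<^bsub>G\<^esub>, j)))))"
        using lookup_perm_act[OF assms(1) xF p(2)] p(1) by (simp del: iscale_frag)
    qed
    finally show "x = (\<Sum>(g, j)\<in>dsupp G (carrier G) (perm_act G) J (\<lambda>j x. poly_mapping.lookup x (\<one>\<^bsub>G\<^esub>, j)) x.
         iscale (poly_mapping.lookup (perm_act G (inv\<^bsub>G\<^esub> g) x) (\<one>\<^bsub>G\<^esub>, j)) (perm_act G g (e (frag_of (\<one>\<^bsub>G\<^esub>, j)))))"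
      unfolding ds[OF x] .
  qed
qed

lemma free_gmod_simps:
  "carrier (free_gmod G I) = free_chains G I"
  "monoid.mult (free_gmod G I) = (+)" "one (free_gmod G I) = 0"
  "act (free_gmod G I) = perm_act G"
  by (auto simp: free_gmod_def permutation_gmod_def free_chains_def perm_act_def fun_eq_iff case_prod_beta)

text \<open>
  A retraction of a free module of finite rank onto P. The module P is a multiplicative record, and
  its image under i is an additive subgroup of formal sums.
\<close>

definition free_embedding :: "('g, 'm) monoid_scheme \<Rightarrow> ('g, 'b) gmod \<Rightarrow> 'x set \<Rightarrow> ('b \<Rightarrow> 'g \<times> 'x \<Rightarrow>\<^sub>0 int)
    \<Rightarrow> (('g \<times> 'x \<Rightarrow>\<^sub>0 int) \<Rightarrow> 'b) \<Rightarrow> bool" where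
  "free_embedding G P J i p \<longleftrightarrow> finite J \<and>
    (\<forall>x\<in>carrier P. \<forall>y\<in>carrier P. i (x \<otimes>\<^bsub>P\<^esub> y) = i x + i y) \<and>
    (\<forall>g\<in>carrier G. \<forall>x\<in>carrier P. i (act P g x) = perm_act G g (i x)) \<and>
    i ` carrier P \<subseteq> free_chains G J \<and> p ` free_chains G J \<subseteq> carrier P \<and>
    (\<forall>x\<in>free_chains G J. \<forall>y\<in>free_chains G J. p (x + y) = p x \<otimes>\<^bsub>P\<^esub> p y) \<and>
    (\<forall>g\<in>carrier G. \<forall>x\<in>free_chains G J. p (perm_act G g x) = act P g (p x)) \<and>
    (\<forall>x\<in>carrier P. p (i x) = x)"

text \<open>
  The images in a free module of finitely many generators involve finitely many basis elements, and
  these span a free module of finite rank that contains the image of P.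
\<close>

lemma fg_projective_embedding:
  fixes P :: "('g, 'b) gmod"
  assumes "group G" "fg_gmod G P" "projective_gmod G P"
  shows "\<exists>(J :: 'b set) i p. free_embedding G P J i p"
proof -
  interpret G: group G by fact
  interpret P: gmodule G P using assms(3) by (simp add: projective_gmod_def)
  obtain I :: "'b set" and i p where i: "i \<in> gmod_hom G P (free_gmod G I)" and p: "p \<in> gmod_hom G (free_gmod G I) P"
    and pi: "\<And>x. x \<in> carrier P \<Longrightarrow> p (i x) = x"
    using assms(3) by (auto simp: projective_gmod_def)
  have i1: "i x \<in> free_chains G I" if "x \<in> carrier P" for x
    using i that by (auto simp: gmod_hom_def hom_def free_gmod_simps)
  have i2: "i (x \<otimes>\<^bsub>P\<^esub> y) = i x + i y" if "x \<in> carrier P" "y \<in> carrier P" for x y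
    using i that by (auto simp: gmod_hom_def hom_def free_gmod_simps)
  have i3: "i (act P g x) = perm_act G g (i x)" if "g \<in> carrier G" "x \<in> carrier P" for g x
    using i that by (auto simp: gmod_hom_def free_gmod_simps)
  have p1: "p x \<in> carrier P" if "x \<in> free_chains G I" for x
    using p that by (auto simp: gmod_hom_def hom_def free_gmod_simps)
  have p2: "p (x + y) = p x \<otimes>\<^bsub>P\<^esub> p y" if "x \<in> free_chains G I" "y \<in> free_chains G I" for x y
    using p that by (auto simp: gmod_hom_def hom_def free_gmod_simps)
  have p3: "p (perm_act G g x) = act P g (p x)" if "g \<in> carrier G" "x \<in> free_chains G I" for g x
    using p that by (auto simp: gmod_hom_def free_gmod_simps)
  obtain S where S: "finite S" "S \<subseteq> carrier P"
    "generate P {act P g s | g s. g \<in> carrier G \<and> s \<in> S} = carrier P"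
    using assms(2) by (auto simp: fg_gmod_def)
  define J where "J = snd ` (\<Union>s\<in>S. Poly_Mapping.keys (i s))"
  have J: "finite J" using S(1) by (simp add: J_def)
  have ki: "Poly_Mapping.keys (i s) \<subseteq> carrier G \<times> I" if "s \<in> S" for s
    using i1[of s] S(2) that by (auto simp: free_chains_def)
  have JI: "J \<subseteq> I"
  proof
    fix j assume "j \<in> J"
    then obtain s q where "s \<in> S" "q \<in> Poly_Mapping.keys (i s)" "j = snd q" by (auto simp: J_def)
    then show "j \<in> I" using ki[of s] by auto
  qed
  have FJ: "free_chains G J \<subseteq> free_chains G I" using JI by (auto simp: free_chains_def)
  have iS: "i s \<in> free_chains G J" if "s \<in> S" for s
  proof -
    have "q \<in> carrier G \<times> J" if "q \<in> Poly_Mapping.keys (i s)" for q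
    proof -
      have "q \<in> carrier G \<times> I" using ki[OF \<open>s \<in> S\<close>] \<open>q \<in> Poly_Mapping.keys (i s)\<close> by blast
      moreover have "snd q \<in> J" unfolding J_def using \<open>q \<in> Poly_Mapping.keys (i s)\<close> \<open>s \<in> S\<close> by blast
      ultimately show ?thesis by (cases q) simp
    qed
    then show ?thesis by (auto simp: free_chains_def)
  qed
  have i0: "i \<one>\<^bsub>P\<^esub> = 0" using i2[of "\<one>\<^bsub>P\<^esub>" "\<one>\<^bsub>P\<^esub>"] by simp
  have iinv: "i (inv\<^bsub>P\<^esub> x) = - i x" if "x \<in> carrier P" for x
    using i2[of "inv\<^bsub>P\<^esub> x" x] that i0 by (simp add: eq_neg_iff_add_eq_0)
  have inJ: "i x \<in> free_chains G J" if "x \<in> generate P {act P g s | g s. g \<in> carrier G \<and> s \<in> S}" for x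
    using that
  proof (induction rule: generate.induct)
    case one
    then show ?case by (simp add: i0 addsubD(1)[OF free_chains_addsub])
  next
    case (incl x)
    then obtain g s where gs: "x = act P g s" "g \<in> carrier G" "s \<in> S" by blast
    then show ?case using gmodD(2)[OF free_chains_gmod[OF assms(1)] gs(2) iS[OF gs(3)]] i3[of g s] S(2) by auto
  next
    case (inv x)
    then obtain g s where gs: "x = act P g s" "g \<in> carrier G" "s \<in> S" by blast
    then have "x \<in> carrier P" using generate.incl[OF inv] S(3) by blast
    moreover have "i x = perm_act G g (i s)" unfolding gs(1) by (rule i3) (use gs S(2) in auto)
    moreover have "perm_act G g (i s) \<in> free_chains G J"
      by (rule gmodD(2)[OF free_chains_gmod[OF assms(1)] gs(2) iS[OF gs(3)]])
    ultimately show ?case using iinv[of x] addsubD(3)[OF free_chains_addsub, of "i x"] by simp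
  next
    case (eng x y)
    then show ?case using i2[of x y] S(3) addsubD(2)[OF free_chains_addsub] by simp
  qed
  have iJ: "i ` carrier P \<subseteq> free_chains G J" using inJ S(3) by blast
  have pJ: "p ` free_chains G J \<subseteq> carrier P" using p1 FJ by blast
  have "free_embedding G P J i p"
    unfolding free_embedding_def
  proof (intro conjI ballI J iJ pJ)
    show "i (x \<otimes>\<^bsub>P\<^esub> y) = i x + i y" if "x \<in> carrier P" "y \<in> carrier P" for x y by (rule i2[OF that])
    show "i (act P g x) = perm_act G g (i x)" if "g \<in> carrier G" "x \<in> carrier P" for g x by (rule i3[OF that])
    show "p (x + y) = p x \<otimes>\<^bsub>P\<^esub> p y" if "x \<in> free_chains G J" "y \<in> free_chains G J" for x y
      by (rule p2) (use that FJ in auto)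
    show "p (perm_act G g x) = act P g (p x)" if "g \<in> carrier G" "x \<in> free_chains G J" for g x
      by (rule p3) (use that FJ in auto)
    show "p (i x) = x" if "x \<in> carrier P" for x by (rule pi[OF that])
  qed
  then show ?thesis by blast
qed

text \<open>
  The terms of a resolution of finite type are carried along their embeddings to additive
  subgroups of free modules.
\<close>

lemma type_FP_resolution:
  fixes G :: "('g, 'm) monoid_scheme"
  assumes "type_FP G"
  obtains M :: "nat \<Rightarrow> ('g \<times> ('g \<times> nat \<Rightarrow>\<^sub>0 int) \<Rightarrow>\<^sub>0 int) set" and d \<epsilon> J b \<kappa> N
  where "resolution G (carrier G) (\<lambda>_. 1) M (\<lambda>_. perm_act G) d \<epsilon>"
    "\<forall>i. finite (J i) \<and> dual_basis G (carrier G) (M i) (perm_act G) (J i :: ('g \<times> nat \<Rightarrow>\<^sub>0 int) set) (b i) (\<kappa> i)"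
    "\<forall>i>N. M i = {0}"
proof -
  have "group G" using assms by (simp add: type_FP_def)
  interpret G: group G by fact
  let ?T = "trivial_int_gmod :: ('g, int) gmod"
  obtain P :: "nat \<Rightarrow> ('g, 'g \<times> nat \<Rightarrow>\<^sub>0 int) gmod" and d \<epsilon> N where
    P: "\<forall>i. fg_gmod G (P i) \<and> projective_gmod G (P i)"
    and N: "\<forall>i>N. carrier (P i) = {\<one>\<^bsub>P i\<^esub>}"
    and d: "\<forall>i. d i \<in> gmod_hom G (P (Suc i)) (P i)"
    and \<epsilon>: "\<epsilon> \<in> gmod_hom G (P 0) ?T" "\<epsilon> ` carrier (P 0) = carrier ?T"
    and ex0: "d 0 ` carrier (P 1) = kernel (P 0) ?T \<epsilon>"
    and ex: "\<forall>i. d (Suc i) ` carrier (P (Suc (Suc i))) = kernel (P (Suc i)) (P i) (d i)"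
    using assms unfolding type_FP_def by (elim conjE exE) (rule that)
  have "\<forall>k. \<exists>(J :: ('g \<times> nat \<Rightarrow>\<^sub>0 int) set) i p. free_embedding G (P k) J i p"
    by (intro allI fg_projective_embedding[OF \<open>group G\<close>]) (use P in auto)
  from choice[OF this] obtain J :: "nat \<Rightarrow> ('g \<times> nat \<Rightarrow>\<^sub>0 int) set" where "\<forall>k. \<exists>i p. free_embedding G (P k) (J k) i p" ..
  from choice[OF this] obtain inc where "\<forall>k. \<exists>p. free_embedding G (P k) (J k) (inc k) p" ..
  from choice[OF this] obtain p where E: "\<forall>k. free_embedding G (P k) (J k) (inc k) (p k)" ..
  have fJ: "finite (J k)"
    and i2: "x \<in> carrier (P k) \<Longrightarrow> y \<in> carrier (P k) \<Longrightarrow> inc k (x \<otimes>\<^bsub>P k\<^esub> y) = inc k x + inc k y"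
    and i3: "g \<in> carrier G \<Longrightarrow> x \<in> carrier (P k) \<Longrightarrow> inc k (act (P k) g x) = perm_act G g (inc k x)"
    and i1: "x \<in> carrier (P k) \<Longrightarrow> inc k x \<in> free_chains G (J k)"
    and p1: "u \<in> free_chains G (J k) \<Longrightarrow> p k u \<in> carrier (P k)"
    and p2: "u \<in> free_chains G (J k) \<Longrightarrow> v \<in> free_chains G (J k) \<Longrightarrow> p k (u + v) = p k u \<otimes>\<^bsub>P k\<^esub> p k v"
    and p3: "g \<in> carrier G \<Longrightarrow> u \<in> free_chains G (J k) \<Longrightarrow> p k (perm_act G g u) = act (P k) g (p k u)"
    and pi: "x \<in> carrier (P k) \<Longrightarrow> p k (inc k x) = x" for k x y u v g
    using E[rule_format, of k] by (simp_all add: free_embedding_def image_subset_iff)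
  have gP: "gmodule G (P k)" for k using P by (simp add: projective_gmod_def)
  have grp: "group (P k)" for k using gP[of k] by (simp add: gmodule_def comm_group_def)
  define M where "M k = inc k ` carrier (P k)" for k
  define dd where "dd k y = inc k (d k (p (Suc k) y))" for k y
  define ee where "ee y = \<epsilon> (p 0 y)" for y
  have i0: "inc k \<one>\<^bsub>P k\<^esub> = 0" for k
  proof -
    interpret Pk: group "P k" by (rule grp)
    show ?thesis using i2[of "\<one>\<^bsub>P k\<^esub>" k "\<one>\<^bsub>P k\<^esub>"] by simp
  qed
  have iz: "inc k x = 0 \<longleftrightarrow> x = \<one>\<^bsub>P k\<^esub>" if "x \<in> carrier (P k)" for k x
    using pi[OF that] pi[of "\<one>\<^bsub>P k\<^esub>" k] i0[of k] group.is_monoid[OF grp[of k]] monoid.one_closed by metis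
  have Msub: "M k \<subseteq> free_chains G (J k)" for k using i1 by (auto simp: M_def)
  have gM: "gmod G (carrier G) (M k) (perm_act G)" for k
  proof -
    interpret Pk: group "P k" by (rule grp)
    interpret Q: gmodule G "P k" by (rule gP)
    have cl: "act (P k) g x \<in> carrier (P k)" if "g \<in> carrier G" "x \<in> carrier (P k)" for g x
      using Q.act_hom[OF that(1)] that(2) by (auto simp: hom_def)
    have neg: "- inc k x \<in> M k" if "x \<in> carrier (P k)" for x
    proof -
      have "inc k (inv\<^bsub>P k\<^esub> x) + inc k x = 0" using i2[of "inv\<^bsub>P k\<^esub> x" k x] that i0 by simp
      then have "- inc k x = inc k (inv\<^bsub>P k\<^esub> x)" by (metis eq_neg_iff_add_eq_0)
      then show ?thesis using that by (simp add: M_def)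
    qed
    have add: "inc k x + inc k y \<in> M k" if "x \<in> carrier (P k)" "y \<in> carrier (P k)" for x y
      using that by (simp add: i2[symmetric] M_def)
    have "0 \<in> M k" using i0[of k] by (auto simp: M_def intro!: image_eqI[of _ _ "\<one>\<^bsub>P k\<^esub>"])
    then have "addsub (M k)" using neg add by (auto simp: addsub_def M_def)
    moreover have "perm_act G g ` M k \<subseteq> M k" if "g \<in> carrier G" for g
      using that cl by (auto simp: M_def i3[symmetric])
    moreover note F = gmodD[OF free_chains_gmod[OF \<open>group G\<close>, of "J k"]]
    ultimately show ?thesis
      unfolding gmod_def using F(4,5) Msub[of k] by (auto simp: addmap_def)
  qed
  have dcl: "d k x \<in> carrier (P k)" if "x \<in> carrier (P (Suc k))" for k x
    using d that by (auto simp: gmod_hom_def hom_def)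
  have dd: "dd k (inc (Suc k) x) = inc k (d k x)" if "x \<in> carrier (P (Suc k))" for k x
    by (simp add: dd_def pi[OF that])
  have ee: "ee (inc 0 x) = \<epsilon> x" if "x \<in> carrier (P 0)" for x by (simp add: ee_def pi[OF that])
  have mc: "x \<otimes>\<^bsub>P k\<^esub> y \<in> carrier (P k)" if "x \<in> carrier (P k)" "y \<in> carrier (P k)" for k x y
    using that group.is_monoid[OF grp[of k]] by (simp add: monoid.m_closed)
  have ac: "act (P k) g x \<in> carrier (P k)" if "g \<in> carrier G" "x \<in> carrier (P k)" for k g x
    using gmodule.act_hom[OF gP[of k] that(1)] that(2) by (auto simp: hom_def)
  have hd: "ghom (carrier G) (M (Suc k)) (perm_act G) (M k) (perm_act G) (dd k)" for k
    unfolding ghom_def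
  proof (intro conjI ballI)
    show "dd k ` M (Suc k) \<subseteq> M k" using dcl by (auto simp: M_def dd)
    have dm: "d k (x \<otimes>\<^bsub>P (Suc k)\<^esub> y) = d k x \<otimes>\<^bsub>P k\<^esub> d k y" if "x \<in> carrier (P (Suc k))" "y \<in> carrier (P (Suc k))" for x y
      using d that by (auto simp: gmod_hom_def hom_def)
    have da: "d k (act (P (Suc k)) g x) = act (P k) g (d k x)" if "x \<in> carrier (P (Suc k))" "g \<in> carrier G" for x g
      using d that by (auto simp: gmod_hom_def)
    show "addmap (M (Suc k)) (dd k)"
      unfolding addmap_def
    proof (intro ballI)
      fix a b assume "a \<in> M (Suc k)" "b \<in> M (Suc k)"
      then obtain x y where xy: "x \<in> carrier (P (Suc k))" "a = inc (Suc k) x" "y \<in> carrier (P (Suc k))" "b = inc (Suc k) y"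
        by (auto simp: M_def)
      then show "dd k (a + b) = dd k a + dd k b"
        by (simp add: i2[symmetric] dd mc dm dcl)
    qed
    fix g a assume g: "g \<in> carrier G" and "a \<in> M (Suc k)"
    then obtain x where x: "x \<in> carrier (P (Suc k))" "a = inc (Suc k) x" by (auto simp: M_def)
    show "dd k (perm_act G g a) = perm_act G g (dd k a)"
      using x g by (simp add: i3[symmetric] dd ac da dcl)
  qed
  have he: "ghom (carrier G) (M 0) (perm_act G) UNIV (\<lambda>g k. 1 * k) ee"
    unfolding ghom_def
  proof (intro conjI ballI)
    have em: "\<epsilon> (x \<otimes>\<^bsub>P 0\<^esub> y) = \<epsilon> x + \<epsilon> y" if "x \<in> carrier (P 0)" "y \<in> carrier (P 0)" for x y
      using \<epsilon>(1) that by (auto simp: gmod_hom_def hom_def trivial_int_gmod_def)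
    have ea: "\<epsilon> (act (P 0) g x) = \<epsilon> x" if "x \<in> carrier (P 0)" "g \<in> carrier G" for x g
      using \<epsilon>(1) that by (auto simp: gmod_hom_def trivial_int_gmod_def)
    show "addmap (M 0) ee"
      unfolding addmap_def
    proof (intro ballI)
      fix a b assume "a \<in> M 0" "b \<in> M 0"
      then obtain x y where xy: "x \<in> carrier (P 0)" "a = inc 0 x" "y \<in> carrier (P 0)" "b = inc 0 y"
        by (auto simp: M_def)
      then show "ee (a + b) = ee a + ee b" by (simp add: i2[symmetric] ee mc em)
    qed
    fix g a assume g: "g \<in> carrier G" and "a \<in> M 0"
    then obtain x where x: "x \<in> carrier (P 0)" "a = inc 0 x" by (auto simp: M_def)
    show "ee (perm_act G g a) = 1 * ee a" using x g by (simp add: i3[symmetric] ee ac ea)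
  qed simp
  have res: "resolution G (carrier G) (\<lambda>_. 1) M (\<lambda>_. perm_act G) dd ee"
    unfolding resolution_def
  proof (intro conjI allI gM hd he)
    have "ee ` M 0 = \<epsilon> ` carrier (P 0)" by (simp add: M_def image_image ee)
    then show "ee ` M 0 = UNIV" using \<epsilon>(2) by (simp add: trivial_int_gmod_def)
    have "dd 0 ` M (Suc 0) = inc 0 ` (d 0 ` carrier (P (Suc 0)))" by (simp add: M_def image_image dd)
    also have "\<dots> = {x \<in> M 0. ee x = 0}"
      using ex0 by (auto simp: kernel_def trivial_int_gmod_def M_def ee)
    finally show "dd 0 ` M (Suc 0) = {x \<in> M 0. ee x = 0}" .
    fix k
    have "dd (Suc k) ` M (Suc (Suc k)) = inc (Suc k) ` (d (Suc k) ` carrier (P (Suc (Suc k))))"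
      by (simp add: M_def image_image dd)
    also have "\<dots> = inc (Suc k) ` {x \<in> carrier (P (Suc k)). d k x = \<one>\<^bsub>P k\<^esub>}" using ex by (simp add: kernel_def)
    also have "\<dots> = {x \<in> M (Suc k). dd k x = 0}"
      using iz dcl by (auto simp: M_def dd i0)
    finally show "dd (Suc k) ` M (Suc (Suc k)) = {x \<in> M (Suc k). dd k x = 0}" .
  qed
  have db: "dual_basis G (carrier G) (M k) (perm_act G) (J k) (\<lambda>j. inc k (p k (frag_of (\<one>\<^bsub>G\<^esub>, j)))) (\<lambda>j x. poly_mapping.lookup x (\<one>\<^bsub>G\<^esub>, j))" for k
  proof (rule free_summand_dual_basis[OF \<open>group G\<close> Msub, where e="\<lambda>y. inc k (p k y)"])
    show "ghom (carrier G) (free_chains G (J k)) (perm_act G) (M k) (perm_act G) (\<lambda>y. inc k (p k y))"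
      using p1 by (auto simp: ghom_def M_def addmap_def p2 i2 p3 i3)
    show "inc k (p k x) = x" if "x \<in> M k" for x using that by (auto simp: M_def pi)
  qed
  have bd: "\<forall>i>N. M i = {0}" using N i0 by (simp add: M_def)
  have fdb: "\<forall>k. finite (J k) \<and> dual_basis G (carrier G) (M k) (perm_act G) (J k)
      (\<lambda>j. inc k (p k (frag_of (\<one>\<^bsub>G\<^esub>, j)))) (\<lambda>j x. poly_mapping.lookup x (\<one>\<^bsub>G\<^esub>, j))"
    using fJ db by blast
  show thesis by (rule that[OF res fdb bd])
qed

section \<open>The bar resolution\<close>

text \<open>
  The differential of the bar resolution. A generator is a pair (g, l), which stands for the
  translate by g of the bar symbol l.
\<close>

definition bar_map :: "('g, 'm) monoid_scheme \<Rightarrow> nat \<Rightarrow> ('g \<times> 'g list \<Rightarrow>\<^sub>0 int) \<Rightarrow> 'g \<times> 'g list \<Rightarrow>\<^sub>0 int" where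
  "bar_map G i = frag_extend (\<lambda>(g, l). frag_of (g \<otimes>\<^bsub>G\<^esub> hd l, tl l) +
     (\<Sum>k<i. frag_cmul ((- 1) ^ Suc k) (frag_of (g, merge_at G k l))) +
     frag_cmul ((- 1) ^ Suc i) (frag_of (g, butlast l)))"

definition bar_chains :: "('g, 'm) monoid_scheme \<Rightarrow> nat \<Rightarrow> ('g \<times> 'g list \<Rightarrow>\<^sub>0 int) set" where
  "bar_chains G i = free_chains G (tuples G i)"

text \<open>The contraction that makes the bar resolution exact; it is additive but not equivariant.\<close>

definition bar_cone :: "('g, 'm) monoid_scheme \<Rightarrow> ('g \<times> 'g list \<Rightarrow>\<^sub>0 int) \<Rightarrow> 'g \<times> 'g list \<Rightarrow>\<^sub>0 int" where
  "bar_cone G = frag_extend (\<lambda>(g, l). frag_of (\<one>\<^bsub>G\<^esub>, g # l))"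

text \<open>The sum of the coefficients, obtained as a formal sum over a one-point set.\<close>

definition augmentation :: "('a \<Rightarrow>\<^sub>0 int) \<Rightarrow> int" where
  "augmentation x = poly_mapping.lookup (frag_extend (\<lambda>_. frag_of ()) x) ()"

lemma augmentation_simps [simp]:
  "augmentation (x + y) = augmentation x + augmentation y" "augmentation (x - y) = augmentation x - augmentation y"
  "augmentation 0 = 0" "augmentation (frag_of a) = 1" "augmentation (frag_cmul c x) = c * augmentation x"
  "augmentation (- x) = - augmentation x"
  by (simp_all add: augmentation_def frag_extend_add frag_extend_diff frag_extend_cmul frag_extend_minus lookup_add lookup_minus)

lemma augmentation_sum: "augmentation (sum f I) = (\<Sum>i\<in>I. augmentation (f i))"
  by (induction I rule: infinite_finite_induct) auto

lemma bar_map_simps [simp]: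
  "bar_map G i (x + y) = bar_map G i x + bar_map G i y" "bar_map G i (x - y) = bar_map G i x - bar_map G i y"
  "bar_map G i 0 = 0" "bar_map G i (frag_cmul c x) = frag_cmul c (bar_map G i x)"
  by (simp_all add: bar_map_def frag_extend_add frag_extend_diff frag_extend_cmul)

lemma bar_cone_simps [simp]:
  "bar_cone G (x + y) = bar_cone G x + bar_cone G y" "bar_cone G (x - y) = bar_cone G x - bar_cone G y"
  "bar_cone G 0 = 0" "bar_cone G (frag_cmul c x) = frag_cmul c (bar_cone G x)"
  "bar_cone G (frag_of (g, l)) = frag_of (\<one>\<^bsub>G\<^esub>, g # l)"
  by (simp_all add: bar_cone_def frag_extend_add frag_extend_diff frag_extend_cmul)

lemma bar_cone_sum: "bar_cone G (sum f I) = (\<Sum>i\<in>I. bar_cone G (f i))"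
  by (induction I rule: infinite_finite_induct) auto

lemma bar_map_of: "bar_map G i (frag_of (g, l)) = frag_of (g \<otimes>\<^bsub>G\<^esub> hd l, tl l) +
     (\<Sum>k<i. frag_cmul ((- 1) ^ Suc k) (frag_of (g, merge_at G k l))) +
     frag_cmul ((- 1) ^ Suc i) (frag_of (g, butlast l))"
  by (simp add: bar_map_def)

lemma perm_act_cmul [simp]: "perm_act G g (frag_cmul c x) = frag_cmul c (perm_act G g x)"
  by (simp add: perm_act_def frag_extend_cmul)

lemma perm_act_sum: "perm_act G g (sum f I) = (\<Sum>i\<in>I. perm_act G g (f i))"
  by (induction I rule: infinite_finite_induct) auto

lemma tuples_faces:
  assumes "group G" "l \<in> tuples G (Suc i)"
  shows "hd l \<in> carrier G" "tl l \<in> tuples G i" "butlast l \<in> tuples G i" "l \<noteq> []"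
    "k < i \<Longrightarrow> merge_at G k l \<in> tuples G i"
proof -
  interpret G: group G by fact
  have l: "set l \<subseteq> carrier G" "length l = Suc i" using assms(2) by (auto simp: tuples_def)
  then show ne: "l \<noteq> []" by auto
  show "hd l \<in> carrier G" using hd_in_set[OF ne] l by blast
  show "tl l \<in> tuples G i" using l by (auto simp: tuples_def dest: list.set_sel(2)[OF ne])
  show "butlast l \<in> tuples G i" using l by (auto simp: tuples_def dest: in_set_butlastD)
  assume k: "k < i"
  have "l ! k \<in> carrier G" "l ! Suc k \<in> carrier G" using k l by (auto simp: subset_iff)
  moreover have "set (take k l) \<subseteq> carrier G" "set (drop (Suc (Suc k)) l) \<subseteq> carrier G"
    using l set_take_subset set_drop_subset by (meson subset_trans)+
  ultimately show "merge_at G k l \<in> tuples G i"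
    using k l by (auto simp: tuples_def merge_at_def)
qed

lemma bar_induct [consumes 1, case_names zero one diff]:
  assumes "c \<in> bar_chains G i" "P 0" "\<And>g l. g \<in> carrier G \<Longrightarrow> l \<in> tuples G i \<Longrightarrow> P (frag_of (g, l))"
    "\<And>x y. x \<in> bar_chains G i \<Longrightarrow> y \<in> bar_chains G i \<Longrightarrow> P x \<Longrightarrow> P y \<Longrightarrow> P (x - y)"
  shows "P c"
  using assms free_chains_induct[of c G "tuples G i" P] unfolding bar_chains_def by blast

lemma bar_chains_addsub: "addsub (bar_chains G i)"
  unfolding bar_chains_def by (rule free_chains_addsub)

lemma bar_chains_of [simp]: "frag_of (g, l) \<in> bar_chains G i \<longleftrightarrow> g \<in> carrier G \<and> l \<in> tuples G i"
  by (simp add: bar_chains_def)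

lemma bar_chains_cmul: "x \<in> bar_chains G i \<Longrightarrow> frag_cmul c x \<in> bar_chains G i"
  using addsub_iscale[OF bar_chains_addsub, of x G i c] by simp

lemma bar_map_closed:
  assumes "group G" "x \<in> bar_chains G (Suc i)"
  shows "bar_map G i x \<in> bar_chains G i"
  using assms(2)
proof (induction rule: bar_induct)
  case (one g l)
  interpret G: group G by fact
  note t = tuples_faces[OF assms(1) one(2)]
  show ?case
    unfolding bar_map_of
    by (intro addsubD(2)[OF bar_chains_addsub] addsub_sum[OF bar_chains_addsub] bar_chains_cmul) (use one t in auto)
qed (auto intro: addsubD[OF bar_chains_addsub])

lemma bar_cone_closed:
  assumes "group G" "x \<in> bar_chains G i"
  shows "bar_cone G x \<in> bar_chains G (Suc i)"
proof -
  interpret G: group G by fact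
  show ?thesis using assms(2)
    by (induction rule: bar_induct) (auto intro: addsubD[OF bar_chains_addsub] simp: tuples_def)
qed

lemma bar_map_act:
  assumes "group G" "x \<in> bar_chains G (Suc i)" "h \<in> carrier G"
  shows "bar_map G i (perm_act G h x) = perm_act G h (bar_map G i x)"
  using assms(2)
proof (induction rule: bar_induct)
  case (one g l)
  interpret G: group G by fact
  note t = tuples_faces[OF assms(1) one(2)]
  show ?case using one(1) t(1) assms(3) by (simp add: bar_map_of perm_act_sum G.m_assoc)
qed simp_all

lemma bar_cone_contraction:
  assumes "group G" "x \<in> bar_chains G (Suc i)"
  shows "bar_map G (Suc i) (bar_cone G x) = x - bar_cone G (bar_map G i x)"
  using assms(2)
proof (induction rule: bar_induct)
  case (one g l)
  interpret G: group G by fact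
  note t = tuples_faces[OF assms(1) one(2)]
  have m0: "merge_at G 0 (g # l) = (g \<otimes>\<^bsub>G\<^esub> hd l) # tl l"
    using t(4) by (cases l) (auto simp: merge_at_def)
  have mS: "merge_at G (Suc k) (g # l) = g # merge_at G k l" for k by (simp add: merge_at_def)
  have "(\<Sum>k<Suc i. frag_cmul ((- 1) ^ Suc k) (frag_of (\<one>\<^bsub>G\<^esub>, merge_at G k (g # l)))) =
     - frag_of (\<one>\<^bsub>G\<^esub>, (g \<otimes>\<^bsub>G\<^esub> hd l) # tl l) - (\<Sum>k<i. frag_cmul ((- 1) ^ Suc k) (frag_of (\<one>\<^bsub>G\<^esub>, g # merge_at G k l)))"
    unfolding sum.lessThan_Suc_shift m0 mS by (simp add: sum_negf[symmetric])
  then show ?case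
    using one(1) t(4) by (simp add: bar_map_of bar_cone_sum)
qed simp_all

lemma bar_cone_contraction_0:
  assumes "group G" "x \<in> bar_chains G 0"
  shows "bar_map G 0 (bar_cone G x) = x - frag_cmul (augmentation x) (frag_of (\<one>\<^bsub>G\<^esub>, []))"
  using assms(2)
proof (induction rule: bar_induct)
  case (one g l)
  interpret G: group G by fact
  have "l = []" using one(2) by (simp add: tuples_def)
  then show ?case using one(1) by (simp add: bar_map_of)
qed (simp_all add: frag_cmul_diff_distrib)

lemma augmentation_bar_map: "augmentation (bar_map G 0 x) = 0"
proof (induction x rule: frag_induction[OF subset_UNIV])
  case (2 p)
  then show ?case by (cases p) (simp add: bar_map_of)
qed simp_all

text \<open>
  The contraction gives this by induction on the degree: the square of the differential is
  equivariant and vanishes on the image of the contraction, which contains the bar symbols.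
\<close>

lemma bar_map_bar_map:
  assumes "group G" "x \<in> bar_chains G (Suc (Suc i))"
  shows "bar_map G i (bar_map G (Suc i) x) = 0"
  using assms(2)
proof (induction i arbitrary: x)
  case 0
  interpret G: group G by fact
  from 0 show ?case
  proof (induction rule: bar_induct)
    case (one g l)
    then obtain a l' where l: "l = a # l'" "a \<in> carrier G" "l' \<in> tuples G (Suc 0)" by (cases l) (auto simp: tuples_def)
    let ?y = "frag_of (a, l')"
    have y: "?y \<in> bar_chains G (Suc 0)" using l by simp
    have e: "frag_of (g, l) = perm_act G g (bar_cone G ?y)" using one(1) l by simp
    have c: "bar_cone G ?y \<in> bar_chains G (Suc (Suc 0))" by (rule bar_cone_closed[OF assms(1) y])
    have *: "bar_map G 0 (bar_map G (Suc 0) (bar_cone G ?y)) = 0"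
      unfolding bar_cone_contraction[OF assms(1) y]
      by (simp add: bar_cone_contraction_0[OF assms(1) bar_map_closed[OF assms(1) y]] augmentation_bar_map)
    show ?case
      unfolding e bar_map_act[OF assms(1) c one(1)] bar_map_act[OF assms(1) bar_map_closed[OF assms(1) c] one(1)] *
      by simp
  qed simp_all
next
  case (Suc i)
  interpret G: group G by fact
  from Suc(2) show ?case
  proof (induction rule: bar_induct)
    case (one g l)
    then obtain a l' where l: "l = a # l'" "a \<in> carrier G" "l' \<in> tuples G (Suc (Suc i))" by (cases l) (auto simp: tuples_def)
    let ?y = "frag_of (a, l')"
    have y: "?y \<in> bar_chains G (Suc (Suc i))" using l by simp
    have e: "frag_of (g, l) = perm_act G g (bar_cone G ?y)" using one(1) l by simp
    have c: "bar_cone G ?y \<in> bar_chains G (Suc (Suc (Suc i)))" by (rule bar_cone_closed[OF assms(1) y])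
    have *: "bar_map G (Suc i) (bar_map G (Suc (Suc i)) (bar_cone G ?y)) = 0"
      unfolding bar_cone_contraction[OF assms(1) y]
      by (simp add: bar_cone_contraction[OF assms(1) bar_map_closed[OF assms(1) y]] Suc(1)[OF y])
    show ?case
      unfolding e bar_map_act[OF assms(1) c one(1)] bar_map_act[OF assms(1) bar_map_closed[OF assms(1) c] one(1)] *
      by simp
  qed simp_all
qed

lemma augmentation_perm_act: "augmentation (perm_act G g x) = augmentation x"
proof (induction x rule: frag_induction[OF subset_UNIV])
  case (2 p)
  then show ?case by (cases p) simp
qed simp_all

lemma bar_resolution:
  assumes "group G"
  shows "resolution G (carrier G) (\<lambda>_. 1) (bar_chains G) (\<lambda>_. perm_act G) (bar_map G) augmentation"
proof -
  interpret G: group G by fact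
  show ?thesis
    unfolding resolution_def
  proof (intro conjI allI)
    show "gmod G (carrier G) (bar_chains G i) (perm_act G)" for i
      unfolding bar_chains_def by (rule free_chains_gmod[OF assms])
    show "ghom (carrier G) (bar_chains G (Suc i)) (perm_act G) (bar_chains G i) (perm_act G) (bar_map G i)" for i
      using bar_map_closed[OF assms] bar_map_act[OF assms] by (auto simp: ghom_def addmap_def)
    show "ghom (carrier G) (bar_chains G 0) (perm_act G) UNIV (\<lambda>g k. 1 * k) augmentation"
      by (simp add: ghom_def addmap_def augmentation_perm_act)
    show "augmentation ` bar_chains G 0 = UNIV"
    proof -
      have "k \<in> augmentation ` bar_chains G 0" for k
        by (rule image_eqI[of _ _ "frag_cmul k (frag_of (\<one>\<^bsub>G\<^esub>, []))"])
          (auto intro!: bar_chains_cmul simp: tuples_def)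
      then show ?thesis by blast
    qed
    show "bar_map G 0 ` bar_chains G (Suc 0) = {x \<in> bar_chains G 0. augmentation x = 0}"
    proof (intro equalityI subsetI)
      fix y assume "y \<in> {x \<in> bar_chains G 0. augmentation x = 0}"
      then have y: "y \<in> bar_chains G 0" "augmentation y = 0" by auto
      then have "y = bar_map G 0 (bar_cone G y)" using bar_cone_contraction_0[OF assms y(1)] by simp
      then show "y \<in> bar_map G 0 ` bar_chains G (Suc 0)" using bar_cone_closed[OF assms y(1)] by blast
    qed (use bar_map_closed[OF assms] augmentation_bar_map in auto)
    fix i
    show "bar_map G (Suc i) ` bar_chains G (Suc (Suc i)) = {x \<in> bar_chains G (Suc i). bar_map G i x = 0}"
    proof (intro equalityI subsetI)
      fix y assume "y \<in> {x \<in> bar_chains G (Suc i). bar_map G i x = 0}"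
      then have y: "y \<in> bar_chains G (Suc i)" "bar_map G i y = 0" by auto
      then have "y = bar_map G (Suc i) (bar_cone G y)" using bar_cone_contraction[OF assms y(1)] by simp
      then show "y \<in> bar_map G (Suc i) ` bar_chains G (Suc (Suc i))" using bar_cone_closed[OF assms y(1)] by blast
    qed (use bar_map_closed[OF assms] bar_map_bar_map[OF assms] in auto)
  qed
qed

lemma bar_dual_basis:
  assumes "group G"
  shows "dual_basis G (carrier G) (bar_chains G i) (perm_act G) (tuples G i)
     (\<lambda>l. frag_of (\<one>\<^bsub>G\<^esub>, l)) (\<lambda>l x. poly_mapping.lookup x (\<one>\<^bsub>G\<^esub>, l))"
  unfolding bar_chains_def
  using free_summand_dual_basis[OF assms subset_refl ghom_id[OF free_chains_gmod[OF assms]]] by simp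

section \<open>Inhomogeneous cochains with coefficients in the group ring\<close>

text \<open>The formal sum with given coefficients on A. It is meaningful only if the support is finite.\<close>

definition frag_of_fun :: "'a set \<Rightarrow> ('a \<Rightarrow> int) \<Rightarrow> 'a \<Rightarrow>\<^sub>0 int" where
  "frag_of_fun S u = (\<Sum>a\<in>{a \<in> S. u a \<noteq> 0}. frag_cmul (u a) (frag_of a))"

lemma lookup_frag_sum: "poly_mapping.lookup (sum f I) x = (\<Sum>i\<in>I. poly_mapping.lookup (f i) x)"
  by (induction I rule: infinite_finite_induct) (auto simp: lookup_add)

lemma lookup_frag_of_fun:
  assumes "finite {a \<in> S. u a \<noteq> 0}"
  shows "poly_mapping.lookup (frag_of_fun S u) x = (if x \<in> S then u x else 0)"
proof -
  have "poly_mapping.lookup (frag_of_fun S u) x = (\<Sum>a\<in>{a \<in> S. u a \<noteq> 0}. if a = x then u a else 0)"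
    unfolding frag_of_fun_def lookup_frag_sum by (intro sum.cong HOL.refl) auto
  also have "\<dots> = (if x \<in> S then u x else 0)" using assms by (simp add: sum.delta)
  finally show ?thesis .
qed

lemma keys_frag_of_fun:
  assumes "finite {a \<in> S. u a \<noteq> 0}"
  shows "Poly_Mapping.keys (frag_of_fun S u) \<subseteq> S"
proof
  fix x assume "x \<in> Poly_Mapping.keys (frag_of_fun S u)"
  then have "poly_mapping.lookup (frag_of_fun S u) x \<noteq> 0" by (simp add: in_keys_iff)
  then show "x \<in> S" by (simp add: lookup_frag_of_fun[OF assms] split: if_splits)
qed

lemma group_ring_simps:
  "carrier (group_ring_gmod G) = {c. Poly_Mapping.keys c \<subseteq> carrier G}"
  "monoid.mult (group_ring_gmod G) = (+)" "one (group_ring_gmod G) = 0"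
  "act (group_ring_gmod G) g = frag_extend (\<lambda>x. frag_of (g \<otimes>\<^bsub>G\<^esub> x))"
  by (auto simp: group_ring_gmod_def permutation_gmod_def)

lemma group_ring_comm_group: "comm_group (group_ring_gmod G)"
proof (rule comm_groupI)
  fix x y :: "'a \<Rightarrow>\<^sub>0 int"
  assume "x \<in> carrier (group_ring_gmod G)" "y \<in> carrier (group_ring_gmod G)"
  then show "x \<otimes>\<^bsub>group_ring_gmod G\<^esub> y \<in> carrier (group_ring_gmod G)"
    using keys_add[of x y] by (auto simp: group_ring_simps)
next
  fix x :: "'a \<Rightarrow>\<^sub>0 int"
  assume "x \<in> carrier (group_ring_gmod G)"
  then show "\<exists>y\<in>carrier (group_ring_gmod G). y \<otimes>\<^bsub>group_ring_gmod G\<^esub> x = \<one>\<^bsub>group_ring_gmod G\<^esub>"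
    by (intro bexI[of _ "- x"]) (auto simp: group_ring_simps)
qed (auto simp: group_ring_simps algebra_simps)

lemma group_ring_sign_pow:
  assumes "x \<in> carrier (group_ring_gmod G)"
  shows "x [^]\<^bsub>group_ring_gmod G\<^esub> ((- 1) ^ k :: int) = frag_cmul ((- 1) ^ k) x"
proof -
  interpret R: comm_group "group_ring_gmod G" by (rule group_ring_comm_group)
  have "inv\<^bsub>group_ring_gmod G\<^esub> x = - x"
    by (rule R.inv_equality) (use assms in \<open>auto simp: group_ring_simps\<close>)
  then show ?thesis
    using R.int_pow_neg[OF assms, of 1] assms by (cases "even k") auto
qed

lemma group_ring_finprod:
  assumes "\<And>i. i \<in> I \<Longrightarrow> f i \<in> carrier (group_ring_gmod G)" "finite I"
  shows "finprod (group_ring_gmod G) f I = sum f I"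
proof -
  interpret R: comm_group "group_ring_gmod G" by (rule group_ring_comm_group)
  show ?thesis using assms(2,1)
  proof (induction I rule: finite_induct)
    case empty
    then show ?case by (simp add: group_ring_simps)
  next
    case (insert i I)
    then show ?case by (subst R.finprod_insert) (auto simp: group_ring_simps)
  qed
qed

lemma lookup_left_translate:
  assumes "group G" "Poly_Mapping.keys y \<subseteq> carrier G" "h \<in> carrier G" "g \<in> carrier G"
  shows "poly_mapping.lookup (frag_extend (\<lambda>x. frag_of (h \<otimes>\<^bsub>G\<^esub> x)) y) g = poly_mapping.lookup y (inv\<^bsub>G\<^esub> h \<otimes>\<^bsub>G\<^esub> g)"
proof -
  interpret G: group G by fact
  show ?thesis using assms(2)
  proof (induction y rule: frag_induction)
    case (one x)
    have "g = h \<otimes>\<^bsub>G\<^esub> x \<longleftrightarrow> inv\<^bsub>G\<^esub> h \<otimes>\<^bsub>G\<^esub> g = x"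
      using one assms(3,4) by (metis G.inv_solve_left)
    then show ?case by auto
  qed (simp_all add: frag_extend_diff lookup_minus)
qed

text \<open>
  The dual of the bar resolution is the complex of cochains with coefficients in the group ring. The
  coefficient at g of the value on a tuple l is the value of the form at the translate of the bar
  symbol l by the inverse of g.
\<close>

definition bar_cochain :: "('g, 'm) monoid_scheme \<Rightarrow> nat \<Rightarrow> (('g \<times> 'g list \<Rightarrow>\<^sub>0 int) \<Rightarrow> int) \<Rightarrow> 'g list \<Rightarrow> 'g \<Rightarrow>\<^sub>0 int" where
  "bar_cochain G i \<phi> = (\<lambda>l\<in>tuples G i. frag_of_fun (carrier G) (\<lambda>g. \<phi> (frag_of (inv\<^bsub>G\<^esub> g, l))))"

abbreviation bar_dual where
  "bar_dual G i \<equiv> dual_mod (carrier G) (bar_chains G i) (perm_act G)"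


lemma bar_cochain_support:
  assumes "group G" "\<phi> \<in> bar_dual G i" "l \<in> tuples G i"
  shows "finite {g \<in> carrier G. \<phi> (frag_of (inv\<^bsub>G\<^esub> g, l)) \<noteq> 0}"
proof -
  interpret G: group G by fact
  have f: "finite {g \<in> carrier G. \<phi> (perm_act G g (frag_of (\<one>\<^bsub>G\<^esub>, l))) \<noteq> 0}"
    by (rule dual_modD(3)[OF assms(2)]) (use assms(3) in simp)
  have "{g \<in> carrier G. \<phi> (frag_of (inv\<^bsub>G\<^esub> g, l)) \<noteq> 0} \<subseteq>
      (\<lambda>g. inv\<^bsub>G\<^esub> g) ` {g \<in> carrier G. \<phi> (perm_act G g (frag_of (\<one>\<^bsub>G\<^esub>, l))) \<noteq> 0}"
  proof
    fix g assume g: "g \<in> {g \<in> carrier G. \<phi> (frag_of (inv\<^bsub>G\<^esub> g, l)) \<noteq> 0}"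
    then show "g \<in> (\<lambda>g. inv\<^bsub>G\<^esub> g) ` {g \<in> carrier G. \<phi> (perm_act G g (frag_of (\<one>\<^bsub>G\<^esub>, l))) \<noteq> 0}"
      by (intro image_eqI[of _ _ "inv\<^bsub>G\<^esub> g"]) auto
  qed
  then show ?thesis by (rule finite_subset) (rule finite_imageI[OF f])
qed

lemma lookup_bar_cochain:
  assumes "group G" "\<phi> \<in> bar_dual G i" "l \<in> tuples G i" "g \<in> carrier G"
  shows "poly_mapping.lookup (bar_cochain G i \<phi> l) g = \<phi> (frag_of (inv\<^bsub>G\<^esub> g, l))"
  using assms(3,4) lookup_frag_of_fun[OF bar_cochain_support[OF assms(1-3)]] by (simp add: bar_cochain_def)

lemma keys_bar_cochain:
  assumes "group G" "\<phi> \<in> bar_dual G i" "l \<in> tuples G i"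
  shows "Poly_Mapping.keys (bar_cochain G i \<phi> l) \<subseteq> carrier G"
  using assms(3) keys_frag_of_fun[OF bar_cochain_support[OF assms]] by (simp add: bar_cochain_def)

lemma frag_eqI:
  assumes "Poly_Mapping.keys x \<subseteq> S" "Poly_Mapping.keys y \<subseteq> S"
    "\<And>g. g \<in> S \<Longrightarrow> poly_mapping.lookup x g = poly_mapping.lookup y g"
  shows "x = y"
proof (rule poly_mapping_eqI)
  fix g
  show "poly_mapping.lookup x g = poly_mapping.lookup y g"
  proof (cases "g \<in> S")
    case False
    then have "g \<notin> Poly_Mapping.keys x" "g \<notin> Poly_Mapping.keys y" using assms(1,2) by blast+
    then show ?thesis by (simp only: in_keys_iff) simp
  qed (rule assms(3))
qed

lemma bar_cochain_carrier:
  assumes "group G" "\<phi> \<in> bar_dual G i"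
  shows "bar_cochain G i \<phi> \<in> carrier (cochain_group G (group_ring_gmod G) i)"
  using keys_bar_cochain[OF assms] by (auto simp: cochain_group_def group_ring_simps bar_cochain_def)

lemma bar_cochain_add:
  assumes "group G" "\<phi> \<in> bar_dual G i" "\<psi> \<in> bar_dual G i"
  shows "bar_cochain G i (\<phi> + \<psi>) = bar_cochain G i \<phi> \<otimes>\<^bsub>cochain_group G (group_ring_gmod G) i\<^esub> bar_cochain G i \<psi>"
proof -
  have s: "\<phi> + \<psi> \<in> bar_dual G i" by (rule addsubD(2)[OF dual_mod_addsub assms(2,3)])
  have "bar_cochain G i (\<phi> + \<psi>) l = bar_cochain G i \<phi> l + bar_cochain G i \<psi> l" if l: "l \<in> tuples G i" for l
  proof (rule frag_eqI[of _ "carrier G"])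
    show "Poly_Mapping.keys (bar_cochain G i (\<phi> + \<psi>) l) \<subseteq> carrier G" by (rule keys_bar_cochain[OF assms(1) s l])
    show "Poly_Mapping.keys (bar_cochain G i \<phi> l + bar_cochain G i \<psi> l) \<subseteq> carrier G"
      by (rule order_trans[OF keys_add Un_least[OF keys_bar_cochain[OF assms(1,2) l] keys_bar_cochain[OF assms(1,3) l]]])
  qed (simp add: lookup_add lookup_bar_cochain[OF assms(1) s l] lookup_bar_cochain[OF assms(1,2) l] lookup_bar_cochain[OF assms(1,3) l])
  then show ?thesis
    by (auto simp: cochain_group_def group_ring_simps fun_eq_iff restrict_def) (auto simp: bar_cochain_def)
qed

lemma bar_cochain_inj:
  assumes "group G" "\<phi> \<in> bar_dual G i" "\<psi> \<in> bar_dual G i" "bar_cochain G i \<phi> = bar_cochain G i \<psi>"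
  shows "\<phi> = \<psi>"
proof
  fix x
  interpret G: group G by fact
  show "\<phi> x = \<psi> x"
  proof (cases "x \<in> bar_chains G i")
    case True
    then show ?thesis
    proof (induction rule: bar_induct)
      case zero
      then show ?case using addmap_0[OF dual_modD(1)[OF assms(2)] bar_chains_addsub] addmap_0[OF dual_modD(1)[OF assms(3)] bar_chains_addsub] by simp
    next
      case (one g l)
      then show ?case
        using lookup_bar_cochain[OF assms(1,2) one(2), of "inv\<^bsub>G\<^esub> g"] lookup_bar_cochain[OF assms(1,3) one(2), of "inv\<^bsub>G\<^esub> g"] assms(4) by simp
    next
      case (diff x y)
      then show ?case
        by (simp add: addmap_diff[OF dual_modD(1)[OF assms(2)] bar_chains_addsub] addmap_diff[OF dual_modD(1)[OF assms(3)] bar_chains_addsub])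
    qed
  next
    case False
    then show ?thesis using dual_modD(2)[OF assms(2)] dual_modD(2)[OF assms(3)] by simp
  qed
qed

lemma bar_cochain_0:
  assumes "group G"
  shows "bar_cochain G i 0 = \<one>\<^bsub>cochain_group G (group_ring_gmod G) i\<^esub>"
  by (auto simp: bar_cochain_def cochain_group_def group_ring_simps frag_of_fun_def)

lemma bar_cochain_surj:
  assumes "group G" "f \<in> carrier (cochain_group G (group_ring_gmod G) i)"
  obtains \<phi> where "\<phi> \<in> bar_dual G i" "bar_cochain G i \<phi> = f"
proof -
  interpret G: group G by fact
  define u where "u p = poly_mapping.lookup (f (snd p)) (inv\<^bsub>G\<^esub> (fst p))" for p
  define \<phi> where "\<phi> x = (if x \<in> bar_chains G i then augmentation (frag_extend (\<lambda>p. frag_cmul (u p) (frag_of ())) x) else 0)" for x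
  have kf: "Poly_Mapping.keys (f l) \<subseteq> carrier G" if "l \<in> tuples G i" for l
    using assms(2) that by (auto simp: cochain_group_def group_ring_simps)
  have \<phi>of: "\<phi> (frag_of (g, l)) = poly_mapping.lookup (f l) (inv\<^bsub>G\<^esub> g)" if "g \<in> carrier G" "l \<in> tuples G i" for g l
    using that by (simp add: \<phi>_def u_def)
  have add: "addmap (bar_chains G i) \<phi>"
    by (simp add: addmap_def \<phi>_def frag_extend_add addsubD(2)[OF bar_chains_addsub])
  note act = gmodD[OF free_chains_gmod[OF assms(1), of "tuples G i"], folded bar_chains_def]
  have fin: "finite {g \<in> carrier G. \<phi> (perm_act G g x) \<noteq> 0}" if "x \<in> bar_chains G i" for x
    using that
  proof (induction rule: bar_induct)
    case zero
    then show ?case using addmap_0[OF add bar_chains_addsub] by simp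
  next
    case (one h l)
    have "{g \<in> carrier G. \<phi> (perm_act G g (frag_of (h, l))) \<noteq> 0} \<subseteq>
        (\<lambda>k. inv\<^bsub>G\<^esub> k \<otimes>\<^bsub>G\<^esub> inv\<^bsub>G\<^esub> h) ` Poly_Mapping.keys (f l)"
    proof
      fix g assume "g \<in> {g \<in> carrier G. \<phi> (perm_act G g (frag_of (h, l))) \<noteq> 0}"
      then have g: "g \<in> carrier G" "inv\<^bsub>G\<^esub> (g \<otimes>\<^bsub>G\<^esub> h) \<in> Poly_Mapping.keys (f l)"
        using one by (auto simp: \<phi>of in_keys_iff)
      have e: "g = inv\<^bsub>G\<^esub> (inv\<^bsub>G\<^esub> (g \<otimes>\<^bsub>G\<^esub> h)) \<otimes>\<^bsub>G\<^esub> inv\<^bsub>G\<^esub> h" using g(1) one(1) by (simp add: G.m_assoc)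
      show "g \<in> (\<lambda>k. inv\<^bsub>G\<^esub> k \<otimes>\<^bsub>G\<^esub> inv\<^bsub>G\<^esub> h) ` Poly_Mapping.keys (f l)" by (rule image_eqI[where x = "inv\<^bsub>G\<^esub> (g \<otimes>\<^bsub>G\<^esub> h)"]) (rule e, rule g(2))
    qed
    then show ?case by (rule finite_subset) simp
  next
    case (diff x y)
    have "{g \<in> carrier G. \<phi> (perm_act G g (x - y)) \<noteq> 0} \<subseteq>
        {g \<in> carrier G. \<phi> (perm_act G g x) \<noteq> 0} \<union> {g \<in> carrier G. \<phi> (perm_act G g y) \<noteq> 0}"
    proof
      fix g assume "g \<in> {g \<in> carrier G. \<phi> (perm_act G g (x - y)) \<noteq> 0}"
      then have g: "g \<in> carrier G" "\<phi> (perm_act G g x) - \<phi> (perm_act G g y) \<noteq> 0"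
        using addmap_diff[OF add bar_chains_addsub act(2)[OF _ diff(1)] act(2)[OF _ diff(2)]] by auto
      then show "g \<in> {g \<in> carrier G. \<phi> (perm_act G g x) \<noteq> 0} \<union> {g \<in> carrier G. \<phi> (perm_act G g y) \<noteq> 0}" by auto
    qed
    then show ?case by (rule finite_subset) (use diff(3,4) in simp)
  qed
  have \<phi>: "\<phi> \<in> bar_dual G i" using add fin by (simp add: dual_mod_def \<phi>_def)
  have "bar_cochain G i \<phi> l = f l" if l: "l \<in> tuples G i" for l
    by (rule frag_eqI[OF keys_bar_cochain[OF assms(1) \<phi> l] kf[OF l]]) (simp add: lookup_bar_cochain[OF assms(1) \<phi> l] \<phi>of l)
  moreover have "f \<in> extensional (tuples G i)" using assms(2) by (auto simp: cochain_group_def PiE_def)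
  ultimately have "bar_cochain G i \<phi> = f"
    by (intro extensionalityI[of _ "tuples G i"]) (auto simp: bar_cochain_def)
  then show thesis using that \<phi> by blast
qed

text \<open>
  The translation by the first entry of the tuple becomes the action on the group ring, and the
  other faces agree term by term.
\<close>

lemma coboundary_bar_cochain:
  assumes "group G" "\<phi> \<in> bar_dual G i"
  shows "coboundary G (group_ring_gmod G) i (bar_cochain G i \<phi>) = bar_cochain G (Suc i) (dual_map (bar_chains G (Suc i)) (bar_map G i) \<phi>)"
proof -
  interpret G: group G by fact
  interpret R: comm_group "group_ring_gmod G" by (rule group_ring_comm_group)
  let ?R = "group_ring_gmod G" and ?f = "bar_cochain G i \<phi>"
  let ?\<psi> = "dual_map (bar_chains G (Suc i)) (bar_map G i) \<phi>"
  have \<psi>: "?\<psi> \<in> bar_dual G (Suc i)"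
    by (rule ghomD(1)[OF dual_cochain_gmod(2)[OF assms(1) G.subgroup_self bar_resolution[OF assms(1)]] assms(2)])
  note \<phi>D = dual_modD(1)[OF assms(2)]
  have c: "?f l \<in> carrier ?R" if "l \<in> tuples G i" for l
    using keys_bar_cochain[OF assms that] by (simp add: group_ring_simps)
  have cm: "frag_cmul k x \<in> carrier ?R" if "x \<in> carrier ?R" for k x
    using that keys_cmul[of k x] by (auto simp: group_ring_simps)
  have "coboundary G ?R i ?f l = bar_cochain G (Suc i) ?\<psi> l" if l: "l \<in> tuples G (Suc i)" for l
  proof -
    note t = tuples_faces[OF assms(1) l]
    let ?A = "frag_extend (\<lambda>x. frag_of (hd l \<otimes>\<^bsub>G\<^esub> x)) (?f (tl l))"
    let ?S = "\<Sum>k<i. frag_cmul ((- 1) ^ Suc k) (?f (merge_at G k l))"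
    let ?B = "frag_cmul ((- 1) ^ Suc i) (?f (butlast l))"
    have "finprod ?R (\<lambda>k. ?f (merge_at G k l) [^]\<^bsub>?R\<^esub> ((- 1) ^ Suc k :: int)) {..<i} = ?S"
    proof -
      have "finprod ?R (\<lambda>k. ?f (merge_at G k l) [^]\<^bsub>?R\<^esub> ((- 1) ^ Suc k :: int)) {..<i} =
          (\<Sum>k<i. ?f (merge_at G k l) [^]\<^bsub>?R\<^esub> ((- 1) ^ Suc k :: int))"
        by (rule group_ring_finprod) (auto intro!: R.int_pow_closed c t(5))
      also have "\<dots> = ?S"
        by (rule sum.cong[OF HOL.refl], rule group_ring_sign_pow, rule c, rule t(5)) simp
      finally show ?thesis .
    qed
    then have e: "coboundary G ?R i ?f l = ?A + ?S + ?B"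
      using l by (simp only: coboundary_def group_ring_simps group_ring_sign_pow[OF c[OF t(3)]] restrict_apply' if_True)
    have kA: "Poly_Mapping.keys ?A \<subseteq> carrier G"
      using keys_frag_extend[of "\<lambda>x. frag_of (hd l \<otimes>\<^bsub>G\<^esub> x)" "?f (tl l)"] keys_bar_cochain[OF assms t(2)] t(1) by (auto simp: keys_frag_of)
    have kS: "?S \<in> carrier ?R"
    proof -
      have "?S = finprod ?R (\<lambda>k. frag_cmul ((- 1) ^ Suc k) (?f (merge_at G k l))) {..<i}"
        by (subst group_ring_finprod) (auto intro!: cm c t(5))
      then show ?thesis by (simp only:) (intro R.finprod_closed, auto intro!: cm c t(5))
    qed
    have k: "Poly_Mapping.keys (coboundary G ?R i ?f l) \<subseteq> carrier G"
    proof -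
      have "Poly_Mapping.keys ?S \<subseteq> carrier G" "Poly_Mapping.keys ?B \<subseteq> carrier G"
        using kS cm[OF c[OF t(3)], of "(- 1) ^ Suc i"] by (simp_all only: group_ring_simps mem_Collect_eq)
      then show ?thesis
        unfolding e by (intro order_trans[OF keys_add] Un_least kA)
    qed
    show ?thesis
    proof (rule frag_eqI[OF k keys_bar_cochain[OF assms(1) \<psi> l]])
      fix g assume g: "g \<in> carrier G"
      let ?q = "inv\<^bsub>G\<^esub> g"
      have "poly_mapping.lookup ?A g = \<phi> (frag_of (?q \<otimes>\<^bsub>G\<^esub> hd l, tl l))"
        using lookup_left_translate[OF assms(1) keys_bar_cochain[OF assms t(2)] t(1) g] lookup_bar_cochain[OF assms t(2), of "inv\<^bsub>G\<^esub> hd l \<otimes>\<^bsub>G\<^esub> g"] t(1) g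
        by (simp add: G.inv_mult_group)
      moreover have "poly_mapping.lookup ?S g = (\<Sum>k<i. (- 1) ^ Suc k * \<phi> (frag_of (?q, merge_at G k l)))"
        unfolding lookup_frag_sum by (intro sum.cong HOL.refl) (simp add: lookup_bar_cochain[OF assms t(5) g])
      moreover have "poly_mapping.lookup ?B g = (- 1) ^ Suc i * \<phi> (frag_of (?q, butlast l))"
        by (simp add: lookup_bar_cochain[OF assms t(3) g])
      moreover have "\<phi> (bar_map G i (frag_of (?q, l))) = \<phi> (frag_of (?q \<otimes>\<^bsub>G\<^esub> hd l, tl l)) +
          (\<Sum>k<i. (- 1) ^ Suc k * \<phi> (frag_of (?q, merge_at G k l))) + (- 1) ^ Suc i * \<phi> (frag_of (?q, butlast l))"
      proof -
        have cm\<phi>: "\<phi> (frag_cmul k x) = k * \<phi> x" if "x \<in> bar_chains G i" for k x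
          using addmap_iscale[OF \<phi>D bar_chains_addsub that, of k] by simp
        have m1: "frag_of (?q \<otimes>\<^bsub>G\<^esub> hd l, tl l) \<in> bar_chains G i" using g t by simp
        have m2: "frag_of (?q, merge_at G k l) \<in> bar_chains G i" if "k < i" for k using g t(5)[OF that] by simp
        have m3: "frag_of (?q, butlast l) \<in> bar_chains G i" using g t(3) by simp
        have m4: "(\<Sum>k<i. frag_cmul ((- 1) ^ Suc k) (frag_of (?q, merge_at G k l))) \<in> bar_chains G i"
          by (rule addsub_sum[OF bar_chains_addsub]) (auto intro!: bar_chains_cmul m2)
        have "\<phi> (\<Sum>k<i. frag_cmul ((- 1) ^ Suc k) (frag_of (?q, merge_at G k l))) =
            (\<Sum>k<i. \<phi> (frag_cmul ((- 1) ^ Suc k) (frag_of (?q, merge_at G k l))))"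
          by (rule addmap_sum[OF \<phi>D bar_chains_addsub]) (auto intro!: bar_chains_cmul m2)
        also have "\<dots> = (\<Sum>k<i. (- 1) ^ Suc k * \<phi> (frag_of (?q, merge_at G k l)))"
          by (intro sum.cong HOL.refl cm\<phi> m2) simp
        finally show ?thesis
          unfolding bar_map_of
          by (simp only: addmap_add[OF \<phi>D addsubD(2)[OF bar_chains_addsub m1 m4] bar_chains_cmul[OF m3]]
              addmap_add[OF \<phi>D m1 m4] cm\<phi>[OF m3])
      qed
      moreover have "poly_mapping.lookup (bar_cochain G (Suc i) ?\<psi> l) g = \<phi> (bar_map G i (frag_of (?q, l)))"
        unfolding lookup_bar_cochain[OF assms(1) \<psi> l g] using g l by (simp add: dual_map_def)
      ultimately show "poly_mapping.lookup (coboundary G ?R i ?f l) g = poly_mapping.lookup (bar_cochain G (Suc i) ?\<psi> l) g"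
        unfolding e lookup_add by simp
    qed
  qed
  moreover have "coboundary G ?R i ?f l = undefined" "bar_cochain G (Suc i) ?\<psi> l = undefined" if "l \<notin> tuples G (Suc i)" for l
    using that by (simp_all add: coboundary_def bar_cochain_def)
  ultimately have "coboundary G ?R i ?f l = bar_cochain G (Suc i) ?\<psi> l" for l
    by (cases "l \<in> tuples G (Suc i)") simp_all
  then show ?thesis by (rule ext)
qed


section \<open>Poincare duality groups have duality data\<close>

abbreviation bar_cocycles where
  "bar_cocycles G \<equiv> dual_cocycles (carrier G) (bar_chains G) (\<lambda>_. perm_act G) (bar_map G)"

lemma cocycles_bar_cochain:
  assumes "group G"
  shows "cocycles G (group_ring_gmod G) i = bar_cochain G i ` bar_cocycles G i"
proof (intro equalityI subsetI)
  interpret G: group G by fact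
  note mem = ghomD(1)[OF dual_cochain_gmod(2)[OF assms(1) G.subgroup_self bar_resolution[OF assms(1)]]]
  {
    fix f assume "f \<in> cocycles G (group_ring_gmod G) i"
    then have f: "f \<in> carrier (cochain_group G (group_ring_gmod G) i)"
      "coboundary G (group_ring_gmod G) i f = \<one>\<^bsub>cochain_group G (group_ring_gmod G) (Suc i)\<^esub>"
      by (auto simp: cocycles_def kernel_def)
    obtain \<phi> where \<phi>: "\<phi> \<in> bar_dual G i" "bar_cochain G i \<phi> = f" by (rule bar_cochain_surj[OF assms f(1)])
    have "bar_cochain G (Suc i) (dual_map (bar_chains G (Suc i)) (bar_map G i) \<phi>) = bar_cochain G (Suc i) 0"
      unfolding bar_cochain_0[OF assms] coboundary_bar_cochain[OF assms \<phi>(1), symmetric] \<phi>(2) by (rule f(2))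
    then have "dual_map (bar_chains G (Suc i)) (bar_map G i) \<phi> = 0"
      by (rule bar_cochain_inj[OF assms mem[OF \<phi>(1)] addsubD(1)[OF dual_mod_addsub]])
    then show "f \<in> bar_cochain G i ` bar_cocycles G i" using \<phi> by (auto simp: dual_cocycles_def)
  next
    fix f assume "f \<in> bar_cochain G i ` bar_cocycles G i"
    then obtain \<phi> where \<phi>: "\<phi> \<in> bar_dual G i" "dual_map (bar_chains G (Suc i)) (bar_map G i) \<phi> = 0" "f = bar_cochain G i \<phi>"
      by (auto simp: dual_cocycles_def)
    then show "f \<in> cocycles G (group_ring_gmod G) i"
      using bar_cochain_carrier[OF assms \<phi>(1)] coboundary_bar_cochain[OF assms \<phi>(1)] bar_cochain_0[OF assms, of "Suc i"]
      by (simp add: cocycles_def kernel_def)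
  }
qed

lemma coboundaries_bar_cochain:
  assumes "group G"
  shows "coboundaries G (group_ring_gmod G) 0 = bar_cochain G 0 ` {0}"
    "coboundaries G (group_ring_gmod G) (Suc i) = bar_cochain G (Suc i) ` dual_map (bar_chains G (Suc i)) (bar_map G i) ` bar_dual G i"
proof -
  show "coboundaries G (group_ring_gmod G) 0 = bar_cochain G 0 ` {0}"
    by (simp add: coboundaries_def bar_cochain_0[OF assms])
  have "carrier (cochain_group G (group_ring_gmod G) i) = bar_cochain G i ` bar_dual G i"
  proof (intro equalityI subsetI)
    fix f assume "f \<in> carrier (cochain_group G (group_ring_gmod G) i)"
    then show "f \<in> bar_cochain G i ` bar_dual G i" by (rule bar_cochain_surj[OF assms]) blast
  qed (use bar_cochain_carrier[OF assms] in blast)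
  then show "coboundaries G (group_ring_gmod G) (Suc i) = bar_cochain G (Suc i) ` dual_map (bar_chains G (Suc i)) (bar_map G i) ` bar_dual G i"
    by (simp add: coboundaries_def image_image coboundary_bar_cochain[OF assms] cong: image_cong)
qed

lemma cochain_group_group: "group (cochain_group G (group_ring_gmod G) i)"
  unfolding cochain_group_def
  by (rule product_group) (rule comm_group.axioms(2)[OF group_ring_comm_group])

lemma cochain_group_comm:
  "f \<otimes>\<^bsub>cochain_group G (group_ring_gmod G) i\<^esub> h = h \<otimes>\<^bsub>cochain_group G (group_ring_gmod G) i\<^esub> f"
  by (simp add: cochain_group_def group_ring_simps add.commute)

lemma bar_cochain_subgroup:
  assumes "group G" "addsub S" "S \<subseteq> bar_dual G i"
  shows "subgroup (bar_cochain G i ` S) (cochain_group G (group_ring_gmod G) i)"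
proof -
  interpret A: group "cochain_group G (group_ring_gmod G) i" by (rule cochain_group_group)
  show ?thesis
  proof (rule A.subgroupI)
    show "bar_cochain G i ` S \<subseteq> carrier (cochain_group G (group_ring_gmod G) i)"
      using bar_cochain_carrier[OF assms(1)] assms(3) by blast
    show "bar_cochain G i ` S \<noteq> {}" using addsubD(1)[OF assms(2)] by blast
    fix f assume "f \<in> bar_cochain G i ` S"
    then obtain \<phi> where \<phi>: "\<phi> \<in> S" "f = bar_cochain G i \<phi>" by blast
    have m: "- \<phi> \<in> S" by (rule addsubD(3)[OF assms(2) \<phi>(1)])
    have d: "\<phi> \<in> bar_dual G i" "- \<phi> \<in> bar_dual G i" using \<phi>(1) m assms(3) by auto
    have "inv\<^bsub>cochain_group G (group_ring_gmod G) i\<^esub> f = bar_cochain G i (- \<phi>)"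
    proof (rule A.inv_equality)
      show "bar_cochain G i (- \<phi>) \<otimes>\<^bsub>cochain_group G (group_ring_gmod G) i\<^esub> f = \<one>\<^bsub>cochain_group G (group_ring_gmod G) i\<^esub>"
        unfolding \<phi>(2) bar_cochain_add[OF assms(1) d(2,1), symmetric] by (simp add: bar_cochain_0[OF assms(1)])
    qed (use d \<phi>(2) bar_cochain_carrier[OF assms(1)] in auto)
    then show "inv\<^bsub>cochain_group G (group_ring_gmod G) i\<^esub> f \<in> bar_cochain G i ` S" using m by blast
    fix h assume "h \<in> bar_cochain G i ` S"
    then obtain \<psi> where \<psi>: "\<psi> \<in> S" "h = bar_cochain G i \<psi>" by blast
    have "f \<otimes>\<^bsub>cochain_group G (group_ring_gmod G) i\<^esub> h = bar_cochain G i (\<phi> + \<psi>)"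
      unfolding \<phi>(2) \<psi>(2) by (rule bar_cochain_add[OF assms(1), symmetric]) (use \<phi>(1) \<psi>(1) assms(3) in auto)
    then show "f \<otimes>\<^bsub>cochain_group G (group_ring_gmod G) i\<^esub> h \<in> bar_cochain G i ` S"
      using addsubD(2)[OF assms(2) \<phi>(1) \<psi>(1)] by blast
  qed
qed

lemma trivial_cohomology_coboundary:
  assumes "group G" "trivial_group (cohomology G (group_ring_gmod G) i)" "\<phi> \<in> bar_cocycles G i"
  shows "bar_cochain G i \<phi> \<in> coboundaries G (group_ring_gmod G) i"
proof -
  interpret G: group G by fact
  let ?A = "cochain_group G (group_ring_gmod G) i" and ?B = "coboundaries G (group_ring_gmod G) i"
  let ?H = "?A\<lparr>carrier := cocycles G (group_ring_gmod G) i\<rparr>"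
  interpret A: group ?A by (rule cochain_group_group)
  let ?f = "bar_cochain G i \<phi>"
  have f: "?f \<in> cocycles G (group_ring_gmod G) i" "?f \<in> carrier ?A"
    using assms(3) bar_cochain_carrier[OF assms(1)] by (auto simp: cocycles_bar_cochain[OF assms(1)] dual_cocycles_def)
  have 1: "\<one>\<^bsub>?A\<^esub> \<in> ?B"
  proof (cases i)
    case 0
    then show ?thesis by (simp add: coboundaries_def)
  next
    case (Suc k)
    have "bar_cochain G (Suc k) (dual_map (bar_chains G (Suc k)) (bar_map G k) 0) \<in> coboundaries G (group_ring_gmod G) (Suc k)"
      unfolding coboundaries_bar_cochain[OF assms(1)] using addsubD(1)[OF dual_mod_addsub] by blast
    then show ?thesis unfolding Suc dual_map_zero bar_cochain_0[OF assms(1)] .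
  qed
  have "?B #>\<^bsub>?H\<^esub> ?f \<in> carrier (cohomology G (group_ring_gmod G) i)"
    using f(1) by (simp add: cohomology_def carrier_FactGroup)
  also have "carrier (cohomology G (group_ring_gmod G) i) = {?B}"
    using assms(2) by (simp add: trivial_group_def cohomology_def)
  finally have "?B #>\<^bsub>?H\<^esub> ?f = ?B" by simp
  moreover have "\<one>\<^bsub>?A\<^esub> \<otimes>\<^bsub>?H\<^esub> ?f \<in> ?B #>\<^bsub>?H\<^esub> ?f" using 1 by (auto simp: r_coset_def)
  ultimately show ?thesis using f(2) by simp
qed

text \<open>
  An infinite cyclic group is a copy of the integers; composing the class of a cocycle with such an
  identification gives \<open>\<eta>\<close>.
\<close>

lemma cyclic_cohomology_iso:
  assumes "group G" "cyclic_group (cohomology G (group_ring_gmod G) (Suc m))"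
    "infinite (carrier (cohomology G (group_ring_gmod G) (Suc m)))"
  obtains \<eta> :: "(('g \<times> 'g list \<Rightarrow>\<^sub>0 int) \<Rightarrow> int) \<Rightarrow> int" where "addmap (bar_cocycles (G :: ('g, 'm) monoid_scheme) (Suc m)) \<eta>"
    "\<eta> ` bar_cocycles G (Suc m) = UNIV"
    "{\<phi> \<in> bar_cocycles G (Suc m). \<eta> \<phi> = 0} = dual_map (bar_chains G (Suc m)) (bar_map G m) ` bar_dual G m"
proof -
  interpret G: group G by fact
  let ?n = "Suc m"
  let ?A = "cochain_group G (group_ring_gmod G) ?n" and ?B = "coboundaries G (group_ring_gmod G) ?n"
  let ?Z = "cocycles G (group_ring_gmod G) ?n" and ?ZZ = "bar_cocycles G ?n"
  let ?BB = "dual_map (bar_chains G ?n) (bar_map G m) ` bar_dual G m"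
  let ?H = "?A\<lparr>carrier := ?Z\<rparr>" and ?c = "bar_cochain G ?n"
  let ?Q = "cohomology G (group_ring_gmod G) ?n"
  note res = bar_resolution[OF assms(1)]
  note dc = dual_cochain_gmod[OF assms(1) G.subgroup_self res]
  interpret A: group ?A by (rule cochain_group_group)
  have ZD: "?ZZ \<subseteq> bar_dual G ?n" by (auto simp: dual_cocycles_def)
  have BZ: "?BB \<subseteq> ?ZZ" using dual_map_in_cocycles[OF assms(1) G.subgroup_self res] by blast
  have addB: "addsub ?BB"
  proof -
    note a = ghomD(2)[OF dc(2)[of m]]
    note s = addsubD[OF dual_mod_addsub[of "carrier G" "bar_chains G m" "perm_act G"]]
    show ?thesis
      unfolding addsub_def
    proof (intro conjI ballI)
      show "0 \<in> ?BB" by (rule image_eqI[of _ _ 0]) (simp add: dual_map_zero, rule s(1))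
    next
      fix x y assume "x \<in> ?BB" "y \<in> ?BB"
      then obtain \<phi> \<psi> where \<phi>: "\<phi> \<in> bar_dual G m" "x = dual_map (bar_chains G ?n) (bar_map G m) \<phi>"
        and \<psi>: "\<psi> \<in> bar_dual G m" "y = dual_map (bar_chains G ?n) (bar_map G m) \<psi>" by blast
      have "x + y = dual_map (bar_chains G ?n) (bar_map G m) (\<phi> + \<psi>)"
        unfolding \<phi>(2) \<psi>(2) by (rule addmap_add[OF a \<phi>(1) \<psi>(1), symmetric])
      then show "x + y \<in> ?BB" using s(2)[OF \<phi>(1) \<psi>(1)] by blast
    next
      fix x assume "x \<in> ?BB"
      then obtain \<phi> where \<phi>: "\<phi> \<in> bar_dual G m" "x = dual_map (bar_chains G ?n) (bar_map G m) \<phi>" by blast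
      have "- x = dual_map (bar_chains G ?n) (bar_map G m) (- \<phi>)"
        unfolding \<phi>(2) by (rule addmap_minus[OF a dual_mod_addsub \<phi>(1), symmetric])
      then show "- x \<in> ?BB" using s(3)[OF \<phi>(1)] by blast
    qed
  qed
  have sZ: "subgroup ?Z ?A"
    unfolding cocycles_bar_cochain[OF assms(1)] by (rule bar_cochain_subgroup[OF assms(1) gmodD(1)[OF dc(3)] ZD])
  have sB: "subgroup ?B ?A"
    unfolding coboundaries_bar_cochain[OF assms(1)] by (rule bar_cochain_subgroup[OF assms(1) addB]) (use BZ ZD in blast)
  have B_Z: "?B \<subseteq> ?Z" unfolding coboundaries_bar_cochain[OF assms(1)] cocycles_bar_cochain[OF assms(1)] using BZ by blast
  have gH: "group ?H" by (rule A.subgroup_imp_group[OF sZ])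
  interpret H: group ?H by (rule gH)
  have cH: "comm_group ?H" by (rule H.group_comm_groupI) (simp add: cochain_group_comm)
  have sBH: "subgroup ?B ?H" by (rule A.subgroup_incl[OF sB sZ B_Z])
  interpret N: normal ?B ?H by (rule comm_group.subgroup_imp_normal[OF cH sBH])
  have Q: "?Q = ?H Mod ?B" by (simp add: cohomology_def)
  interpret Q: group ?Q unfolding Q by (rule N.factorgroup_is_group)
  obtain x where x: "x \<in> carrier ?Q" "carrier ?Q = range (\<lambda>k::int. x [^]\<^bsub>?Q\<^esub> k)"
    using assms(2) unfolding Q.cyclic_group by blast
  have inj: "x [^]\<^bsub>?Q\<^esub> (k::int) = x [^]\<^bsub>?Q\<^esub> l \<longleftrightarrow> k = l" for k l
  proof -
    have "carrier (subgroup_generated ?Q {x}) = carrier ?Q"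
      using Q.carrier_subgroup_generated_by_singleton[OF x(1)] x(2) by auto
    then show ?thesis using Q.infinite_cyclic_subgroup_int[OF x(1)] assms(3) by auto
  qed
  define q where "q \<phi> = ?B #>\<^bsub>?H\<^esub> ?c \<phi>" for \<phi>
  have cZ: "?c \<phi> \<in> ?Z" if "\<phi> \<in> ?ZZ" for \<phi> using that by (simp add: cocycles_bar_cochain[OF assms(1)])
  have qQ: "q \<phi> \<in> carrier ?Q" if "\<phi> \<in> ?ZZ" for \<phi>
    unfolding Q q_def carrier_FactGroup using cZ[OF that] by simp
  have qadd: "q (\<phi> + \<psi>) = q \<phi> \<otimes>\<^bsub>?Q\<^esub> q \<psi>" if "\<phi> \<in> ?ZZ" "\<psi> \<in> ?ZZ" for \<phi> \<psi>
  proof -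
    have "?c (\<phi> + \<psi>) = ?c \<phi> \<otimes>\<^bsub>?H\<^esub> ?c \<psi>" using bar_cochain_add[OF assms(1)] that ZD by auto
    then show ?thesis
      unfolding q_def Q using hom_mult[OF N.r_coset_hom_Mod, of "?c \<phi>" "?c \<psi>"] cZ[OF that(1)] cZ[OF that(2)] by simp
  qed
  define \<eta> where "\<eta> \<phi> = (THE k::int. q \<phi> = x [^]\<^bsub>?Q\<^esub> k)" for \<phi>
  have \<eta>_eq: "\<eta> \<phi> = k \<longleftrightarrow> q \<phi> = x [^]\<^bsub>?Q\<^esub> k" if \<phi>Z: "\<phi> \<in> ?ZZ" for \<phi> k
  proof -
    obtain l :: int where l: "q \<phi> = x [^]\<^bsub>?Q\<^esub> l" using qQ[OF \<phi>Z] unfolding x(2) by blast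
    have "\<eta> \<phi> = l" unfolding \<eta>_def l inj by simp
    then show ?thesis using l inj by auto
  qed
  have 1: "addmap ?ZZ \<eta>"
    unfolding addmap_def
  proof (intro ballI)
    fix \<phi> \<psi> assume \<phi>: "\<phi> \<in> ?ZZ" and \<psi>: "\<psi> \<in> ?ZZ"
    have s: "\<phi> + \<psi> \<in> ?ZZ" by (rule addsubD(2)[OF gmodD(1)[OF dc(3)] \<phi> \<psi>])
    have "q \<phi> = x [^]\<^bsub>?Q\<^esub> \<eta> \<phi>" "q \<psi> = x [^]\<^bsub>?Q\<^esub> \<eta> \<psi>" using \<eta>_eq[OF \<phi>] \<eta>_eq[OF \<psi>] by blast+
    then have "q (\<phi> + \<psi>) = x [^]\<^bsub>?Q\<^esub> (\<eta> \<phi> + \<eta> \<psi>)" using qadd[OF \<phi> \<psi>] Q.int_pow_mult[OF x(1)] by simp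
    then show "\<eta> (\<phi> + \<psi>) = \<eta> \<phi> + \<eta> \<psi>" using \<eta>_eq[OF s] by blast
  qed
  have 2: "\<eta> ` ?ZZ = UNIV"
  proof -
    have "k \<in> \<eta> ` ?ZZ" for k :: int
    proof -
      have "x [^]\<^bsub>?Q\<^esub> k \<in> carrier ?Q" using x(1) by simp
      then obtain f where f: "f \<in> ?Z" "x [^]\<^bsub>?Q\<^esub> k = ?B #>\<^bsub>?H\<^esub> f" unfolding Q carrier_FactGroup by auto
      then obtain \<phi> where \<phi>: "\<phi> \<in> ?ZZ" "f = ?c \<phi>" unfolding cocycles_bar_cochain[OF assms(1)] by blast
      then have "\<eta> \<phi> = k" using \<eta>_eq[OF \<phi>(1)] f(2) by (simp add: q_def)
      then show ?thesis using \<phi>(1) by blast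
    qed
    then show ?thesis by blast
  qed
  have "\<eta> \<phi> = 0 \<longleftrightarrow> \<phi> \<in> ?BB" if \<phi>: "\<phi> \<in> ?ZZ" for \<phi>
  proof -
    have "\<eta> \<phi> = 0 \<longleftrightarrow> q \<phi> = ?B" using \<eta>_eq[OF \<phi>, of 0] by (simp add: Q)
    also have "\<dots> \<longleftrightarrow> ?c \<phi> \<in> ?B"
      unfolding q_def using H.coset_join1[of ?B "?c \<phi>"] H.coset_join2[of "?c \<phi>" ?B] cZ[OF \<phi>] sBH by auto
    also have "\<dots> \<longleftrightarrow> \<phi> \<in> ?BB"
      unfolding coboundaries_bar_cochain[OF assms(1)] using bar_cochain_inj[OF assms(1)] \<phi> BZ ZD by blast
    finally show ?thesis .
  qed
  then have 3: "{\<phi> \<in> ?ZZ. \<eta> \<phi> = 0} = ?BB" using BZ by blast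
  show thesis by (rule that[OF 1 2 3])
qed

lemma PD_group_bar_dual_exact:
  fixes G :: "('a, 'm) monoid_scheme"
  assumes "PD_group n G" "0 < n"
  obtains \<eta> where "dual_exact (carrier G) n (bar_chains G) (\<lambda>_. perm_act G) (bar_map G) \<eta>"
proof -
  have "group G" using assms(1) by (simp add: PD_group_def type_FP_def)
  interpret G: group G by fact
  obtain m where m: "n = Suc m" using assms(2) by (cases n) auto
  have tr: "trivial_group (cohomology G (group_ring_gmod G) i)" if "i \<noteq> n" for i
    using assms(1) that by (simp add: PD_group_def)
  have cy: "cyclic_group (cohomology G (group_ring_gmod G) (Suc m))" "infinite (carrier (cohomology G (group_ring_gmod G) (Suc m)))"
    using assms(1) by (auto simp: PD_group_def m)
  obtain \<eta> :: "(('a \<times> 'a list \<Rightarrow>\<^sub>0 int) \<Rightarrow> int) \<Rightarrow> int" where \<eta>: "addmap (bar_cocycles G (Suc m)) \<eta>" "\<eta> ` bar_cocycles G (Suc m) = UNIV"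
    "{\<phi> \<in> bar_cocycles G (Suc m). \<eta> \<phi> = 0} = dual_map (bar_chains G (Suc m)) (bar_map G m) ` bar_dual G m"
    by (rule cyclic_cohomology_iso[OF \<open>group G\<close> cy])
  have ZD: "\<phi> \<in> bar_dual G i" if "\<phi> \<in> bar_cocycles G i" for \<phi> i using that by (simp add: dual_cocycles_def)
  have "bar_cocycles G 0 \<subseteq> {0}"
  proof
    fix \<phi> assume \<phi>: "\<phi> \<in> bar_cocycles G 0"
    have "bar_cochain G 0 \<phi> = bar_cochain G 0 0"
      using trivial_cohomology_coboundary[OF \<open>group G\<close> tr \<phi>] assms(2) coboundaries_bar_cochain(1)[OF \<open>group G\<close>] by auto
    then show "\<phi> \<in> {0}" using bar_cochain_inj[OF \<open>group G\<close> ZD[OF \<phi>] addsubD(1)[OF dual_mod_addsub]] by simp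
  qed
  moreover have "bar_cocycles G (Suc i) \<subseteq> dual_map (bar_chains G (Suc i)) (bar_map G i) ` bar_dual G i" if ne: "Suc i \<noteq> n" for i
  proof
    fix \<phi> assume \<phi>: "\<phi> \<in> bar_cocycles G (Suc i)"
    obtain \<psi> where \<psi>: "\<psi> \<in> bar_dual G i"
      "bar_cochain G (Suc i) \<phi> = bar_cochain G (Suc i) (dual_map (bar_chains G (Suc i)) (bar_map G i) \<psi>)"
      using trivial_cohomology_coboundary[OF \<open>group G\<close> tr[OF ne] \<phi>] unfolding coboundaries_bar_cochain(2)[OF \<open>group G\<close>] by blast
    have "dual_map (bar_chains G (Suc i)) (bar_map G i) \<psi> \<in> bar_dual G (Suc i)"
      by (rule ghomD(1)[OF dual_cochain_gmod(2)[OF \<open>group G\<close> G.subgroup_self bar_resolution[OF \<open>group G\<close>]] \<psi>(1)])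
    then have "\<phi> = dual_map (bar_chains G (Suc i)) (bar_map G i) \<psi>"
      by (rule bar_cochain_inj[OF \<open>group G\<close> ZD[OF \<phi>] _ \<psi>(2)])
    then show "\<phi> \<in> dual_map (bar_chains G (Suc i)) (bar_map G i) ` bar_dual G i" using \<psi>(1) by blast
  qed
  ultimately have "dual_exact (carrier G) n (bar_chains G) (\<lambda>_. perm_act G) (bar_map G) \<eta>"
    unfolding dual_exact_def using \<eta> assms(2) m by simp
  then show thesis by (rule that)
qed

text \<open>
  The finite resolution comes from type FP, and its dual complex inherits the cohomology from the
  bar resolution.
\<close>

lemma PD_group_pd_data:
  fixes G :: "('g, 'm) monoid_scheme"
  assumes "PD_group n G" "0 < n"
  obtains M :: "nat \<Rightarrow> ('g \<times> ('g \<times> nat \<Rightarrow>\<^sub>0 int) \<Rightarrow>\<^sub>0 int) set" and d \<epsilon> b \<kappa> w \<eta>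
    and J :: "nat \<Rightarrow> ('g \<times> nat \<Rightarrow>\<^sub>0 int) set"
  where "pd_data G (carrier G) n (\<lambda>_. 1) M (\<lambda>_. perm_act G) d \<epsilon> J b \<kappa> w \<eta>"
    "\<forall>g\<in>carrier G. \<forall>h\<in>carrier G. w (g \<otimes>\<^bsub>G\<^esub> h) = w g * w h" "w \<one>\<^bsub>G\<^esub> = 1" "\<forall>g\<in>carrier G. w g \<in> {1, -1}"
proof -
  have FP: "type_FP G" and "group G" using assms(1) by (auto simp: PD_group_def type_FP_def)
  interpret G: group G by fact
  obtain M :: "nat \<Rightarrow> ('g \<times> ('g \<times> nat \<Rightarrow>\<^sub>0 int) \<Rightarrow>\<^sub>0 int) set" and d \<epsilon> b \<kappa> N
    and J :: "nat \<Rightarrow> ('g \<times> nat \<Rightarrow>\<^sub>0 int) set" where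
    M: "resolution G (carrier G) (\<lambda>_. 1) M (\<lambda>_. perm_act G) d \<epsilon>"
    and db: "\<forall>i. finite (J i) \<and> dual_basis G (carrier G) (M i) (perm_act G) (J i) (b i) (\<kappa> i)"
    and bd: "\<forall>i>N. M i = {0}"
    by (rule type_FP_resolution[OF FP])
  obtain \<eta>0 where ex0: "dual_exact (carrier G) n (bar_chains G) (\<lambda>_. perm_act G) (bar_map G) \<eta>0"
    by (rule PD_group_bar_dual_exact[OF assms])
  have db': "dual_basis G (carrier G) (M i) (perm_act G) (J i) (b i) (\<kappa> i)" for i using db by blast
  obtain \<eta> where ex: "dual_exact (carrier G) n M (\<lambda>_. perm_act G) d \<eta>"
    by (rule dual_exact_transfer[OF \<open>group G\<close> M bar_resolution[OF \<open>group G\<close>] db' bar_dual_basis[OF \<open>group G\<close>] ex0])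
  have "\<exists>w. (\<forall>g\<in>carrier G. \<forall>h\<in>carrier G. w (g \<otimes>\<^bsub>G\<^esub> h) = w g * w h) \<and> w \<one>\<^bsub>G\<^esub> = 1 \<and> (\<forall>g\<in>carrier G. w g \<in> {1, -1::int}) \<and>
    (\<forall>g\<in>carrier G. \<forall>\<phi>\<in>dual_cocycles (carrier G) M (\<lambda>_. perm_act G) d n. \<eta> (dual_act G (carrier G) (M n) (perm_act G) g \<phi>) = w g * \<eta> \<phi>)"
    by (rule orientation_character[OF \<open>group G\<close> G.subgroup_self M ex], rule exI, intro conjI ballI) assumption+
  then obtain w where w: "\<forall>g\<in>carrier G. \<forall>h\<in>carrier G. w (g \<otimes>\<^bsub>G\<^esub> h) = w g * w h" "w \<one>\<^bsub>G\<^esub> = 1" "\<forall>g\<in>carrier G. w g \<in> {1, -1::int}"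
    "\<forall>g\<in>carrier G. \<forall>\<phi>\<in>dual_cocycles (carrier G) M (\<lambda>_. perm_act G) d n. \<eta> (dual_act G (carrier G) (M n) (perm_act G) g \<phi>) = w g * \<eta> \<phi>"
    by blast
  have "pd_data G (carrier G) n (\<lambda>_. 1) M (\<lambda>_. perm_act G) d \<epsilon> J b \<kappa> w \<eta>"
    unfolding pd_data_def using M db bd ex w(4) by blast
  then show thesis using w(1-3) by (rule that)
qed

section \<open>Chains on cosets and derivations\<close>

definition chains_on :: "'a set \<Rightarrow> ('a \<Rightarrow>\<^sub>0 int) set" where
  "chains_on \<Omega> = {m. Poly_Mapping.keys m \<subseteq> \<Omega>}"

definition set_act :: "('g, 'm) monoid_scheme \<Rightarrow> 'g \<Rightarrow> ('g set \<Rightarrow>\<^sub>0 int) \<Rightarrow> 'g set \<Rightarrow>\<^sub>0 int" where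
  "set_act G g = frag_extend (\<lambda>S. frag_of (g <#\<^bsub>G\<^esub> S))"

text \<open>
  The map of chains induced by g K to g T. Multiplying a coset by the set T realises it without a
  choice of representatives.
\<close>

definition push :: "('g, 'm) monoid_scheme \<Rightarrow> 'g set \<Rightarrow> ('g set \<Rightarrow>\<^sub>0 int) \<Rightarrow> 'g set \<Rightarrow>\<^sub>0 int" where
  "push G T = frag_extend (\<lambda>S. frag_of (S <#>\<^bsub>G\<^esub> T))"

definition left_cosets :: "('g, 'm) monoid_scheme \<Rightarrow> 'g set \<Rightarrow> 'g set set" where
  "left_cosets G T = (\<lambda>g. g <#\<^bsub>G\<^esub> T) ` carrier G"

text \<open>
  Derivations with values in chains on cosets of a subgroup are the 1-cocycles with these
  coefficients.
\<close>

definition derivation :: "('g, 'm) monoid_scheme \<Rightarrow> 'g set set \<Rightarrow> ('g \<Rightarrow> 'g set \<Rightarrow>\<^sub>0 int) \<Rightarrow> bool" where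
  "derivation G \<Omega> d \<longleftrightarrow> (\<forall>g\<in>carrier G. d g \<in> chains_on \<Omega>) \<and>
     (\<forall>g\<in>carrier G. \<forall>h\<in>carrier G. d (g \<otimes>\<^bsub>G\<^esub> h) = d g + set_act G g (d h))"

lemma set_act_simps [simp]:
  "set_act G g (x + y) = set_act G g x + set_act G g y" "set_act G g (x - y) = set_act G g x - set_act G g y"
  "set_act G g 0 = 0" "set_act G g (frag_of S) = frag_of (g <#\<^bsub>G\<^esub> S)" "set_act G g (- x) = - set_act G g x"
  "set_act G g (frag_cmul c x) = frag_cmul c (set_act G g x)"
  by (simp_all add: set_act_def frag_extend_add frag_extend_diff frag_extend_minus frag_extend_cmul)

lemma push_simps [simp]:
  "push G T (x + y) = push G T x + push G T y" "push G T (x - y) = push G T x - push G T y"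
  "push G T 0 = 0" "push G T (frag_of S) = frag_of (S <#>\<^bsub>G\<^esub> T)" "push G T (- x) = - push G T x"
  "push G T (frag_cmul c x) = frag_cmul c (push G T x)"
  by (simp_all add: push_def frag_extend_add frag_extend_diff frag_extend_minus frag_extend_cmul)

lemma chains_addsub: "addsub (chains_on \<Omega>)"
  using keys_add by (fastforce simp: addsub_def chains_on_def)

lemma chains_of [simp]: "frag_of S \<in> chains_on \<Omega> \<longleftrightarrow> S \<in> \<Omega>"
  by (simp add: chains_on_def)

lemma chains_cmul: "x \<in> chains_on \<Omega> \<Longrightarrow> frag_cmul c x \<in> chains_on \<Omega>"
  using addsub_iscale[OF chains_addsub, of x \<Omega> c] by simp

lemma chains_induct [consumes 1, case_names zero one diff]:
  assumes "c \<in> chains_on \<Omega>" "P 0" "\<And>S. S \<in> \<Omega> \<Longrightarrow> P (frag_of S)"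
    "\<And>x y. x \<in> chains_on \<Omega> \<Longrightarrow> y \<in> chains_on \<Omega> \<Longrightarrow> P x \<Longrightarrow> P y \<Longrightarrow> P (x - y)"
  shows "P c"
proof -
  have "Poly_Mapping.keys c \<subseteq> \<Omega>" using assms(1) by (simp add: chains_on_def)
  then show ?thesis
    by (rule free_Abelian_group_induct) (use assms(2-4) in \<open>auto simp: chains_on_def\<close>)
qed

lemma augmentation_set_act: "augmentation (set_act G g x) = augmentation x"
  by (induction x rule: frag_induction[OF subset_UNIV]) simp_all

lemma augmentation_push: "augmentation (push G T x) = augmentation x"
  by (induction x rule: frag_induction[OF subset_UNIV]) simp_all

context group
begin

lemma l_coset_carrier: "g \<in> carrier G \<Longrightarrow> S \<subseteq> carrier G \<Longrightarrow> g <# S \<subseteq> carrier G"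
  by (auto simp: l_coset_def)

lemma left_cosets_Pow: "T \<subseteq> carrier G \<Longrightarrow> left_cosets G T \<subseteq> Pow (carrier G)"
  using l_coset_carrier by (auto simp: left_cosets_def)

lemma left_cosets_stable: "T \<subseteq> carrier G \<Longrightarrow> g \<in> carrier G \<Longrightarrow> S \<in> left_cosets G T \<Longrightarrow> g <# S \<in> left_cosets G T"
  by (auto simp: left_cosets_def lcos_m_assoc)

lemma left_cosets_self: "T \<subseteq> carrier G \<Longrightarrow> T \<in> left_cosets G T"
  unfolding left_cosets_def by (rule image_eqI[of _ _ \<one>]) (simp_all add: lcos_mult_one)

lemma set_act_gmod:
  assumes "T \<subseteq> carrier G"
  shows "gmod G (carrier G) (chains_on (left_cosets G T)) (set_act G)"
  unfolding gmod_def
proof (intro conjI ballI chains_addsub)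
  show "set_act G g ` chains_on (left_cosets G T) \<subseteq> chains_on (left_cosets G T)" if "g \<in> carrier G" for g
  proof (rule image_subsetI)
    fix c assume "c \<in> chains_on (left_cosets G T)"
    then show "set_act G g c \<in> chains_on (left_cosets G T)"
      by (induction rule: chains_induct)
        (auto intro: addsubD[OF chains_addsub] left_cosets_stable[OF assms that])
  qed
  show "addmap (chains_on (left_cosets G T)) (set_act G g)" for g by (simp add: addmap_def)
next
  fix c assume "c \<in> chains_on (left_cosets G T)"
  then show "set_act G \<one> c = c"
    by (induction rule: chains_induct) (use left_cosets_Pow[OF assms] in \<open>auto simp: lcos_mult_one\<close>)
next
  fix g h c assume g: "g \<in> carrier G" and h: "h \<in> carrier G" and "c \<in> chains_on (left_cosets G T)"
  from this(3) show "set_act G (g \<otimes> h) c = set_act G g (set_act G h c)"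
  proof (induction rule: chains_induct)
    case (one S)
    then have "S \<subseteq> carrier G" using left_cosets_Pow[OF assms] by blast
    then show ?case using g h by (simp add: lcos_m_assoc)
  qed simp_all
qed

lemma l_coset_set_mult: "g \<in> carrier G \<Longrightarrow> S \<subseteq> carrier G \<Longrightarrow> T \<subseteq> carrier G \<Longrightarrow> (g <# S) <#> T = g <# (S <#> T)"
  by (force simp: l_coset_def set_mult_def m_assoc subset_iff)

lemma l_coset_push:
  assumes "subgroup K G" "T \<subseteq> carrier G" "\<And>c. c \<in> K \<Longrightarrow> c <# T = T" "g \<in> carrier G"
  shows "(g <# K) <#> T = g <# T"
proof -
  interpret K: subgroup K G by fact
  have "K <#> T = T"
  proof
    show "K <#> T \<subseteq> T" using assms(3) by (auto simp: l_coset_def set_mult_def)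
    show "T \<subseteq> K <#> T"
    proof
      fix x assume x: "x \<in> T"
      then have "x = \<one> \<otimes> x" using assms(2) by auto
      then show "x \<in> K <#> T" using x K.one_closed unfolding set_mult_def by blast
    qed
  qed
  then show ?thesis using l_coset_set_mult[OF assms(4) K.subset assms(2)] by simp
qed

lemma push_closed:
  assumes "subgroup K G" "T \<subseteq> carrier G" "\<And>c. c \<in> K \<Longrightarrow> c <# T = T" "m \<in> chains_on (left_cosets G K)"
  shows "push G T m \<in> chains_on (left_cosets G T)"
  using assms(4)
proof (induction rule: chains_induct)
  case (one S)
  then obtain g where "g \<in> carrier G" "S = g <# K" by (auto simp: left_cosets_def)
  then show ?case using l_coset_push[OF assms(1-3)] by (simp add: left_cosets_def)
qed (auto intro: addsubD[OF chains_addsub])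

lemma push_act:
  assumes "K \<subseteq> carrier G" "T \<subseteq> carrier G" "g \<in> carrier G" "m \<in> chains_on (left_cosets G K)"
  shows "push G T (set_act G g m) = set_act G g (push G T m)"
  using assms(4)
proof (induction rule: chains_induct)
  case (one S)
  then have "S \<subseteq> carrier G" using left_cosets_Pow[OF assms(1)] by blast
  then show ?case using l_coset_set_mult[OF assms(3) _ assms(2)] by simp
qed simp_all

lemma l_coset_eq_iff:
  assumes "subgroup K G" "g \<in> carrier G" "h \<in> carrier G"
  shows "g <# K = h <# K \<longleftrightarrow> inv h \<otimes> g \<in> K"
proof -
  interpret K: subgroup K G by fact
  show ?thesis
  proof
    assume "g <# K = h <# K"
    moreover have "g \<in> g <# K" using K.one_closed assms(2) by (force simp: l_coset_def)
    ultimately obtain k where "k \<in> K" "g = h \<otimes> k" by (auto simp: l_coset_def)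
    then show "inv h \<otimes> g \<in> K" using assms by (simp add: m_assoc[symmetric])
  next
    assume k: "inv h \<otimes> g \<in> K"
    have "g <# K = (h \<otimes> (inv h \<otimes> g)) <# K" using assms by (simp add: m_assoc[symmetric])
    also have "\<dots> = h <# ((inv h \<otimes> g) <# K)" using assms by (simp add: lcos_m_assoc K.subset)
    also have "(inv h \<otimes> g) <# K = K" using coset_join3[OF _ assms(1) k] assms by simp
    finally show "g <# K = h <# K" .
  qed
qed

lemma l_coset_self_iff: "subgroup K G \<Longrightarrow> g \<in> carrier G \<Longrightarrow> g <# K = K \<longleftrightarrow> g \<in> K"
  using l_coset_eq_iff[of K g \<one>] by (simp add: lcos_mult_one subgroup.subset)

lemma lookup_set_act:
  assumes "T \<subseteq> carrier G" "g \<in> carrier G" "m \<in> chains_on (left_cosets G T)" "S \<subseteq> carrier G"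
  shows "poly_mapping.lookup (set_act G g m) S = poly_mapping.lookup m (inv g <# S)"
  using assms(3)
proof (induction rule: chains_induct)
  case (one U)
  then have U: "U \<subseteq> carrier G" using left_cosets_Pow[OF assms(1)] by blast
  have "S = g <# U \<longleftrightarrow> inv g <# S = U"
    using lcos_m_assoc[of U "inv g" g] lcos_m_assoc[of S g "inv g"] assms(2,4) U by (auto simp: lcos_mult_one)
  then show ?case by auto
qed (simp_all add: lookup_minus)

lemma derivation_one:
  assumes "T \<subseteq> carrier G" "derivation G (left_cosets G T) d"
  shows "d \<one> = 0"
proof -
  have c: "d \<one> \<in> chains_on (left_cosets G T)" using assms(2) by (simp add: derivation_def)
  have "d (\<one> \<otimes> \<one>) = d \<one> + set_act G \<one> (d \<one>)"
    using assms(2) unfolding derivation_def by blast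
  then show ?thesis by (simp add: gmodD(4)[OF set_act_gmod[OF assms(1)] c])
qed

lemma derivation_inv:
  assumes "T \<subseteq> carrier G" "derivation G (left_cosets G T) d" "g \<in> carrier G"
  shows "d (inv g) = - set_act G (inv g) (d g)"
proof -
  have "d (inv g \<otimes> g) = d (inv g) + set_act G (inv g) (d g)"
    using assms(2) inv_closed[OF assms(3)] assms(3) unfolding derivation_def by blast
  then show ?thesis using derivation_one[OF assms(1,2)] assms(3) by (simp add: eq_neg_iff_add_eq_0)
qed

lemma derivation_eq_on_generators:
  assumes "T \<subseteq> carrier G" "derivation G (left_cosets G T) d" "derivation G (left_cosets G T) d'"
    "S \<subseteq> carrier G" "\<And>s. s \<in> S \<Longrightarrow> d s = d' s" "g \<in> generate G S"
  shows "d g = d' g"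
  using assms(6)
proof (induction rule: generate.induct)
  case one
  then show ?case using derivation_one[OF assms(1,2)] derivation_one[OF assms(1,3)] by simp
next
  case (incl h)
  then show ?case by (rule assms(5))
next
  case (inv h)
  then have "h \<in> carrier G" using assms(4) by blast
  then show ?case using derivation_inv[OF assms(1,2)] derivation_inv[OF assms(1,3)] assms(5)[OF inv] by simp
next
  case (eng g h)
  have c: "g \<in> carrier G" "h \<in> carrier G" using eng(1,2) generate_in_carrier[OF assms(4)] by auto
  have "d (g \<otimes> h) = d g + set_act G g (d h)" "d' (g \<otimes> h) = d' g + set_act G g (d' h)"
    using assms(2,3) c by (auto simp: derivation_def)
  then show ?case using eng(3,4) by simp
qed

lemma principal_derivation:
  assumes "T \<subseteq> carrier G" "m \<in> chains_on (left_cosets G T)"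
  shows "derivation G (left_cosets G T) (\<lambda>g. set_act G g m - m)"
  unfolding derivation_def
  using gmodD(2)[OF set_act_gmod[OF assms(1)] _ assms(2)] gmodD(5)[OF set_act_gmod[OF assms(1)] _ _ assms(2)]
    addsubD(4)[OF chains_addsub _ assms(2)]
  by auto

lemma push_derivation:
  assumes "subgroup K G" "T \<subseteq> carrier G" "\<And>c. c \<in> K \<Longrightarrow> c <# T = T" "derivation G (left_cosets G K) d"
  shows "derivation G (left_cosets G T) (\<lambda>g. push G T (d g))"
  unfolding derivation_def
proof (intro conjI ballI)
  have dc: "d g \<in> chains_on (left_cosets G K)" if "g \<in> carrier G" for g using assms(4) that by (auto simp: derivation_def)
  show "push G T (d g) \<in> chains_on (left_cosets G T)" if "g \<in> carrier G" for g
    by (rule push_closed[OF assms(1-3) dc[OF that]])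
  fix g h assume g: "g \<in> carrier G" and h: "h \<in> carrier G"
  have "d (g \<otimes> h) = d g + set_act G g (d h)" using assms(4) g h by (auto simp: derivation_def)
  then show "push G T (d (g \<otimes> h)) = push G T (d g) + set_act G g (push G T (d h))"
    using push_act[OF subgroup.subset[OF assms(1)] assms(2) g dc[OF h]] by simp
qed

end

section \<open>Divisibility modulo the index\<close>

text \<open>Divisibility of all coefficients. For n = 0 it says that the chain is zero.\<close>

definition frag_dvd :: "int \<Rightarrow> ('a \<Rightarrow>\<^sub>0 int) \<Rightarrow> bool" where
  "frag_dvd n m \<longleftrightarrow> (\<forall>x. n dvd poly_mapping.lookup m x)"

lemma frag_dvd_augmentation:
  assumes "frag_dvd n m"
  shows "n dvd augmentation m"
proof -
  have "augmentation m = (\<Sum>x\<in>Poly_Mapping.keys m. poly_mapping.lookup m x)"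
    by (subst (1) frag_expansion) (simp add: frag_extend_def augmentation_sum)
  then show ?thesis using assms by (auto simp: frag_dvd_def intro: dvd_sum)
qed

lemma frag_dvd_push:
  assumes "frag_dvd n m"
  shows "frag_dvd n (push G T m)"
  using assms unfolding frag_dvd_def push_def frag_extend_def lookup_frag_sum
  by (auto intro!: dvd_sum)

lemma frag_dvd_diff: "frag_dvd n m \<Longrightarrow> frag_dvd n m' \<Longrightarrow> frag_dvd n (m - m')"
  by (simp add: frag_dvd_def lookup_minus)

context group
begin

text \<open>
  The coefficients of an invariant chain are constant modulo n, and on an infinite set of cosets
  one of them is zero.
\<close>

lemma invariant_chain_dvd:
  assumes "subgroup A G" "infinite (left_cosets G A)" "m \<in> chains_on (left_cosets G A)"
    "\<And>g. g \<in> carrier G \<Longrightarrow> frag_dvd n (set_act G g m - m)"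
  shows "frag_dvd n m"
proof (rule ccontr)
  assume "\<not> frag_dvd n m"
  then obtain S where S: "\<not> n dvd poly_mapping.lookup m S" by (auto simp: frag_dvd_def)
  interpret A: subgroup A G by fact
  have "poly_mapping.lookup m S \<noteq> 0" using S by auto
  then have "S \<in> Poly_Mapping.keys m" by (simp add: in_keys_iff)
  then obtain h where h: "h \<in> carrier G" "S = h <# A" using assms(3) by (auto simp: chains_on_def left_cosets_def)
  have "left_cosets G A \<subseteq> Poly_Mapping.keys m"
  proof
    fix U assume "U \<in> left_cosets G A"
    then obtain g where g: "g \<in> carrier G" "U = g <# A" by (auto simp: left_cosets_def)
    let ?k = "h \<otimes> inv g"
    have k: "?k \<in> carrier G" using g h by simp
    have e: "inv ?k <# S = U" using g h by (simp add: lcos_m_assoc A.subset inv_mult_group m_assoc)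
    have "S \<subseteq> carrier G" using l_coset_carrier[OF h(1) A.subset] h(2) by simp
    then have "poly_mapping.lookup (set_act G ?k m) S = poly_mapping.lookup m U"
      using lookup_set_act[OF A.subset k assms(3)] e by simp
    moreover have "n dvd poly_mapping.lookup (set_act G ?k m - m) S"
      using assms(4)[OF k] by (simp add: frag_dvd_def)
    ultimately have d: "n dvd poly_mapping.lookup m U - poly_mapping.lookup m S"
      by (simp add: lookup_minus)
    have "\<not> n dvd poly_mapping.lookup m U"
    proof
      assume "n dvd poly_mapping.lookup m U"
      from dvd_diff[OF this d] show False using S by simp
    qed
    then have "poly_mapping.lookup m U \<noteq> 0" by auto
    then show "U \<in> Poly_Mapping.keys m" by (simp add: in_keys_iff)
  qed
  from finite_subset[OF this finite_keys] show False using assms(2) by blast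
qed

end

text \<open>
  The equivariant map to chains on G/C whose coefficient at the coset C is the norm of \<open>\<theta>\<close>. The
  coefficient at g C has to be the norm at the translate by the inverse of g.
\<close>

definition norm_chain :: "('g, 'm) monoid_scheme \<Rightarrow> 'g set \<Rightarrow> ('g \<Rightarrow> 'a \<Rightarrow> 'a) \<Rightarrow> ('a \<Rightarrow> int) \<Rightarrow> 'a \<Rightarrow> 'g set \<Rightarrow>\<^sub>0 int" where
  "norm_chain G C \<alpha> \<theta> x =
     frag_of_fun (left_cosets G C) (\<lambda>S. norm_over C \<alpha> \<theta> (\<alpha> (inv\<^bsub>G\<^esub> (SOME g. g \<in> carrier G \<and> S = g <#\<^bsub>G\<^esub> C)) x))"

lemma norm_chain:
  assumes "group G" "subgroup C G" "gmod G (carrier G) M \<alpha>" "\<theta> \<in> dual_mod (carrier G) M \<alpha>" "x \<in> M"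
  shows "norm_chain G C \<alpha> \<theta> x \<in> chains_on (left_cosets G C)"
    "g \<in> carrier G \<Longrightarrow> poly_mapping.lookup (norm_chain G C \<alpha> \<theta> x) (g <#\<^bsub>G\<^esub> C) = norm_over C \<alpha> \<theta> (\<alpha> (inv\<^bsub>G\<^esub> g) x)"
proof -
  interpret G: group G by fact
  interpret C: subgroup C G by fact
  note MD = gmodD[OF assms(3)]
  let ?s = "\<lambda>S. SOME g. g \<in> carrier G \<and> S = g <#\<^bsub>G\<^esub> C"
  let ?u = "\<lambda>S. norm_over C \<alpha> \<theta> (\<alpha> (inv\<^bsub>G\<^esub> ?s S) x)"
  have s: "?s S \<in> carrier G \<and> S = ?s S <#\<^bsub>G\<^esub> C" if "S \<in> left_cosets G C" for S
  proof -
    have "\<exists>g. g \<in> carrier G \<and> S = g <#\<^bsub>G\<^esub> C" using that by (auto simp: left_cosets_def)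
    then show ?thesis by (rule someI_ex)
  qed
  have u: "?u (g <#\<^bsub>G\<^esub> C) = norm_over C \<alpha> \<theta> (\<alpha> (inv\<^bsub>G\<^esub> g) x)" if g: "g \<in> carrier G" for g
  proof -
    let ?h = "?s (g <#\<^bsub>G\<^esub> C)"
    have "g <#\<^bsub>G\<^esub> C \<in> left_cosets G C" using g by (simp add: left_cosets_def)
    from s[OF this] have h: "?h \<in> carrier G" "g <#\<^bsub>G\<^esub> C = ?h <#\<^bsub>G\<^esub> C" by blast+
    have c: "inv\<^bsub>G\<^esub> ?h \<otimes>\<^bsub>G\<^esub> g \<in> C" using h G.l_coset_eq_iff[OF assms(2) g h(1)] by simp
    have "\<alpha> (inv\<^bsub>G\<^esub> ?h) x = \<alpha> ((inv\<^bsub>G\<^esub> ?h \<otimes>\<^bsub>G\<^esub> g) \<otimes>\<^bsub>G\<^esub> inv\<^bsub>G\<^esub> g) x"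
      using g h(1) by (simp add: G.m_assoc)
    also have "\<dots> = \<alpha> (inv\<^bsub>G\<^esub> ?h \<otimes>\<^bsub>G\<^esub> g) (\<alpha> (inv\<^bsub>G\<^esub> g) x)" using g h(1) assms(5) by (intro MD(5)) auto
    finally show ?thesis
      using norm_over_act[OF assms(1) G.subgroup_self assms(3,2) C.subset c MD(2)[OF G.inv_closed[OF g] assms(5)]] by simp
  qed
  have "{S \<in> left_cosets G C. ?u S \<noteq> 0} \<subseteq> (\<lambda>k. inv\<^bsub>G\<^esub> k <#\<^bsub>G\<^esub> C) ` {k \<in> carrier G. \<theta> (\<alpha> k x) \<noteq> 0}"
  proof
    fix S assume "S \<in> {S \<in> left_cosets G C. ?u S \<noteq> 0}"
    then obtain g where g: "g \<in> carrier G" "S = g <#\<^bsub>G\<^esub> C" and nz: "?u S \<noteq> 0" by (auto simp: left_cosets_def)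
    then have "norm_over C \<alpha> \<theta> (\<alpha> (inv\<^bsub>G\<^esub> g) x) \<noteq> 0" using u by simp
    then obtain c where c: "c \<in> C" "\<theta> (\<alpha> c (\<alpha> (inv\<^bsub>G\<^esub> g) x)) \<noteq> 0"
      by (cases "\<exists>c\<in>C. \<theta> (\<alpha> c (\<alpha> (inv\<^bsub>G\<^esub> g) x)) \<noteq> 0") (auto simp: norm_over_def)
    have cG: "c \<in> carrier G" using c(1) by simp
    have k: "\<theta> (\<alpha> (c \<otimes>\<^bsub>G\<^esub> inv\<^bsub>G\<^esub> g) x) \<noteq> 0" using c(2) MD(5)[OF cG G.inv_closed[OF g(1)] assms(5)] by simp
    have "S = inv\<^bsub>G\<^esub> (c \<otimes>\<^bsub>G\<^esub> inv\<^bsub>G\<^esub> g) <#\<^bsub>G\<^esub> C"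
      unfolding g(2) using g(1) cG c(1) by (subst G.l_coset_eq_iff[OF assms(2)]) (simp_all add: G.inv_mult_group G.m_assoc)
    then show "S \<in> (\<lambda>k. inv\<^bsub>G\<^esub> k <#\<^bsub>G\<^esub> C) ` {k \<in> carrier G. \<theta> (\<alpha> k x) \<noteq> 0}"
      by (rule image_eqI) (use k cG g(1) in simp)
  qed
  then have fin: "finite {S \<in> left_cosets G C. ?u S \<noteq> 0}"
    by (rule finite_subset) (rule finite_imageI[OF dual_modD(3)[OF assms(4,5)]])
  show "norm_chain G C \<alpha> \<theta> x \<in> chains_on (left_cosets G C)"
    using keys_frag_of_fun[OF fin] by (simp add: chains_on_def norm_chain_def)
  show "poly_mapping.lookup (norm_chain G C \<alpha> \<theta> x) (g <#\<^bsub>G\<^esub> C) = norm_over C \<alpha> \<theta> (\<alpha> (inv\<^bsub>G\<^esub> g) x)"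
    if g: "g \<in> carrier G"
    unfolding norm_chain_def lookup_frag_of_fun[OF fin] using u[OF g] g by (simp add: left_cosets_def)
qed

lemma chain_coset_eqI:
  assumes "x \<in> chains_on \<Omega>" "y \<in> chains_on \<Omega>" "\<And>S. S \<in> \<Omega> \<Longrightarrow> poly_mapping.lookup x S = poly_mapping.lookup y S"
  shows "x = y"
  using frag_eqI[of x \<Omega> y] assms by (simp add: chains_on_def)

lemma norm_chain_equivariant:
  assumes "group G" "subgroup C G" "gmod G (carrier G) M \<alpha>" "\<theta> \<in> dual_mod (carrier G) M \<alpha>"
  shows "x \<in> M \<Longrightarrow> y \<in> M \<Longrightarrow> norm_chain G C \<alpha> \<theta> (x + y) = norm_chain G C \<alpha> \<theta> x + norm_chain G C \<alpha> \<theta> y"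
    "x \<in> M \<Longrightarrow> h \<in> carrier G \<Longrightarrow> norm_chain G C \<alpha> \<theta> (\<alpha> h x) = set_act G h (norm_chain G C \<alpha> \<theta> x)"
proof -
  interpret G: group G by fact
  interpret C: subgroup C G by fact
  note MD = gmodD[OF assms(3)] and nc = norm_chain[OF assms]
  note na = norm_over_addmap_right[OF assms(3,4) C.subset]
  show "norm_chain G C \<alpha> \<theta> (x + y) = norm_chain G C \<alpha> \<theta> x + norm_chain G C \<alpha> \<theta> y" if x: "x \<in> M" and y: "y \<in> M"
  proof (rule chain_coset_eqI[OF nc(1)[OF addsubD(2)[OF MD(1) x y]] addsubD(2)[OF chains_addsub nc(1)[OF x] nc(1)[OF y]]])
    fix S assume "S \<in> left_cosets G C"
    then obtain g where g: "g \<in> carrier G" "S = g <#\<^bsub>G\<^esub> C" by (auto simp: left_cosets_def)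
    note i = G.inv_closed[OF g(1)]
    show "poly_mapping.lookup (norm_chain G C \<alpha> \<theta> (x + y)) S = poly_mapping.lookup (norm_chain G C \<alpha> \<theta> x + norm_chain G C \<alpha> \<theta> y) S"
      unfolding g(2) lookup_add nc(2)[OF x g(1)] nc(2)[OF y g(1)] nc(2)[OF addsubD(2)[OF MD(1) x y] g(1)] addmap_add[OF MD(3)[OF i] x y]
      by (rule addmap_add[OF na MD(2)[OF i x] MD(2)[OF i y]])
  qed
  show "norm_chain G C \<alpha> \<theta> (\<alpha> h x) = set_act G h (norm_chain G C \<alpha> \<theta> x)" if x: "x \<in> M" and h: "h \<in> carrier G"
  proof (rule chain_coset_eqI[OF nc(1)[OF MD(2)[OF h x]] gmodD(2)[OF G.set_act_gmod[OF C.subset] h nc(1)[OF x]]])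
    fix S assume "S \<in> left_cosets G C"
    then obtain g where g: "g \<in> carrier G" "S = g <#\<^bsub>G\<^esub> C" by (auto simp: left_cosets_def)
    have ig: "inv\<^bsub>G\<^esub> h \<otimes>\<^bsub>G\<^esub> g \<in> carrier G" using g h by simp
    have SC: "S \<subseteq> carrier G" unfolding g(2) by (rule G.l_coset_carrier[OF g(1) C.subset])
    have "poly_mapping.lookup (set_act G h (norm_chain G C \<alpha> \<theta> x)) S = poly_mapping.lookup (norm_chain G C \<alpha> \<theta> x) (inv\<^bsub>G\<^esub> h <#\<^bsub>G\<^esub> S)"
      by (rule G.lookup_set_act[OF C.subset h nc(1)[OF x] SC])
    also have "inv\<^bsub>G\<^esub> h <#\<^bsub>G\<^esub> S = (inv\<^bsub>G\<^esub> h \<otimes>\<^bsub>G\<^esub> g) <#\<^bsub>G\<^esub> C"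
      unfolding g(2) using g(1) h by (simp add: G.lcos_m_assoc C.subset)
    also have "poly_mapping.lookup (norm_chain G C \<alpha> \<theta> x) ((inv\<^bsub>G\<^esub> h \<otimes>\<^bsub>G\<^esub> g) <#\<^bsub>G\<^esub> C) = norm_over C \<alpha> \<theta> (\<alpha> (inv\<^bsub>G\<^esub> (inv\<^bsub>G\<^esub> h \<otimes>\<^bsub>G\<^esub> g)) x)" by (rule nc(2)[OF x ig])
    also have "inv\<^bsub>G\<^esub> (inv\<^bsub>G\<^esub> h \<otimes>\<^bsub>G\<^esub> g) = inv\<^bsub>G\<^esub> g \<otimes>\<^bsub>G\<^esub> h" using g(1) h by (simp add: G.inv_mult_group)
    also have "\<alpha> (inv\<^bsub>G\<^esub> g \<otimes>\<^bsub>G\<^esub> h) x = \<alpha> (inv\<^bsub>G\<^esub> g) (\<alpha> h x)" by (rule MD(5)[OF G.inv_closed[OF g(1)] h x])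
    also have "norm_over C \<alpha> \<theta> (\<alpha> (inv\<^bsub>G\<^esub> g) (\<alpha> h x)) = poly_mapping.lookup (norm_chain G C \<alpha> \<theta> (\<alpha> h x)) S"
      unfolding g(2) by (rule nc(2)[OF MD(2)[OF h x] g(1), symmetric])
    finally show "poly_mapping.lookup (norm_chain G C \<alpha> \<theta> (\<alpha> h x)) S = poly_mapping.lookup (set_act G h (norm_chain G C \<alpha> \<theta> x)) S" by simp
  qed
qed


text \<open>
  The cosets of C' that are mapped to C are those contained in C. Representatives of right cosets
  are used because norms are taken over right cosets; their inverses represent left cosets.
\<close>

lemma lookup_push_reps:
  assumes "group G" "subgroup C G" "subgroup C' G" "C' \<subseteq> C" "m \<in> chains_on (left_cosets G C')"
    and R: "finite R" "R \<subseteq> C" "independent_reps G C' R"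
      "\<And>g. g \<in> C \<Longrightarrow> g <#\<^bsub>G\<^esub> C' \<in> Poly_Mapping.keys m \<Longrightarrow> \<exists>l\<in>C'. \<exists>r\<in>R. inv\<^bsub>G\<^esub> g = l \<otimes>\<^bsub>G\<^esub> r"
  shows "poly_mapping.lookup (push G C m) C = (\<Sum>r\<in>R. poly_mapping.lookup m (inv\<^bsub>G\<^esub> r <#\<^bsub>G\<^esub> C'))"
proof -
  interpret G: group G by fact
  interpret C: subgroup C G by fact
  interpret C': subgroup C' G by fact
  have Rc: "r \<in> carrier G" if "r \<in> R" for r using that R(2) by auto
  have pc: "(g <#\<^bsub>G\<^esub> C') <#>\<^bsub>G\<^esub> C = g <#\<^bsub>G\<^esub> C" if "g \<in> carrier G" for g
  proof (rule G.l_coset_push[OF assms(3) C.subset _ that])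
    fix c assume "c \<in> C'"
    then have "c \<in> C" using assms(4) by blast
    then show "c <#\<^bsub>G\<^esub> C = C" by (simp add: G.l_coset_self_iff[OF assms(2)])
  qed
  let ?f = "\<lambda>r. inv\<^bsub>G\<^esub> r <#\<^bsub>G\<^esub> C'"
  have inj: "inj_on ?f R"
  proof (rule inj_onI)
    fix r s assume r: "r \<in> R" and s: "s \<in> R" and e: "?f r = ?f s"
    have "inv\<^bsub>G\<^esub> (inv\<^bsub>G\<^esub> s) \<otimes>\<^bsub>G\<^esub> inv\<^bsub>G\<^esub> r \<in> C'"
      using e G.l_coset_eq_iff[OF assms(3) G.inv_closed[OF Rc[OF r]] G.inv_closed[OF Rc[OF s]]] by blast
    then have sr: "s \<otimes>\<^bsub>G\<^esub> inv\<^bsub>G\<^esub> r \<in> C'" using Rc[OF s] by simp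
    have "s = (s \<otimes>\<^bsub>G\<^esub> inv\<^bsub>G\<^esub> r) \<otimes>\<^bsub>G\<^esub> r" using Rc[OF r] Rc[OF s] by (simp add: G.m_assoc)
    then have "s = r" using R(3) r s sr unfolding independent_reps_def by blast
    then show "r = s" by simp
  qed
  let ?K = "{T \<in> Poly_Mapping.keys m. T <#>\<^bsub>G\<^esub> C = C}"
  have sub: "?K \<subseteq> ?f ` R"
  proof
    fix T assume T: "T \<in> ?K"
    then obtain g where g: "g \<in> carrier G" "T = g <#\<^bsub>G\<^esub> C'" using assms(5) by (auto simp: chains_on_def left_cosets_def)
    have "g <#\<^bsub>G\<^esub> C = C" using T pc[OF g(1)] g(2) by simp
    then have gC: "g \<in> C" using G.l_coset_self_iff[OF assms(2) g(1)] by simp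
    obtain l r where lr: "l \<in> C'" "r \<in> R" "inv\<^bsub>G\<^esub> g = l \<otimes>\<^bsub>G\<^esub> r" using R(4)[OF gC] T g(2) by blast
    have rc: "r \<in> carrier G" by (rule Rc[OF lr(2)])
    have "inv\<^bsub>G\<^esub> (inv\<^bsub>G\<^esub> g) = inv\<^bsub>G\<^esub> (l \<otimes>\<^bsub>G\<^esub> r)" using lr(3) by simp
    then have "g = inv\<^bsub>G\<^esub> r \<otimes>\<^bsub>G\<^esub> inv\<^bsub>G\<^esub> l" using g(1) rc lr(1) by (simp add: G.inv_mult_group)
    then have "inv\<^bsub>G\<^esub> (inv\<^bsub>G\<^esub> r) \<otimes>\<^bsub>G\<^esub> g \<in> C'" using rc lr(1) by (simp add: G.m_assoc[symmetric])
    then have "T = ?f r" unfolding g(2) using G.l_coset_eq_iff[OF assms(3) g(1) G.inv_closed[OF rc]] by blast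
    then show "T \<in> ?f ` R" using lr(2) by blast
  qed
  have fC: "?f r <#>\<^bsub>G\<^esub> C = C" if "r \<in> R" for r
    using pc[OF G.inv_closed[OF Rc[OF that]]] G.l_coset_self_iff[OF assms(2) G.inv_closed[OF Rc[OF that]]] R(2) that by auto
  have "poly_mapping.lookup (push G C m) C = (\<Sum>T\<in>Poly_Mapping.keys m. poly_mapping.lookup m T * (if C = T <#>\<^bsub>G\<^esub> C then 1 else 0))"
    unfolding push_def frag_extend_def lookup_frag_sum by simp
  also have "\<dots> = (\<Sum>T\<in>?K. poly_mapping.lookup m T)"
    by (rule sum.mono_neutral_cong_right) auto
  also have "\<dots> = (\<Sum>T\<in>?f ` R. poly_mapping.lookup m T)"
    using fC by (intro sum.mono_neutral_left sub) (auto simp: R(1) in_keys_iff)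
  also have "\<dots> = (\<Sum>r\<in>R. poly_mapping.lookup m (?f r))" by (simp add: sum.reindex[OF inj])
  finally show ?thesis .
qed

text \<open>
  A derivation D defines an extension of the trivial module of integers by the chains, in which g
  maps (m, k) to (g m + k D g, k). The augmentation of the resolution lifts to this extension, and
  \<open>\<sigma>\<close> is the first component of the lift.
\<close>

lemma derivation_cochain:
  assumes "group G" "K \<subseteq> carrier G" "derivation G (left_cosets G K) D"
    and M: "resolution G (carrier G) (\<lambda>_. 1) M \<alpha> d \<epsilon>" and db: "dual_basis G (carrier G) (M 0) (\<alpha> 0) J b \<kappa>"
  obtains \<sigma> where "\<forall>x\<in>M 0. \<sigma> x \<in> chains_on (left_cosets G K)" "\<forall>x\<in>M 0. \<forall>y\<in>M 0. \<sigma> (x + y) = \<sigma> x + \<sigma> y"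
    "\<forall>g\<in>carrier G. \<forall>x\<in>M 0. \<sigma> (\<alpha> 0 g x) = set_act G g (\<sigma> x) + frag_cmul (\<epsilon> x) (D g)"
proof -
  interpret G: group G by fact
  let ?Ch = "chains_on (left_cosets G K)"
  let ?E = "?Ch \<times> (UNIV :: int set)"
  let ?a = "\<lambda>g p. (set_act G g (fst p) + frag_cmul (snd p) (D g), snd p)"
  note SD = gmodD[OF G.set_act_gmod[OF assms(2)]] and ca = addsubD[OF chains_addsub[of "left_cosets G K"]]
  have DC: "D g \<in> ?Ch" if "g \<in> carrier G" for g using assms(3) that by (simp add: derivation_def)
  have Dm: "D (g \<otimes>\<^bsub>G\<^esub> h) = D g + set_act G g (D h)" if "g \<in> carrier G" "h \<in> carrier G" for g h
    using assms(3) that unfolding derivation_def by blast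
  have E: "gmod G (carrier G) ?E ?a"
    unfolding gmod_def
  proof (intro conjI ballI)
    show "addsub ?E"
      unfolding addsub_def
    proof (intro conjI ballI)
      show "0 \<in> ?E" using ca(1) by (simp add: zero_prod_def)
      fix p q assume "p \<in> ?E" "q \<in> ?E"
      then show "p + q \<in> ?E" using ca(2)[of "fst p" "fst q"] by (simp add: mem_Times_iff)
    next
      fix p assume "p \<in> ?E"
      then show "- p \<in> ?E" using ca(3)[of "fst p"] by (simp add: mem_Times_iff)
    qed
    fix g assume g: "g \<in> carrier G"
    show "?a g ` ?E \<subseteq> ?E"
    proof (rule image_subsetI)
      fix p assume "p \<in> ?E"
      then have "fst p \<in> ?Ch" by (simp add: mem_Times_iff)
      then show "?a g p \<in> ?E" using ca(2)[OF SD(2)[OF g] chains_cmul[OF DC[OF g]]] by simp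
    qed
    show "addmap ?E (?a g)"
      unfolding addmap_def
    proof (intro ballI)
      fix p q assume "p \<in> ?E" "q \<in> ?E"
      then have "fst p \<in> ?Ch" "fst q \<in> ?Ch" by (simp_all add: mem_Times_iff)
      then show "?a g (p + q) = ?a g p + ?a g q"
        using addmap_add[OF SD(3)[OF g]] by (simp add: frag_cmul_distrib)
    qed
    fix h p assume h: "h \<in> carrier G" and p: "p \<in> ?E"
    then have "fst p \<in> ?Ch" by (simp add: mem_Times_iff)
    then show "?a (g \<otimes>\<^bsub>G\<^esub> h) p = ?a g (?a h p)"
      using SD(5)[OF g h] by (simp add: Dm[OF g h] frag_cmul_distrib2)
  next
    fix p assume "p \<in> ?E"
    then have "fst p \<in> ?Ch" by (simp add: mem_Times_iff)
    then show "?a \<one>\<^bsub>G\<^esub> p = p" using SD(4) G.derivation_one[OF assms(2,3)] by simp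
  qed
  have Z: "gmod G (carrier G) UNIV (\<lambda>g k. 1 * k :: int)" by (simp add: gmod_def addmap_def)
  have p: "ghom (carrier G) ?E ?a UNIV (\<lambda>g k. 1 * k) snd" by (simp add: ghom_def addmap_def)
  have im: "\<epsilon> ` M 0 \<subseteq> snd ` ?E"
  proof
    fix k assume "k \<in> \<epsilon> ` M 0"
    show "k \<in> snd ` ?E" by (rule image_eqI[of _ _ "(0, k)"]) (simp_all add: ca(1))
  qed
  have "\<exists>L. ghom (carrier G) (M 0) (\<alpha> 0) ?E ?a L \<and> (\<forall>x\<in>M 0. snd (L x) = \<epsilon> x)"
    by (rule projective_lift[OF assms(1) G.subgroup_self G.subgroup_self subset_refl resolutionD(1)[OF M] db Z E p resolutionD(3)[OF M] im],
        rule exI, rule conjI, assumption, blast)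
  then obtain L where L: "ghom (carrier G) (M 0) (\<alpha> 0) ?E ?a L" "\<forall>x\<in>M 0. snd (L x) = \<epsilon> x" by blast
  show thesis
  proof (rule that[of "\<lambda>x. fst (L x)"])
    show "\<forall>x\<in>M 0. fst (L x) \<in> ?Ch" using ghomD(1)[OF L(1)] by (auto simp: mem_Times_iff)
    show "\<forall>x\<in>M 0. \<forall>y\<in>M 0. fst (L (x + y)) = fst (L x) + fst (L y)" using addmap_add[OF ghomD(2)[OF L(1)]] by simp
    show "\<forall>g\<in>carrier G. \<forall>x\<in>M 0. fst (L (\<alpha> 0 g x)) = set_act G g (fst (L x)) + frag_cmul (\<epsilon> x) (D g)"
      using ghomD(3)[OF L(1)] L(2) by simp
  qed
qed

text \<open>
  Duality in dimensions 3 and 2. The derivation is represented by a cochain \<open>\<sigma>\<close> as above. The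
  coefficient of \<open>\<sigma> d\<close> at the coset C' is an invariant cocycle, to which the transfer applies; the
  resulting form \<open>\<theta>\<close> corrects the push of \<open>\<sigma>\<close> to an equally twisted map that is divisible by the
  index on the kernel of the augmentation. Its value at an element of augmentation one is, up to
  sign, the chain x. The index is zero if it is infinite, and then the pushed derivation is inner.
\<close>

lemma PD3_derivation_divisible:
  fixes G :: "('g, 'm) monoid_scheme"
  assumes "PD_group 3 G" "subgroup C G" "PD_group 2 (G\<lparr>carrier := C\<rparr>)" "subgroup C' G" "C' \<subseteq> C"
    and D: "derivation G (left_cosets G C') D"
  obtains x where "x \<in> chains_on (left_cosets G C)"
    "\<forall>g\<in>carrier G. frag_dvd (int (card ((\<lambda>c. C' #>\<^bsub>G\<^esub> c) ` C))) (push G C (D g) - (set_act G g x - x))"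
proof -
  have "group G" using assms(1) by (simp add: PD_group_def type_FP_def)
  interpret G: group G by fact
  interpret C: subgroup C G by fact
  interpret C': subgroup C' G by fact
  let ?n = "int (card ((\<lambda>c. C' #>\<^bsub>G\<^esub> c) ` C))"
  let ?GC = "G\<lparr>carrier := C\<rparr>"
  \<comment> \<open>duality data for both groups\<close>
  obtain M :: "nat \<Rightarrow> ('g \<times> ('g \<times> nat \<Rightarrow>\<^sub>0 int) \<Rightarrow>\<^sub>0 int) set" and d \<epsilon> b \<kappa> w \<eta>
    and J :: "nat \<Rightarrow> ('g \<times> nat \<Rightarrow>\<^sub>0 int) set"
    where PG: "pd_data G (carrier G) 3 (\<lambda>_. 1) M (\<lambda>_. perm_act G) d \<epsilon> J b \<kappa> w \<eta>"
    and w: "\<forall>g\<in>carrier G. \<forall>h\<in>carrier G. w (g \<otimes>\<^bsub>G\<^esub> h) = w g * w h" "w \<one>\<^bsub>G\<^esub> = 1" "\<forall>g\<in>carrier G. w g \<in> {1, -1}"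
    by (rule PD_group_pd_data[OF assms(1) zero_less_numeral])
  obtain Q :: "nat \<Rightarrow> ('g \<times> ('g \<times> nat \<Rightarrow>\<^sub>0 int) \<Rightarrow>\<^sub>0 int) set" and e \<epsilon>' c \<mu> v \<eta>'
    and I :: "nat \<Rightarrow> ('g \<times> nat \<Rightarrow>\<^sub>0 int) set"
    where PC0: "pd_data ?GC (carrier ?GC) 2 (\<lambda>_. 1) Q (\<lambda>_. perm_act ?GC) e \<epsilon>' I c \<mu> v \<eta>'"
    and v0: "\<forall>g\<in>carrier ?GC. \<forall>h\<in>carrier ?GC. v (g \<otimes>\<^bsub>?GC\<^esub> h) = v g * v h" "v \<one>\<^bsub>?GC\<^esub> = 1" "\<forall>g\<in>carrier ?GC. v g \<in> {1, -1}"
    by (rule PD_group_pd_data[OF assms(3) zero_less_numeral])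
  have v: "v (g \<otimes>\<^bsub>G\<^esub> h) = v g * v h" "v g \<in> {1, -1}" if "g \<in> C" "h \<in> C" for g h
    using v0 that by auto
  have inv: "inv\<^bsub>?GC\<^esub> g = inv\<^bsub>G\<^esub> g" if "g \<in> C" for g
    using G.m_inv_consistent[OF assms(2) that] .
  have gm: "gmod ?GC C N \<alpha> = gmod G C N \<alpha>" for N and \<alpha> :: "'g \<Rightarrow> 'z::ab_group_add \<Rightarrow> 'z" by (simp add: gmod_def)
  have ds: "dsupp ?GC C \<alpha> JJ kk y = dsupp G C \<alpha> JJ kk y" for \<alpha> :: "'g \<Rightarrow> 'z \<Rightarrow> 'z" and JJ :: "'y set" and kk y
    unfolding dsupp_def using inv by auto
  have dbe: "dual_basis ?GC C N \<alpha> JJ bb kk = dual_basis G C N \<alpha> JJ bb kk"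
    for N and \<alpha> :: "'g \<Rightarrow> 'z::ab_group_add \<Rightarrow> 'z" and JJ :: "'y set" and bb kk
  proof -
    have "(\<Sum>(g, j)\<in>dsupp G C \<alpha> JJ kk x. iscale (kk j (\<alpha> (inv\<^bsub>?GC\<^esub> g) x)) (\<alpha> g (bb j))) =
        (\<Sum>(g, j)\<in>dsupp G C \<alpha> JJ kk x. iscale (kk j (\<alpha> (inv\<^bsub>G\<^esub> g) x)) (\<alpha> g (bb j)))" for x
      by (rule sum.cong[OF HOL.refl]) (auto simp: dsupp_def inv)
    then show ?thesis by (simp add: dual_basis_def ds)
  qed
  have rs: "resolution ?GC C = (resolution G C :: _ \<Rightarrow> (nat \<Rightarrow> 'z::ab_group_add set) \<Rightarrow> _)"
    by (simp add: resolution_def gm fun_eq_iff)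
  have da: "dual_act ?GC C N \<alpha> = dual_act G C N \<alpha>" for N and \<alpha> :: "'g \<Rightarrow> 'z \<Rightarrow> 'z"
    using inv by (auto simp: dual_act_def fun_eq_iff)
  have PC: "pd_data G C 2 (\<lambda>_. 1) Q (\<lambda>_. perm_act ?GC) e \<epsilon>' I c \<mu> v \<eta>'"
    using PC0 by (simp add: pd_data_def rs dbe da)
  define \<chi> where "\<chi> g = w g * v g" for g
  have wC: "w (g \<otimes>\<^bsub>G\<^esub> h) = w g * w h" "w g \<in> {1, -1}" if "g \<in> C" "h \<in> C" for g h
    using w that C.mem_carrier by auto
  have \<chi>: "\<chi> (g \<otimes>\<^bsub>G\<^esub> h) = \<chi> g * \<chi> h" "\<chi> g \<in> {1, -1}" if "g \<in> C" "h \<in> C" for g h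
    using v[OF that] wC[OF that] by (auto simp: \<chi>_def)
  \<comment> \<open>the resolution of C is twisted so that the orientation characters of C and G agree on C\<close>
  have PC1: "pd_data G C 2 (\<lambda>g. \<chi> g * 1) Q (\<lambda>i g x. iscale (\<chi> g) (perm_act ?GC g x)) e \<epsilon>' I c \<mu> (\<lambda>g. \<chi> g * v g) \<eta>'"
    by (rule pd_data_twist[OF \<open>group G\<close> assms(2) PC]) (use \<chi> in blast)+
  have \<chi>v: "\<chi> g * v g = w g" if "g \<in> C" for g
    using v(2)[OF that that] by (auto simp: \<chi>_def)
  have PC2: "pd_data G C 2 (\<lambda>g. \<chi> g * 1) Q (\<lambda>i g x. iscale (\<chi> g) (perm_act ?GC g x)) e \<epsilon>' I c \<mu> w \<eta>'"
    using PC1 \<chi>v by (simp add: pd_data_def)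
  have M: "resolution G (carrier G) (\<lambda>_. 1) M (\<lambda>_. perm_act G) d \<epsilon>"
    and db: "dual_basis G (carrier G) (M i) (perm_act G) (J i) (b i) (\<kappa> i)" for i
    using PG by (auto simp: pd_data_def)
  note MD = resolutionD[OF M] and MG = gmodD[OF resolutionD(1)[OF M]]
  obtain \<sigma> where \<sigma>: "\<forall>x\<in>M 0. \<sigma> x \<in> chains_on (left_cosets G C')" "\<forall>x\<in>M 0. \<forall>y\<in>M 0. \<sigma> (x + y) = \<sigma> x + \<sigma> y"
    "\<forall>g\<in>carrier G. \<forall>x\<in>M 0. \<sigma> (perm_act G g x) = set_act G g (\<sigma> x) + frag_cmul (\<epsilon> x) (D g)"
    by (rule derivation_cochain[OF \<open>group G\<close> C'.subset D M db])
  have \<sigma>add: "addmap (M 0) \<sigma>" using \<sigma>(2) by (simp add: addmap_def)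
  have d0: "d 0 y \<in> M 0" "\<epsilon> (d 0 y) = 0" if "y \<in> M (Suc 0)" for y using MD(5) that by auto
  \<comment> \<open>on boundaries the twist disappears, and the coefficient at the coset C' determines the others\<close>
  define s where "s y = poly_mapping.lookup (\<sigma> (d 0 y)) C'" for y
  have sg: "s (perm_act G g y) = poly_mapping.lookup (\<sigma> (d 0 y)) (inv\<^bsub>G\<^esub> g <#\<^bsub>G\<^esub> C')"
    if "g \<in> carrier G" "y \<in> M (Suc 0)" for g y
  proof -
    have "\<sigma> (d 0 (perm_act G g y)) = set_act G g (\<sigma> (d 0 y))"
      using \<sigma>(3) d0[OF that(2)] that(1) ghomD(3)[OF MD(2) that] by simp
    then show ?thesis
      unfolding s_def using G.lookup_set_act[OF C'.subset that(1) _ C'.subset] \<sigma>(1) d0(1)[OF that(2)] by simp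
  qed
  have sinv: "s \<in> inv_mod G (carrier G) C' (M (Suc 0)) (perm_act G)"
    unfolding inv_mod_def mem_Collect_eq
  proof (intro conjI ballI)
    show "addmap (M (Suc 0)) s"
      using d0(1) by (simp add: addmap_def s_def addmap_add[OF ghomD(2)[OF MD(2)]] addmap_add[OF \<sigma>add] lookup_add)
  next
    fix l y assume l: "l \<in> C'" and y: "y \<in> M (Suc 0)"
    have "inv\<^bsub>G\<^esub> l <#\<^bsub>G\<^esub> C' = C'" using G.l_coset_self_iff[OF assms(4)] l by simp
    then show "s (perm_act G l y) = s y" using sg[OF C'.mem_carrier[OF l] y] by (simp add: s_def)
  next
    fix y assume y: "y \<in> M (Suc 0)"
    let ?K = "Poly_Mapping.keys (\<sigma> (d 0 y))"
    have "\<forall>S\<in>?K. \<exists>f\<in>carrier G. S = inv\<^bsub>G\<^esub> f <#\<^bsub>G\<^esub> C'"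
    proof
      fix S assume "S \<in> ?K"
      then have "S \<in> left_cosets G C'" using \<sigma>(1) d0(1)[OF y] by (auto simp: chains_on_def)
      then obtain g where "g \<in> carrier G" "S = g <#\<^bsub>G\<^esub> C'" by (auto simp: left_cosets_def)
      then show "\<exists>f\<in>carrier G. S = inv\<^bsub>G\<^esub> f <#\<^bsub>G\<^esub> C'" by (intro bexI[of _ "inv\<^bsub>G\<^esub> g"]) auto
    qed
    from bchoice[OF this[unfolded Bex_def]] obtain F where F: "\<forall>S\<in>?K. F S \<in> carrier G \<and> S = inv\<^bsub>G\<^esub> F S <#\<^bsub>G\<^esub> C'" by blast
    show "\<exists>F. finite F \<and> F \<subseteq> carrier G \<and>
        (\<forall>g\<in>carrier G. s (perm_act G g y) \<noteq> 0 \<longrightarrow> (\<exists>l\<in>C'. \<exists>f\<in>F. g = l \<otimes>\<^bsub>G\<^esub> f))"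
    proof (intro exI conjI ballI impI)
      show "finite (F ` ?K)" by simp
      show "F ` ?K \<subseteq> carrier G" using F by blast
      fix g assume g: "g \<in> carrier G" and "s (perm_act G g y) \<noteq> 0"
      then have k: "inv\<^bsub>G\<^esub> g <#\<^bsub>G\<^esub> C' \<in> ?K" using sg[OF g y] by (simp add: in_keys_iff)
      let ?f = "F (inv\<^bsub>G\<^esub> g <#\<^bsub>G\<^esub> C')"
      have f: "?f \<in> carrier G" "inv\<^bsub>G\<^esub> g <#\<^bsub>G\<^esub> C' = inv\<^bsub>G\<^esub> ?f <#\<^bsub>G\<^esub> C'" using F k by blast+
      have "inv\<^bsub>G\<^esub> (inv\<^bsub>G\<^esub> g) \<otimes>\<^bsub>G\<^esub> inv\<^bsub>G\<^esub> ?f \<in> C'"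
        using G.l_coset_eq_iff[OF assms(4) G.inv_closed[OF f(1)] G.inv_closed[OF g]] f(2) by simp
      moreover have "g = (inv\<^bsub>G\<^esub> (inv\<^bsub>G\<^esub> g) \<otimes>\<^bsub>G\<^esub> inv\<^bsub>G\<^esub> ?f) \<otimes>\<^bsub>G\<^esub> ?f" using g f(1) by (simp add: G.m_assoc)
      ultimately show "\<exists>l\<in>C'. \<exists>f\<in>F ` ?K. g = l \<otimes>\<^bsub>G\<^esub> f" using k by blast
    qed
  qed
  have sz: "s (d (Suc 0) x) = 0" if "x \<in> M (Suc (Suc 0))" for x
  proof -
    have "d 0 (d (Suc 0) x) = 0" using MD(6)[of 0] that by auto
    then show ?thesis using addmap_0[OF \<sigma>add MG(1)] by (simp add: s_def)
  qed
  have \<chi>1: "\<chi> g * 1 \<in> {1, -1}" if "g \<in> C" for g using \<chi>(2)[OF that that] by simp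
  have "\<exists>t \<theta>. t \<in> dual_mod (carrier G) (M (Suc 0)) (perm_act G) \<and>
      (\<forall>x\<in>M (Suc 0). norm_over C' (perm_act G) t x = s x) \<and> \<theta> \<in> dual_mod (carrier G) (M 0) (perm_act G) \<and>
      (\<forall>y\<in>M (Suc 0). ?n dvd norm_over C (perm_act G) t y + norm_over C (perm_act G) \<theta> (d 0 y))"
  proof (rule transfer_mod_index[OF \<open>group G\<close> assms(2,4,5) PG PC2 \<chi>1 wC(1) w(2) sinv sz])
    fix t \<theta> assume 1: "t \<in> dual_mod (carrier G) (M (Suc 0)) (perm_act G)"
      "\<And>x. x \<in> M (Suc 0) \<Longrightarrow> norm_over C' (perm_act G) t x = s x"
      "\<theta> \<in> dual_mod (carrier G) (M 0) (perm_act G)"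
      "\<And>y. y \<in> M (Suc 0) \<Longrightarrow> ?n dvd norm_over C (perm_act G) t y + norm_over C (perm_act G) \<theta> (d 0 y)"
    show ?thesis using 1 by (intro exI[of _ t] exI[of _ \<theta>]) blast
  qed
  then obtain t \<theta> where t: "t \<in> dual_mod (carrier G) (M (Suc 0)) (perm_act G)"
      "\<forall>x\<in>M (Suc 0). norm_over C' (perm_act G) t x = s x" and \<theta>: "\<theta> \<in> dual_mod (carrier G) (M 0) (perm_act G)"
      and dv: "\<forall>y\<in>M (Suc 0). ?n dvd norm_over C (perm_act G) t y + norm_over C (perm_act G) \<theta> (d 0 y)"
    by blast
  have nt: "norm_over C (perm_act G) t y = poly_mapping.lookup (push G C (\<sigma> (d 0 y))) C" if y: "y \<in> M (Suc 0)" for y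
  proof -
    let ?m = "\<sigma> (d 0 y)"
    have m: "?m \<in> chains_on (left_cosets G C')" using \<sigma>(1) d0(1)[OF y] by blast
    have "\<forall>S\<in>Poly_Mapping.keys ?m. \<exists>f\<in>carrier G. S = inv\<^bsub>G\<^esub> f <#\<^bsub>G\<^esub> C'"
    proof
      fix S assume "S \<in> Poly_Mapping.keys ?m"
      then have "S \<in> left_cosets G C'" using m by (auto simp: chains_on_def)
      then obtain g where "g \<in> carrier G" "S = g <#\<^bsub>G\<^esub> C'" by (auto simp: left_cosets_def)
      then show "\<exists>f\<in>carrier G. S = inv\<^bsub>G\<^esub> f <#\<^bsub>G\<^esub> C'" by (intro bexI[of _ "inv\<^bsub>G\<^esub> g"]) auto
    qed
    from bchoice[OF this[unfolded Bex_def]] obtain F where F: "\<forall>S\<in>Poly_Mapping.keys ?m. F S \<in> carrier G \<and> S = inv\<^bsub>G\<^esub> F S <#\<^bsub>G\<^esub> C'" by blast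
    let ?S = "({g \<in> C. t (perm_act G g y) \<noteq> 0} \<union> F ` Poly_Mapping.keys ?m) \<inter> C"
    have S: "finite ?S" "?S \<subseteq> carrier G" using dual_support_finite[OF t(1) C.subset y] by auto
    obtain R where R: "finite R" "independent_reps G C' R" "R \<subseteq> carrier G"
      and R1: "\<forall>r\<in>R. \<exists>l\<in>C'. \<exists>s\<in>?S. r = l \<otimes>\<^bsub>G\<^esub> s" and R2: "\<forall>s\<in>?S. \<exists>l\<in>C'. \<exists>r\<in>R. s = l \<otimes>\<^bsub>G\<^esub> r"
      by (rule finite_coset_reps[OF \<open>group G\<close> assms(4) S])
    have RC: "R \<subseteq> C"
    proof
      fix r assume "r \<in> R"
      then obtain l q where "l \<in> C'" "q \<in> ?S" "r = l \<otimes>\<^bsub>G\<^esub> q" using R1 by blast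
      then show "r \<in> C" using assms(5) by auto
    qed
    have "norm_over C (perm_act G) t y = (\<Sum>r\<in>R. norm_over C' (perm_act G) t (perm_act G r y))"
      by (rule norm_over_trans[OF \<open>group G\<close> G.subgroup_self MD(1) assms(2,4,5) C.subset t(1) y R(1) RC R(2)]) (use R2 in blast)
    also have "\<dots> = (\<Sum>r\<in>R. poly_mapping.lookup ?m (inv\<^bsub>G\<^esub> r <#\<^bsub>G\<^esub> C'))"
    proof (rule sum.cong[OF HOL.refl])
      fix r assume "r \<in> R"
      then have r: "r \<in> carrier G" using R(3) by blast
      show "norm_over C' (perm_act G) t (perm_act G r y) = poly_mapping.lookup ?m (inv\<^bsub>G\<^esub> r <#\<^bsub>G\<^esub> C')"
        using t(2) MG(2)[OF r y] sg[OF r y] by simp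
    qed
    also have "\<dots> = poly_mapping.lookup (push G C ?m) C"
    proof (rule lookup_push_reps[OF \<open>group G\<close> assms(2,4,5) m R(1) RC R(2), symmetric])
      fix g assume g: "g \<in> C" and k: "g <#\<^bsub>G\<^esub> C' \<in> Poly_Mapping.keys ?m"
      let ?f = "F (g <#\<^bsub>G\<^esub> C')"
      have gc: "g \<in> carrier G" using g by simp
      have f: "?f \<in> carrier G" "g <#\<^bsub>G\<^esub> C' = inv\<^bsub>G\<^esub> ?f <#\<^bsub>G\<^esub> C'" using F k by blast+
      have 1: "inv\<^bsub>G\<^esub> g \<otimes>\<^bsub>G\<^esub> inv\<^bsub>G\<^esub> ?f \<in> C'"
        using G.l_coset_eq_iff[OF assms(4) G.inv_closed[OF f(1)] gc] f(2) by simp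
      then have "g \<otimes>\<^bsub>G\<^esub> (inv\<^bsub>G\<^esub> g \<otimes>\<^bsub>G\<^esub> inv\<^bsub>G\<^esub> ?f) \<in> C" using g assms(5) by auto
      then have "inv\<^bsub>G\<^esub> ?f \<in> C" using gc f(1) by (simp add: G.m_assoc[symmetric])
      then have "inv\<^bsub>G\<^esub> (inv\<^bsub>G\<^esub> ?f) \<in> C" by (rule C.m_inv_closed)
      then have "?f \<in> ?S" using f(1) k by simp
      then obtain l r where lr: "l \<in> C'" "r \<in> R" "?f = l \<otimes>\<^bsub>G\<^esub> r" using R2 by blast
      have rc: "r \<in> carrier G" using lr(2) R(3) by blast
      have "inv\<^bsub>G\<^esub> g = (inv\<^bsub>G\<^esub> g \<otimes>\<^bsub>G\<^esub> inv\<^bsub>G\<^esub> ?f) \<otimes>\<^bsub>G\<^esub> ?f" using gc f(1) by (simp add: G.m_assoc)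
      also have "\<dots> = (inv\<^bsub>G\<^esub> g \<otimes>\<^bsub>G\<^esub> inv\<^bsub>G\<^esub> ?f \<otimes>\<^bsub>G\<^esub> l) \<otimes>\<^bsub>G\<^esub> r"
        using lr gc f(1) rc by (simp add: G.m_assoc)
      finally show "\<exists>l\<in>C'. \<exists>r\<in>R. inv\<^bsub>G\<^esub> g = l \<otimes>\<^bsub>G\<^esub> r" using 1 lr(1,2) by blast
    qed
    finally show ?thesis .
  qed
  \<comment> \<open>the corrected lift, which is divisible on the kernel of the augmentation\<close>
  define \<tau> where "\<tau> z = push G C (\<sigma> z) + norm_chain G C (perm_act G) \<theta> z" for z
  note nc = norm_chain[OF \<open>group G\<close> assms(2) MD(1) \<theta>] and ne = norm_chain_equivariant[OF \<open>group G\<close> assms(2) MD(1) \<theta>]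
  have cC: "c <#\<^bsub>G\<^esub> C = C" if "c \<in> C'" for c using G.l_coset_self_iff[OF assms(2)] that assms(5) by auto
  have pc: "push G C m \<in> chains_on (left_cosets G C)" if "m \<in> chains_on (left_cosets G C')" for m
    by (rule G.push_closed[OF assms(4) C.subset cC that])
  have \<tau>c: "\<tau> z \<in> chains_on (left_cosets G C)" if "z \<in> M 0" for z
    unfolding \<tau>_def using \<sigma>(1) that by (intro addsubD(2)[OF chains_addsub] pc nc(1)) auto
  have \<tau>add: "addmap (M 0) \<tau>" using \<sigma>(2) ne(1) by (simp add: addmap_def \<tau>_def)
  have \<tau>act: "\<tau> (perm_act G g z) = set_act G g (\<tau> z) + frag_cmul (\<epsilon> z) (push G C (D g))" if g: "g \<in> carrier G" and z: "z \<in> M 0" for g z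
    using \<sigma>(1,3) g z by (simp add: \<tau>_def ne(2)[OF z g] G.push_act[OF C'.subset C.subset g])
  have \<tau>dv: "frag_dvd ?n (\<tau> z)" if z: "z \<in> M 0" "\<epsilon> z = 0" for z
    unfolding frag_dvd_def
  proof
    fix S
    have base: "?n dvd poly_mapping.lookup (\<tau> u) C" if u: "u \<in> M 0" "\<epsilon> u = 0" for u
    proof -
      obtain y where y: "y \<in> M (Suc 0)" "u = d 0 y" using MD(5) u by auto
      have "poly_mapping.lookup (norm_chain G C (perm_act G) \<theta> u) C = norm_over C (perm_act G) \<theta> u"
        using nc(2)[OF u(1) G.one_closed] MG(4)[OF u(1)] by (simp add: G.lcos_mult_one C.subset)
      moreover have "?n dvd norm_over C (perm_act G) t y + norm_over C (perm_act G) \<theta> (d 0 y)"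
        using dv y(1) by (rule bspec)
      ultimately show ?thesis using nt[OF y(1)] unfolding \<tau>_def lookup_add y(2) by (simp only:)
    qed
    show "?n dvd poly_mapping.lookup (\<tau> z) S"
    proof (cases "S \<in> left_cosets G C")
      case True
      then obtain g where g: "g \<in> carrier G" "S = g <#\<^bsub>G\<^esub> C" by (auto simp: left_cosets_def)
      have ig: "inv\<^bsub>G\<^esub> g \<in> carrier G" using g(1) by simp
      have z': "perm_act G (inv\<^bsub>G\<^esub> g) z \<in> M 0" "\<epsilon> (perm_act G (inv\<^bsub>G\<^esub> g) z) = 0"
        using MG(2)[OF ig z(1)] ghomD(3)[OF MD(3) ig z(1)] z(2) by auto
      have "\<tau> (perm_act G (inv\<^bsub>G\<^esub> g) z) = set_act G (inv\<^bsub>G\<^esub> g) (\<tau> z)" using \<tau>act[OF ig z(1)] z(2) by simp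
      then have "poly_mapping.lookup (\<tau> (perm_act G (inv\<^bsub>G\<^esub> g) z)) C = poly_mapping.lookup (\<tau> z) S"
        using G.lookup_set_act[OF C.subset ig \<tau>c[OF z(1)] C.subset] g by simp
      then show ?thesis using base[OF z'] by simp
    next
      case False
      then have "S \<notin> Poly_Mapping.keys (\<tau> z)" using \<tau>c[OF z(1)] by (auto simp: chains_on_def)
      then show ?thesis by (simp add: in_keys_iff)
    qed
  qed
  have "1 \<in> \<epsilon> ` M 0" using MD(4) by blast
  then obtain u where u: "u \<in> M 0" "\<epsilon> u = 1" by auto
  show thesis
  proof (rule that[of "- \<tau> u"])
    show "- \<tau> u \<in> chains_on (left_cosets G C)" by (rule addsubD(3)[OF chains_addsub \<tau>c[OF u(1)]])
    show "\<forall>g\<in>carrier G. frag_dvd ?n (push G C (D g) - (set_act G g (- \<tau> u) - - \<tau> u))"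
    proof
      fix g assume g: "g \<in> carrier G"
      have gu: "perm_act G g u \<in> M 0" by (rule MG(2)[OF g u(1)])
      have z: "perm_act G g u - u \<in> M 0" by (rule addsubD(4)[OF MG(1) gu u(1)])
      have "\<epsilon> (perm_act G g u - u) = 0"
        using addmap_diff[OF ghomD(2)[OF MD(3)] MG(1) gu u(1)] ghomD(3)[OF MD(3) g u(1)] by simp
      then have "frag_dvd ?n (\<tau> (perm_act G g u - u))" by (rule \<tau>dv[OF z])
      also have "\<tau> (perm_act G g u - u) = push G C (D g) - (set_act G g (- \<tau> u) - - \<tau> u)"
        unfolding addmap_diff[OF \<tau>add MG(1) gu u(1)] \<tau>act[OF g u(1)] by (simp add: u(2))
      finally show "frag_dvd ?n (push G C (D g) - (set_act G g (- \<tau> u) - - \<tau> u))" .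
    qed
  qed
qed

section \<open>Presentations and their universal property\<close>

lemma word_value_closed:
  assumes "monoid H" "v ` L \<subseteq> carrier H" "w \<in> lists L"
  shows "word_value H v w \<in> carrier H"
proof -
  interpret monoid H by fact
  show ?thesis using assms(3) by (induction w) (use assms(2) in \<open>auto simp: word_value_def\<close>)
qed

lemma word_value_append:
  assumes "monoid H" "v ` L \<subseteq> carrier H" "u \<in> lists L" "w \<in> lists L"
  shows "word_value H v (u @ w) = word_value H v u \<otimes>\<^bsub>H\<^esub> word_value H v w"
proof -
  interpret monoid H by fact
  have w: "word_value H v w \<in> carrier H" by (rule word_value_closed[OF assms(1,2,4)])
  show ?thesis using assms(3)
  proof (induction u)
    case Nil
    then show ?case using w by (simp add: word_value_def)
  next
    case (Cons a u)
    have "u \<in> lists L" "v a \<in> carrier H" using Cons.hyps assms(2) by auto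
    then show ?case
      using Cons.IH w word_value_closed[OF assms(1,2), of u] by (simp add: word_value_def m_assoc)
  qed
qed

lemma word_cong_value:
  assumes "monoid H" "v ` L \<subseteq> carrier H" "R \<subseteq> lists L \<times> lists L"
    and eq: "\<forall>(u, w)\<in>R. word_value H v u = word_value H v w"
    and "word_cong L R u w"
  shows "u \<in> lists L \<and> w \<in> lists L \<and> word_value H v u = word_value H v w"
  using assms(5)
proof (induction rule: word_cong.induct)
  case (rel u w)
  then show ?case using assms(3) eq by auto
next
  case (append u u' w w')
  then have "word_value H v (u @ w) = word_value H v u \<otimes>\<^bsub>H\<^esub> word_value H v w"
    "word_value H v (u' @ w') = word_value H v u' \<otimes>\<^bsub>H\<^esub> word_value H v w'"
    by (blast intro: word_value_append[OF assms(1,2)])+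
  then show ?case using append by simp
qed simp_all

text \<open>
  If a presentation is isomorphic to G by evaluation, then every element is the value of a word, and
  words with the same value are congruent.
\<close>

lemma presented_iso:
  assumes "group G" "v ` L \<subseteq> carrier G" "R \<subseteq> lists L \<times> lists L"
    and eq: "\<forall>(u, w)\<in>R. word_value G v u = word_value G v w"
    and iso: "induced_map G v \<in> iso (presented L R) G"
  shows "g \<in> carrier G \<Longrightarrow> \<exists>w\<in>lists L. word_value G v w = g"
    and "u \<in> lists L \<Longrightarrow> w \<in> lists L \<Longrightarrow> word_value G v u = word_value G v w \<Longrightarrow> word_cong L R u w"
proof -
  interpret G: group G by fact
  let ?E = "{(u, w). word_cong L R u w}"
  have car: "carrier (presented L R) = lists L // ?E" by (simp add: presented_def Let_def)
  have cl: "induced_map G v (?E `` {w}) = word_value G v w" if w: "w \<in> lists L" for w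
  proof -
    have "word_value G v ` (?E `` {w}) = {word_value G v w}"
    proof (intro equalityI subsetI)
      fix y assume "y \<in> word_value G v ` (?E `` {w})"
      then obtain u where "word_cong L R w u" "y = word_value G v u" by blast
      then show "y \<in> {word_value G v w}"
        using word_cong_value[OF G.monoid_axioms assms(2,3) eq] by simp
    next
      fix y assume "y \<in> {word_value G v w}"
      then show "y \<in> word_value G v ` (?E `` {w})" using word_cong.refl[OF w, of R] by blast
    qed
    then show ?thesis by (simp add: induced_map_def)
  qed
  have bij: "bij_betw (induced_map G v) (lists L // ?E) (carrier G)"
    using iso unfolding iso_def car by blast
  show "\<exists>w\<in>lists L. word_value G v w = g" if "g \<in> carrier G"
  proof -
    have "g \<in> induced_map G v ` (lists L // ?E)" using bij that by (simp add: bij_betw_def)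
    then obtain U where U: "U \<in> lists L // ?E" "g = induced_map G v U" by (rule imageE)
    from U(1) obtain w where w: "w \<in> lists L" "U = ?E `` {w}" by (rule quotientE)
    show ?thesis using U(2) cl[OF w(1)] w by (intro bexI[of _ w]) simp_all
  qed
  show "word_cong L R u w" if u: "u \<in> lists L" and w: "w \<in> lists L" and e: "word_value G v u = word_value G v w"
  proof -
    have qu: "?E `` {u} \<in> lists L // ?E" and qw: "?E `` {w} \<in> lists L // ?E"
      using quotientI[OF u, of ?E] quotientI[OF w, of ?E] by -
    have "induced_map G v (?E `` {u}) = induced_map G v (?E `` {w})" unfolding cl[OF u] cl[OF w] by (rule e)
    then have "?E `` {u} = ?E `` {w}"
      using bij_betw_imp_inj_on[OF bij, unfolded inj_on_def] qu qw by (simp only:)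
    then have "w \<in> ?E `` {u}" using word_cong.refl[OF w, of R] by simp
    then show ?thesis by simp
  qed
qed

text \<open>
  Compatible values of the letters in a monoid extend to a homomorphism: by injectivity of the
  induced map, two words for the same element are congruent, and so have the same value. Monoids are
  the right targets here, since no inverses have to be constructed in the applications.
\<close>

lemma presented_universal:
  assumes "group G" "v ` L \<subseteq> carrier G" "R \<subseteq> lists L \<times> lists L"
    and eq: "\<forall>(u, w)\<in>R. word_value G v u = word_value G v w"
    and iso: "induced_map G v \<in> iso (presented L R) G"
    and H: "monoid H" "v' ` L \<subseteq> carrier H"
    and eq': "\<forall>(u, w)\<in>R. word_value H v' u = word_value H v' w"
  shows "\<exists>\<Theta>. \<Theta> \<in> hom G H \<and> \<Theta> \<one>\<^bsub>G\<^esub> = \<one>\<^bsub>H\<^esub> \<and> (\<forall>l\<in>L. \<Theta> (v l) = v' l)"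
proof -
  interpret G: group G by fact
  interpret H: monoid H by fact
  note pr = presented_iso[OF assms(1-3) eq iso]
  define W where "W g = (SOME w. w \<in> lists L \<and> word_value G v w = g)" for g
  have W: "W g \<in> lists L" "word_value G v (W g) = g" if "g \<in> carrier G" for g
    using someI_ex[of "\<lambda>w. w \<in> lists L \<and> word_value G v w = g"] pr(1)[OF that] unfolding W_def by blast+
  have val: "word_value H v' (W (word_value G v w)) = word_value H v' w" if w: "w \<in> lists L" for w
  proof -
    have c: "word_value G v w \<in> carrier G" by (rule word_value_closed[OF G.monoid_axioms assms(2) w])
    have "word_cong L R (W (word_value G v w)) w" by (rule pr(2)[OF W(1)[OF c] w W(2)[OF c]])
    then show ?thesis using word_cong_value[OF H assms(3) eq'] by blast
  qed
  show ?thesis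
  proof (intro exI[of _ "\<lambda>g. word_value H v' (W g)"] conjI ballI)
    show "(\<lambda>g. word_value H v' (W g)) \<in> hom G H"
    proof (rule homI)
      show "word_value H v' (W g) \<in> carrier H" if "g \<in> carrier G" for g
        by (rule word_value_closed[OF H W(1)[OF that]])
      fix g h assume g: "g \<in> carrier G" and h: "h \<in> carrier G"
      have "word_value G v (W g @ W h) = g \<otimes>\<^bsub>G\<^esub> h"
        using word_value_append[OF G.monoid_axioms assms(2) W(1)[OF g] W(1)[OF h]] W(2)[OF g] W(2)[OF h] by simp
      moreover have "W g @ W h \<in> lists L" using W(1)[OF g] W(1)[OF h] by simp
      ultimately show "word_value H v' (W (g \<otimes>\<^bsub>G\<^esub> h)) = word_value H v' (W g) \<otimes>\<^bsub>H\<^esub> word_value H v' (W h)"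
        using val[of "W g @ W h"] word_value_append[OF H W(1)[OF g] W(1)[OF h]] by simp
    qed
    show "word_value H v' (W \<one>\<^bsub>G\<^esub>) = \<one>\<^bsub>H\<^esub>" using val[of "[]"] by (simp add: word_value_def)
    fix l assume l: "l \<in> L"
    then have "v l \<in> carrier G" "v' l \<in> carrier H" using assms(2) H(2) by auto
    then show "word_value H v' (W (v l)) = v' l" using val[of "[l]"] l by (simp add: word_value_def)
  qed
qed

lemma presented_generate:
  assumes "group G" "v ` L \<subseteq> carrier G" "R \<subseteq> lists L \<times> lists L"
    and eq: "\<forall>(u, w)\<in>R. word_value G v u = word_value G v w"
    and iso: "induced_map G v \<in> iso (presented L R) G"
    and S: "\<And>l. l \<in> L \<Longrightarrow> v l \<in> generate G S" and g: "g \<in> carrier G"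
  shows "g \<in> generate G S"
proof -
  have *: "word_value G v w \<in> generate G S" if "w \<in> lists L" for w
    using that
  proof (induction w)
    case Nil
    show ?case by (simp add: word_value_def generate.one)
  next
    case (Cons a w)
    then show ?case using generate.eng[OF S, of a "word_value G v w"] by (simp add: word_value_def)
  qed
  show ?thesis using presented_iso(1)[OF assms(1-3) eq iso g] * by blast
qed

lemma amalgam_valid:
  assumes "group G" "amalgam_splitting G A B C"
  shows "case_sum id id ` (Inl ` A \<union> Inr ` B) \<subseteq> carrier G"
    "amalgam_relations G A B C \<subseteq> lists (Inl ` A \<union> Inr ` B) \<times> lists (Inl ` A \<union> Inr ` B)"
    "\<forall>(u, w)\<in>amalgam_relations G A B C. word_value G (case_sum id id) u = word_value G (case_sum id id) w"
    "induced_map G (case_sum id id) \<in> iso (presented (Inl ` A \<union> Inr ` B) (amalgam_relations G A B C)) G"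
proof -
  interpret G: group G by fact
  interpret A: subgroup A G using assms(2) by (simp add: amalgam_splitting_def)
  interpret B: subgroup B G using assms(2) by (simp add: amalgam_splitting_def)
  have C: "C \<subseteq> A" "C \<subseteq> B" using assms(2) by (auto simp: amalgam_splitting_def)
  show "case_sum id id ` (Inl ` A \<union> Inr ` B) \<subseteq> carrier G" by auto
  show "amalgam_relations G A B C \<subseteq> lists (Inl ` A \<union> Inr ` B) \<times> lists (Inl ` A \<union> Inr ` B)"
    using C by (auto simp: amalgam_relations_def)
  show "\<forall>(u, w)\<in>amalgam_relations G A B C. word_value G (case_sum id id) u = word_value G (case_sum id id) w"
    using C by (auto simp: amalgam_relations_def word_value_def G.m_assoc)
  show "induced_map G (case_sum id id) \<in> iso (presented (Inl ` A \<union> Inr ` B) (amalgam_relations G A B C)) G"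
    using assms(2) by (simp add: amalgam_splitting_def amalgamated_product_def)
qed

lemma amalgam_universal:
  assumes "group G" "amalgam_splitting G A B C" "monoid H"
    and f: "\<And>a. a \<in> A \<Longrightarrow> f a \<in> carrier H" "\<And>a a'. a \<in> A \<Longrightarrow> a' \<in> A \<Longrightarrow> f (a \<otimes>\<^bsub>G\<^esub> a') = f a \<otimes>\<^bsub>H\<^esub> f a'"
      "f \<one>\<^bsub>G\<^esub> = \<one>\<^bsub>H\<^esub>"
    and h: "\<And>b. b \<in> B \<Longrightarrow> h b \<in> carrier H" "\<And>b b'. b \<in> B \<Longrightarrow> b' \<in> B \<Longrightarrow> h (b \<otimes>\<^bsub>G\<^esub> b') = h b \<otimes>\<^bsub>H\<^esub> h b'"
      "h \<one>\<^bsub>G\<^esub> = \<one>\<^bsub>H\<^esub>"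
    and fh: "\<And>c. c \<in> C \<Longrightarrow> f c = h c"
  shows "\<exists>\<Theta>. \<Theta> \<in> hom G H \<and> \<Theta> \<one>\<^bsub>G\<^esub> = \<one>\<^bsub>H\<^esub> \<and> (\<forall>a\<in>A. \<Theta> a = f a) \<and> (\<forall>b\<in>B. \<Theta> b = h b)"
proof -
  interpret H: monoid H by fact
  interpret A: subgroup A G using assms(2) by (simp add: amalgam_splitting_def)
  interpret B: subgroup B G using assms(2) by (simp add: amalgam_splitting_def)
  have C: "C \<subseteq> A" "C \<subseteq> B" using assms(2) by (auto simp: amalgam_splitting_def)
  have "\<exists>\<Theta>. \<Theta> \<in> hom G H \<and> \<Theta> \<one>\<^bsub>G\<^esub> = \<one>\<^bsub>H\<^esub> \<and> (\<forall>l\<in>Inl ` A \<union> Inr ` B. \<Theta> (case_sum id id l) = case_sum f h l)"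
  proof (rule presented_universal[OF assms(1) amalgam_valid[OF assms(1,2)] assms(3)])
    show "case_sum f h ` (Inl ` A \<union> Inr ` B) \<subseteq> carrier H" using f(1) h(1) by auto
    show "\<forall>(u, w)\<in>amalgam_relations G A B C. word_value H (case_sum f h) u = word_value H (case_sum f h) w"
      using C f h fh by (auto simp: amalgam_relations_def word_value_def H.m_assoc subset_iff)
  qed
  then show ?thesis by (auto simp: ball_Un)
qed

lemma amalgam_generate:
  assumes "group G" "amalgam_splitting G A B C" "g \<in> carrier G"
  shows "g \<in> generate G (A \<union> B)"
  by (rule presented_generate[OF assms(1) amalgam_valid[OF assms(1,2)] _ assms(3)]) (auto intro: generate.incl)

lemma hnn_valid:
  assumes "group G" "hnn_splitting G A C \<phi> t"
  shows "hnn_letter_value G t ` (Base ` A \<union> {Stable, Stable_inv}) \<subseteq> carrier G"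
    "hnn_relations G A C \<phi> \<subseteq> lists (Base ` A \<union> {Stable, Stable_inv}) \<times> lists (Base ` A \<union> {Stable, Stable_inv})"
    "\<forall>(u, w)\<in>hnn_relations G A C \<phi>. word_value G (hnn_letter_value G t) u = word_value G (hnn_letter_value G t) w"
    "induced_map G (hnn_letter_value G t) \<in> iso (presented (Base ` A \<union> {Stable, Stable_inv}) (hnn_relations G A C \<phi>)) G"
proof -
  interpret G: group G by fact
  interpret A: subgroup A G using assms(2) by (simp add: hnn_splitting_def)
  have C: "C \<subseteq> A" and t: "t \<in> carrier G" and \<phi>: "\<And>c. c \<in> C \<Longrightarrow> t \<otimes>\<^bsub>G\<^esub> c \<otimes>\<^bsub>G\<^esub> inv\<^bsub>G\<^esub> t = \<phi> c"
    and \<phi>A: "\<And>c. c \<in> C \<Longrightarrow> \<phi> c \<in> A"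
    using assms(2) by (auto simp: hnn_splitting_def hom_def)
  show "hnn_letter_value G t ` (Base ` A \<union> {Stable, Stable_inv}) \<subseteq> carrier G" using t by auto
  show "hnn_relations G A C \<phi> \<subseteq> lists (Base ` A \<union> {Stable, Stable_inv}) \<times> lists (Base ` A \<union> {Stable, Stable_inv})"
    using C \<phi>A by (auto simp: hnn_relations_def)
  show "\<forall>(u, w)\<in>hnn_relations G A C \<phi>. word_value G (hnn_letter_value G t) u = word_value G (hnn_letter_value G t) w"
    using C t \<phi>A by (auto simp: hnn_relations_def word_value_def G.m_assoc \<phi>[symmetric] subset_iff)
  show "induced_map G (hnn_letter_value G t) \<in> iso (presented (Base ` A \<union> {Stable, Stable_inv}) (hnn_relations G A C \<phi>)) G"
    using assms(2) by (simp add: hnn_splitting_def hnn_extension_def)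
qed

lemma hnn_universal:
  assumes "group G" "hnn_splitting G A C \<phi> t" "monoid H"
    and f: "\<And>a. a \<in> A \<Longrightarrow> f a \<in> carrier H" "\<And>a a'. a \<in> A \<Longrightarrow> a' \<in> A \<Longrightarrow> f (a \<otimes>\<^bsub>G\<^esub> a') = f a \<otimes>\<^bsub>H\<^esub> f a'"
      "f \<one>\<^bsub>G\<^esub> = \<one>\<^bsub>H\<^esub>"
    and s: "s \<in> carrier H" "s' \<in> carrier H" "s \<otimes>\<^bsub>H\<^esub> s' = \<one>\<^bsub>H\<^esub>" "s' \<otimes>\<^bsub>H\<^esub> s = \<one>\<^bsub>H\<^esub>"
    and fs: "\<And>c. c \<in> C \<Longrightarrow> s \<otimes>\<^bsub>H\<^esub> (f c \<otimes>\<^bsub>H\<^esub> s') = f (t \<otimes>\<^bsub>G\<^esub> c \<otimes>\<^bsub>G\<^esub> inv\<^bsub>G\<^esub> t)"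
  shows "\<exists>\<Theta>. \<Theta> \<in> hom G H \<and> \<Theta> \<one>\<^bsub>G\<^esub> = \<one>\<^bsub>H\<^esub> \<and> (\<forall>a\<in>A. \<Theta> a = f a) \<and> \<Theta> t = s"
proof -
  interpret H: monoid H by fact
  interpret A: subgroup A G using assms(2) by (simp add: hnn_splitting_def)
  have C: "C \<subseteq> A" and \<phi>: "\<And>c. c \<in> C \<Longrightarrow> t \<otimes>\<^bsub>G\<^esub> c \<otimes>\<^bsub>G\<^esub> inv\<^bsub>G\<^esub> t = \<phi> c"
    and \<phi>A: "\<And>c. c \<in> C \<Longrightarrow> \<phi> c \<in> A"
    using assms(2) by (auto simp: hnn_splitting_def hom_def)
  have fs': "s \<otimes>\<^bsub>H\<^esub> (f c \<otimes>\<^bsub>H\<^esub> s') = f (\<phi> c)" if "c \<in> C" for c using fs[OF that] \<phi>[OF that] by simp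
  let ?v = "case_hnn_letter f s s'"
  have "\<exists>\<Theta>. \<Theta> \<in> hom G H \<and> \<Theta> \<one>\<^bsub>G\<^esub> = \<one>\<^bsub>H\<^esub> \<and>
      (\<forall>l\<in>Base ` A \<union> {Stable, Stable_inv}. \<Theta> (hnn_letter_value G t l) = ?v l)"
  proof (rule presented_universal[OF assms(1) hnn_valid[OF assms(1,2)] assms(3)])
    show "?v ` (Base ` A \<union> {Stable, Stable_inv}) \<subseteq> carrier H" using f(1) s by auto
    show "\<forall>(u, w)\<in>hnn_relations G A C \<phi>. word_value H ?v u = word_value H ?v w"
      using C f s fs' \<phi>A by (auto simp: hnn_relations_def word_value_def H.m_assoc subset_iff)
  qed
  then show ?thesis by (auto simp: ball_Un)
qed

lemma hnn_generate:
  assumes "group G" "hnn_splitting G A C \<phi> t" "g \<in> carrier G"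
  shows "g \<in> generate G (insert t A)"
  by (rule presented_generate[OF assms(1) hnn_valid[OF assms(1,2)] _ assms(3)])
    (auto intro: generate.incl generate.inv)

section \<open>Semidirect products and infinite index of the vertex groups\<close>

text \<open>Homomorphisms to this monoid that lift the identity of G are derivations.\<close>

definition chain_semidirect :: "('g, 'm) monoid_scheme \<Rightarrow> 'g set \<Rightarrow> (('g set \<Rightarrow>\<^sub>0 int) \<times> 'g) monoid" where
  "chain_semidirect G T = \<lparr>carrier = chains_on (left_cosets G T) \<times> carrier G,
     monoid.mult = (\<lambda>p q. (fst p + set_act G (snd p) (fst q), snd p \<otimes>\<^bsub>G\<^esub> snd q)), one = (0, \<one>\<^bsub>G\<^esub>)\<rparr>"

text \<open>
  An amalgam acts on triples of a group element, a level and a side. Elements of A act by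
  left translation and elements of B by left translation conjugated with this involution. It
  commutes with left translation by C, so the two actions agree on C, and it exchanges the cosets C
  on the two sides, and C a at a positive level with C b one level lower on the other side. In this
  way the product of the inverse of a with b raises the level of the identity by one.
\<close>

definition coset_switch :: "('g, 'm) monoid_scheme \<Rightarrow> 'g set \<Rightarrow> 'g \<Rightarrow> 'g \<Rightarrow> 'g \<times> nat \<times> bool \<Rightarrow> 'g \<times> nat \<times> bool" where
  "coset_switch G C a b = (\<lambda>(x, n, s).
     if x \<notin> carrier G then (x, n, s) else if x \<in> C then (x, n, \<not> s)
     else if s then (if x \<otimes>\<^bsub>G\<^esub> inv\<^bsub>G\<^esub> b \<in> C then (x \<otimes>\<^bsub>G\<^esub> (inv\<^bsub>G\<^esub> b \<otimes>\<^bsub>G\<^esub> a), Suc n, False) else (x, n, s))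
     else if n \<noteq> 0 \<and> x \<otimes>\<^bsub>G\<^esub> inv\<^bsub>G\<^esub> a \<in> C then (x \<otimes>\<^bsub>G\<^esub> (inv\<^bsub>G\<^esub> a \<otimes>\<^bsub>G\<^esub> b), n - 1, True) else (x, n, s))"

definition left_translate :: "('g, 'm) monoid_scheme \<Rightarrow> 'g \<Rightarrow> 'g \<times> nat \<times> bool \<Rightarrow> 'g \<times> nat \<times> bool" where
  "left_translate G g = (\<lambda>(x, n, s). (if x \<in> carrier G then g \<otimes>\<^bsub>G\<^esub> x else x, n, s))"

context group
begin

lemma chain_semidirect_monoid:
  assumes "T \<subseteq> carrier G"
  shows "monoid (chain_semidirect G T)"
proof -
  note SD = gmodD[OF set_act_gmod[OF assms]] and ca = addsubD[OF chains_addsub[of "left_cosets G T"]]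
  show ?thesis
  proof (unfold_locales, goal_cases)
    case (1 p q)
    then show ?case using ca(2)[OF _ SD(2)[of "snd p" "fst q"], of "fst p"]
      by (simp add: chain_semidirect_def mem_Times_iff)
  next
    case (2 p q r)
    then show ?case using SD(5)[of "snd p" "snd q" "fst r"]
      by (simp add: chain_semidirect_def mem_Times_iff m_assoc add.assoc)
  next
    case 3
    show ?case using ca(1) by (simp add: chain_semidirect_def)
  next
    case (4 p)
    then show ?case using SD(4)[of "fst p"] by (simp add: chain_semidirect_def mem_Times_iff)
  next
    case (5 p)
    then show ?case by (simp add: chain_semidirect_def mem_Times_iff)
  qed
qed

lemma derivation_of_hom:
  assumes "\<Theta> \<in> hom G (chain_semidirect G T)" "\<Theta> \<one> = (0, \<one>)"
    and S: "S \<subseteq> carrier G" "\<And>s. s \<in> S \<Longrightarrow> snd (\<Theta> s) = s" "\<And>g. g \<in> carrier G \<Longrightarrow> g \<in> generate G S"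
  shows "derivation G (left_cosets G T) (\<lambda>g. fst (\<Theta> g))"
proof -
  have cl: "fst (\<Theta> g) \<in> chains_on (left_cosets G T)" "snd (\<Theta> g) \<in> carrier G" if "g \<in> carrier G" for g
    using hom_in_carrier[OF assms(1) that] by (auto simp: chain_semidirect_def)
  have mult: "\<Theta> (g \<otimes> h) = (fst (\<Theta> g) + set_act G (snd (\<Theta> g)) (fst (\<Theta> h)), snd (\<Theta> g) \<otimes> snd (\<Theta> h))"
    if "g \<in> carrier G" "h \<in> carrier G" for g h
    using hom_mult[OF assms(1) that] by (simp add: chain_semidirect_def)
  have "snd (\<Theta> g) = g" if "g \<in> generate G S" for g
    using that
  proof (induction rule: generate.induct)
    case one
    then show ?case using assms(2) by simp
  next
    case (incl s)
    then show ?case by (rule S(2))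
  next
    case (inv s)
    then have s: "s \<in> carrier G" using S(1) by blast
    have "snd (\<Theta> (s \<otimes> inv s)) = s \<otimes> snd (\<Theta> (inv s))" using mult[OF s inv_closed[OF s]] S(2)[OF inv] by simp
    then have "s \<otimes> snd (\<Theta> (inv s)) = \<one>" using s assms(2) by simp
    then show ?case using inv_unique'[OF s cl(2)[OF inv_closed[OF s]]]
      inv_comm[OF _ s cl(2)[OF inv_closed[OF s]]] by simp
  next
    case (eng g h)
    have "g \<in> carrier G" "h \<in> carrier G" using eng(1,2) generate_in_carrier[OF S(1)] by blast+
    then show ?case using mult eng by simp
  qed
  then have "snd (\<Theta> g) = g" if "g \<in> carrier G" for g using S(3)[OF that] by blast
  then show ?thesis using cl mult by (simp add: derivation_def)
qed

lemma l_coset_self: "subgroup K G \<Longrightarrow> g \<in> K \<Longrightarrow> g <# K = K"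
  using l_coset_self_iff[of K g] subgroup.mem_carrier[of K G g] by simp

text \<open>
  Such a function \<open>\<psi>\<close> is a function on the cosets, and its values tell infinitely many of them
  apart.
\<close>

lemma invariant_function_infinite_cosets:
  assumes "subgroup A G" "\<And>g a. g \<in> carrier G \<Longrightarrow> a \<in> A \<Longrightarrow> \<psi> (g \<otimes> a) = \<psi> g" "infinite (\<psi> ` carrier G)"
  shows "infinite (left_cosets G A)"
proof
  assume fin: "finite (left_cosets G A)"
  interpret A: subgroup A G by fact
  have "\<psi> ` carrier G \<subseteq> (\<lambda>S. \<psi> (SOME g. g \<in> S)) ` left_cosets G A"
  proof (rule image_subsetI)
    fix g assume g: "g \<in> carrier G"
    have "g \<in> g <# A" using g A.one_closed by (force simp: l_coset_def)
    then have "(SOME h. h \<in> g <# A) \<in> g <# A" by (rule someI)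
    then obtain a where "a \<in> A" "(SOME h. h \<in> g <# A) = g \<otimes> a" by (auto simp: l_coset_def)
    then have "\<psi> g = \<psi> (SOME h. h \<in> g <# A)" using assms(2)[OF g] by simp
    then show "\<psi> g \<in> (\<lambda>S. \<psi> (SOME g. g \<in> S)) ` left_cosets G A"
      using g unfolding left_cosets_def by blast
  qed
  then show False using fin assms(3) finite_surj by blast
qed

text \<open>The exponent sum of the stable letter is a homomorphism to the integers that vanishes on A.\<close>

lemma hnn_infinite_index:
  assumes "hnn_splitting G A C \<phi> t"
  shows "infinite (left_cosets G A)"
proof -
  have A: "subgroup A G" and t: "t \<in> carrier G" and C: "C \<subseteq> A"
    using assms by (auto simp: hnn_splitting_def)
  interpret A: subgroup A G by fact
  have "\<exists>\<Theta>. \<Theta> \<in> hom G integer_group \<and> \<Theta> \<one> = \<one>\<^bsub>integer_group\<^esub> \<and> (\<forall>a\<in>A. \<Theta> a = 0) \<and> \<Theta> t = 1"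
    by (rule hnn_universal[OF group_axioms assms group.is_monoid[OF group_integer_group], where s' = "- 1"])
      (simp_all add: integer_group_def)
  then obtain \<Theta> where \<Theta>: "\<Theta> \<in> hom G integer_group" "\<forall>a\<in>A. \<Theta> a = 0" "\<Theta> t = 1" "\<Theta> \<one> = 0" by (auto simp: integer_group_def)
  have add: "\<Theta> (g \<otimes> h) = \<Theta> g + \<Theta> h" if "g \<in> carrier G" "h \<in> carrier G" for g h
    using hom_mult[OF \<Theta>(1) that] by (simp add: integer_group_def)
  have pw: "\<Theta> (t [^] n) = int n" for n :: nat
    by (induction n) (simp_all add: \<Theta>(3,4) add t)
  have "range int \<subseteq> \<Theta> ` carrier G"
  proof (rule image_subsetI)
    fix n show "int n \<in> \<Theta> ` carrier G" by (rule image_eqI[of _ _ "t [^] n"]) (simp_all add: pw t)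
  qed
  moreover have "infinite (range int)" by (rule range_inj_infinite) (rule inj_of_nat)
  ultimately have "infinite (\<Theta> ` carrier G)" using finite_subset by blast
  then show ?thesis
    by (rule invariant_function_infinite_cosets[OF A, rotated]) (use add \<Theta>(2) A.subset in auto)
qed

lemma left_translate_simps:
  assumes "g \<in> carrier G"
  shows "h \<in> carrier G \<Longrightarrow> left_translate G (g \<otimes> h) = left_translate G g \<circ> left_translate G h"
    "left_translate G \<one> = id" "fst (snd (left_translate G g p)) = fst (snd p)"
  using assms by (auto simp: left_translate_def fun_eq_iff m_assoc split: prod.splits)

lemma coset_switch_involution:
  assumes "subgroup C G" "a \<in> carrier G" "b \<in> carrier G" "a \<notin> C" "b \<notin> C"
  shows "coset_switch G C a b (coset_switch G C a b p) = p"
proof -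
  interpret C: subgroup C G by fact
  obtain x n s where p: "p = (x, n, s)" by (metis prod_cases3)
  have notin: "y \<otimes> h \<notin> C" if "y \<in> C" "h \<in> carrier G" "h \<notin> C" for y h
  proof
    assume "y \<otimes> h \<in> C"
    then have "inv y \<otimes> (y \<otimes> h) \<in> C" using that(1) by simp
    then show False using that by (simp add: m_assoc[symmetric])
  qed
  have sw: "coset_switch G C h k (y \<otimes> h, Suc i, False) = (y \<otimes> k, i, True)"
    "coset_switch G C k h (y \<otimes> h, i, True) = (y \<otimes> k, Suc i, False)"
    if "y \<in> C" "h \<in> carrier G" "h \<notin> C" "k \<in> carrier G" for y h k i
  proof -
    have y: "y \<in> carrier G" using that(1) by simp
    have 1: "y \<otimes> h \<otimes> inv h = y" using that(2) y by (simp add: m_assoc)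
    have 2: "y \<otimes> h \<otimes> (inv h \<otimes> k) = y \<otimes> k" using that(2,4) y by (simp add: m_assoc[symmetric]) (simp add: m_assoc)
    show "coset_switch G C h k (y \<otimes> h, Suc i, False) = (y \<otimes> k, i, True)"
      "coset_switch G C k h (y \<otimes> h, i, True) = (y \<otimes> k, Suc i, False)"
      using notin[OF that(1-3)] y that by (simp_all add: coset_switch_def 1 2)
  qed
  consider "x \<in> C" | "x \<in> carrier G" "x \<notin> C" "s" "x \<otimes> inv b \<in> C"
    | "x \<in> carrier G" "x \<notin> C" "\<not> s" "n \<noteq> 0" "x \<otimes> inv a \<in> C"
    | "coset_switch G C a b (x, n, s) = (x, n, s)"
    by (cases "x \<in> carrier G"; cases "x \<in> C"; cases s; cases "x \<otimes> inv b \<in> C"; cases "n \<noteq> 0"; cases "x \<otimes> inv a \<in> C") (simp_all add: coset_switch_def)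
  then show ?thesis
  proof cases
    case 1
    then show ?thesis by (simp add: p coset_switch_def)
  next
    case 2
    have e: "x = x \<otimes> inv b \<otimes> b" using 2(1) assms(3) by (simp add: m_assoc)
    show ?thesis
      using sw(2)[OF 2(4) assms(3,5,2), of n] sw(1)[OF 2(4) assms(2,4,3), of n] 2(3) by (simp add: p flip: e)
  next
    case 3
    obtain k where k: "n = Suc k" using 3(4) by (cases n) auto
    have e: "x = x \<otimes> inv a \<otimes> a" using 3(1) assms(2) by (simp add: m_assoc)
    show ?thesis
      using sw(1)[OF 3(5) assms(2,4,3), of k] sw(2)[OF 3(5) assms(3,5,2), of k] 3(3) k by (simp add: p flip: e)
  qed (simp add: p)
qed

lemma coset_switch_equivariant:
  assumes "subgroup C G" "a \<in> carrier G" "b \<in> carrier G" "c \<in> C"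
  shows "coset_switch G C a b (left_translate G c p) = left_translate G c (coset_switch G C a b p)"
proof -
  interpret C: subgroup C G by fact
  obtain x n s where p: "p = (x, n, s)" by (metis prod_cases3)
  have c: "c \<in> carrier G" using assms(4) by simp
  have iff: "c \<otimes> y \<in> C \<longleftrightarrow> y \<in> C" if "y \<in> carrier G" for y
  proof
    assume "c \<otimes> y \<in> C"
    then have "inv c \<otimes> (c \<otimes> y) \<in> C" using assms(4) by simp
    then show "y \<in> C" using c that by (simp add: m_assoc[symmetric])
  qed (use assms(4) in simp)
  show ?thesis
  proof (cases "x \<in> carrier G")
    case False
    then show ?thesis by (simp add: p coset_switch_def left_translate_def)
  next
    case True
    have 1: "c \<otimes> x \<otimes> h \<in> C \<longleftrightarrow> x \<otimes> h \<in> C" "c \<otimes> x \<otimes> h = c \<otimes> (x \<otimes> h)" if "h \<in> carrier G" for h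
      using iff[of "x \<otimes> h"] True that c by (simp_all add: m_assoc)
    have 2: "inv b \<otimes> a \<in> carrier G" "inv a \<otimes> b \<in> carrier G" "inv a \<in> carrier G" "inv b \<in> carrier G"
      using assms by simp_all
    show ?thesis
      unfolding p coset_switch_def left_translate_def
      using True c iff[OF True] 1(1)[OF 2(3)] 1(1)[OF 2(4)] 1(2)[OF 2(1)] 1(2)[OF 2(2)] 2 by simp
  qed
qed

text \<open>
  The level of the image of a fixed triple under the inverse of g depends only on the coset g A,
  because A preserves levels; after applying the involution it depends only on g B. Powers of the
  product of the inverse of a with b show that it is unbounded.
\<close>

lemma amalgam_infinite_index:
  assumes "amalgam_splitting G A B C"
  shows "infinite (left_cosets G A)" "infinite (left_cosets G B)"
proof -
  have A: "subgroup A G" and B: "subgroup B G" and C: "subgroup C G" "C \<subset> A" "C \<subset> B"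
    using assms by (auto simp: amalgam_splitting_def)
  interpret A: subgroup A G by fact
  interpret B: subgroup B G by fact
  interpret C: subgroup C G by fact
  obtain a b where a: "a \<in> A" "a \<notin> C" and b: "b \<in> B" "b \<notin> C" using C(2,3) by blast
  have ac: "a \<in> carrier G" and bc: "b \<in> carrier G" using a b by simp_all
  define H :: "('a \<times> nat \<times> bool \<Rightarrow> 'a \<times> nat \<times> bool) monoid" where
    "H = \<lparr>carrier = UNIV, monoid.mult = (\<circ>), one = id\<rparr>"
  have H: "monoid H" by unfold_locales (auto simp: H_def)
  define \<theta> where "\<theta> = coset_switch G C a b"
  define \<tau> where "\<tau> = left_translate G"
  have \<theta>: "\<theta> (\<theta> p) = p" for p unfolding \<theta>_def by (rule coset_switch_involution[OF C(1) ac bc a(2) b(2)])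
  have \<theta>o: "\<theta> \<circ> \<theta> = id" by (rule ext) (simp only: o_apply id_apply \<theta>)
  note lt = left_translate_simps[folded \<tau>_def]
  have eq: "\<theta> (\<tau> c p) = \<tau> c (\<theta> p)" if "c \<in> C" for c p
    unfolding \<theta>_def \<tau>_def by (rule coset_switch_equivariant[OF C(1) ac bc that])
  have "\<exists>\<Theta>. \<Theta> \<in> hom G H \<and> \<Theta> \<one> = \<one>\<^bsub>H\<^esub> \<and> (\<forall>a\<in>A. \<Theta> a = \<tau> a) \<and> (\<forall>b\<in>B. \<Theta> b = \<theta> \<circ> \<tau> b \<circ> \<theta>)"
  proof (rule amalgam_universal[OF group_axioms assms H])
    show "\<tau> (x \<otimes> y) = \<tau> x \<otimes>\<^bsub>H\<^esub> \<tau> y" if "x \<in> A" "y \<in> A" for x y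
      using lt(1)[of x y] that by (simp add: H_def)
    show "\<theta> \<circ> \<tau> (x \<otimes> y) \<circ> \<theta> = (\<theta> \<circ> \<tau> x \<circ> \<theta>) \<otimes>\<^bsub>H\<^esub> (\<theta> \<circ> \<tau> y \<circ> \<theta>)" if "x \<in> B" "y \<in> B" for x y
    proof
      fix p
      have "\<tau> (x \<otimes> y) (\<theta> p) = \<tau> x (\<tau> y (\<theta> p))" using lt(1)[of x y] that by simp
      then show "(\<theta> \<circ> \<tau> (x \<otimes> y) \<circ> \<theta>) p = ((\<theta> \<circ> \<tau> x \<circ> \<theta>) \<otimes>\<^bsub>H\<^esub> (\<theta> \<circ> \<tau> y \<circ> \<theta>)) p"
        by (simp add: H_def \<theta>)
    qed
    show "\<tau> \<one> = \<one>\<^bsub>H\<^esub>" "\<theta> \<circ> \<tau> \<one> \<circ> \<theta> = \<one>\<^bsub>H\<^esub>" using lt(2)[OF one_closed] \<theta>o by (simp_all add: H_def)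
    show "\<tau> c = \<theta> \<circ> \<tau> c \<circ> \<theta>" if "c \<in> C" for c by (rule ext) (simp add: eq[OF that] \<theta>)
  qed (simp_all add: H_def)
  then obtain \<Theta> where hom: "\<Theta> \<in> hom G H" and one: "\<Theta> \<one> = id" and \<Theta>A: "\<forall>a\<in>A. \<Theta> a = \<tau> a"
    and \<Theta>B: "\<forall>b\<in>B. \<Theta> b = \<theta> \<circ> \<tau> b \<circ> \<theta>" by (auto simp: H_def)
  have mult: "\<Theta> (g \<otimes> h) p = \<Theta> g (\<Theta> h p)" if "g \<in> carrier G" "h \<in> carrier G" for g h p
    using hom_mult[OF hom that] by (simp add: H_def)
  let ?h = "inv a \<otimes> b"
  have h: "?h \<in> carrier G" using ac bc by simp
  have step: "\<Theta> ?h (\<one>, n, False) = (\<one>, Suc n, False)" for n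
  proof -
    have "\<theta> (\<one>, n, False) = (\<one>, n, True)" by (simp add: \<theta>_def coset_switch_def)
    moreover have "\<tau> b (\<one>, n, True) = (b, n, True)" using bc by (simp add: \<tau>_def left_translate_def)
    moreover have "\<theta> (b, n, True) = (a, Suc n, False)"
      using ac bc b(2) by (simp add: \<theta>_def coset_switch_def m_assoc[symmetric])
    moreover have "\<tau> (inv a) (a, Suc n, False) = (\<one>, Suc n, False)" using ac by (simp add: \<tau>_def left_translate_def)
    ultimately show ?thesis using mult[of "inv a" b] ac bc a(1) b(1) \<Theta>A \<Theta>B by simp
  qed
  have pw: "\<Theta> (?h [^] n) (\<one>, 0, False) = (\<one>, n, False)" for n :: nat
  proof (induction n)
    case 0
    then show ?case by (simp add: one)
  next
    case (Suc n)
    have "?h [^] Suc n = ?h \<otimes> ?h [^] n" using h by (rule nat_pow_Suc2)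
    then show ?case using Suc mult[OF h nat_pow_closed[OF h]] step by simp
  qed
  have inf: "infinite (\<psi> ` carrier G)" if "\<And>n. \<psi> (inv (?h [^] n)) = n" for \<psi> :: "'a \<Rightarrow> nat"
  proof -
    have "(UNIV :: nat set) \<subseteq> \<psi> ` carrier G"
    proof
      fix n :: nat
      show "n \<in> \<psi> ` carrier G" by (rule image_eqI[of _ _ "inv (?h [^] n)"]) (simp_all add: that ac bc)
    qed
    then show ?thesis using infinite_UNIV_nat finite_subset by blast
  qed
  show "infinite (left_cosets G A)"
  proof (rule invariant_function_infinite_cosets[OF A, where \<psi> = "\<lambda>g. fst (snd (\<Theta> (inv g) (\<one>, 0, False)))"])
    show "infinite ((\<lambda>g. fst (snd (\<Theta> (inv g) (\<one>, 0, False)))) ` carrier G)"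
      by (rule inf) (use h in \<open>simp add: pw\<close>)
    show "fst (snd (\<Theta> (inv (g \<otimes> x)) (\<one>, 0, False))) = fst (snd (\<Theta> (inv g) (\<one>, 0, False)))"
      if "g \<in> carrier G" "x \<in> A" for g x
      using that \<Theta>A mult[of "inv x" "inv g"] lt(3)[of "inv x"] by (simp add: inv_mult_group)
  qed
  show "infinite (left_cosets G B)"
  proof (rule invariant_function_infinite_cosets[OF B, where \<psi> = "\<lambda>g. fst (snd (\<theta> (\<Theta> (inv g) (\<one>, 0, False))))"])
    show "infinite ((\<lambda>g. fst (snd (\<theta> (\<Theta> (inv g) (\<one>, 0, False))))) ` carrier G)"
      by (rule inf) (use h in \<open>simp add: pw, simp add: \<theta>_def coset_switch_def\<close>)
    show "fst (snd (\<theta> (\<Theta> (inv (g \<otimes> x)) (\<one>, 0, False)))) = fst (snd (\<theta> (\<Theta> (inv g) (\<one>, 0, False))))"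
      if "g \<in> carrier G" "x \<in> B" for g x
      using that \<Theta>B mult[of "inv x" "inv g"] lt(3)[of "inv x"] by (simp add: inv_mult_group \<theta>)
  qed
qed

end

section \<open>Derivations of splittings and minimality\<close>

context group
begin

text \<open>
  On B this is the inner derivation of the chain C, which vanishes on C; so it fits together with
  zero on A.
\<close>

lemma amalgam_derivation:
  assumes "amalgam_splitting G A B C"
  obtains d where "derivation G (left_cosets G C) d" "\<forall>a\<in>A. d a = 0"
    "\<forall>b\<in>B. d b = frag_of (b <#\<^bsub>G\<^esub> C) - frag_of C"
proof -
  have A: "subgroup A G" and B: "subgroup B G" and C: "subgroup C G" "C \<subseteq> A" "C \<subseteq> B"
    using assms by (auto simp: amalgam_splitting_def)
  interpret A: subgroup A G by fact
  interpret B: subgroup B G by fact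
  interpret C: subgroup C G by fact
  let ?H = "chain_semidirect G C"
  have ch: "frag_of (g <#\<^bsub>G\<^esub> C) - frag_of C \<in> chains_on (left_cosets G C)" if "g \<in> carrier G" for g
    by (rule addsubD(4)[OF chains_addsub]) (use that left_cosets_self[OF C.subset] in \<open>auto simp: left_cosets_def\<close>)
  have "\<exists>\<Theta>. \<Theta> \<in> hom G ?H \<and> \<Theta> \<one> = \<one>\<^bsub>?H\<^esub> \<and> (\<forall>a\<in>A. \<Theta> a = (0, a)) \<and>
      (\<forall>b\<in>B. \<Theta> b = (frag_of (b <#\<^bsub>G\<^esub> C) - frag_of C, b))"
  proof (rule amalgam_universal[OF group_axioms assms chain_semidirect_monoid[OF C.subset]])
    show "(0, a) \<in> carrier ?H" if "a \<in> A" for a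
      using that addsubD(1)[OF chains_addsub] by (simp add: chain_semidirect_def)
    show "(frag_of (b <#\<^bsub>G\<^esub> C) - frag_of C, b) \<in> carrier ?H" if "b \<in> B" for b
      using that ch by (simp add: chain_semidirect_def)
    show "(frag_of ((b \<otimes> b') <#\<^bsub>G\<^esub> C) - frag_of C, b \<otimes> b') =
        (frag_of (b <#\<^bsub>G\<^esub> C) - frag_of C, b) \<otimes>\<^bsub>?H\<^esub> (frag_of (b' <#\<^bsub>G\<^esub> C) - frag_of C, b')" if "b \<in> B" "b' \<in> B" for b b'
      using that by (simp add: chain_semidirect_def lcos_m_assoc C.subset)
    show "(0, c) = (frag_of (c <#\<^bsub>G\<^esub> C) - frag_of C, c)" if "c \<in> C" for c using l_coset_self[OF C(1) that] by simp
  qed (simp_all add: chain_semidirect_def lcos_mult_one C.subset)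
  then obtain \<Theta> where hom: "\<Theta> \<in> hom G ?H" and one: "\<Theta> \<one> = (0, \<one>)" and \<Theta>: "\<forall>a\<in>A. \<Theta> a = (0, a)"
    "\<forall>b\<in>B. \<Theta> b = (frag_of (b <#\<^bsub>G\<^esub> C) - frag_of C, b)" by (auto simp: chain_semidirect_def)
  have "derivation G (left_cosets G C) (\<lambda>g. fst (\<Theta> g))"
  proof (rule derivation_of_hom[OF hom one, of "A \<union> B"])
    show "A \<union> B \<subseteq> carrier G" using A.subset B.subset by blast
    show "snd (\<Theta> s) = s" if "s \<in> A \<union> B" for s using that \<Theta> by auto
    show "g \<in> generate G (A \<union> B)" if "g \<in> carrier G" for g by (rule amalgam_generate[OF group_axioms assms that])
  qed
  then show thesis by (rule that) (use \<Theta> in auto)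
qed

text \<open>
  The value at the stable letter is free except for the relations with C, and these hold because the
  chain C is fixed by C.
\<close>

lemma hnn_derivation:
  assumes "hnn_splitting G A C \<phi> t"
  obtains d where "derivation G (left_cosets G C) d" "\<forall>a\<in>A. d a = 0" "d t = frag_of (t <#\<^bsub>G\<^esub> C)"
proof -
  have A: "subgroup A G" and C: "subgroup C G" "C \<subseteq> A" and t: "t \<in> carrier G"
    using assms by (auto simp: hnn_splitting_def)
  interpret A: subgroup A G by fact
  interpret C: subgroup C G by fact
  let ?H = "chain_semidirect G C"
  have tC: "t <#\<^bsub>G\<^esub> C \<in> left_cosets G C" using t by (simp add: left_cosets_def)
  have "\<exists>\<Theta>. \<Theta> \<in> hom G ?H \<and> \<Theta> \<one> = \<one>\<^bsub>?H\<^esub> \<and> (\<forall>a\<in>A. \<Theta> a = (0, a)) \<and> \<Theta> t = (frag_of (t <#\<^bsub>G\<^esub> C), t)"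
  proof (rule hnn_universal[OF group_axioms assms chain_semidirect_monoid[OF C.subset], where s' = "(- frag_of C, inv t)"])
    show "(0, a) \<in> carrier ?H" if "a \<in> A" for a
      using that addsubD(1)[OF chains_addsub] by (simp add: chain_semidirect_def)
    show "(frag_of (t <#\<^bsub>G\<^esub> C), t) \<in> carrier ?H" using t tC by (simp add: chain_semidirect_def)
    show "(- frag_of C, inv t) \<in> carrier ?H"
      using t addsubD(3)[OF chains_addsub, of "frag_of C"] left_cosets_self[OF C.subset] by (simp add: chain_semidirect_def)
    show "(frag_of (t <#\<^bsub>G\<^esub> C), t) \<otimes>\<^bsub>?H\<^esub> (- frag_of C, inv t) = \<one>\<^bsub>?H\<^esub>"
      using t by (simp add: chain_semidirect_def)
    show "(- frag_of C, inv t) \<otimes>\<^bsub>?H\<^esub> (frag_of (t <#\<^bsub>G\<^esub> C), t) = \<one>\<^bsub>?H\<^esub>"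
      using t by (simp add: chain_semidirect_def lcos_m_assoc C.subset lcos_mult_one)
    show "(frag_of (t <#\<^bsub>G\<^esub> C), t) \<otimes>\<^bsub>?H\<^esub> ((0, c) \<otimes>\<^bsub>?H\<^esub> (- frag_of C, inv t)) = (0, t \<otimes> c \<otimes> inv t)" if "c \<in> C" for c
      using t that l_coset_self[OF C(1) that] by (simp add: chain_semidirect_def m_assoc)
  qed (simp_all add: chain_semidirect_def)
  then obtain \<Theta> where hom: "\<Theta> \<in> hom G ?H" and one: "\<Theta> \<one> = (0, \<one>)" and \<Theta>: "\<forall>a\<in>A. \<Theta> a = (0, a)"
    "\<Theta> t = (frag_of (t <#\<^bsub>G\<^esub> C), t)" by (auto simp: chain_semidirect_def)
  have "derivation G (left_cosets G C) (\<lambda>g. fst (\<Theta> g))"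
  proof (rule derivation_of_hom[OF hom one, of "insert t A"])
    show "insert t A \<subseteq> carrier G" using A.subset t by blast
    show "snd (\<Theta> s) = s" if "s \<in> insert t A" for s using that \<Theta> by auto
    show "g \<in> generate G (insert t A)" if "g \<in> carrier G" for g by (rule hnn_generate[OF group_axioms assms that])
  qed
  then show thesis by (rule that) (use \<Theta> in auto)
qed

lemma push_push:
  assumes "subgroup K G" "subgroup L G" "K \<subseteq> L" "T \<subseteq> carrier G" "\<And>c. c \<in> L \<Longrightarrow> c <#\<^bsub>G\<^esub> T = T"
    "m \<in> chains_on (left_cosets G K)"
  shows "push G T (push G L m) = push G T m"
  using assms(6)
proof (induction rule: chains_induct)
  case (one S)
  then obtain g where g: "g \<in> carrier G" "S = g <#\<^bsub>G\<^esub> K" by (auto simp: left_cosets_def)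
  have "S <#> L = g <#\<^bsub>G\<^esub> L"
    unfolding g(2) using l_coset_push[OF assms(1) subgroup.subset[OF assms(2)] _ g(1)] l_coset_self[OF assms(2)] assms(3) by blast
  moreover have "(g <#\<^bsub>G\<^esub> L) <#> T = g <#\<^bsub>G\<^esub> T" by (rule l_coset_push[OF assms(2,4,5) g(1)])
  moreover have "S <#> T = g <#\<^bsub>G\<^esub> T"
    unfolding g(2) by (rule l_coset_push[OF assms(1,4) _ g(1)]) (use assms(3,5) in blast)
  ultimately show ?case by simp
qed simp_all

lemma push_left_coset:
  assumes "subgroup K G" "subgroup T G" "K \<subseteq> T" "g \<in> carrier G"
  shows "(g <#\<^bsub>G\<^esub> K) <#> T = g <#\<^bsub>G\<^esub> T"
  using l_coset_push[OF assms(1) subgroup.subset[OF assms(2)] _ assms(4)] l_coset_self[OF assms(2)] assms(3) by blast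

text \<open>
  Both sides are derivations, so they are compared on generators. On B the pushes are b P - P and
  b Q - Q, and the latter is zero. The subgroups P and Q may be larger than A and B, as
  the derivation of one splitting is pushed to the vertex groups of a larger one.
\<close>

lemma amalgam_derivation_push:
  assumes "amalgam_splitting G A B C" "derivation G (left_cosets G C) d" "\<forall>a\<in>A. d a = 0"
    "\<forall>b\<in>B. d b = frag_of (b <#\<^bsub>G\<^esub> C) - frag_of C" and g: "g \<in> carrier G"
  shows "subgroup P G \<Longrightarrow> A \<subseteq> P \<Longrightarrow> push G P (d g) = frag_of (g <#\<^bsub>G\<^esub> P) - frag_of P"
    and "subgroup Q G \<Longrightarrow> B \<subseteq> Q \<Longrightarrow> push G Q (d g) = 0"
proof -
  have A: "subgroup A G" and B: "subgroup B G" and C: "subgroup C G" "C \<subseteq> A" "C \<subseteq> B"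
    using assms(1) by (auto simp: amalgam_splitting_def)
  interpret A: subgroup A G by fact
  interpret B: subgroup B G by fact
  have AB: "A \<union> B \<subseteq> carrier G" using A.subset B.subset by blast
  have gen: "g \<in> generate G (A \<union> B)" by (rule amalgam_generate[OF group_axioms assms(1) g])
  have push: "push G T (d b) = frag_of (b <#\<^bsub>G\<^esub> T) - frag_of T" if T: "subgroup T G" "C \<subseteq> T" and b: "b \<in> B" for T b
    using push_left_coset[OF C(1) T, of b] push_left_coset[OF C(1) T one_closed] assms(4) b
      subgroup.subset[OF C(1)] subgroup.subset[OF T(1)] by (simp add: lcos_mult_one)
  have der: "derivation G (left_cosets G T) (\<lambda>g. push G T (d g))" if T: "subgroup T G" "C \<subseteq> T" for T
    by (rule push_derivation[OF C(1) subgroup.subset[OF T(1)] _ assms(2)]) (use l_coset_self[OF T(1)] T(2) in blast)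
  show "push G P (d g) = frag_of (g <#\<^bsub>G\<^esub> P) - frag_of P" if P: "subgroup P G" "A \<subseteq> P"
  proof -
    have T: "subgroup P G" "C \<subseteq> P" using P C(2) by auto
    have PC: "P \<subseteq> carrier G" by (rule subgroup.subset[OF P(1)])
    have in_ch: "frag_of P \<in> chains_on (left_cosets G P)" using left_cosets_self[OF PC] by simp
    have "push G P (d g) = set_act G g (frag_of P) - frag_of P"
    proof (rule derivation_eq_on_generators[OF PC der[OF T] principal_derivation[OF PC in_ch] AB _ gen])
      fix s assume "s \<in> A \<union> B"
      then show "push G P (d s) = set_act G s (frag_of P) - frag_of P"
        using assms(3) push[OF T] l_coset_self[OF P(1)] P(2) by auto
    qed
    then show ?thesis by simp
  qed
  show "push G Q (d g) = 0" if Q: "subgroup Q G" "B \<subseteq> Q"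
  proof -
    have T: "subgroup Q G" "C \<subseteq> Q" using Q C(3) by auto
    have QC: "Q \<subseteq> carrier G" by (rule subgroup.subset[OF Q(1)])
    have "push G Q (d g) = set_act G g 0 - 0"
    proof (rule derivation_eq_on_generators[OF QC der[OF T] principal_derivation[OF QC addsubD(1)[OF chains_addsub]] AB _ gen])
      fix s assume "s \<in> A \<union> B"
      then show "push G Q (d s) = set_act G s 0 - 0"
        using assms(3) push[OF T] l_coset_self[OF Q(1)] Q(2) by auto
    qed
    then show ?thesis by simp
  qed
qed

text \<open>
  The coset \<open>inv t\<close> P is the other end of the edge C: it is fixed by c because the conjugate of c by
  t lies in P.
\<close>

lemma translate_stable:
  assumes "subgroup P G" "t \<in> carrier G" "c \<in> carrier G" "t \<otimes> c \<otimes> inv t \<in> P"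
  shows "c <#\<^bsub>G\<^esub> (inv t <#\<^bsub>G\<^esub> P) = inv t <#\<^bsub>G\<^esub> P"
proof -
  have P: "P \<subseteq> carrier G" by (rule subgroup.subset[OF assms(1)])
  have "c <#\<^bsub>G\<^esub> (inv t <#\<^bsub>G\<^esub> P) = (inv t \<otimes> (t \<otimes> c \<otimes> inv t)) <#\<^bsub>G\<^esub> P"
    using assms P by (simp add: lcos_m_assoc m_assoc[symmetric])
  also have "\<dots> = inv t <#\<^bsub>G\<^esub> ((t \<otimes> c \<otimes> inv t) <#\<^bsub>G\<^esub> P)" using assms P by (simp add: lcos_m_assoc)
  finally show ?thesis using l_coset_self[OF assms(1,4)] by simp
qed

lemma left_cosets_translate:
  assumes "subgroup P G" "t \<in> carrier G"
  shows "left_cosets G (inv t <#\<^bsub>G\<^esub> P) = left_cosets G P"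
proof -
  have P: "P \<subseteq> carrier G" by (rule subgroup.subset[OF assms(1)])
  have "left_cosets G (inv t <#\<^bsub>G\<^esub> P) = (\<lambda>g. (g \<otimes> inv t) <#\<^bsub>G\<^esub> P) ` carrier G"
    unfolding left_cosets_def using P assms(2) by (intro image_cong) (simp_all add: lcos_m_assoc)
  also have "\<dots> = left_cosets G P"
    unfolding left_cosets_def
  proof (intro equalityI image_subsetI)
    fix g assume g: "g \<in> carrier G"
    show "(g \<otimes> inv t) <#\<^bsub>G\<^esub> P \<in> (\<lambda>g. g <#\<^bsub>G\<^esub> P) ` carrier G" using g assms(2) by (intro imageI) simp
    show "g <#\<^bsub>G\<^esub> P \<in> (\<lambda>g. (g \<otimes> inv t) <#\<^bsub>G\<^esub> P) ` carrier G"
      using g assms(2) by (intro image_eqI[of _ _ "g \<otimes> t"]) (simp_all add: m_assoc)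
  qed
  finally show ?thesis .
qed

text \<open>
  The two pushes send the edge g C to its end points g P and g \<open>inv t\<close> P. At the stable letter the
  difference is t P - P, and on A it is zero.
\<close>

lemma hnn_derivation_push:
  assumes "hnn_splitting G A C \<phi> t" "derivation G (left_cosets G C) d" "\<forall>a\<in>A. d a = 0"
    "d t = frag_of (t <#\<^bsub>G\<^esub> C)" and P: "subgroup P G" "A \<subseteq> P" and g: "g \<in> carrier G"
  shows "push G P (d g) - push G (inv t <#\<^bsub>G\<^esub> P) (d g) = frag_of (g <#\<^bsub>G\<^esub> P) - frag_of P"
proof -
  have A: "subgroup A G" and C: "subgroup C G" "C \<subseteq> A" and t: "t \<in> carrier G"
    and \<phi>: "\<And>c. c \<in> C \<Longrightarrow> t \<otimes> c \<otimes> inv t \<in> A"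
    using assms(1) by (auto simp: hnn_splitting_def hom_def Pi_def)
  interpret A: subgroup A G by fact
  interpret C: subgroup C G by fact
  interpret P: subgroup P G by fact
  let ?T = "inv t <#\<^bsub>G\<^esub> P"
  have TC: "?T \<subseteq> carrier G" by (rule l_coset_carrier[OF inv_closed[OF t] P.subset])
  have st: "c <#\<^bsub>G\<^esub> P = P" "c <#\<^bsub>G\<^esub> ?T = ?T" if "c \<in> C" for c
    using l_coset_self[OF P(1)] translate_stable[OF P(1) t] \<phi>[OF that] that C(2) P(2) by auto
  have 1: "derivation G (left_cosets G P) (\<lambda>g. push G P (d g))"
    by (rule push_derivation[OF C(1) P.subset st(1) assms(2)])
  have 2: "derivation G (left_cosets G P) (\<lambda>g. push G ?T (d g))"
    using push_derivation[OF C(1) TC st(2) assms(2)] left_cosets_translate[OF P(1) t] by simp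
  have "derivation G (left_cosets G P) (\<lambda>g. push G P (d g) - push G ?T (d g))"
    unfolding derivation_def
  proof (intro conjI ballI)
    fix g h assume g: "g \<in> carrier G" and h: "h \<in> carrier G"
    have "push G P (d (g \<otimes> h)) = push G P (d g) + set_act G g (push G P (d h))"
      "push G ?T (d (g \<otimes> h)) = push G ?T (d g) + set_act G g (push G ?T (d h))"
      using 1 2 g h unfolding derivation_def by blast+
    then show "push G P (d (g \<otimes> h)) - push G ?T (d (g \<otimes> h)) =
        push G P (d g) - push G ?T (d g) + set_act G g (push G P (d h) - push G ?T (d h))" by simp
  next
    fix g assume "g \<in> carrier G"
    then show "push G P (d g) - push G ?T (d g) \<in> chains_on (left_cosets G P)"
      using 1 2 unfolding derivation_def by (intro addsubD(4)[OF chains_addsub]) blast+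
  qed
  note der = this
  have in_ch: "frag_of P \<in> chains_on (left_cosets G P)" using left_cosets_self[OF P.subset] by simp
  have tA: "insert t A \<subseteq> carrier G" using t A.subset by blast
  have gen: "g \<in> generate G (insert t A)" by (rule hnn_generate[OF group_axioms assms(1) g])
  have "push G P (d g) - push G ?T (d g) = set_act G g (frag_of P) - frag_of P"
  proof (rule derivation_eq_on_generators[OF P.subset der principal_derivation[OF P.subset in_ch] tA _ gen])
    fix s assume "s \<in> insert t A"
    then consider "s = t" | "s \<in> A" by blast
    then show "push G P (d s) - push G ?T (d s) = set_act G s (frag_of P) - frag_of P"
    proof cases
      case 1
      have "(t <#\<^bsub>G\<^esub> C) <#> P = t <#\<^bsub>G\<^esub> P" by (rule l_coset_push[OF C(1) P.subset st(1) t])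
      moreover have "(t <#\<^bsub>G\<^esub> C) <#> ?T = t <#\<^bsub>G\<^esub> ?T" by (rule l_coset_push[OF C(1) TC st(2) t])
      moreover have "t <#\<^bsub>G\<^esub> ?T = P" using t P.subset by (simp add: lcos_m_assoc lcos_mult_one)
      ultimately show ?thesis using assms(4) 1 by simp
    next
      case 2
      then show ?thesis using assms(3) l_coset_self[OF P(1)] P(2) by auto
    qed
  qed
  then show ?thesis by simp
qed

text \<open>
  If E is inner modulo n, given by x, and becomes exactly inner, given by m, under \<open>\<pi>\<close>, then
  the difference of m and the image of x is invariant modulo n.
\<close>

lemma inner_image_dvd:
  assumes "subgroup A G" "infinite (left_cosets G A)" "\<forall>g\<in>carrier G. frag_dvd n (E g - (set_act G g x - x))"
    and \<pi>: "\<And>y z. \<pi> (y - z) = \<pi> y - \<pi> z" "\<And>y. frag_dvd n y \<Longrightarrow> frag_dvd n (\<pi> y)"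
      "\<And>g. g \<in> carrier G \<Longrightarrow> \<pi> (set_act G g x) = set_act G g (\<pi> x)" "\<pi> x \<in> chains_on (left_cosets G A)"
    and m: "m \<in> chains_on (left_cosets G A)" "\<And>g. g \<in> carrier G \<Longrightarrow> \<pi> (E g) = set_act G g m - m"
  shows "n dvd augmentation m - augmentation (\<pi> x)"
proof -
  have "frag_dvd n (m - \<pi> x)"
  proof (rule invariant_chain_dvd[OF assms(1,2) addsubD(4)[OF chains_addsub m(1) \<pi>(4)]])
    show "frag_dvd n (set_act G g (m - \<pi> x) - (m - \<pi> x))" if g: "g \<in> carrier G" for g
    proof -
      have "frag_dvd n (\<pi> (E g - (set_act G g x - x)))" using assms(3) g by (intro \<pi>(2)) blast
      also have "\<pi> (E g - (set_act G g x - x)) = set_act G g (m - \<pi> x) - (m - \<pi> x)"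
        unfolding \<pi>(1) m(2)[OF g] \<pi>(3)[OF g] by simp
      finally show ?thesis .
    qed
  qed
  then show ?thesis using frag_dvd_augmentation by fastforce
qed

text \<open>The hypothesis excludes infinite index, for which the cardinality would be zero.\<close>

lemma index_one_eq:
  assumes "subgroup C' G" "subgroup C G" "C' \<subseteq> C" "int (card ((\<lambda>c. C' #> c) ` C)) dvd 1"
  shows "C' = C"
proof -
  interpret C': subgroup C' G by fact
  interpret C: subgroup C G by fact
  have "card ((\<lambda>c. C' #> c) ` C) = 1" using assms(4) by simp
  then obtain S where S: "(\<lambda>c. C' #> c) ` C = {S}" by (rule card_1_singletonE)
  have "c \<in> C'" if c: "c \<in> C" for c
  proof -
    have "C' #> c = S" "C' #> \<one> = S" using S c C.one_closed by blast+
    then have "C' #> c = C'" by (simp add: coset_mult_one C'.subset)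
    then show ?thesis using rcos_self[OF C.mem_carrier[OF c] assms(1)] by simp
  qed
  then show ?thesis using assms(3) by blast
qed

lemma frag_of_coset_diff_zero:
  assumes "subgroup K G" "g \<in> carrier G" "frag_of (g <#\<^bsub>G\<^esub> K) - frag_of K = 0"
  shows "g \<in> K"
proof -
  have "frag_of (g <#\<^bsub>G\<^esub> K) = frag_of K" using assms(3) by simp
  then have "g <#\<^bsub>G\<^esub> K = K" by (simp add: frag_of_eq)
  then show ?thesis using l_coset_self_iff[OF assms(1,2)] by simp
qed

end

theorem lemma2:
  fixes G :: "('g, 'm) monoid_scheme"
  assumes "PD_group 3 G"
  shows "(\<forall>A B C A' B' C'.
            amalgam_splitting G A B C \<longrightarrow> PD_group 2 (G\<lparr>carrier := C\<rparr>) \<longrightarrow>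
            amalgam_splitting G A' B' C' \<longrightarrow> amalgam_le (A', B', C') (A, B, C) \<longrightarrow>
            A' = A \<and> B' = B \<and> C' = C) \<and>
         (\<forall>A C \<phi> t A' C' \<phi>' t'.
            hnn_splitting G A C \<phi> t \<longrightarrow> PD_group 2 (G\<lparr>carrier := C\<rparr>) \<longrightarrow>
            hnn_splitting G A' C' \<phi>' t' \<longrightarrow> hnn_le (A', C', \<phi>', t') (A, C, \<phi>, t) \<longrightarrow>
            A' = A \<and> C' = C \<and> (\<forall>c\<in>C. \<phi>' c = \<phi> c))"
proof (rule conjI)
  have grp: "group G" using assms by (simp add: PD_group_def type_FP_def)
  interpret group G by (rule grp)
  show "\<forall>A B C A' B' C'.
            amalgam_splitting G A B C \<longrightarrow> PD_group 2 (G\<lparr>carrier := C\<rparr>) \<longrightarrow>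
            amalgam_splitting G A' B' C' \<longrightarrow> amalgam_le (A', B', C') (A, B, C) \<longrightarrow>
            A' = A \<and> B' = B \<and> C' = C"
  proof (intro allI impI)
    fix A B C A' B' C'
    assume spl: "amalgam_splitting G A B C" and PD2: "PD_group 2 (G\<lparr>carrier := C\<rparr>)"
      and spl': "amalgam_splitting G A' B' C'" and "amalgam_le (A', B', C') (A, B, C)"
    then have le: "A' \<subseteq> A" "B' \<subseteq> B" "C' \<subseteq> C" by (simp_all add: amalgam_le_def)
    have A: "subgroup A G" and B: "subgroup B G" and C: "subgroup C G" "C \<subseteq> A" "C \<subseteq> B"
      using spl by (auto simp: amalgam_splitting_def)
    have A': "subgroup A' G" and B': "subgroup B' G" and C': "subgroup C' G"
      using spl' by (auto simp: amalgam_splitting_def)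
    note inf = amalgam_infinite_index[OF spl]
    obtain d' where d': "derivation G (left_cosets G C') d'" "\<forall>a\<in>A'. d' a = 0"
      "\<forall>b\<in>B'. d' b = frag_of (b <#\<^bsub>G\<^esub> C') - frag_of C'" by (rule amalgam_derivation[OF spl'])
    note d'push = amalgam_derivation_push[OF spl' d']
    let ?n = "int (card ((\<lambda>c. C' #>\<^bsub>G\<^esub> c) ` C))"
    obtain x where x: "x \<in> chains_on (left_cosets G C)"
      "\<forall>g\<in>carrier G. frag_dvd ?n (push G C (d' g) - (set_act G g x - x))"
      by (rule PD3_derivation_divisible[OF assms C(1) PD2 C' le(3) d'(1)])
    have dvd: "?n dvd augmentation m - augmentation x"
      if T: "subgroup T G" "C \<subseteq> T" "infinite (left_cosets G T)" and m: "m \<in> chains_on (left_cosets G T)"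
        "\<And>g. g \<in> carrier G \<Longrightarrow> push G T (d' g) = set_act G g m - m" for T m
    proof -
      have TG: "T \<subseteq> carrier G" by (rule subgroup.subset[OF T(1)])
      have st: "c <#\<^bsub>G\<^esub> T = T" if "c \<in> C" for c using l_coset_self[OF T(1)] T(2) that by blast
      have "?n dvd augmentation m - augmentation (push G T x)"
      proof (rule inner_image_dvd[OF T(1,3) x(2) _ _ _ _ m(1)])
        show "push G T (set_act G g x) = set_act G g (push G T x)" if "g \<in> carrier G" for g
          by (rule push_act[OF subgroup.subset[OF C(1)] TG that x(1)])
        show "push G T x \<in> chains_on (left_cosets G T)" by (rule push_closed[OF C(1) TG st x(1)])
        fix g assume g: "g \<in> carrier G"
        have "d' g \<in> chains_on (left_cosets G C')" using d'(1) g by (simp add: derivation_def)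
        then show "push G T (push G C (d' g)) = set_act G g m - m"
          using push_push[OF C' C(1) le(3) TG st] m(2)[OF g] by simp
      qed (simp_all add: frag_dvd_push)
      then show ?thesis by (simp add: augmentation_push)
    qed
    have "?n dvd augmentation (frag_of A) - augmentation x"
      by (rule dvd[OF A C(2) inf(1)])
        (use d'push(1)[OF _ A le(1)] left_cosets_self[OF subgroup.subset[OF A]] in simp_all)
    moreover have "?n dvd augmentation (0 :: 'g set \<Rightarrow>\<^sub>0 int) - augmentation x"
      by (rule dvd[OF B C(3) inf(2)]) (use d'push(2)[OF _ B le(2)] addsubD(1)[OF chains_addsub] in simp_all)
    ultimately have "?n dvd (augmentation (frag_of A) - augmentation x) - (augmentation (0 :: 'g set \<Rightarrow>\<^sub>0 int) - augmentation x)"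
      by (rule dvd_diff)
    then have "?n dvd 1" by simp
    then have CC: "C' = C" by (rule index_one_eq[OF C' C(1) le(3)])
    obtain d where d: "derivation G (left_cosets G C) d" "\<forall>a\<in>A. d a = 0"
      "\<forall>b\<in>B. d b = frag_of (b <#\<^bsub>G\<^esub> C) - frag_of C" by (rule amalgam_derivation[OF spl])
    have dd: "d g = d' g" if g: "g \<in> carrier G" for g
    proof (rule derivation_eq_on_generators[OF subgroup.subset[OF C(1)] d(1) d'(1)[unfolded CC] _ _ amalgam_generate[OF grp spl' g]])
      show "A' \<union> B' \<subseteq> carrier G" using subgroup.subset[OF A'] subgroup.subset[OF B'] by blast
      fix s assume "s \<in> A' \<union> B'"
      then show "d s = d' s" using d(2,3) d'(2,3) le(1,2) CC by auto
    qed
    have "A \<subseteq> A'"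
    proof
      fix a assume a: "a \<in> A"
      then have ac: "a \<in> carrier G" using subgroup.subset[OF A] by blast
      have "d' a = 0" using dd[OF ac] d(2) a by simp
      then have "frag_of (a <#\<^bsub>G\<^esub> A') - frag_of A' = 0" using d'push(1)[OF ac A'] by simp
      then show "a \<in> A'" by (rule frag_of_coset_diff_zero[OF A' ac])
    qed
    moreover have "B \<subseteq> B'"
    proof
      fix b assume b: "b \<in> B"
      then have bc: "b \<in> carrier G" using subgroup.subset[OF B] by blast
      have "d' b = frag_of (b <#\<^bsub>G\<^esub> C) - frag_of C" using dd[OF bc] d(3) b by simp
      moreover have CB': "C \<subseteq> B'" using spl' CC by (auto simp: amalgam_splitting_def)
      ultimately have "push G B' (d' b) = frag_of (b <#\<^bsub>G\<^esub> B') - frag_of B'"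
        using push_left_coset[OF C(1) B' CB' bc] push_left_coset[OF C(1) B' CB' one_closed]
          subgroup.subset[OF C(1)] subgroup.subset[OF B'] by (simp add: lcos_mult_one)
      then have "frag_of (b <#\<^bsub>G\<^esub> B') - frag_of B' = 0" using d'push(2)[OF bc B'] by simp
      then show "b \<in> B'" by (rule frag_of_coset_diff_zero[OF B' bc])
    qed
    ultimately show "A' = A \<and> B' = B \<and> C' = C" using le CC by blast
  qed
  show "\<forall>A C \<phi> t A' C' \<phi>' t'.
            hnn_splitting G A C \<phi> t \<longrightarrow> PD_group 2 (G\<lparr>carrier := C\<rparr>) \<longrightarrow>
            hnn_splitting G A' C' \<phi>' t' \<longrightarrow> hnn_le (A', C', \<phi>', t') (A, C, \<phi>, t) \<longrightarrow>
            A' = A \<and> C' = C \<and> (\<forall>c\<in>C. \<phi>' c = \<phi> c)"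
  proof (intro allI impI)
    fix A C \<phi> t A' C' \<phi>' t'
    assume spl: "hnn_splitting G A C \<phi> t" and PD2: "PD_group 2 (G\<lparr>carrier := C\<rparr>)"
      and spl'0: "hnn_splitting G A' C' \<phi>' t'" and "hnn_le (A', C', \<phi>', t') (A, C, \<phi>, t)"
    then have le: "A' \<subseteq> A" "C' \<subseteq> C" "\<forall>c\<in>C'. \<phi> c = \<phi>' c" and tt: "t' = t" by (simp_all add: hnn_le_def)
    have spl': "hnn_splitting G A' C' \<phi>' t" using spl'0 tt by simp
    have A: "subgroup A G" and C: "subgroup C G" "C \<subseteq> A" and t: "t \<in> carrier G"
      and \<phi>: "\<And>c. c \<in> C \<Longrightarrow> t \<otimes>\<^bsub>G\<^esub> c \<otimes>\<^bsub>G\<^esub> inv\<^bsub>G\<^esub> t \<in> A"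
      using spl by (auto simp: hnn_splitting_def hom_def Pi_def)
    have A': "subgroup A' G" and C': "subgroup C' G" using spl' by (auto simp: hnn_splitting_def)
    have AG: "A \<subseteq> carrier G" and CG: "C \<subseteq> carrier G" using subgroup.subset[OF A] subgroup.subset[OF C(1)] .
    obtain d' where d': "derivation G (left_cosets G C') d'" "\<forall>a\<in>A'. d' a = 0" "d' t = frag_of (t <#\<^bsub>G\<^esub> C')"
      by (rule hnn_derivation[OF spl'])
    let ?n = "int (card ((\<lambda>c. C' #>\<^bsub>G\<^esub> c) ` C))"
    obtain x where x: "x \<in> chains_on (left_cosets G C)"
      "\<forall>g\<in>carrier G. frag_dvd ?n (push G C (d' g) - (set_act G g x - x))"
      by (rule PD3_derivation_divisible[OF assms C(1) PD2 C' le(2) d'(1)])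
    let ?T = "inv\<^bsub>G\<^esub> t <#\<^bsub>G\<^esub> A"
    let ?\<delta> = "\<lambda>m. push G A m - push G ?T m"
    have TG: "?T \<subseteq> carrier G" by (rule l_coset_carrier[OF inv_closed[OF t] AG])
    have st: "c <#\<^bsub>G\<^esub> A = A" "c <#\<^bsub>G\<^esub> ?T = ?T" if "c \<in> C" for c
      using l_coset_self[OF A] translate_stable[OF A t] \<phi>[OF that] that C(2) CG by auto
    have "?n dvd augmentation (frag_of A) - augmentation (?\<delta> x)"
    proof (rule inner_image_dvd[OF A hnn_infinite_index[OF spl] x(2), where \<pi> = ?\<delta>])
      show "frag_of A \<in> chains_on (left_cosets G A)" using left_cosets_self[OF AG] by simp
      show "?\<delta> (y - z) = ?\<delta> y - ?\<delta> z" for y z by simp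
      show "frag_dvd ?n (?\<delta> y)" if "frag_dvd ?n y" for y by (intro frag_dvd_diff frag_dvd_push that)
      show "?\<delta> (set_act G g x) = set_act G g (?\<delta> x)" if "g \<in> carrier G" for g
        using push_act[OF CG AG that x(1)] push_act[OF CG TG that x(1)] by simp
      show "?\<delta> x \<in> chains_on (left_cosets G A)"
        using push_closed[OF C(1) AG st(1) x(1)] push_closed[OF C(1) TG st(2) x(1)] left_cosets_translate[OF A t]
        by (intro addsubD(4)[OF chains_addsub]) simp_all
      fix g assume g: "g \<in> carrier G"
      have ch: "d' g \<in> chains_on (left_cosets G C')" using d'(1) g by (simp add: derivation_def)
      show "?\<delta> (push G C (d' g)) = set_act G g (frag_of A) - frag_of A"
        using push_push[OF C' C(1) le(2) AG st(1) ch] push_push[OF C' C(1) le(2) TG st(2) ch]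
          hnn_derivation_push[OF spl' d' A le(1) g] by simp
    qed
    moreover have "augmentation (?\<delta> x) = 0" by (simp add: augmentation_push)
    ultimately have "?n dvd 1" by simp
    then have CC: "C' = C" by (rule index_one_eq[OF C' C(1) le(2)])
    obtain d where d: "derivation G (left_cosets G C) d" "\<forall>a\<in>A. d a = 0" "d t = frag_of (t <#\<^bsub>G\<^esub> C)"
      by (rule hnn_derivation[OF spl])
    have dd: "d g = d' g" if g: "g \<in> carrier G" for g
    proof (rule derivation_eq_on_generators[OF CG d(1) d'(1)[unfolded CC] _ _ hnn_generate[OF grp spl' g]])
      show "insert t A' \<subseteq> carrier G" using subgroup.subset[OF A'] t by blast
      fix s assume "s \<in> insert t A'"
      then show "d s = d' s" using d(2,3) d'(2,3) le(1) CC by auto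
    qed
    have "A \<subseteq> A'"
    proof
      fix a assume a: "a \<in> A"
      then have ac: "a \<in> carrier G" using AG by blast
      have "d' a = 0" using dd[OF ac] d(2) a by simp
      then have "frag_of (a <#\<^bsub>G\<^esub> A') - frag_of A' = 0"
        using hnn_derivation_push[OF spl' d' A' _ ac] by simp
      then show "a \<in> A'" by (rule frag_of_coset_diff_zero[OF A' ac])
    qed
    then show "A' = A \<and> C' = C \<and> (\<forall>c\<in>C. \<phi>' c = \<phi> c)" using le CC by auto
  qed
qed

end
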